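(* Let $q\in L^{\infty}(\Omega)$ with $q>0$, let $\phi\in C(\Omega)\cap L^2(\Omega)$, and let $v\in C^1([0,T])$ be a nonzero nonnegative function with $v(0)=0$. Then the problem $$\begin{cases}{}_{0}D_t^{\alpha}u-\sum_{k,l=1}^{d}\frac{\partial}{\partial x_k}\Big(a_{kl}(x)\frac{\partial u}{\partial x_l}\Big)+q(x)u=\phi(x)v(t) & \text{in } D,\\ u=0 & \text{on }\partial\Omega\times(0,T),\\ u=0 & \text{in }\Omega\times\{0\}\end{cases}$$ has a unique weak solution $u\in B^{\frac{\alpha}{2}}(D)$, and $u$ satisfies $$\|u\|_{B^{\frac{\alpha}{2}}(D)}\le C\,\|\phi v\|_{L^2(D)},$$ where $C$ is a constant independent of $u$.
   Context: Setting: $d\ge 1$, $T>0$, $\alpha\in(0,1)$; $\Omega\subset\mathbb{R}^d$ is a bounded domain with smooth boundary; $D=\Omega\times(0,T)$. The matrix $A=(a_{kl})_{d\times d}\in C^1(\overline\Omega)^{d\times d}$ satisfies $a_{kl}=a_{lk}$ and there is $\lambda_0>0$ with $\sum_{k,l} a_{kl}(x)\xi_k\xi_l\ge\lambda_0|\xi|^2$ for all $x\in\overline\Omega$, $\xi\in\mathbb{R}^d$. ${}_0D_t^\alpha$ is the Caputo derivative ${}_{0}D_t^{\alpha}u=\frac{1}{\Gamma(1-\alpha)}\int_0^t(t-s)^{-\alpha}\partial_s u(x,s)\,ds$. Function spaces: ${}_0C^\infty(0,T)$ is the space of infinitely differentiable functions on $(0,T)$ with compact support in $(0,T]$; ${}_0H^s(0,T)$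 is its closure in the norm of the usual fractional Sobolev space $H^s(0,T)$. For $s\in(0,1)$, $$B^s(D)={}_0H^s(0,T;L^2(\Omega))\cap L^2(0,T;H_0^1(\Omega)),\qquad \|u\|_{B^s(D)}=\Big(\|u\|_{H^s(0,T;L^2(\Omega))}^2+\|u\|_{L^2(0,T;H^1_0(\Omega))}^2\Big)^{1/2}.$$ Weak solution: $u\in B^{\frac\alpha2}(D)$ is a weak solution if for all $w\in B^{\frac\alpha2}(D)$ $$({}_0D_t^{\frac\alpha2}u,{}_tD_T^{\frac\alpha2}w)_{L^2(D)}+\int_D\sum_{k,l=1}^d a_{kl}\frac{\partial u}{\partial x_k}\frac{\partial w}{\partial x_l}\,dx\,dt+(qu,w)_{L^2(D)}=(\phi v,w)_{L^2(D)},$$ where ${}_0D_t^{\alpha/2}$ and ${}_tD_T^{\alpha/2}$ are the left and right fractional derivatives in time of order $\alpha/2\in(0,1/2)$; on $H^{\alpha/2}(0,T)={}_0H^{\alpha/2}(0,T)$ they are the Riemann–Liouville ones, ${}_0D_t^{\sigma}u=\frac{1}{\Gamma(1-\sigma)}\frac{d}{dt}\int_0^t(t-\tau)^{-\sigma}u(\tau)\,d\tau$ and ${}_tD_T^{\sigma}w=-\frac{1}{\Gamma(1-\sigma)}\frac{d}{dt}\int_t^T(\tau-t)^{-\sigma}w(\tau)\,d\tau$. *)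

theory Defs
  imports "HOL-Analysis.Analysis"
begin

text \<open>
  Elements of L2 spaces are represented by measurable functions and compared almost everywhere.
  Squared norms take values in \<open>ennreal\<close>, so that finiteness of a norm is never hidden by the
  default value of a non-convergent integral. A function on \<open>D\<close> (space times time) has the
  type \<open>(real ^ 'd) \<times> real \<Rightarrow> real\<close>; its values outside \<open>D\<close> are irrelevant.
\<close>

subsection \<open>Smooth functions and domains\<close>

text \<open>Meant for open \<open>S\<close>.\<close>

primrec Ck_on :: "nat \<Rightarrow> ('a::euclidean_space \<Rightarrow> real) \<Rightarrow> 'a set \<Rightarrow> bool" where
  "Ck_on 0 f S \<longleftrightarrow> continuous_on S f"
| "Ck_on (Suc k) f S \<longleftrightarrow> (\<forall>x\<in>S. f differentiable (at x)) \<and>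
     (\<forall>b\<in>Basis. Ck_on k (\<lambda>x. frechet_derivative f (at x) b) S)"

definition smooth_on :: "('a::euclidean_space \<Rightarrow> real) \<Rightarrow> 'a set \<Rightarrow> bool" where
  "smooth_on f S \<longleftrightarrow> (\<forall>k. Ck_on k f S)"

text \<open>
  Near each boundary point, in suitably rotated coordinates with \<open>e\<close> as last axis, the domain is
  the region above the graph of a smooth function \<open>\<gamma>\<close> of the remaining coordinates. These are
  encoded by the orthogonal projection onto the hyperplane orthogonal to \<open>e\<close>.
\<close>

definition smooth_bounded_domain :: "'a::euclidean_space set \<Rightarrow> bool" where
  "smooth_bounded_domain \<Omega> \<longleftrightarrow> open \<Omega> \<and> connected \<Omega> \<and> \<Omega> \<noteq> {} \<and> bounded \<Omega> \<and>
     (\<forall>p\<in>frontier \<Omega>. \<exists>r>0. \<exists>e \<gamma>. norm e = 1 \<and> smooth_on \<gamma> UNIV \<and>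
        \<Omega> \<inter> ball p r = {x \<in> ball p r. x \<bullet> e > \<gamma> (x - (x \<bullet> e) *\<^sub>R e)})"

text \<open>C1 up to the boundary: the function and its gradient extend continuously to the closure.\<close>

definition C1_closure :: "'a::euclidean_space set \<Rightarrow> ('a \<Rightarrow> real) \<Rightarrow> bool" where
  "C1_closure \<Omega> f \<longleftrightarrow> continuous_on (closure \<Omega>) f \<and>
     (\<exists>G. continuous_on (closure \<Omega>) G \<and> (\<forall>x\<in>\<Omega>. (f has_derivative (\<lambda>h. G x \<bullet> h)) (at x)))"

definition C1_interval :: "real \<Rightarrow> real \<Rightarrow> (real \<Rightarrow> real) \<Rightarrow> bool" where
  "C1_interval a b v \<longleftrightarrow>
     (\<exists>v'. continuous_on {a..b} v' \<and>
        (\<forall>t\<in>{a..b}. (v has_real_derivative v' t) (at t within {a..b})))"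

definition test_fun :: "'a::euclidean_space set \<Rightarrow> ('a \<Rightarrow> real) \<Rightarrow> bool" where
  "test_fun \<Omega> \<psi> \<longleftrightarrow> smooth_on \<psi> UNIV \<and>
     (\<exists>K. compact K \<and> K \<subseteq> \<Omega> \<and> (\<forall>x. x \<notin> K \<longrightarrow> \<psi> x = 0))"

definition grad :: "(real ^ 'd \<Rightarrow> real) \<Rightarrow> real ^ 'd \<Rightarrow> real ^ 'd" where
  "grad \<psi> x = (\<chi> k. frechet_derivative \<psi> (at x) (axis k 1))"

subsection \<open>Lebesgue spaces\<close>

definition L2_sq :: "'a::euclidean_space set \<Rightarrow> ('a \<Rightarrow> 'b::euclidean_space) \<Rightarrow> ennreal" where
  "L2_sq S f = (\<integral>\<^sup>+x\<in>S. ennreal ((norm (f x))\<^sup>2) \<partial>lebesgue)"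

definition L2 :: "'a::euclidean_space set \<Rightarrow> ('a \<Rightarrow> 'b::euclidean_space) \<Rightarrow> bool" where
  "L2 S f \<longleftrightarrow> f \<in> borel_measurable (lebesgue_on S) \<and> L2_sq S f < \<infinity>"

definition L2_norm :: "'a::euclidean_space set \<Rightarrow> ('a \<Rightarrow> 'b::euclidean_space) \<Rightarrow> real" where
  "L2_norm S f = sqrt (enn2real (L2_sq S f))"

definition Linf :: "'a::euclidean_space set \<Rightarrow> ('a \<Rightarrow> real) \<Rightarrow> bool" where
  "Linf S f \<longleftrightarrow> f \<in> borel_measurable (lebesgue_on S) \<and>
     (\<exists>M. AE x in lebesgue_on S. \<bar>f x\<bar> \<le> M)"

subsection \<open>Spatial Sobolev spaces\<close>

definition weak_gradient ::
    "(real ^ 'd) set \<Rightarrow> (real ^ 'd \<Rightarrow> real) \<Rightarrow> (real ^ 'd \<Rightarrow> real ^ 'd) \<Rightarrow> bool" where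
  "weak_gradient \<Omega> f G \<longleftrightarrow> L2 \<Omega> f \<and> L2 \<Omega> G \<and>
     (\<forall>\<psi> k. test_fun \<Omega> \<psi> \<longrightarrow>
        (LINT x:\<Omega>|lebesgue. f x * grad \<psi> x $ k) = - (LINT x:\<Omega>|lebesgue. G x $ k * \<psi> x))"

text \<open>The closure of the test functions in the H1 norm.\<close>

definition H10 :: "(real ^ 'd) set \<Rightarrow> (real ^ 'd \<Rightarrow> real) \<Rightarrow> bool" where
  "H10 \<Omega> f \<longleftrightarrow> (\<exists>G. weak_gradient \<Omega> f G \<and>
     (\<forall>\<epsilon>>0. \<exists>\<psi>. test_fun \<Omega> \<psi> \<and>
        L2_sq \<Omega> (\<lambda>x. f x - \<psi> x) + L2_sq \<Omega> (\<lambda>x. G x - grad \<psi> x) < \<epsilon>))"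

definition cylinder :: "(real ^ 'd) set \<Rightarrow> real \<Rightarrow> ((real ^ 'd) \<times> real) set" where
  "cylinder \<Omega> T = \<Omega> \<times> {0<..<T}"

text \<open>
  The gradient in \<open>x\<close> of a function of \<open>(x, t)\<close>, taken on almost every time slice. Joint
  measurability of \<open>u\<close> and \<open>G\<close> is what Bochner measurability of \<open>t \<mapsto> u(\<cdot>, t)\<close> as a map
  into H1 amounts to.
\<close>

definition is_x_gradient ::
    "(real ^ 'd) set \<Rightarrow> real \<Rightarrow> ((real ^ 'd) \<times> real \<Rightarrow> real) \<Rightarrow> ((real ^ 'd) \<times> real \<Rightarrow> real ^ 'd) \<Rightarrow> bool" where
  "is_x_gradient \<Omega> T u G \<longleftrightarrow> G \<in> borel_measurable (lebesgue_on (cylinder \<Omega> T)) \<and>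
     (AE t in lebesgue_on {0<..<T}. weak_gradient \<Omega> (\<lambda>x. u (x, t)) (\<lambda>x. G (x, t)))"

definition x_grad ::
    "(real ^ 'd) set \<Rightarrow> real \<Rightarrow> ((real ^ 'd) \<times> real \<Rightarrow> real) \<Rightarrow> (real ^ 'd) \<times> real \<Rightarrow> real ^ 'd" where
  "x_grad \<Omega> T u = (SOME G. is_x_gradient \<Omega> T u G)"

definition L2_H1_sq :: "(real ^ 'd) set \<Rightarrow> real \<Rightarrow> ((real ^ 'd) \<times> real \<Rightarrow> real) \<Rightarrow> ennreal" where
  "L2_H1_sq \<Omega> T u = (\<integral>\<^sup>+t\<in>{0<..<T}.
     (L2_sq \<Omega> (\<lambda>x. u (x, t)) + L2_sq \<Omega> (\<lambda>x. x_grad \<Omega> T u (x, t))) \<partial>lebesgue)"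

definition L2_H10 :: "(real ^ 'd) set \<Rightarrow> real \<Rightarrow> ((real ^ 'd) \<times> real \<Rightarrow> real) \<Rightarrow> bool" where
  "L2_H10 \<Omega> T u \<longleftrightarrow> u \<in> borel_measurable (lebesgue_on (cylinder \<Omega> T)) \<and>
     (AE t in lebesgue_on {0<..<T}. H10 \<Omega> (\<lambda>x. u (x, t))) \<and>
     (\<exists>G. is_x_gradient \<Omega> T u G) \<and> L2_H1_sq \<Omega> T u < \<infinity>"

subsection \<open>Fractional Sobolev spaces in time with values in L2\<close>

text \<open>The Sobolev-Slobodeckij norm, for \<open>0 < s < 1\<close>.\<close>

definition Hs_L2_sq :: "(real ^ 'd) set \<Rightarrow> real \<Rightarrow> real \<Rightarrow> ((real ^ 'd) \<times> real \<Rightarrow> real) \<Rightarrow> ennreal" where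
  "Hs_L2_sq \<Omega> T s u =
     (\<integral>\<^sup>+t\<in>{0<..<T}. L2_sq \<Omega> (\<lambda>x. u (x, t)) \<partial>lebesgue) +
     (\<integral>\<^sup>+t\<in>{0<..<T}. (\<integral>\<^sup>+r\<in>{0<..<T}.
        L2_sq \<Omega> (\<lambda>x. u (x, t) - u (x, r)) * ennreal (\<bar>t - r\<bar> powr - (1 + 2 * s)) \<partial>lebesgue) \<partial>lebesgue)"

text \<open>
  \<open>W k\<close> is the \<open>k\<close>-th derivative of \<open>w\<close>, regarded as a map from \<open>(0, T)\<close> into L2; difference
  quotients converge in the L2 norm. A compact support in \<open>(0, T]\<close> means that \<open>w\<close> vanishes near
  time 0, with no condition at time \<open>T\<close>.
\<close>

definition zero_Cinf_L2 :: "(real ^ 'd) set \<Rightarrow> real \<Rightarrow> ((real ^ 'd) \<times> real \<Rightarrow> real) \<Rightarrow> bool" where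
  "zero_Cinf_L2 \<Omega> T w \<longleftrightarrow> w \<in> borel_measurable (lebesgue_on (cylinder \<Omega> T)) \<and>
     (\<exists>W. W 0 = w \<and>
        (\<forall>k::nat. \<forall>t\<in>{0<..<T}. L2 \<Omega> (\<lambda>x. W k (x, t)) \<and>
           ((\<lambda>h. L2_sq \<Omega> (\<lambda>x. (W k (x, t + h) - W k (x, t)) / h - W (Suc k) (x, t)))
              \<longlongrightarrow> 0) (at 0))) \<and>
     (\<exists>\<delta>>0. \<forall>t\<in>{0<..<T}. t < \<delta> \<longrightarrow> (AE x in lebesgue_on \<Omega>. w (x, t) = 0))"

definition zero_Hs_L2 :: "(real ^ 'd) set \<Rightarrow> real \<Rightarrow> real \<Rightarrow> ((real ^ 'd) \<times> real \<Rightarrow> real) \<Rightarrow> bool" where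
  "zero_Hs_L2 \<Omega> T s u \<longleftrightarrow> u \<in> borel_measurable (lebesgue_on (cylinder \<Omega> T)) \<and>
     Hs_L2_sq \<Omega> T s u < \<infinity> \<and>
     (\<forall>\<epsilon>>0. \<exists>w. zero_Cinf_L2 \<Omega> T w \<and> Hs_L2_sq \<Omega> T s (\<lambda>p. u p - w p) < \<epsilon>)"

subsection \<open>Weak solutions\<close>

definition B_space :: "(real ^ 'd) set \<Rightarrow> real \<Rightarrow> real \<Rightarrow> ((real ^ 'd) \<times> real \<Rightarrow> real) \<Rightarrow> bool" where
  "B_space \<Omega> T s u \<longleftrightarrow> zero_Hs_L2 \<Omega> T s u \<and> L2_H10 \<Omega> T u"

definition B_norm :: "(real ^ 'd) set \<Rightarrow> real \<Rightarrow> real \<Rightarrow> ((real ^ 'd) \<times> real \<Rightarrow> real) \<Rightarrow> real" where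
  "B_norm \<Omega> T s u = sqrt (enn2real (Hs_L2_sq \<Omega> T s u + L2_H1_sq \<Omega> T u))"

text \<open>
  Riemann-Liouville derivatives. For \<open>s < 1/2\<close> and square integrable \<open>f\<close> the integrals converge
  for every \<open>t\<close>; if \<open>f\<close> is moreover in \<open>H\<^sup>s\<close>, they are absolutely continuous in \<open>t\<close>, hence
  differentiable almost everywhere.
\<close>

definition RL_left :: "real \<Rightarrow> (real \<Rightarrow> real) \<Rightarrow> real \<Rightarrow> real" where
  "RL_left s f t = 1 / Gamma (1 - s) *
     deriv (\<lambda>t. LINT \<tau>:{0<..<t}|lebesgue. (t - \<tau>) powr - s * f \<tau>) t"

definition RL_right :: "real \<Rightarrow> real \<Rightarrow> (real \<Rightarrow> real) \<Rightarrow> real \<Rightarrow> real" where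
  "RL_right T s f t = - (1 / Gamma (1 - s)) *
     deriv (\<lambda>t. LINT \<tau>:{t<..<T}|lebesgue. (\<tau> - t) powr - s * f \<tau>) t"

text \<open>
  Weak solutions, with source term \<open>F\<close>. The homogeneous boundary and initial conditions are
  encoded in membership in the space \<open>B\<close>.
\<close>

definition weak_solution ::
    "(real ^ 'd) set \<Rightarrow> real \<Rightarrow> real \<Rightarrow> (real ^ 'd \<Rightarrow> real ^ 'd ^ 'd) \<Rightarrow> (real ^ 'd \<Rightarrow> real) \<Rightarrow>
     ((real ^ 'd) \<times> real \<Rightarrow> real) \<Rightarrow> ((real ^ 'd) \<times> real \<Rightarrow> real) \<Rightarrow> bool" where
  "weak_solution \<Omega> T \<alpha> A q F u \<longleftrightarrow> B_space \<Omega> T (\<alpha> / 2) u \<and>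
     (\<forall>w. B_space \<Omega> T (\<alpha> / 2) w \<longrightarrow>
        (LINT p:cylinder \<Omega> T|lebesgue.
           RL_left (\<alpha> / 2) (\<lambda>\<tau>. u (fst p, \<tau>)) (snd p) *
           RL_right T (\<alpha> / 2) (\<lambda>\<tau>. w (fst p, \<tau>)) (snd p)) +
        (LINT p:cylinder \<Omega> T|lebesgue.
           (\<Sum>k\<in>UNIV. \<Sum>l\<in>UNIV. A (fst p) $ k $ l * x_grad \<Omega> T u p $ k * x_grad \<Omega> T w p $ l)) +
        (LINT p:cylinder \<Omega> T|lebesgue. q (fst p) * u p * w p) =
        (LINT p:cylinder \<Omega> T|lebesgue. F p * w p))"

end

theory Submission
  imports Defs
begin

text \<open>
  Put \<open>\<sigma> = \<alpha>/2\<close> and extend functions by zero in time. The increments of the kernels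
  \<open>K (t - p)\<close> and \<open>K (p - t)\<close> of the two fractional integrals, and those of a step function weighted
  by the Slobodeckij kernel, have proportional Gram matrices in L2, because all of them depend only
  on \<open>\<bar>p - q\<bar> powr (1 - 2\<sigma>)\<close>. Hence the left and right fractional derivatives of \<open>u\<close> exist
  almost everywhere, their L2 norms are multiples of the Slobodeckij seminorm of \<open>u\<close> on the whole
  line, and the L2 product of the left and the right derivative of \<open>u\<close> is a positive multiple of its
  square. By a fractional Hardy inequality, which uses \<open>\<sigma> < 1/2\<close>, the seminorm on the line is
  controlled by the norm of \<open>H\<^sup>\<sigma>(0, T)\<close>. So the weak formulation is a bounded and coercive bilinear
  form on the complete space \<open>B\<^sup>\<sigma>(D)\<close>, and the Lax-Milgram theorem applies.
\<close>

text \<open>Only increments of the kernel \<open>K\<close> lie in L2, since \<open>K\<close> itself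
  decays too slowly. Hence the use of difference quotients: the quotient of a fractional integral
  superposes kernel increments with the function as density, so its squared norm is a double
  integral against a Gram matrix. Polarisation reduces Gram matrices to squared distances, and
  homogeneity forces these to be multiples of a single power. For the step functions the same
  superposition is the Slobodeckij quotient of running averages of the function, which visibly
  converges; proportionality carries the Cauchy property over to the kernels. Left against right
  kernels give a one-sided power; symmetrising it yields the same Gram matrix with a minus sign,
  which the sign in \<open>RL_right\<close> cancels. Two obstacles shape the rest.
  \<open>RL_left\<close> and \<open>RL_right\<close> are pointwise derivatives, so an L2 limit must
  be upgraded to a derivative almost everywhere, first on time slices and then jointly in
  \<open>(x, t)\<close>. And \<open>x_grad\<close> is a choice specified on slices, so the solution
  space stores a function together with its gradient, and uniqueness of weak gradients links the
  two.\<close>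

lemma quadratic_nonneg_imp_square_le:
  fixes a b c :: real
  assumes q: "\<And>t. 0 \<le> a - 2 * t * b + t\<^sup>2 * c" and c: "0 \<le> c"
  shows "b\<^sup>2 \<le> a * c"
proof (cases "c = 0")
  case True
  have "b = 0"
  proof (rule ccontr)
    assume "b \<noteq> 0"
    \<comment> \<open>Without the quadratic term the expression is affine in \<open>t\<close>; this
      \<open>t\<close> gives it the value -1.\<close>
    with q[of "(a+1)/(2*b)"] True show False by simp
  qed
  with True show ?thesis by simp
next
  case False
  with c have c: "0 < c" by simp
  \<comment> \<open>\<open>b/c\<close> is the minimiser of the quadratic.\<close>
  from q[of "b/c"] have "0 \<le> a - b\<^sup>2 / c"
    using c by (simp add: field_simps power2_eq_square)
  then show ?thesis using c by (simp add: field_simps)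
qed

lemma sq_norm_add_le:
  fixes x y :: "'b::real_inner"
  shows "(norm (x + y))\<^sup>2 \<le> 2 * (norm x)\<^sup>2 + 2 * (norm y)\<^sup>2"
proof -
  have "(norm (x + y))\<^sup>2 + (norm (x - y))\<^sup>2 = 2 * (norm x)\<^sup>2 + 2 * (norm y)\<^sup>2"
    by (simp add: power2_norm_eq_inner inner_simps)
  then show ?thesis using zero_le_power2[of "norm (x - y)"] by linarith
qed

lemma sq_norm_diff_le:
  fixes x y :: "'b::real_inner"
  shows "(norm (x - y))\<^sup>2 \<le> 2 * (norm x)\<^sup>2 + 2 * (norm y)\<^sup>2"
  using sq_norm_add_le[of x "- y"] by simp

subsection \<open>Square-integrable functions\<close>

text \<open>Stated for an arbitrary measure because the same calculus is used on the line, on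
  products and on restricted completed Lebesgue measure. Euclidean values cover a function paired
  with its gradient.\<close>

definition sq_int :: "'a measure \<Rightarrow> ('a \<Rightarrow> 'b::euclidean_space) \<Rightarrow> bool" where
  "sq_int M f \<longleftrightarrow> f \<in> borel_measurable M \<and> integrable M (\<lambda>x. (norm (f x))\<^sup>2)"

lemma sq_int_measurable [measurable_dest]: "sq_int M f \<Longrightarrow> f \<in> borel_measurable M"
  by (simp add: sq_int_def)

lemma sq_int_integrable: "sq_int M f \<Longrightarrow> integrable M (\<lambda>x. (norm (f x))\<^sup>2)"
  by (simp add: sq_int_def)

lemma sq_int_real_iff:
  "sq_int M f \<longleftrightarrow> f \<in> borel_measurable M \<and> integrable M (\<lambda>x. (f x)\<^sup>2)" for f :: "'a \<Rightarrow> real"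
  by (simp add: sq_int_def)

lemma sq_int_iff_nn_integral:
  "sq_int M f \<longleftrightarrow> f \<in> borel_measurable M \<and> (\<integral>\<^sup>+x. ennreal ((norm (f x))\<^sup>2) \<partial>M) < \<infinity>"
  by (auto simp: sq_int_def integrable_iff_bounded)

lemma sq_int_nn_integral_eq:
  "sq_int M f \<Longrightarrow> (\<integral>\<^sup>+x. ennreal ((norm (f x))\<^sup>2) \<partial>M) = ennreal (\<integral>x. (norm (f x))\<^sup>2 \<partial>M)"
  by (intro nn_integral_eq_integral) (auto simp: sq_int_def)

lemma sq_int_bound:
  assumes "sq_int M f" "g \<in> borel_measurable M" "AE x in M. norm (g x) \<le> norm (f x)"
  shows "sq_int M g"
proof -
  have "integrable M (\<lambda>x. (norm (g x))\<^sup>2)"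
    by (rule Bochner_Integration.integrable_bound[OF sq_int_integrable[OF assms(1)]])
       (use assms in \<open>auto intro: power_mono elim!: eventually_mono\<close>)
  with assms show ?thesis by (simp add: sq_int_def)
qed

lemma sq_int_add:
  assumes f: "sq_int M f" and g: "sq_int M g" shows "sq_int M (\<lambda>x. f x + g x)"
proof -
  have "integrable M (\<lambda>x. (norm (f x + g x))\<^sup>2)"
  proof (rule Bochner_Integration.integrable_bound)
    show "integrable M (\<lambda>x. 2 * (norm (f x))\<^sup>2 + 2 * (norm (g x))\<^sup>2)"
      using f g by (auto simp: sq_int_def)
    show "(\<lambda>x. (norm (f x + g x))\<^sup>2) \<in> borel_measurable M"
      using f g by (auto simp: sq_int_def)
  qed (use sq_norm_add_le in auto)
  then show ?thesis using f g by (auto simp: sq_int_def)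
qed

lemma sq_int_scaleR:
  assumes f: "sq_int M f" shows "sq_int M (\<lambda>x. c *\<^sub>R f x)"
  using f by (auto simp: sq_int_def power_mult_distrib)

lemma sq_int_cmult: "sq_int M f \<Longrightarrow> sq_int M (\<lambda>x. c * f x)" for f :: "'a \<Rightarrow> real"
  using sq_int_scaleR[of M f c] by simp

lemma sq_int_diff:
  assumes f: "sq_int M f" and g: "sq_int M g" shows "sq_int M (\<lambda>x. f x - g x)"
  using sq_int_add[OF f sq_int_scaleR[OF g, of "-1"]] by simp

lemma sq_int_zero [simp]: "sq_int M (\<lambda>x. 0)"
  by (simp add: sq_int_def)

lemma integrable_inner_sq_int:
  assumes f: "sq_int M f" and g: "sq_int M g" shows "integrable M (\<lambda>x. f x \<bullet> g x)"
proof (rule Bochner_Integration.integrable_bound)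
  show "integrable M (\<lambda>x. (norm (f x))\<^sup>2 + (norm (g x))\<^sup>2)"
    using f g by (auto simp: sq_int_def)
  show "(\<lambda>x. f x \<bullet> g x) \<in> borel_measurable M"
    using f g by (auto simp: sq_int_def)
  have "\<bar>x \<bullet> y\<bar> \<le> (norm x)\<^sup>2 + (norm y)\<^sup>2" for x y :: 'b
  proof -
    have "\<bar>x \<bullet> y\<bar> \<le> norm x * norm y" by (rule Cauchy_Schwarz_ineq2)
    moreover have "2 * (norm x * norm y) \<le> (norm x)\<^sup>2 + (norm y)\<^sup>2"
      using zero_le_power2[of "norm x - norm y"] unfolding power2_diff by linarith
    moreover have "0 \<le> norm x * norm y" by simp
    ultimately show ?thesis by linarith
  qed
  then show "AE x in M. norm (f x \<bullet> g x) \<le> norm ((norm (f x))\<^sup>2 + (norm (g x))\<^sup>2)"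
    by simp
qed

lemma integrable_mult_sq_int:
  "sq_int M f \<Longrightarrow> sq_int M g \<Longrightarrow> integrable M (\<lambda>x. f x * g x)" for f g :: "'a \<Rightarrow> real"
  using integrable_inner_sq_int[of M f g] by simp

lemma integral_Cauchy_Schwarz_sq:
  assumes f: "sq_int M f" and g: "sq_int M g"
  shows "(\<integral>x. f x \<bullet> g x \<partial>M)\<^sup>2 \<le> (\<integral>x. (norm (f x))\<^sup>2 \<partial>M) * (\<integral>x. (norm (g x))\<^sup>2 \<partial>M)"
proof (rule quadratic_nonneg_imp_square_le)
  fix t
  have "0 \<le> (\<integral>x. (norm (f x - t *\<^sub>R g x))\<^sup>2 \<partial>M)" by simp
  also have "\<dots> = (\<integral>x. (norm (f x))\<^sup>2 - 2 * t * (f x \<bullet> g x) + t\<^sup>2 * (norm (g x))\<^sup>2 \<partial>M)"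
    by (intro Bochner_Integration.integral_cong refl)
       (simp add: power2_norm_eq_inner inner_simps inner_commute algebra_simps power2_eq_square[of t])
  also have "\<dots> = (\<integral>x. (norm (f x))\<^sup>2 \<partial>M) - 2 * t * (\<integral>x. f x \<bullet> g x \<partial>M) + t\<^sup>2 * (\<integral>x. (norm (g x))\<^sup>2 \<partial>M)"
    using integrable_inner_sq_int[OF f g] sq_int_integrable[OF f] sq_int_integrable[OF g] by simp
  finally show "0 \<le> \<dots>" .
qed simp

lemma integral_Cauchy_Schwarz:
  assumes f: "sq_int M f" and g: "sq_int M g"
  shows "\<bar>\<integral>x. f x \<bullet> g x \<partial>M\<bar> \<le> sqrt (\<integral>x. (norm (f x))\<^sup>2 \<partial>M) * sqrt (\<integral>x. (norm (g x))\<^sup>2 \<partial>M)"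
  using real_sqrt_le_mono[OF integral_Cauchy_Schwarz_sq[OF f g]] by (simp add: real_sqrt_mult)

lemma integral_sq_add_le:
  assumes f: "sq_int M f" and g: "sq_int M g"
  shows "(\<integral>x. (norm (f x + g x))\<^sup>2 \<partial>M) \<le> 2 * (\<integral>x. (norm (f x))\<^sup>2 \<partial>M) + 2 * (\<integral>x. (norm (g x))\<^sup>2 \<partial>M)"
proof -
  have "(\<integral>x. (norm (f x + g x))\<^sup>2 \<partial>M) \<le> (\<integral>x. 2 * (norm (f x))\<^sup>2 + 2 * (norm (g x))\<^sup>2 \<partial>M)"
    using sq_int_integrable[OF f] sq_int_integrable[OF g] sq_int_integrable[OF sq_int_add[OF f g]]
    by (intro integral_mono sq_norm_add_le) auto
  also have "\<dots> = 2 * (\<integral>x. (norm (f x))\<^sup>2 \<partial>M) + 2 * (\<integral>x. (norm (g x))\<^sup>2 \<partial>M)"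
    using sq_int_integrable[OF f] sq_int_integrable[OF g] by simp
  finally show ?thesis .
qed

text \<open>Expand around the limits: \<open>f n \<bullet> g n - f' \<bullet> g'\<close> is a sum of
  three products, each containing a difference that tends to 0 in L2.\<close>

lemma tendsto_integral_inner:
  fixes f g :: "nat \<Rightarrow> 'a \<Rightarrow> 'b::euclidean_space"
  assumes f: "\<And>n. sq_int M (f n)" "sq_int M f'" and g: "\<And>n. sq_int M (g n)" "sq_int M g'"
    and lf: "(\<lambda>n. \<integral>x. (norm (f n x - f' x))\<^sup>2 \<partial>M) \<longlonglongrightarrow> 0"
    and lg: "(\<lambda>n. \<integral>x. (norm (g n x - g' x))\<^sup>2 \<partial>M) \<longlonglongrightarrow> 0"
  shows "(\<lambda>n. \<integral>x. f n x \<bullet> g n x \<partial>M) \<longlonglongrightarrow> (\<integral>x. f' x \<bullet> g' x \<partial>M)"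
proof -
  let ?F = "\<lambda>n. \<integral>x. (norm (f n x - f' x))\<^sup>2 \<partial>M" and ?G = "\<lambda>n. \<integral>x. (norm (g n x - g' x))\<^sup>2 \<partial>M"
  let ?a = "sqrt (\<integral>x. (norm (f' x))\<^sup>2 \<partial>M)" and ?b = "sqrt (\<integral>x. (norm (g' x))\<^sup>2 \<partial>M)"
  note df = sq_int_diff[OF f] and dg = sq_int_diff[OF g]
  have "(\<lambda>n. (\<integral>x. f n x \<bullet> g n x \<partial>M) - (\<integral>x. f' x \<bullet> g' x \<partial>M)) \<longlonglongrightarrow> 0"
  proof (rule Lim_null_comparison[OF always_eventually])
    show "\<forall>n. norm ((\<integral>x. f n x \<bullet> g n x \<partial>M) - (\<integral>x. f' x \<bullet> g' x \<partial>M)) \<le>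
       sqrt (?F n) * sqrt (?G n) + sqrt (?F n) * ?b + ?a * sqrt (?G n)"
    proof
      fix n
      have "(\<integral>x. f n x \<bullet> g n x \<partial>M) - (\<integral>x. f' x \<bullet> g' x \<partial>M) = (\<integral>x. f n x \<bullet> g n x - f' x \<bullet> g' x \<partial>M)"
        by (rule Bochner_Integration.integral_diff[symmetric]) (intro integrable_inner_sq_int f g)+
      also have "\<dots> = (\<integral>x. ((f n x - f' x) \<bullet> (g n x - g' x) + (f n x - f' x) \<bullet> g' x) + f' x \<bullet> (g n x - g' x) \<partial>M)"
        by (intro Bochner_Integration.integral_cong refl) (simp add: inner_simps)
      also have "\<dots> = (\<integral>x. (f n x - f' x) \<bullet> (g n x - g' x) \<partial>M) + (\<integral>x. (f n x - f' x) \<bullet> g' x \<partial>M) + (\<integral>x. f' x \<bullet> (g n x - g' x) \<partial>M)"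
        using integrable_inner_sq_int[OF df dg] integrable_inner_sq_int[OF df g(2)] integrable_inner_sq_int[OF f(2) dg]
        by simp
      finally show "norm ((\<integral>x. f n x \<bullet> g n x \<partial>M) - (\<integral>x. f' x \<bullet> g' x \<partial>M)) \<le>
       sqrt (?F n) * sqrt (?G n) + sqrt (?F n) * ?b + ?a * sqrt (?G n)"
        using integral_Cauchy_Schwarz[OF df[of n] dg[of n]] integral_Cauchy_Schwarz[OF df[of n] g(2)] integral_Cauchy_Schwarz[OF f(2) dg[of n]]
        by simp
    qed
    have "(\<lambda>n. sqrt (?F n) * sqrt (?G n) + sqrt (?F n) * ?b + ?a * sqrt (?G n)) \<longlonglongrightarrow> sqrt 0 * sqrt 0 + sqrt 0 * ?b + ?a * sqrt 0"
      by (intro tendsto_intros lf lg)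
    then show "(\<lambda>n. sqrt (?F n) * sqrt (?G n) + sqrt (?F n) * ?b + ?a * sqrt (?G n)) \<longlonglongrightarrow> 0" by simp
  qed
  then show ?thesis by (simp add: LIM_zero_iff)
qed

text \<open>A subsequence with geometrically small steps converges almost everywhere, and Fatou's
  lemma turns its limit into the L2 limit of the whole sequence. The subsequence is part of the
  conclusion because pointwise convergence is used later to identify limits.\<close>

theorem Riesz_Fischer:
  fixes f :: "nat \<Rightarrow> 'a \<Rightarrow> 'b::euclidean_space"
  assumes f: "\<And>n. sq_int M (f n)"
  and C: "\<And>e. 0 < e \<Longrightarrow> \<exists>N. \<forall>m\<ge>N. \<forall>n\<ge>N. (\<integral>x. (norm (f m x - f n x))\<^sup>2 \<partial>M) < e"
  obtains g r where "sq_int M g" "(\<lambda>n. \<integral>x. (norm (f n x - g x))\<^sup>2 \<partial>M) \<longlonglongrightarrow> 0"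
    "strict_mono (r :: nat \<Rightarrow> nat)" "AE x in M. (\<lambda>k. f (r k) x) \<longlonglongrightarrow> g x"
proof -
  have [measurable]: "f n \<in> borel_measurable M" for n using f by (simp add: sq_int_def)
  have "\<exists>N. \<forall>k::nat. \<forall>m\<ge>N k. \<forall>n\<ge>N k. (\<integral>x. (norm (f m x - f n x))\<^sup>2 \<partial>M) < (1/4)^k"
    by (rule choice) (use C in auto)
  then obtain N where N: "\<And>k m n. m \<ge> N k \<Longrightarrow> n \<ge> N k \<Longrightarrow> (\<integral>x. (norm (f m x - f n x))\<^sup>2 \<partial>M) < (1/4)^k"
    by blast
  \<comment> \<open>Partial sums of \<open>Suc (N i)\<close> are strictly increasing and at the same
    time dominate each \<open>N k\<close>.\<close>
  define r where "r k = (\<Sum>i\<le>k. Suc (N i))" for k :: nat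
  have r: "strict_mono r" by (rule strict_monoI_Suc) (simp add: r_def)
  have rN: "N k \<le> r k" for k
    using member_le_sum[of k "{..k}" "\<lambda>i. Suc (N i)"] by (simp add: r_def)
  have rle: "N k \<le> r j" if "k \<le> j" for k j
    using rN[of k] strict_mono_less_eq[OF r, of k j] that by simp
  define D where "D k x = norm (f (r (Suc k)) x - f (r k) x)" for k x
  have [measurable]: "D k \<in> borel_measurable M" for k unfolding D_def by measurable
  have iD: "(\<integral>\<^sup>+x. ennreal ((D k x)\<^sup>2) \<partial>M) \<le> ennreal ((1/4)^k)" for k
    using sq_int_nn_integral_eq[OF sq_int_diff[OF f f], of "r (Suc k)" "r k"] N[of k "r (Suc k)" "r k"] rle[of k "Suc k"] rN
    by (simp add: D_def ennreal_leI less_imp_le)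
  have "(\<integral>\<^sup>+x. (\<Sum>k. ennreal (2^k * (D k x)\<^sup>2)) \<partial>M) = (\<Sum>k. \<integral>\<^sup>+x. ennreal (2^k * (D k x)\<^sup>2) \<partial>M)"
    by (rule nn_integral_suminf) measurable
  also have "\<dots> \<le> (\<Sum>k. ennreal ((1/2)^k))"
  proof (rule suminf_le)
    fix k
    have "(\<integral>\<^sup>+x. ennreal (2^k * (D k x)\<^sup>2) \<partial>M) = ennreal (2^k) * (\<integral>\<^sup>+x. ennreal ((D k x)\<^sup>2) \<partial>M)"
      by (subst nn_integral_cmult[symmetric]) (auto simp: ennreal_mult)
    also have "\<dots> \<le> ennreal (2^k) * ennreal ((1/4)^k)" by (intro mult_left_mono iD) simp
    also have "\<dots> = ennreal ((1/2)^k)" by (subst ennreal_mult[symmetric]) (simp_all add: power_mult_distrib[symmetric])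
    finally show "(\<integral>\<^sup>+x. ennreal (2^k * (D k x)\<^sup>2) \<partial>M) \<le> ennreal ((1/2)^k)" .
  qed auto
  also have "\<dots> < top" unfolding less_top[symmetric]
    by (rule ennreal_suminf_neq_top) (auto intro: summable_geometric)
  finally have "(\<integral>\<^sup>+x. (\<Sum>k. ennreal (2^k * (D k x)\<^sup>2)) \<partial>M) \<noteq> \<infinity>" by auto
  then have "AE x in M. (\<Sum>k. ennreal (2^k * (D k x)\<^sup>2)) \<noteq> \<infinity>"
    by (intro nn_integral_noteq_infinite) measurable
  then have conv: "AE x in M. convergent (\<lambda>k. f (r k) x)"
  proof (rule eventually_mono)
    fix x assume x: "(\<Sum>k. ennreal (2^k * (D k x)\<^sup>2)) \<noteq> \<infinity>"
    have s: "summable (\<lambda>k. 2^k * (D k x)\<^sup>2)"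
      by (rule summable_suminf_not_top) (use x in auto)
    have "summable (\<lambda>k. D k x)"
    proof (rule summable_comparison_test)
      \<comment> \<open>The weight \<open>2^k\<close> still loses against the bound
        \<open>(1/4)^k\<close> on the squared steps, and \<open>D \<le> 2^k * D^2 + (1/2)^k\<close>
        converts summable weighted squares into summable distances.\<close>
      show "summable (\<lambda>k. 2^k * (D k x)\<^sup>2 + (1/2)^k)"
        by (intro summable_add s summable_geometric) simp
      have "D k x \<le> 2^k * (D k x)\<^sup>2 + (1/2)^k" for k
      proof -
        have "0 \<le> 2^k * (D k x - (1/2)^k)\<^sup>2" by simp
        also have "\<dots> = 2^k * (D k x)\<^sup>2 - 2 * D k x + (1/2)^k"
          by (simp add: power2_diff algebra_simps power_divide) (simp add: power2_eq_square)
        finally have "2 * D k x \<le> 2^k * (D k x)\<^sup>2 + (1/2)^k" by simp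
        moreover have "0 \<le> D k x" by (simp add: D_def)
        ultimately show ?thesis by linarith
      qed
      then show "\<exists>N. \<forall>n\<ge>N. norm (D n x) \<le> 2^n * (D n x)\<^sup>2 + (1/2)^n"
        by (auto simp: D_def)
    qed
    then have "summable (\<lambda>k. f (r (Suc k)) x - f (r k) x)"
      unfolding D_def by (rule summable_norm_cancel)
    then have "convergent (\<lambda>n. \<Sum>k<n. f (r (Suc k)) x - f (r k) x)"
      by (simp add: summable_iff_convergent)
    then have "convergent (\<lambda>n. f (r n) x - f (r 0) x)" by (simp add: sum_lessThan_telescope[of "\<lambda>i. f (r i) x"])
    then have "convergent (\<lambda>n. (f (r n) x - f (r 0) x) + f (r 0) x)"
      by (rule convergent_add) (rule convergent_const)
    then show "convergent (\<lambda>k. f (r k) x)" by simp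
  qed
  define g where "g x = lim (\<lambda>k. f (r k) x)" for x
  have [measurable]: "g \<in> borel_measurable M" unfolding g_def by measurable
  have lim: "AE x in M. (\<lambda>k. f (r k) x) \<longlonglongrightarrow> g x"
    using conv by eventually_elim (simp add: g_def convergent_LIMSEQ_iff)
  \<comment> \<open>Fatou along \<open>r\<close>: the Cauchy estimate between \<open>f n\<close> and
    \<open>f (r k)\<close> survives the limit in \<open>k\<close>.\<close>
  have bound: "\<exists>N. \<forall>n\<ge>N. (\<integral>\<^sup>+x. ennreal ((norm (f n x - g x))\<^sup>2) \<partial>M) \<le> ennreal e" if "0 < e" for e
  proof -
    obtain N' where N': "\<And>m n. m \<ge> N' \<Longrightarrow> n \<ge> N' \<Longrightarrow> (\<integral>x. (norm (f m x - f n x))\<^sup>2 \<partial>M) < e" using C[OF \<open>0 < e\<close>] by blast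
    show ?thesis
    proof (intro exI allI impI)
      fix n assume n: "N' \<le> n"
      have "(\<integral>\<^sup>+x. ennreal ((norm (f n x - g x))\<^sup>2) \<partial>M) = (\<integral>\<^sup>+x. liminf (\<lambda>k. ennreal ((norm (f n x - f (r k) x))\<^sup>2)) \<partial>M)"
      proof (rule nn_integral_cong_AE, use lim in eventually_elim)
        fix x assume "(\<lambda>k. f (r k) x) \<longlonglongrightarrow> g x"
        then have "(\<lambda>k. ennreal ((norm (f n x - f (r k) x))\<^sup>2)) \<longlonglongrightarrow> ennreal ((norm (f n x - g x))\<^sup>2)"
          by (intro tendsto_intros)
        then show "ennreal ((norm (f n x - g x))\<^sup>2) = liminf (\<lambda>k. ennreal ((norm (f n x - f (r k) x))\<^sup>2))"
          by (rule lim_imp_Liminf[OF trivial_limit_sequentially, symmetric])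
      qed
      also have "\<dots> \<le> liminf (\<lambda>k. \<integral>\<^sup>+x. ennreal ((norm (f n x - f (r k) x))\<^sup>2) \<partial>M)"
        by (rule nn_integral_liminf) measurable
      also have "\<dots> \<le> liminf (\<lambda>k::nat. ennreal e)"
      proof (rule Liminf_mono, rule eventually_sequentiallyI[of N'])
        fix k assume "N' \<le> k"
        then have "N' \<le> r k" using seq_suble[OF r, of k] by simp
        then show "(\<integral>\<^sup>+x. ennreal ((norm (f n x - f (r k) x))\<^sup>2) \<partial>M) \<le> ennreal e"
          using sq_int_nn_integral_eq[OF sq_int_diff[OF f f], of n "r k"] N'[OF n, of "r k"] by (simp add: ennreal_leI less_imp_le)
      qed
      also have "\<dots> = ennreal e" by (simp add: Liminf_const)
      finally show "(\<integral>\<^sup>+x. ennreal ((norm (f n x - g x))\<^sup>2) \<partial>M) \<le> ennreal e" .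
    qed
  qed
  obtain n0 where n0: "\<forall>n\<ge>n0. (\<integral>\<^sup>+x. ennreal ((norm (f n x - g x))\<^sup>2) \<partial>M) \<le> ennreal 1" using bound[of 1] by auto
  have dg: "sq_int M (\<lambda>x. f n0 x - g x)"
    unfolding sq_int_iff_nn_integral using le_less_trans[OF n0[rule_format, of n0] ennreal_less_top] by auto
  have g: "sq_int M g" using sq_int_diff[OF f[of n0] dg] by simp
  have "(\<lambda>n. \<integral>x. (norm (f n x - g x))\<^sup>2 \<partial>M) \<longlonglongrightarrow> 0"
  proof (rule LIMSEQ_I)
    fix e :: real assume e: "0 < e"
    obtain n1 where n1: "\<forall>n\<ge>n1. (\<integral>\<^sup>+x. ennreal ((norm (f n x - g x))\<^sup>2) \<partial>M) \<le> ennreal (e/2)" using bound[of "e/2"] e by auto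
    show "\<exists>no. \<forall>n\<ge>no. norm ((\<integral>x. (norm (f n x - g x))\<^sup>2 \<partial>M) - 0) < e"
    proof (intro exI[of _ n1] allI impI)
      fix n assume "n1 \<le> n"
      then have "(\<integral>x. (norm (f n x - g x))\<^sup>2 \<partial>M) \<le> e/2"
        using n1[rule_format, of n, unfolded sq_int_nn_integral_eq[OF sq_int_diff[OF f g], of n]] ennreal_le_iff[of "e/2"] e by simp
      then show "norm ((\<integral>x. (norm (f n x - g x))\<^sup>2 \<partial>M) - 0) < e" using e by simp
    qed
  qed
  from that[OF g this r lim] show thesis .
qed

lemma L2_tendsto_Cauchy:
  fixes f :: "nat \<Rightarrow> 'a \<Rightarrow> 'b::euclidean_space"
  assumes f: "\<And>n. sq_int M (f n)" and g: "sq_int M g"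
    and l: "(\<lambda>n. \<integral>x. (norm (f n x - g x))\<^sup>2 \<partial>M) \<longlonglongrightarrow> 0" and e: "0 < e"
  shows "\<exists>N. \<forall>m\<ge>N. \<forall>n\<ge>N. (\<integral>x. (norm (f m x - f n x))\<^sup>2 \<partial>M) < e"
proof -
  obtain N where N: "\<And>n. n \<ge> N \<Longrightarrow> (\<integral>x. (norm (f n x - g x))\<^sup>2 \<partial>M) < e/4"
    using LIMSEQ_D[OF l, of "e/4"] e by auto
  have "(\<integral>x. (norm (f m x - f n x))\<^sup>2 \<partial>M) < e" if "m \<ge> N" "n \<ge> N" for m n
  proof -
    have "(\<integral>x. (norm (f m x - f n x))\<^sup>2 \<partial>M) = (\<integral>x. (norm ((f m x - g x) + (g x - f n x)))\<^sup>2 \<partial>M)" by simp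
    also have "\<dots> \<le> 2 * (\<integral>x. (norm (f m x - g x))\<^sup>2 \<partial>M) + 2 * (\<integral>x. (norm (g x - f n x))\<^sup>2 \<partial>M)"
      by (intro integral_sq_add_le sq_int_diff f g)
    also have "\<dots> < e" using N[OF that(1)] N[OF that(2)] by (simp add: norm_minus_commute)
    finally show ?thesis .
  qed
  then show ?thesis by blast
qed

text \<open>Riesz-Fischer produces a subsequence converging to some limit \<open>g'\<close>; both
  \<open>g\<close> and \<open>g'\<close> are L2 limits of \<open>f\<close>, hence equal almost
  everywhere.\<close>

lemma L2_tendsto_AE_subseq:
  fixes f :: "nat \<Rightarrow> 'a \<Rightarrow> 'b::euclidean_space"
  assumes f: "\<And>n. sq_int M (f n)" and g: "sq_int M g"
    and l: "(\<lambda>n. \<integral>x. (norm (f n x - g x))\<^sup>2 \<partial>M) \<longlonglongrightarrow> 0"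
  obtains r :: "nat \<Rightarrow> nat" where "strict_mono r" "AE x in M. (\<lambda>k. f (r k) x) \<longlonglongrightarrow> g x"
proof -
  obtain g' r where g': "sq_int M g'" "(\<lambda>n. \<integral>x. (norm (f n x - g' x))\<^sup>2 \<partial>M) \<longlonglongrightarrow> 0"
    "strict_mono (r :: nat \<Rightarrow> nat)" "AE x in M. (\<lambda>k. f (r k) x) \<longlonglongrightarrow> g' x"
    by (rule Riesz_Fischer[OF f L2_tendsto_Cauchy[OF f g l]])
  have "(\<integral>x. (norm (g' x - g x))\<^sup>2 \<partial>M) \<le> 0"
  proof (rule LIMSEQ_le_const)
    show "(\<lambda>n. 2 * (\<integral>x. (norm (f n x - g' x))\<^sup>2 \<partial>M) + 2 * (\<integral>x. (norm (f n x - g x))\<^sup>2 \<partial>M)) \<longlonglongrightarrow> 0"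
      using tendsto_add[OF tendsto_mult_left[OF g'(2), of 2] tendsto_mult_left[OF l, of 2]] by simp
    have "(\<integral>x. (norm (g' x - g x))\<^sup>2 \<partial>M) \<le> 2 * (\<integral>x. (norm (f n x - g' x))\<^sup>2 \<partial>M) + 2 * (\<integral>x. (norm (f n x - g x))\<^sup>2 \<partial>M)" for n
      using integral_sq_add_le[OF sq_int_diff[OF g'(1) f[of n]] sq_int_diff[OF f[of n] g]] by (simp add: norm_minus_commute)
    then show "\<exists>N. \<forall>n\<ge>N. (\<integral>x. (norm (g' x - g x))\<^sup>2 \<partial>M) \<le> 2 * (\<integral>x. (norm (f n x - g' x))\<^sup>2 \<partial>M) + 2 * (\<integral>x. (norm (f n x - g x))\<^sup>2 \<partial>M)"
      by blast
  qed
  then have "(\<integral>x. (norm (g' x - g x))\<^sup>2 \<partial>M) = 0" by (simp add: order_antisym)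
  then have "AE x in M. (norm (g' x - g x))\<^sup>2 = 0"
    using sq_int_integrable[OF sq_int_diff[OF g'(1) g]] by (simp add: integral_nonneg_eq_0_iff_AE)
  with g'(4) have "AE x in M. (\<lambda>k. f (r k) x) \<longlonglongrightarrow> g x" by eventually_elim simp
  with g'(3) show thesis by (rule that)
qed

text \<open>Fatou's lemma applied to the parallelogram remainder \<open>2 |f n|^2 + 2 |g|^2 - |f n - g|^2\<close>.\<close>

lemma L2_tendsto_if_AE_tendsto_norm_le:
  fixes f :: "nat \<Rightarrow> 'a \<Rightarrow> 'b::euclidean_space"
  assumes f: "\<And>n. sq_int M (f n)" and g: "sq_int M g"
    and ae: "AE x in M. (\<lambda>n. f n x) \<longlonglongrightarrow> g x"
    and le: "\<And>n. (\<integral>x. (norm (f n x))\<^sup>2 \<partial>M) \<le> (\<integral>x. (norm (g x))\<^sup>2 \<partial>M)"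
  shows "(\<lambda>n. \<integral>x. (norm (f n x - g x))\<^sup>2 \<partial>M) \<longlonglongrightarrow> 0"
proof (rule LIMSEQ_I)
  fix e :: real assume e: "0 < e"
  have [measurable]: "f n \<in> borel_measurable M" "g \<in> borel_measurable M" for n using f g by (auto simp: sq_int_def)
  let ?G = "\<integral>x. (norm (g x))\<^sup>2 \<partial>M"
  define h where "h n x = 2 * (norm (f n x))\<^sup>2 + 2 * (norm (g x))\<^sup>2 - (norm (f n x - g x))\<^sup>2" for n x
  have h0: "0 \<le> h n x" for n x using sq_norm_diff_le[of "f n x" "g x"] by (simp add: h_def)
  have [measurable]: "h n \<in> borel_measurable M" for n unfolding h_def by measurable
  have ih: "integrable M (h n)" for n unfolding h_def
    using sq_int_integrable[OF f] sq_int_integrable[OF g] sq_int_integrable[OF sq_int_diff[OF f g]] by auto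
  have eh: "(\<integral>x. h n x \<partial>M) = 2 * (\<integral>x. (norm (f n x))\<^sup>2 \<partial>M) + 2 * ?G - (\<integral>x. (norm (f n x - g x))\<^sup>2 \<partial>M)" for n
    unfolding h_def using sq_int_integrable[OF f] sq_int_integrable[OF g] sq_int_integrable[OF sq_int_diff[OF f g]] by simp
  have "ennreal (4 * ?G) = (\<integral>\<^sup>+x. ennreal (4 * (norm (g x))\<^sup>2) \<partial>M)"
    using sq_int_integrable[OF g] by (subst nn_integral_eq_integral) auto
  also have "\<dots> = (\<integral>\<^sup>+x. liminf (\<lambda>n. ennreal (h n x)) \<partial>M)"
  proof (rule nn_integral_cong_AE, use ae in eventually_elim)
    fix x assume "(\<lambda>n. f n x) \<longlonglongrightarrow> g x"
    then have "(\<lambda>n. ennreal (h n x)) \<longlonglongrightarrow> ennreal (2 * (norm (g x))\<^sup>2 + 2 * (norm (g x))\<^sup>2 - (norm (g x - g x))\<^sup>2)"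
      unfolding h_def by (intro tendsto_intros)
    from lim_imp_Liminf[OF trivial_limit_sequentially this]
    show "ennreal (4 * (norm (g x))\<^sup>2) = liminf (\<lambda>n. ennreal (h n x))" by simp
  qed
  also have "\<dots> \<le> liminf (\<lambda>n. \<integral>\<^sup>+x. ennreal (h n x) \<partial>M)"
    by (rule nn_integral_liminf) measurable
  also have "\<dots> = liminf (\<lambda>n. ennreal (\<integral>x. h n x \<partial>M))"
    by (subst nn_integral_eq_integral[OF ih]) (use h0 in auto)
  finally have L: "ennreal (4 * ?G) \<le> liminf (\<lambda>n. ennreal (\<integral>x. h n x \<partial>M))" .
  \<comment> \<open>The alternative is needed because \<open>ennreal\<close> maps negative numbers
    to 0, where a strict inequality could fail.\<close>
  have "eventually (\<lambda>n. ennreal (4 * ?G - e) < ennreal (\<integral>x. h n x \<partial>M) \<or> 4 * ?G - e < 0) sequentially"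
  proof (cases "4 * ?G - e < 0")
    case False
    then have "ennreal (4 * ?G - e) < ennreal (4 * ?G)" using e by (simp add: ennreal_less_iff)
    also note L
    finally show ?thesis using less_LiminfD by (fastforce elim: eventually_mono)
  qed simp
  then obtain N where N: "\<And>n. n \<ge> N \<Longrightarrow> ennreal (4 * ?G - e) < ennreal (\<integral>x. h n x \<partial>M) \<or> 4 * ?G - e < 0"
    by (auto simp: eventually_sequentially)
  show "\<exists>no. \<forall>n\<ge>no. norm ((\<integral>x. (norm (f n x - g x))\<^sup>2 \<partial>M) - 0) < e"
  proof (intro exI[of _ N] allI impI)
    fix n assume "N \<le> n"
    have "0 \<le> (\<integral>x. h n x \<partial>M)" using h0 by simp
    then have "4 * ?G - e < (\<integral>x. h n x \<partial>M)"
      using N[OF \<open>N \<le> n\<close>] by (cases "4 * ?G - e < 0") (auto simp: ennreal_less_iff)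
    then show "norm ((\<integral>x. (norm (f n x - g x))\<^sup>2 \<partial>M) - 0) < e" using eh[of n] le[of n] by simp
  qed
qed

subsection \<open>Lebesgue differentiation on the line\<close>

text \<open>At a point where the derivative fails, arbitrarily short intervals starting or ending
  there carry a discrepancy proportional to their length. A disjoint Vitali subfamily, tagged at
  these end points, is a partial division of the kind controlled by Henstock's lemma, so its total
  length is small.\<close>

theorem negligible_not_DERIV_integral:
  fixes f :: "real \<Rightarrow> real"
  assumes f: "f integrable_on {a..b}"
  shows "negligible {x \<in> {a<..<b}. \<not> ((\<lambda>t. integral {a..t} f) has_real_derivative f x) (at x)}"
proof -
  define F where "F t = integral {a..t} f" for t
  \<comment> \<open>The interval between \<open>x\<close> and \<open>x + h\<close>, written as a
    ball to fit the Vitali theorem.\<close>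
  define S where "S = (\<lambda>(x, h). cball (x + h/2) (\<bar>h\<bar>/2) :: real set)"
  define bad where "bad k = (\<lambda>(x, h). \<bar>h\<bar> / (real k + 1) < \<bar>F (x + h) - F x - f x * h\<bar>)" for k
  define E where "E k = {x \<in> {a<..<b}. \<forall>d>0. \<exists>h. h \<noteq> 0 \<and> \<bar>h\<bar> < d \<and> bad k (x, h)}" for k
  have S_eq: "S (x, h) = (if h > 0 then {x..x+h} else {x+h..x})" for x h
    unfolding S_def by (auto simp: cball_eq_atLeastAtMost field_simps)
  have neg: "negligible (E k)" for k
    unfolding negligible_outer_le
  proof (intro allI impI)
    fix e :: real assume e: "0 < e"
    have "e / (real k + 1) > 0" using e by simp
    from Henstock_lemma[OF f[folded box_real(2)] this] obtain \<gamma> where gam: "gauge \<gamma>"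
      and hl: "\<And>p. \<lbrakk>p tagged_partial_division_of (cbox a b); \<gamma> fine p\<rbrakk> \<Longrightarrow>
             sum (\<lambda>(x,k). norm(measure lborel k *\<^sub>R f x - integral k f)) p < e / (real k + 1)" by auto
    \<comment> \<open>The bad intervals that are fine for the gauge; every point of
      \<open>E k\<close> has arbitrarily short ones, so they form a Vitali cover.\<close>
    define K where "K = {i. fst i \<in> E k \<and> snd i \<noteq> 0 \<and> S i \<subseteq> \<gamma> (fst i) \<and> S i \<subseteq> {a..b} \<and> bad k i}"
    obtain C where C: "countable C" "C \<subseteq> K"
     "pairwise (\<lambda>i j. disjnt (cball (fst i + snd i/2) (\<bar>snd i\<bar>/2)) (cball (fst j + snd j/2) (\<bar>snd j\<bar>/2))) C"
     "negligible(E k - (\<Union>i \<in> C. cball (fst i + snd i/2) (\<bar>snd i\<bar>/2)))"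
    proof (rule Vitali_covering_theorem_cballs[of K "\<lambda>i. \<bar>snd i\<bar>/2" "E k" "\<lambda>i. fst i + snd i/2"])
      fix i assume "i \<in> K" then show "0 < \<bar>snd i\<bar>/2" by (simp add: K_def)
    next
      fix x d :: real assume x: "x \<in> E k" and d: "0 < d"
      from gam have "open (\<gamma> x)" "x \<in> \<gamma> x" by (auto simp: gauge_def)
      then obtain d1 where d1: "0 < d1" "ball x d1 \<subseteq> \<gamma> x" by (meson openE)
      from x have "x \<in> {a<..<b}" by (simp add: E_def)
      then obtain d2 where d2: "0 < d2" "ball x d2 \<subseteq> {a<..<b}" by (meson openE open_greaterThanLessThan)
      define m where "m = min d (min d1 d2)"
      have "m > 0" using d d1 d2 by (simp add: m_def)
      with x obtain h where h: "h \<noteq> 0" "\<bar>h\<bar> < m" "bad k (x, h)" unfolding E_def by blast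
      have "S (x,h) \<subseteq> ball x m" using h by (auto simp: S_eq dist_real_def split: if_splits)
      then have "S (x,h) \<subseteq> ball x d1" "S (x,h) \<subseteq> ball x d2" by (auto simp: m_def)
      then have "(x, h) \<in> K" using d1 d2 h x greaterThanLessThan_subseteq_atLeastAtMost_iff[of a b a b] by (fastforce simp: K_def)
      moreover have "x \<in> cball (fst (x,h) + snd (x,h)/2) (\<bar>snd (x,h)\<bar>/2)" by (simp add: dist_real_def)
      moreover have "\<bar>snd (x,h)\<bar>/2 < d" using h d by (simp add: m_def)
      ultimately show "\<exists>i. i \<in> K \<and> x \<in> cball (fst i + snd i / 2) (\<bar>snd i\<bar> / 2) \<and> \<bar>snd i\<bar> / 2 < d" by blast
    qed
    have S': "cball (fst i + snd i/2) (\<bar>snd i\<bar>/2) = S i" for i by (cases i) (simp add: S_def)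
    note C = C[unfolded S']
    have S_cont: "measure lborel (S i) = \<bar>snd i\<bar>" for i by (cases i) (auto simp: S_eq)
    have S_b: "S i \<in> sets borel" for i by (cases i) (auto simp: S_def)
    have S_fm: "S i \<in> lmeasurable" for i by (cases i) (auto simp: S_def)
    \<comment> \<open>Each interval contributes at least its length over \<open>k + 1\<close> to the
      Henstock sum, and that sum is below \<open>e / (real k + 1)\<close>.\<close>
    have fin: "(\<Sum>i\<in>C'. \<bar>snd i\<bar>) \<le> e" if C': "C' \<subseteq> C" "finite C'" for C'
    proof -
      have mem: "fst i \<in> S i" for i by (cases i) (auto simp: S_eq)
      have disj: "S i \<inter> S j = {}" if "i \<in> C'" "j \<in> C'" "i \<noteq> j" for i j
        using C(3) C' that unfolding pairwise_def disjnt_def by blast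
      have inj: "inj_on (\<lambda>i. (fst i, S i)) C'"
        by (rule inj_onI) (use disj mem in \<open>metis (no_types, lifting) Pair_inject disjoint_iff\<close>)
      let ?p = "(\<lambda>i. (fst i, S i)) ` C'"
      have "?p tagged_partial_division_of (cbox a b)"
        unfolding tagged_partial_division_of_def
      proof (intro conjI allI impI)
        show "finite ?p" using C' by simp
      next
        fix x1 K1 assume 1: "(x1, K1) \<in> ?p"
        then obtain i where i: "i \<in> C'" "x1 = fst i" "K1 = S i" by auto
        show "x1 \<in> K1" using i mem by simp
        show "K1 \<subseteq> cbox a b" using i C C' by (auto simp: K_def)
        show "\<exists>a b. K1 = cbox a b" using i by (cases i) (auto simp: S_eq box_real[symmetric] simp del: box_real)
      next
        fix x1 K1 x2 K2 assume 2: "(x1, K1) \<in> ?p \<and> (x2, K2) \<in> ?p \<and> (x1, K1) \<noteq> (x2, K2)"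
        then obtain i where i: "i \<in> C'" "x1 = fst i" "K1 = S i" by auto
        from 2        obtain j where j: "j \<in> C'" "x2 = fst j" "K2 = S j" by auto
        with 2 i have "i \<noteq> j" by auto
        then have "S i \<inter> S j = {}" using disj i j by blast
        then show "interior K1 \<inter> interior K2 = {}" using i j interior_subset by blast
      qed
      moreover have "\<gamma> fine ?p" using C C' by (auto simp: fine_def K_def)
      ultimately have "sum (\<lambda>(x,k). norm(measure lborel k *\<^sub>R f x - integral k f)) ?p < e / (real k + 1)" by (rule hl)
      also have "sum (\<lambda>(x,k). norm(measure lborel k *\<^sub>R f x - integral k f)) ?p = (\<Sum>i\<in>C'. \<bar>measure lborel (S i) * f (fst i) - integral (S i) f\<bar>)"
        by (subst sum.reindex[OF inj]) simp
      finally have 1: "(\<Sum>i\<in>C'. \<bar>measure lborel (S i) * f (fst i) - integral (S i) f\<bar>) < e / (real k + 1)" .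
      have "(\<Sum>i\<in>C'. \<bar>snd i\<bar> / (real k + 1)) \<le> (\<Sum>i\<in>C'. \<bar>measure lborel (S i) * f (fst i) - integral (S i) f\<bar>)"
      proof (rule sum_mono)
        fix i assume "i \<in> C'"
        then have iK: "i \<in> K" using C C' by auto
        obtain x h where ih: "i = (x, h)" by (cases i)
        have h: "h \<noteq> 0" and sub: "S (x,h) \<subseteq> {a..b}" and b: "bad k (x,h)" using iK by (auto simp: K_def ih)
        have "\<bar>F (x + h) - F x - f x * h\<bar> = \<bar>measure lborel (S i) * f (fst i) - integral (S i) f\<bar>"
        proof (cases "h > 0")
          case True
          then have s: "S i = {x..x+h}" by (simp add: S_eq ih)
          then have "a \<le> x" "x + h \<le> b" using sub True ih by auto
          then have "integral {a..x} f + integral {x..x+h} f = integral {a..x+h} f"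
            using True by (intro Henstock_Kurzweil_Integration.integral_combine integrable_on_subinterval[OF f]) auto
          then show ?thesis using True s by (simp add: F_def ih algebra_simps)
        next
          case False
          then have s: "S i = {x+h..x}" "h < 0" using h by (auto simp: S_eq ih)
          then have "a \<le> x + h" "x \<le> b" using sub ih by auto
          then have "integral {a..x+h} f + integral {x+h..x} f = integral {a..x} f"
            using s by (intro Henstock_Kurzweil_Integration.integral_combine integrable_on_subinterval[OF f]) auto
          then show ?thesis using s by (simp add: F_def ih algebra_simps)
        qed
        then show "\<bar>snd i\<bar> / (real k + 1) \<le> \<bar>measure lborel (S i) * f (fst i) - integral (S i) f\<bar>"
          using b by (simp add: bad_def ih)
      qed
      with 1 have "(\<Sum>i\<in>C'. \<bar>snd i\<bar>) / (real k + 1) < e / (real k + 1)" by (simp add: sum_divide_distrib)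
      then show ?thesis by (simp add: divide_less_cancel split: if_splits)
    qed
    have bnd: "measure lebesgue (\<Union>i\<in>C'. S i) \<le> e" if "C' \<subseteq> C" "finite C'" for C'
    proof -
      have "measure lebesgue (\<Union>i\<in>C'. S i) \<le> (\<Sum>i\<in>C'. measure lebesgue (S i))"
        by (rule measure_UNION_le) (use that S_fm in \<open>auto simp: fmeasurable_def\<close>)
      also have "\<dots> = (\<Sum>i\<in>C'. \<bar>snd i\<bar>)" using S_cont S_b by (simp add: measure_completion)
      finally show ?thesis using fin[OF that] by simp
    qed
    have U: "(\<Union>i\<in>C. S i) \<in> lmeasurable" "measure lebesgue (\<Union>i\<in>C. S i) \<le> e"
      by (rule fmeasurable_UN_bound[OF C(1) S_fm, where B=e] measure_UN_bound[OF C(1) S_fm]; use bnd in blast)+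
    let ?N = "E k - (\<Union>i\<in>C. S i)"
    show "\<exists>T. E k \<subseteq> T \<and> T \<in> lmeasurable \<and> measure lebesgue T \<le> e"
    proof (intro exI conjI)
      show "E k \<subseteq> (\<Union>i\<in>C. S i) \<union> ?N" by blast
      show "(\<Union>i\<in>C. S i) \<union> ?N \<in> lmeasurable" by (intro fmeasurable.Un U(1) negligible_imp_measurable C(4))
      have "measure lebesgue ((\<Union>i\<in>C. S i) \<union> ?N) \<le> measure lebesgue (\<Union>i\<in>C. S i) + measure lebesgue ?N"
        by (intro measure_Un_le fmeasurableD U(1) negligible_imp_sets C(4))
      then show "measure lebesgue ((\<Union>i\<in>C. S i) \<union> ?N) \<le> e" using U(2) negligible_imp_measure0[OF C(4)] by linarith
    qed
  qed
  have "{x \<in> {a<..<b}. \<not> (F has_real_derivative f x) (at x)} \<subseteq> (\<Union>k. E k)"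
  proof
    fix x assume x: "x \<in> {x \<in> {a<..<b}. \<not> (F has_real_derivative f x) (at x)}"
    show "x \<in> (\<Union>k. E k)"
    proof (rule ccontr)
      assume n: "x \<notin> (\<Union>k. E k)"
      have "(\<lambda>h. (F (x + h) - F x) / h) \<midarrow>0\<rightarrow> f x"
      proof (rule LIM_I)
        fix r :: real assume "0 < r"
        then obtain k :: nat where k: "1 / (real k + 1) < r" using reals_Archimedean[of r] by (auto simp: inverse_eq_divide add.commute)
        from n have "x \<notin> E k" by blast
        with x have "\<exists>d>0. \<forall>h::real. h \<noteq> 0 \<and> \<bar>h\<bar> < d \<longrightarrow> \<not> bad k (x, h)" unfolding E_def by blast
        then obtain d where d: "d > 0" "\<And>h::real. h \<noteq> 0 \<Longrightarrow> \<bar>h\<bar> < d \<Longrightarrow> \<not> bad k (x, h)" by blast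
        show "\<exists>s>0. \<forall>h. h \<noteq> 0 \<and> norm (h - 0) < s \<longrightarrow> norm ((F (x + h) - F x) / h - f x) < r"
        proof (intro exI[of _ d] conjI allI impI)
          fix h :: real assume h: "h \<noteq> 0 \<and> norm (h - 0) < d"
          then have "\<bar>F (x + h) - F x - f x * h\<bar> \<le> \<bar>h\<bar> / (real k + 1)" using d(2)[of h] by (simp add: bad_def)
          then have "\<bar>F (x + h) - F x - f x * h\<bar> / \<bar>h\<bar> \<le> 1 / (real k + 1)" using h by (simp add: field_simps)
          also have "\<bar>F (x + h) - F x - f x * h\<bar> / \<bar>h\<bar> = \<bar>(F (x + h) - F x) / h - f x\<bar>"
            using h by (simp add: abs_divide[symmetric] diff_divide_distrib)
          finally show "norm ((F (x + h) - F x) / h - f x) < r" using k by simp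
        qed (fact d(1))
      qed
      then show False using x by (simp add: DERIV_def)
    qed
  qed
  moreover have "negligible (\<Union>k. E k)" using neg by (intro negligible_countable_Union) auto
  ultimately show ?thesis unfolding F_def by (rule negligible_subset[rotated])
qed

subsection \<open>Integrals of powers\<close>

lemma nn_integral_powr_from_0:
  fixes a c :: real
  assumes "-1 < a" "0 \<le> c"
  shows "(\<integral>\<^sup>+x. ennreal (indicator {0..c} x * x powr a) \<partial>lborel) = ennreal (c powr (a + 1) / (a + 1))"
  using nn_integral_has_integral_lebesgue[OF _ has_integral_powr_from_0[OF assms]] by simp

lemma nn_integral_powr_to_inf:
  fixes a e :: real
  assumes "e < -1" "0 < a"
  shows "(\<integral>\<^sup>+x. ennreal (indicator {a..} x * x powr e) \<partial>lborel) = ennreal (-(a powr (e + 1)) / (e + 1))"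
  using nn_integral_has_integral_lebesgue[OF _ has_integral_powr_to_inf[OF assms]] by simp

lemma nn_integral_lborel_reflect:
  fixes f :: "real \<Rightarrow> ennreal"
  assumes [measurable]: "f \<in> borel_measurable borel"
  shows "(\<integral>\<^sup>+x. f (c - x) \<partial>lborel) = (\<integral>\<^sup>+x. f x \<partial>lborel)"
  using nn_integral_real_affine[of f "-1" c] by simp

lemma nn_integral_lborel_shift:
  fixes f :: "real \<Rightarrow> ennreal"
  assumes [measurable]: "f \<in> borel_measurable borel"
  shows "(\<integral>\<^sup>+x. f (x + c) \<partial>lborel) = (\<integral>\<^sup>+x. f x \<partial>lborel)"
  using nn_integral_real_affine[of f 1 c] by (simp add: add.commute)

abbreviation lborel2 :: "(real \<times> real) measure" where "lborel2 \<equiv> lborel \<Otimes>\<^sub>M lborel"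

lemma nn_integral_lborel2:
  assumes [measurable]: "f \<in> borel_measurable lborel2"
  shows "(\<integral>\<^sup>+z. f z \<partial>lborel2) = (\<integral>\<^sup>+t. \<integral>\<^sup>+s. f (t, s) \<partial>lborel \<partial>lborel)"
  by (rule lborel.nn_integral_fst[symmetric]) fact

subsection \<open>The kernels of fractional integration and of the Slobodeckij seminorm\<close>

locale fractional_order =
  fixes \<sigma> :: real
  assumes \<sigma>_pos: "0 < \<sigma>" and \<sigma>_half: "\<sigma> < 1/2"
begin

text \<open>The kernel of fractional integration of order \<open>1 - \<sigma>\<close> without its
  factor \<open>1 / Gamma (1 - \<sigma>)\<close>, which returns later as \<open>\<gamma>\<close>.
  The zero extension makes the integral up to time \<open>t\<close> a convolution over the
  line.\<close>

definition K :: "real \<Rightarrow> real" where "K t = (if 0 < t then t powr (-\<sigma>) else 0)"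

text \<open>The square root of the Slobodeckij weight, so that the seminorm becomes an L2 norm of a
  function of two times.\<close>

definition m :: "real \<Rightarrow> real" where "m r = \<bar>r\<bar> powr (-((1 + 2 * \<sigma>) / 2))"

text \<open>The variogram of fractional Brownian motion with Hurst index
  \<open>1/2 - \<sigma>\<close>.\<close>

definition dist_pow :: "real \<Rightarrow> real \<Rightarrow> real" where "dist_pow p q = \<bar>p - q\<bar> powr (1 - 2 * \<sigma>)"

lemma measurable_K [measurable]: "K \<in> borel_measurable borel"
  unfolding K_def by measurable

lemma measurable_m [measurable]: "m \<in> borel_measurable borel"
  unfolding m_def by measurable

lemma K_nonneg [simp]: "0 \<le> K t" by (simp add: K_def)

lemma m_nonneg [simp]: "0 \<le> m t" by (simp add: m_def)

lemma m_sq: "(m r)\<^sup>2 = \<bar>r\<bar> powr (-(1 + 2 * \<sigma>))"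
  unfolding m_def power2_eq_square by (simp add: powr_add[symmetric])

lemma m_minus [simp]: "m (- r) = m r" by (simp add: m_def)

lemma K_sq: "(K t)\<^sup>2 = (if 0 < t then t powr (-2 * \<sigma>) else 0)"
  unfolding K_def power2_eq_square by (simp add: powr_add[symmetric])

lemma K_scale: "0 < c \<Longrightarrow> K (c * t) = c powr (-\<sigma>) * K t"
  by (auto simp: K_def powr_mult zero_less_mult_iff)

lemma m_sq_scale: "0 < c \<Longrightarrow> (m (c * t))\<^sup>2 = c powr (-(1 + 2 * \<sigma>)) * (m t)\<^sup>2"
  by (simp add: m_sq abs_mult powr_mult)

lemma dist_pow_commute: "dist_pow p q = dist_pow q p"
  by (simp add: dist_pow_def abs_minus_commute)

lemma dist_pow_nonneg [simp]: "0 \<le> dist_pow p q"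
  by (simp add: dist_pow_def)

lemma dist_pow_self [simp]: "dist_pow p p = 0"
  by (simp add: dist_pow_def)

lemma nn_integral_K_sq:
  assumes "0 \<le> c"
  shows "(\<integral>\<^sup>+t. ennreal (indicator {0..c} t * t powr (-2 * \<sigma>)) \<partial>lborel) < \<infinity>"
  using nn_integral_powr_from_0[of "-2 * \<sigma>" c] \<sigma>_half assms by simp

text \<open>The two singularities are square integrable because \<open>2 * \<sigma> < 1\<close>; far
  out the increment decays like \<open>1 / t\<close>, although \<open>K\<close> itself is not square
  integrable there.\<close>

lemma K_increment_le:
  "(K (t + 1) - K t)\<^sup>2 \<le> indicator {0..1} (t + 1) * (t + 1) powr (-2 * \<sigma>) + indicator {0..1} t * t powr (-2 * \<sigma>)
     + indicator {1..} t * t powr (-2)"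
proof -
  consider "t \<le> -1" | "-1 < t" "t \<le> 0" | "0 < t" "t \<le> 1" | "1 < t" by linarith
  then show ?thesis
  proof cases
    case 1 then show ?thesis by (simp add: K_def)
  next
    case 2
    then have "(K (t + 1) - K t)\<^sup>2 = (t + 1) powr (-2 * \<sigma>)" using K_sq[of "t + 1"] by (simp add: K_def)
    then show ?thesis using 2 by (simp add: indicator_def)
  next
    case 3
    have "(t + 1) powr (-\<sigma>) \<le> t powr (-\<sigma>)" using 3 \<sigma>_pos by (intro powr_mono2') auto
    then have "\<bar>K (t + 1) - K t\<bar> \<le> K t" using 3 by (simp add: K_def)
    then have "(K (t + 1) - K t)\<^sup>2 \<le> (K t)\<^sup>2" using K_nonneg[of t] by (intro abs_le_square_iff[THEN iffD1]) simp
    then show ?thesis using 3 K_sq[of t] by (cases "t = 1") (auto simp: indicator_def)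
  next
    case 4
    have le: "(t + 1) powr (-\<sigma>) \<le> t powr (-\<sigma>)" using 4 \<sigma>_pos by (intro powr_mono2') auto
    \<comment> \<open>Since \<open>\<sigma> < 1\<close>, this bounds \<open>K (t + 1)\<close> below
      by \<open>t / (t + 1)\<close> times \<open>K t\<close>, so the increment is at most
      \<open>K t / (t + 1)\<close>.\<close>
    have "((t + 1) / t) powr (-1) \<le> ((t + 1) / t) powr (-\<sigma>)"
      using 4 \<sigma>_half by (intro powr_mono) (auto simp: field_simps)
    then have "t / (t + 1) \<le> (t + 1) powr (-\<sigma>) / t powr (-\<sigma>)"
      using 4 by (simp add: powr_divide powr_minus_divide)
    then have a: "t powr (-\<sigma>) * (t / (t + 1)) \<le> (t + 1) powr (-\<sigma>)"
      using 4 by (simp add: field_simps)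
    have "t powr (-\<sigma>) \<le> t powr 0" using 4 \<sigma>_pos by (intro powr_mono) auto
    then have b: "t powr (-\<sigma>) \<le> 1" using 4 by simp
    have "t powr (-\<sigma>) - (t + 1) powr (-\<sigma>) \<le> t powr (-\<sigma>) * (1 / (t + 1))"
      using a 4 by (simp add: field_simps)
    also have "\<dots> \<le> 1 * (1 / t)" using b 4 by (intro mult_mono) (auto simp: field_simps)
    finally have "\<bar>K (t + 1) - K t\<bar> \<le> \<bar>1 / t\<bar>" using 4 le by (simp add: K_def)
    then have "(K (t + 1) - K t)\<^sup>2 \<le> (1 / t)\<^sup>2" by (intro abs_le_square_iff[THEN iffD1])
    also have "(1 / t)\<^sup>2 = t powr (-2)" using 4 by (simp add: powr_minus power2_eq_square powr_numeral inverse_eq_divide)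
    finally show ?thesis using 4 by (simp add: indicator_def)
  qed
qed

definition k1 :: real where "k1 = (\<integral>t. (K (t + 1) - K t)\<^sup>2 \<partial>lborel)"

lemma sq_int_K_increment: "sq_int lborel (\<lambda>t. K (t + 1) - K t)"
proof -
  let ?a = "\<lambda>t. ennreal (indicator {0..1} t * t powr (-2 * \<sigma>))"
  have "(\<integral>\<^sup>+t. ennreal ((norm (K (t + 1) - K t))\<^sup>2) \<partial>lborel)
     \<le> (\<integral>\<^sup>+t. ?a (t + 1) + ?a t + ennreal (indicator {1..} t * t powr (-2)) \<partial>lborel)"
    using K_increment_le by (intro nn_integral_mono) (simp add: ennreal_plus[symmetric] ennreal_leI del: ennreal_plus)
  also have "\<dots> = (\<integral>\<^sup>+t. ?a (t + 1) \<partial>lborel) + (\<integral>\<^sup>+t. ?a t \<partial>lborel) + (\<integral>\<^sup>+t. ennreal (indicator {1..} t * t powr (-2)) \<partial>lborel)"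
    by (simp add: nn_integral_add)
  also have "\<dots> < \<infinity>"
    using nn_integral_lborel_shift[of ?a 1] nn_integral_K_sq[of 1] nn_integral_powr_to_inf[of "-2" 1] by simp
  finally show ?thesis by (simp add: sq_int_iff_nn_integral)
qed

text \<open>
  An increment family on \<open>M\<close> embeds the real line with the metric \<open>(p, q) \<mapsto> dist_pow p q powr (1/2)\<close>
  into L2, up to the factor \<open>k\<close>. Hence the Gram matrices of the increments of any two such families
  are proportional; this replaces Plancherel's theorem.
\<close>

definition increment_family :: "'a measure \<Rightarrow> (real \<Rightarrow> 'a \<Rightarrow> real) \<Rightarrow> real \<Rightarrow> bool" where
  "increment_family M E k \<longleftrightarrow> sigma_finite_measure M \<and> (\<lambda>(p, x). E p x) \<in> borel_measurable (borel \<Otimes>\<^sub>M M) \<and>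
     (\<forall>p q. sq_int M (\<lambda>x. E p x - E q x) \<and> (\<integral>x. (E p x - E q x)\<^sup>2 \<partial>M) = k * dist_pow p q)"

lemma increment_familyI:
  assumes "sigma_finite_measure M" "(\<lambda>(p, x). E p x) \<in> borel_measurable (borel \<Otimes>\<^sub>M M)"
    and *: "\<And>p q. p < q \<Longrightarrow> sq_int M (\<lambda>x. E p x - E q x) \<and> (\<integral>x. (E p x - E q x)\<^sup>2 \<partial>M) = k * dist_pow p q"
  shows "increment_family M E k"
proof -
  have "sq_int M (\<lambda>x. E p x - E q x) \<and> (\<integral>x. (E p x - E q x)\<^sup>2 \<partial>M) = k * dist_pow p q" for p q
  proof (cases p q rule: linorder_cases)
    case greater
    from *[OF greater] have "sq_int M (\<lambda>x. (-1) *\<^sub>R (E q x - E p x))" by (intro sq_int_scaleR) simp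
    then show ?thesis using *[OF greater] by (simp add: power2_commute[of "E p _" "E q _"] dist_pow_commute[of p q])
  qed (use * in auto)
  then show ?thesis using assms by (simp add: increment_family_def)
qed

text \<open>Substituting \<open>t = q + (q - p) * s\<close> and using that \<open>K\<close> is
  homogeneous of degree \<open>-\<sigma>\<close> reduces every pair to the pair at distance 1; the
  squared norm scales by \<open>c * c powr (-2 * \<sigma>)\<close>.\<close>

lemma increment_family_K: "increment_family lborel (\<lambda>p t. K (t - p)) k1"
proof (rule increment_familyI)
  fix p q :: real assume "p < q"
  define c where "c = q - p"
  have c: "0 < c" using \<open>p < q\<close> by (simp add: c_def)
  have eq: "(K (q + c * s - p) - K (q + c * s - q))\<^sup>2 = c powr (-2 * \<sigma>) * (K (s + 1) - K s)\<^sup>2" for s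
  proof -
    have "K (q + c * s - p) = K (c * (s + 1))" "K (q + c * s - q) = K (c * s)" by (auto simp: c_def algebra_simps)
    then have "K (q + c * s - p) - K (q + c * s - q) = c powr (-\<sigma>) * (K (s + 1) - K s)"
      using c by (simp only: K_scale right_diff_distrib)
    then show ?thesis using c by (simp add: power_mult_distrib power2_eq_square powr_add[symmetric])
  qed
  let ?f = "\<lambda>t. (K (t - p) - K (t - q))\<^sup>2"
  have "integrable lborel (\<lambda>s. ?f (q + c * s))"
    unfolding eq using sq_int_integrable[OF sq_int_K_increment] by simp
  then have "integrable lborel ?f" using lborel_integrable_real_affine_iff[of c ?f q] c by simp
  moreover have "(\<integral>t. ?f t \<partial>lborel) = k1 * dist_pow p q"
    using lborel_integral_real_affine[of c ?f q] c \<open>p < q\<close> unfolding eq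
    by (simp add: k1_def dist_pow_def c_def[symmetric] powr_mult_base abs_minus_commute mult.assoc[symmetric])
  ultimately show "sq_int lborel (\<lambda>x. K (x - p) - K (x - q)) \<and> (\<integral>x. (K (x - p) - K (x - q))\<^sup>2 \<partial>lborel) = k1 * dist_pow p q"
    by (simp add: sq_int_real_iff)
qed (auto intro: lborel.sigma_finite_measure_axioms)

text \<open>Reflection of the time axis maps this family to the previous one at the points
  \<open>-p\<close> and \<open>-q\<close>, with unchanged distance.\<close>

lemma increment_family_K_reflected: "increment_family lborel (\<lambda>p t. K (p - t)) k1"
proof (rule increment_familyI)
  fix p q :: real
  from increment_family_K have 1: "integrable lborel (\<lambda>t. (K (t - (-p)) - K (t - (-q)))\<^sup>2)"
    "(\<integral>t. (K (t - (-p)) - K (t - (-q)))\<^sup>2 \<partial>lborel) = k1 * dist_pow (-p) (-q)"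
    unfolding increment_family_def sq_int_real_iff by blast+
  show "sq_int lborel (\<lambda>t. K (p - t) - K (q - t)) \<and> (\<integral>t. (K (p - t) - K (q - t))\<^sup>2 \<partial>lborel) = k1 * dist_pow p q"
    using lborel_integrable_real_affine_iff[of "-1" "\<lambda>t. (K (p - t) - K (q - t))\<^sup>2" 0] 1
      lborel_integral_real_affine[of "-1" "\<lambda>t. (K (p - t) - K (q - t))\<^sup>2" 0]
    by (simp add: sq_int_real_iff dist_pow_def abs_minus_commute add.commute)
qed (auto intro: lborel.sigma_finite_measure_axioms)

lemma nn_integral_m_tail_below:
  assumes "a < t"
  shows "(\<integral>\<^sup>+s. ennreal (indicator {..a} s * (m (t - s))\<^sup>2) \<partial>lborel) = ennreal ((t - a) powr (-2 * \<sigma>) / (2 * \<sigma>))"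
proof -
  have "(\<integral>\<^sup>+s. ennreal (indicator {..a} s * (m (t - s))\<^sup>2) \<partial>lborel)
     = (\<integral>\<^sup>+s. ennreal (indicator {t - a..} (t - s) * (t - s) powr (-(1 + 2 * \<sigma>))) \<partial>lborel)"
    using assms by (intro nn_integral_cong arg_cong[where f=ennreal]) (auto simp: indicator_def m_sq)
  also have "\<dots> = (\<integral>\<^sup>+r. ennreal (indicator {t - a..} r * r powr (-(1 + 2 * \<sigma>))) \<partial>lborel)"
    by (rule nn_integral_lborel_reflect) measurable
  also have "\<dots> = ennreal ((t - a) powr (-2 * \<sigma>) / (2 * \<sigma>))"
    using assms \<sigma>_pos by (subst nn_integral_powr_to_inf) auto
  finally show ?thesis .
qed

lemma nn_integral_m_tail_above:
  assumes "t < b"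
  shows "(\<integral>\<^sup>+s. ennreal (indicator {b..} s * (m (t - s))\<^sup>2) \<partial>lborel) = ennreal ((b - t) powr (-2 * \<sigma>) / (2 * \<sigma>))"
proof -
  have "(\<integral>\<^sup>+s. ennreal (indicator {b..} s * (m (t - s))\<^sup>2) \<partial>lborel)
     = (\<integral>\<^sup>+s. ennreal (indicator {..-b} (0 - s) * (m ((-t) - (0 - s)))\<^sup>2) \<partial>lborel)"
    by (intro nn_integral_cong arg_cong[where f=ennreal]) (auto simp: indicator_def m_sq abs_minus_commute)
  also have "\<dots> = (\<integral>\<^sup>+s. ennreal (indicator {..-b} s * (m ((-t) - s))\<^sup>2) \<partial>lborel)"
    by (rule nn_integral_lborel_reflect) measurable
  also have "\<dots> = ennreal ((b - t) powr (-2 * \<sigma>) / (2 * \<sigma>))"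
    using nn_integral_m_tail_below[of "-b" "-t"] assms by (simp add: algebra_simps)
  finally show ?thesis .
qed

text \<open>The weight with which the complement of the interval enters the seminorm of a function
  extended by zero. This is where the Hardy weight \<open>t powr (-2 * \<sigma>)\<close> comes
  from.\<close>

lemma nn_integral_m_outside:
  assumes "0 < t" "t < T"
  shows "(\<integral>\<^sup>+s. ennreal (indicator (-{0<..<T}) s * (m (t - s))\<^sup>2) \<partial>lborel)
    = ennreal ((t powr (-2 * \<sigma>) + (T - t) powr (-2 * \<sigma>)) / (2 * \<sigma>))"
proof -
  have "(\<integral>\<^sup>+s. ennreal (indicator (-{0<..<T}) s * (m (t - s))\<^sup>2) \<partial>lborel)
    = (\<integral>\<^sup>+s. ennreal (indicator {..0} s * (m (t - s))\<^sup>2) + ennreal (indicator {T..} s * (m (t - s))\<^sup>2) \<partial>lborel)"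
    using assms by (intro nn_integral_cong) (auto simp: indicator_def)
  also have "\<dots> = ennreal (t powr (-2 * \<sigma>) / (2 * \<sigma>)) + ennreal ((T - t) powr (-2 * \<sigma>) / (2 * \<sigma>))"
    using nn_integral_m_tail_below[of 0 t] nn_integral_m_tail_above[of t T] assms by (subst nn_integral_add) auto
  also have "\<dots> = ennreal ((t powr (-2 * \<sigma>) + (T - t) powr (-2 * \<sigma>)) / (2 * \<sigma>))"
    using \<sigma>_pos by (simp add: ennreal_plus[symmetric] add_divide_distrib del: ennreal_plus)
  finally show ?thesis .
qed

text \<open>The Slobodeckij quotient of the step function that jumps at \<open>p\<close>. It is not
  in L2, but its increments are: they are the quotients of indicators of bounded intervals.\<close>

definition stepY :: "real \<Rightarrow> real \<times> real \<Rightarrow> real" where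
  "stepY p = (\<lambda>(t, s). (indicator {p<..} t - indicator {p<..} s) * m (t - s))"

lemma stepY_diff: "p < q \<Longrightarrow> stepY p (t, s) - stepY q (t, s) = (indicator {p<..q} t - indicator {p<..q} s) * m (t - s)"
  by (auto simp: stepY_def indicator_def)

definition k2 :: real where "k2 = (\<integral>z. (stepY 0 z - stepY 1 z)\<^sup>2 \<partial>lborel2)"

lemma measurable_stepY [measurable]: "(\<lambda>(p, z). stepY p z) \<in> borel_measurable (borel \<Otimes>\<^sub>M lborel2)"
proof -
  have "(\<lambda>(p, z). stepY p z) = (\<lambda>x. (indicator {y. fst y < snd y} (fst x, fst (snd x)) - indicator {y. fst y < snd y} (fst x, snd (snd x))) * m (fst (snd x) - snd (snd x)))"
    by (auto simp: stepY_def indicator_def fun_eq_iff)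
  also have "\<dots> \<in> borel_measurable (borel \<Otimes>\<^sub>M lborel2)" by measurable
  finally show ?thesis .
qed

lemma measurable_stepY' [measurable]: "stepY p \<in> borel_measurable lborel2"
  unfolding stepY_def by measurable

text \<open>The integrand lives where exactly one of \<open>t\<close>, \<open>s\<close> lies in the
  unit interval, so the inner integral is the weight of the complement, integrable because
  \<open>2 * \<sigma> < 1\<close>. Positivity makes \<open>k2\<close> a legitimate divisor.\<close>

lemma nn_integral_stepY_01:
  "(\<integral>\<^sup>+z. ennreal ((stepY 0 z - stepY 1 z)\<^sup>2) \<partial>lborel2) < \<infinity>" (is "?I < _")
  "0 < (\<integral>\<^sup>+z. ennreal ((stepY 0 z - stepY 1 z)\<^sup>2) \<partial>lborel2)"
proof -
  let ?A = "\<lambda>t s. ennreal (indicator {0<..<1} t * (indicator (-{0<..<1}) s * (m (t - s))\<^sup>2))"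
  have 1: "(\<integral>\<^sup>+t. \<integral>\<^sup>+s. ?A t s \<partial>lborel \<partial>lborel) < \<infinity>"
  proof -
    have "(\<integral>\<^sup>+t. \<integral>\<^sup>+s. ?A t s \<partial>lborel \<partial>lborel)
       \<le> (\<integral>\<^sup>+t. ennreal (1 / (2 * \<sigma>)) * (ennreal (indicator {0..1} t * t powr (-2 * \<sigma>)) + ennreal (indicator {0..1} (1 - t) * (1 - t) powr (-2 * \<sigma>))) \<partial>lborel)"
    proof (rule nn_integral_mono)
      fix t :: real
      show "(\<integral>\<^sup>+s. ?A t s \<partial>lborel) \<le> ennreal (1 / (2 * \<sigma>)) * (ennreal (indicator {0..1} t * t powr (-2 * \<sigma>)) + ennreal (indicator {0..1} (1 - t) * (1 - t) powr (-2 * \<sigma>)))"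
      proof (cases "t \<in> {0<..<1}")
        case True
        then have "(\<integral>\<^sup>+s. ?A t s \<partial>lborel) = ennreal ((t powr (-2 * \<sigma>) + (1 - t) powr (-2 * \<sigma>)) / (2 * \<sigma>))"
          using nn_integral_m_outside[of t 1] by simp
        also have "\<dots> = ennreal (1 / (2 * \<sigma>)) * (ennreal (indicator {0..1} t * t powr (-2 * \<sigma>)) + ennreal (indicator {0..1} (1 - t) * (1 - t) powr (-2 * \<sigma>)))"
          using True \<sigma>_pos by (simp add: ennreal_plus[symmetric] ennreal_mult[symmetric] del: ennreal_plus)
        finally show ?thesis by simp
      qed simp
    qed
    also have "\<dots> = ennreal (1 / (2 * \<sigma>)) * ((\<integral>\<^sup>+t. ennreal (indicator {0..1} t * t powr (-2 * \<sigma>)) \<partial>lborel) + (\<integral>\<^sup>+t. ennreal (indicator {0..1} (1 - t) * (1 - t) powr (-2 * \<sigma>)) \<partial>lborel))"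
      by (subst nn_integral_cmult) (auto simp: nn_integral_add)
    also have "\<dots> < \<infinity>"
      using nn_integral_lborel_reflect[of "\<lambda>t. ennreal (indicator {0..1} t * t powr (-2 * \<sigma>))" 1] nn_integral_K_sq[of 1]
      by (simp add: ennreal_mult_less_top)
    finally show ?thesis .
  qed
  have meas: "(\<lambda>z. ?A (fst z) (snd z)) \<in> borel_measurable lborel2" "(\<lambda>z. ?A (snd z) (fst z)) \<in> borel_measurable lborel2"
    by measurable
  \<comment> \<open>The increment uses the half-open interval and the tail weight the open one; the
    mismatch at 1 is a null set.\<close>
  have "AE z in lborel2. fst z \<noteq> 1 \<and> snd z \<noteq> 1"
  proof (rule lborel_pair.AE_pair_measure)
    show "{x \<in> space lborel2. fst x \<noteq> 1 \<and> snd x \<noteq> 1} \<in> sets lborel2" by measurable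
    show "AE x in lborel. AE y in lborel. fst (x, y) \<noteq> (1::real) \<and> snd (x, y) \<noteq> (1::real)"
      using AE_lborel_singleton[of "1::real"]
    proof (rule eventually_mono)
      fix x :: real assume "x \<noteq> 1"
      then show "AE y in lborel. fst (x, y) \<noteq> (1::real) \<and> snd (x, y) \<noteq> (1::real)" using AE_lborel_singleton[of "1::real"] by simp
    qed
  qed
  then have "?I \<le> (\<integral>\<^sup>+z. ?A (fst z) (snd z) + ?A (snd z) (fst z) \<partial>lborel2)"
  proof (intro nn_integral_mono_AE, elim eventually_mono)
    fix z :: "real \<times> real" assume z: "fst z \<noteq> 1 \<and> snd z \<noteq> 1"
    obtain t s where ts: "z = (t, s)" by (cases z)
    have "(stepY 0 z - stepY 1 z)\<^sup>2 = (indicator {0<..1} t - indicator {0<..1} s)\<^sup>2 * (m (t - s))\<^sup>2"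
      by (simp add: ts stepY_diff power_mult_distrib)
    then show "ennreal ((stepY 0 z - stepY 1 z)\<^sup>2) \<le> ?A (fst z) (snd z) + ?A (snd z) (fst z)"
      using z by (auto simp: ts indicator_def m_sq abs_minus_commute)
  qed
  also have "\<dots> = (\<integral>\<^sup>+z. ?A (fst z) (snd z) \<partial>lborel2) + (\<integral>\<^sup>+z. ?A (snd z) (fst z) \<partial>lborel2)"
    by (rule nn_integral_add) measurable
  also have "(\<integral>\<^sup>+z. ?A (snd z) (fst z) \<partial>lborel2) = (\<integral>\<^sup>+s. \<integral>\<^sup>+t. ?A s t \<partial>lborel \<partial>lborel)"
    using lborel_pair.nn_integral_snd[OF meas(2)] by simp
  also have "(\<integral>\<^sup>+z. ?A (fst z) (snd z) \<partial>lborel2) = (\<integral>\<^sup>+t. \<integral>\<^sup>+s. ?A t s \<partial>lborel \<partial>lborel)"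
    using nn_integral_lborel2[OF meas(1)] by simp
  also have "\<dots> + (\<integral>\<^sup>+s. \<integral>\<^sup>+t. ?A s t \<partial>lborel \<partial>lborel) < \<infinity>" using 1 by simp
  finally show "?I < \<infinity>" .
  \<comment> \<open>On the rectangle used below the two times are at most 2 apart, which bounds the
    weight from below.\<close>
  have "0 < ennreal (2 powr (-(1 + 2 * \<sigma>)))" by simp
  also have "\<dots> = (\<integral>\<^sup>+z. ennreal (2 powr (-(1 + 2 * \<sigma>))) * indicator ({0<..1} \<times> {1<..2}) z \<partial>lborel2)"
    by (subst nn_integral_cmult_indicator) (auto simp: lborel.emeasure_pair_measure_Times)
  also have "\<dots> \<le> ?I"
  proof (rule nn_integral_mono)
    fix z :: "real \<times> real"
    obtain t s where z: "z = (t, s)" by (cases z)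
    show "ennreal (2 powr (-(1 + 2 * \<sigma>))) * indicator ({0<..1} \<times> {1<..2}) z \<le> ennreal ((stepY 0 z - stepY 1 z)\<^sup>2)"
    proof (cases "0 < t \<and> t \<le> 1 \<and> 1 < s \<and> s \<le> 2")
      case True
      then have "2 powr (-(1 + 2 * \<sigma>)) \<le> \<bar>t - s\<bar> powr (-(1 + 2 * \<sigma>))"
        using \<sigma>_pos by (intro powr_mono2') auto
      then show ?thesis using True by (auto simp: z stepY_diff indicator_def power_mult_distrib m_sq intro!: ennreal_leI)
    qed (auto simp: z indicator_def)
  qed
  finally show "0 < ?I" .
qed

lemma sigma_finite_lborel2: "sigma_finite_measure lborel2"
  using lborel_pair.sigma_finite_measure_axioms .

text \<open>The weight has degree \<open>-(1 + 2 * \<sigma>)\<close> and there are two variables to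
  rescale, so the squared norm scales by \<open>c * c * c powr (-(1 + 2 * \<sigma>))\<close>, the
  same power of \<open>c\<close> as for \<open>K\<close>.\<close>

lemma increment_family_stepY: "increment_family lborel2 stepY k2"
proof (rule increment_familyI[OF sigma_finite_lborel2])
  fix p q :: real assume "p < q"
  define c where "c = q - p"
  have c: "0 < c" using \<open>p < q\<close> by (simp add: c_def)
  have "sq_int lborel2 (\<lambda>z. stepY 0 z - stepY 1 z)"
    using nn_integral_stepY_01(1) by (simp add: sq_int_iff_nn_integral)
  from sq_int_nn_integral_eq[OF this] have I0: "(\<integral>\<^sup>+z. ennreal ((stepY 0 z - stepY 1 z)\<^sup>2) \<partial>lborel2) = ennreal k2"
    by (simp add: k2_def)
  have eq: "ennreal ((stepY p (p + c * t, p + c * s) - stepY q (p + c * t, p + c * s))\<^sup>2) = ennreal (c powr (-(1 + 2 * \<sigma>))) * ennreal ((stepY 0 (t, s) - stepY 1 (t, s))\<^sup>2)" for t s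
  proof -
    have i: "indicator {p<..q} (p + c * x) = (indicator {0<..1} x :: real)" for x
      proof -
      have "q = p + c" by (simp add: c_def)
      then show ?thesis using c by (auto simp: indicator_def zero_less_mult_iff)
    qed
    have "m (p + c * t - (p + c * s)) = m (c * (t - s))" by (simp add: algebra_simps)
    then have "(stepY p (p + c * t, p + c * s) - stepY q (p + c * t, p + c * s))\<^sup>2 = c powr (-(1 + 2 * \<sigma>)) * (stepY 0 (t, s) - stepY 1 (t, s))\<^sup>2"
      using \<open>p < q\<close> m_sq_scale[OF c, of "t - s"] by (simp add: stepY_diff i power_mult_distrib)
    then show ?thesis by (simp add: ennreal_mult)
  qed
  have "(\<integral>\<^sup>+z. ennreal ((stepY p z - stepY q z)\<^sup>2) \<partial>lborel2) = (\<integral>\<^sup>+t. \<integral>\<^sup>+s. ennreal ((stepY p (t, s) - stepY q (t, s))\<^sup>2) \<partial>lborel \<partial>lborel)"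
    by (rule nn_integral_lborel2) measurable
  also have "\<dots> = (\<integral>\<^sup>+t. ennreal c * (\<integral>\<^sup>+s. ennreal ((stepY p (t, p + c * s) - stepY q (t, p + c * s))\<^sup>2) \<partial>lborel) \<partial>lborel)"
    using c by (intro nn_integral_cong) (subst nn_integral_real_affine[where c=c and t=p], auto)
  also have "\<dots> = ennreal c * (\<integral>\<^sup>+t. \<integral>\<^sup>+s. ennreal ((stepY p (t, p + c * s) - stepY q (t, p + c * s))\<^sup>2) \<partial>lborel \<partial>lborel)"
    by (rule nn_integral_cmult) measurable
  also have "(\<integral>\<^sup>+t. \<integral>\<^sup>+s. ennreal ((stepY p (t, p + c * s) - stepY q (t, p + c * s))\<^sup>2) \<partial>lborel \<partial>lborel)
     = ennreal c * (\<integral>\<^sup>+t. \<integral>\<^sup>+s. ennreal ((stepY p (p + c * t, p + c * s) - stepY q (p + c * t, p + c * s))\<^sup>2) \<partial>lborel \<partial>lborel)"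
    using c by (subst nn_integral_real_affine[where c=c and t=p]) auto
  also have "(\<integral>\<^sup>+t. \<integral>\<^sup>+s. ennreal ((stepY p (p + c * t, p + c * s) - stepY q (p + c * t, p + c * s))\<^sup>2) \<partial>lborel \<partial>lborel)
     = (\<integral>\<^sup>+t. \<integral>\<^sup>+s. ennreal (c powr (-(1 + 2 * \<sigma>))) * ennreal ((stepY 0 (t, s) - stepY 1 (t, s))\<^sup>2) \<partial>lborel \<partial>lborel)"
    unfolding eq ..
  also have "\<dots> = (\<integral>\<^sup>+z. ennreal (c powr (-(1 + 2 * \<sigma>))) * ennreal ((stepY 0 z - stepY 1 z)\<^sup>2) \<partial>lborel2)"
    by (rule nn_integral_lborel2[symmetric]) measurable
  also have "\<dots> = ennreal (c powr (-(1 + 2 * \<sigma>))) * ennreal k2"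
    by (subst nn_integral_cmult) (auto simp: I0)
  also have "ennreal c * (ennreal c * (ennreal (c powr (-(1 + 2 * \<sigma>))) * ennreal k2)) = ennreal (k2 * dist_pow p q)"
  proof -
    have "c * (c * c powr (-(1 + 2 * \<sigma>))) = c powr (1 - 2 * \<sigma>)" using c by (simp add: powr_mult_base)
    then show ?thesis using c \<open>p < q\<close> by (simp add: dist_pow_def ennreal_mult[symmetric] c_def[symmetric] abs_minus_commute mult_ac k2_def)
  qed
  finally have N: "(\<integral>\<^sup>+z. ennreal ((stepY p z - stepY q z)\<^sup>2) \<partial>lborel2) = ennreal (k2 * dist_pow p q)" .
  then have S: "sq_int lborel2 (\<lambda>z. stepY p z - stepY q z)" by (simp add: sq_int_iff_nn_integral)
  have "0 \<le> k2" by (simp add: k2_def)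
  then show "sq_int lborel2 (\<lambda>z. stepY p z - stepY q z) \<and> (\<integral>z. (stepY p z - stepY q z)\<^sup>2 \<partial>lborel2) = k2 * dist_pow p q"
    using S N sq_int_nn_integral_eq[OF S] by simp
qed simp

lemma k2_pos: "0 < k2"
proof -
  have "sq_int lborel2 (\<lambda>z. stepY 0 z - stepY 1 z)"
    using nn_integral_stepY_01(1) by (simp add: sq_int_iff_nn_integral)
  from sq_int_nn_integral_eq[OF this] nn_integral_stepY_01(2) show ?thesis by (simp add: k2_def)
qed

text \<open>The value of the Beta function at \<open>(1 - \<sigma>, 1 - \<sigma>)\<close>.\<close>

definition k3 :: real where "k3 = (\<integral>t. K t * K (1 - t) \<partial>lborel)"

lemma integrable_K_K1: "integrable lborel (\<lambda>t. K t * K (1 - t))"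
proof (rule integrableI_bounded)
  let ?a = "\<lambda>t. ennreal (indicator {0..1} t * t powr (-2 * \<sigma>))"
  have "(\<integral>\<^sup>+t. ennreal (norm (K t * K (1 - t))) \<partial>lborel) \<le> (\<integral>\<^sup>+t. ?a t + ?a (1 - t) \<partial>lborel)"
  proof (rule nn_integral_mono)
    fix t :: real
    have "2 * (K t * K (1 - t)) \<le> (K t)\<^sup>2 + (K (1 - t))\<^sup>2"
      using zero_le_power2[of "K t - K (1 - t)"] unfolding power2_diff by linarith
    moreover have "0 \<le> K t * K (1 - t)" by simp
    ultimately have "K t * K (1 - t) \<le> (K t)\<^sup>2 + (K (1 - t))\<^sup>2" by linarith
    then have "K t * K (1 - t) \<le> indicator {0..1} t * t powr (-2 * \<sigma>) + indicator {0..1} (1 - t) * (1 - t) powr (-2 * \<sigma>)"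
      unfolding K_sq by (cases "0 < t \<and> t < 1") (auto simp: K_def indicator_def)
    then show "ennreal (norm (K t * K (1 - t))) \<le> ?a t + ?a (1 - t)"
      by (simp add: ennreal_plus[symmetric] ennreal_leI del: ennreal_plus)
  qed
  also have "\<dots> = (\<integral>\<^sup>+t. ?a t \<partial>lborel) + (\<integral>\<^sup>+t. ?a (1 - t) \<partial>lborel)" by (rule nn_integral_add) auto
  also have "\<dots> < \<infinity>" using nn_integral_lborel_reflect[of ?a 1] nn_integral_K_sq[of 1] by simp
  finally show "(\<integral>\<^sup>+t. ennreal (norm (K t * K (1 - t))) \<partial>lborel) < \<infinity>" .
qed simp

lemma k3_pos: "0 < k3"
proof -
  have "(1::real) = (\<integral>t. indicator {0<..<1} t \<partial>(lborel :: real measure))" by simp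
  also have "\<dots> \<le> k3" unfolding k3_def
  proof (rule integral_mono[OF _ integrable_K_K1])
    fix t :: real
    show "indicator {0<..<1} t \<le> K t * K (1 - t)"
    proof (cases "0 < t \<and> t < 1")
      case True
      have *: "1 \<le> x powr (-\<sigma>)" if "0 < x" "x < 1" for x
        using powr_le1[of \<sigma> x] that \<sigma>_pos by (simp add: powr_minus one_le_inverse)
      have "1 * 1 \<le> t powr (-\<sigma>) * (1 - t) powr (-\<sigma>)" using True by (intro mult_mono *) auto
      then show ?thesis using True by (simp add: K_def)
    qed (auto simp: indicator_def)
  qed simp
  finally show ?thesis by simp
qed

text \<open>The one-sided half of \<open>dist_pow\<close>; it is what the product of a left and a
  right kernel integrates to.\<close>

definition pos_pow :: "real \<Rightarrow> real \<Rightarrow> real" where "pos_pow a b = (max 0 (b - a)) powr (1 - 2 * \<sigma>)"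

lemma pos_pow_add: "pos_pow a b + pos_pow b a = dist_pow a b"
  by (cases a b rule: linorder_cases) (auto simp: pos_pow_def dist_pow_def)

text \<open>The convolution of \<open>K\<close> with itself at \<open>b - a\<close>: empty overlap
  unless \<open>a < b\<close>, otherwise the same rescaling to the unit interval as before.\<close>

lemma integral_K_K:
  "integrable lborel (\<lambda>t. K (t - a) * K (b - t))"
  "(\<integral>t. K (t - a) * K (b - t) \<partial>lborel) = k3 * pos_pow a b"
proof -
  have "integrable lborel (\<lambda>t. K (t - a) * K (b - t)) \<and> (\<integral>t. K (t - a) * K (b - t) \<partial>lborel) = k3 * pos_pow a b"
  proof (cases "a < b")
    case False
    then have "(\<lambda>t. K (t - a) * K (b - t)) = (\<lambda>t. 0)" by (auto simp: K_def)
    then show ?thesis using False by (simp add: pos_pow_def)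
  next
    case True
    define c where "c = b - a"
    have c: "0 < c" using True by (simp add: c_def)
    have eq: "K (a + c * s - a) * K (b - (a + c * s)) = c powr (-2 * \<sigma>) * (K s * K (1 - s))" for s
    proof -
      have "b - (a + c * s) = c * (1 - s)" by (simp add: c_def algebra_simps)
      then have "K (a + c * s - a) * K (b - (a + c * s)) = (c powr (-\<sigma>) * K s) * (c powr (-\<sigma>) * K (1 - s))"
        using K_scale[OF c] by simp
      also have "\<dots> = (c powr (-\<sigma>) * c powr (-\<sigma>)) * (K s * K (1 - s))" by simp
      also have "c powr (-\<sigma>) * c powr (-\<sigma>) = c powr (-2 * \<sigma>)" by (simp add: powr_add[symmetric])
      finally show ?thesis .
    qed
    let ?f = "\<lambda>t. K (t - a) * K (b - t)"
    have "integrable lborel (\<lambda>s. ?f (a + c * s))" unfolding eq using integrable_K_K1 by simp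
    then have "integrable lborel ?f" using lborel_integrable_real_affine_iff[of c ?f a] c by simp
    moreover have "(\<integral>t. ?f t \<partial>lborel) = k3 * pos_pow a b"
      using lborel_integral_real_affine[of c ?f a] c True unfolding eq integral_mult_right_zero
      by (simp add: k3_def pos_pow_def c_def[symmetric] powr_mult_base mult.assoc[symmetric])
    ultimately show ?thesis by simp
  qed
  then show "integrable lborel (\<lambda>t. K (t - a) * K (b - t))"
    "(\<integral>t. K (t - a) * K (b - t) \<partial>lborel) = k3 * pos_pow a b" by auto
qed

end

section \<open>Indefinite integrals, and superpositions of families in L2\<close>

lemma AE_DERIV_indefinite_integral:
  fixes f J :: "real \<Rightarrow> real"
  assumes f: "\<And>a b. set_integrable lborel {a..b} f"
    and J: "\<And>a b. a \<le> b \<Longrightarrow> J b - J a = (LINT x:{a..b}|lborel. f x)"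
  shows "AE t in lborel. (J has_real_derivative f t) (at t)"
proof -
  define N where "N n = {x \<in> {- real n<..<real n}. \<not> ((\<lambda>t. integral {- real n..t} f) has_real_derivative f x) (at x)}" for n :: nat
  have "negligible (N n)" for n
    unfolding N_def using set_borel_integral_eq_integral(1)[OF f] by (rule negligible_not_DERIV_integral)
  then have "(\<Union>n. N n) \<in> null_sets lebesgue"
    unfolding negligible_iff_null_sets[symmetric] by (intro negligible_countable_Union) auto
  \<comment> \<open>The exceptional set is null for the completed measure only; a Borel null set
    around it is needed for a statement about \<open>lborel\<close>.\<close>
  then obtain N' where N': "N' \<in> null_sets lborel" "(\<Union>n. N n) \<subseteq> N'"
    unfolding null_sets_completion_iff2 by blast
  show ?thesis
  proof (rule AE_I'[OF N'(1)], rule subsetI)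
    fix x assume x: "x \<in> {x \<in> space lborel. \<not> (J has_real_derivative f x) (at x)}"
    obtain n :: nat where n: "\<bar>x\<bar> < real n" using reals_Archimedean2 by blast
    have "x \<in> N n"
    proof (rule ccontr)
      assume "x \<notin> N n"
      with n have d: "((\<lambda>t. integral {- real n..t} f) has_real_derivative f x) (at x)" by (auto simp: N_def abs_less_iff)
      have d': "((\<lambda>t. J (- real n) + integral {- real n..t} f) has_real_derivative (0 + f x)) (at x)"
        by (intro derivative_intros d)
      have "J (- real n) + integral {- real n..t} f = J t" if "t \<in> {- real n<..}" for t
        using J[of "- real n" t] that set_borel_integral_eq_integral(2)[OF f] by simp
      then have "(J has_real_derivative (0 + f x)) (at x)"
        using n by (intro has_field_derivative_transform_within_open[OF d', where S="{- real n<..}"]) auto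
      with x show False by simp
    qed
    with N' show "x \<in> N'" by blast
  qed
qed

lemma sq_int_imp_set_integrable:
  fixes f :: "real \<Rightarrow> real"
  assumes "sq_int lborel f" shows "set_integrable lborel {a..b} f"
proof -
  have "sq_int lborel (indicator {a..b} :: real \<Rightarrow> real)"
  proof -
    have "(\<lambda>x. (indicator {a..b} x :: real)\<^sup>2) = indicator {a..b}" by (auto simp: indicator_def)
    then show ?thesis using integrable_real_indicator[of "{a..b}" lborel] by (cases "a \<le> b") (auto simp: sq_int_real_iff)
  qed
  from integrable_mult_sq_int[OF this assms] show ?thesis by (simp add: set_integrable_def)
qed

text \<open>The families are bounded in L2 uniformly in the parameter and \<open>f\<close> is
  integrable, so by Cauchy-Schwarz the triple integral converges absolutely. The double integral
  over parameters then sees the families only through their inner products.\<close>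

lemma Fubini_gram:
  fixes e e' :: "real \<Rightarrow> 'a \<Rightarrow> real"
  assumes M: "sigma_finite_measure M"
    and me: "(\<lambda>(a, x). e a x) \<in> borel_measurable (borel \<Otimes>\<^sub>M M)" "(\<lambda>(a, x). e' a x) \<in> borel_measurable (borel \<Otimes>\<^sub>M M)"
    and e: "\<And>a. sq_int M (e a)" "\<And>a. (\<integral>x. (e a x)\<^sup>2 \<partial>M) \<le> B"
    and e': "\<And>a. sq_int M (e' a)" "\<And>a. (\<integral>x. (e' a x)\<^sup>2 \<partial>M) \<le> B'"
    and f: "integrable lborel f"
  shows "integrable lborel2 (\<lambda>z. f (fst z) * f (snd z) * (\<integral>x. e (fst z) x * e' (snd z) x \<partial>M))"
    and "(\<integral>x. (\<integral>a. f a * e a x \<partial>lborel) * (\<integral>b. f b * e' b x \<partial>lborel) \<partial>M)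
      = (\<integral>z. f (fst z) * f (snd z) * (\<integral>x. e (fst z) x * e' (snd z) x \<partial>M) \<partial>lborel2)"
    and "integrable M (\<lambda>x. (\<integral>a. f a * e a x \<partial>lborel) * (\<integral>b. f b * e' b x \<partial>lborel))"
proof -
  interpret M: sigma_finite_measure M by fact
  interpret P: pair_sigma_finite lborel2 M ..
  have [measurable]: "f \<in> borel_measurable borel" using f by auto
  define F where "F w = f (fst (fst w)) * f (snd (fst w)) * (e (fst (fst w)) (snd w) * e' (snd (fst w)) (snd w))" for w
  have [measurable]: "(\<lambda>w. e (fst (fst w)) (snd w)) \<in> borel_measurable (lborel2 \<Otimes>\<^sub>M M)"
    "(\<lambda>w. e' (snd (fst w)) (snd w)) \<in> borel_measurable (lborel2 \<Otimes>\<^sub>M M)"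
    using measurable_compose[OF _ me(1), of "\<lambda>w. (fst (fst w), snd w)" "lborel2 \<Otimes>\<^sub>M M"]
      measurable_compose[OF _ me(2), of "\<lambda>w. (snd (fst w), snd w)" "lborel2 \<Otimes>\<^sub>M M"] by auto
  have [measurable]: "F \<in> borel_measurable (lborel2 \<Otimes>\<^sub>M M)" unfolding F_def by measurable
  have aa: "integrable lborel2 (\<lambda>z. \<bar>f (fst z)\<bar> * \<bar>f (snd z)\<bar>)"
    by (rule lborel_pair.Fubini_integrable) (use f in \<open>auto simp: abs_mult\<close>)
  have inn: "(\<integral>x. \<bar>e a x\<bar> * \<bar>e' b x\<bar> \<partial>M) \<le> sqrt B * sqrt B'" for a b
  proof -
    have s: "sq_int M (\<lambda>x. \<bar>e a x\<bar>)" "sq_int M (\<lambda>x. \<bar>e' b x\<bar>)"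
      using e(1)[of a] e'(1)[of b] by (auto simp: sq_int_real_iff)
    have "(\<integral>x. \<bar>e a x\<bar> * \<bar>e' b x\<bar> \<partial>M) \<le> sqrt (\<integral>x. (e a x)\<^sup>2 \<partial>M) * sqrt (\<integral>x. (e' b x)\<^sup>2 \<partial>M)"
      using integral_Cauchy_Schwarz[OF s] by simp
    also have "\<dots> \<le> sqrt B * sqrt B'"
    proof -
      have "0 \<le> (\<integral>x. (e a x)\<^sup>2 \<partial>M)" "0 \<le> (\<integral>x. (e' b x)\<^sup>2 \<partial>M)" by simp_all
      then have "0 \<le> B" "0 \<le> B'" using e(2)[of a] e'(2)[of b] by linarith+
      then show ?thesis using e(2) e'(2) by (intro mult_mono real_sqrt_le_mono) auto
    qed
    finally show ?thesis .
  qed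
  have iF: "integrable (lborel2 \<Otimes>\<^sub>M M) F"
  proof (rule P.Fubini_integrable)
    show "F \<in> borel_measurable (lborel2 \<Otimes>\<^sub>M M)" by measurable
    show "AE z in lborel2. integrable M (\<lambda>x. F (z, x))"
      using integrable_mult_sq_int[OF e(1) e'(1)] by (auto simp: F_def)
    show "integrable lborel2 (\<lambda>z. \<integral>x. norm (F (z, x)) \<partial>M)"
    proof (rule Bochner_Integration.integrable_bound)
      show "integrable lborel2 (\<lambda>z. (\<bar>f (fst z)\<bar> * \<bar>f (snd z)\<bar>) * (sqrt B * sqrt B'))"
        using aa by (rule integrable_mult_left)
      show "(\<lambda>z. \<integral>x. norm (F (z, x)) \<partial>M) \<in> borel_measurable lborel2" by measurable
      show "AE z in lborel2. norm (\<integral>x. norm (F (z, x)) \<partial>M) \<le> norm (\<bar>f (fst z)\<bar> * \<bar>f (snd z)\<bar> * (sqrt B * sqrt B'))"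
      proof (rule AE_I2)
        fix z
        have "(\<integral>x. norm (F (z, x)) \<partial>M) = \<bar>f (fst z)\<bar> * \<bar>f (snd z)\<bar> * (\<integral>x. \<bar>e (fst z) x\<bar> * \<bar>e' (snd z) x\<bar> \<partial>M)"
          by (simp add: F_def abs_mult)
        also have "\<dots> \<le> \<bar>f (fst z)\<bar> * \<bar>f (snd z)\<bar> * (sqrt B * sqrt B')"
          by (intro mult_left_mono inn) auto
        also have "\<dots> \<le> norm (\<bar>f (fst z)\<bar> * \<bar>f (snd z)\<bar> * (sqrt B * sqrt B'))"
          unfolding real_norm_def by (rule abs_ge_self)
        finally show "norm (\<integral>x. norm (F (z, x)) \<partial>M) \<le> norm (\<bar>f (fst z)\<bar> * \<bar>f (snd z)\<bar> * (sqrt B * sqrt B'))"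
          by simp
      qed
    qed
  qed
  have Fz: "(\<integral>x. F (z, x) \<partial>M) = f (fst z) * f (snd z) * (\<integral>x. e (fst z) x * e' (snd z) x \<partial>M)" for z
    by (simp add: F_def)
  show "integrable lborel2 (\<lambda>z. f (fst z) * f (snd z) * (\<integral>x. e (fst z) x * e' (snd z) x \<partial>M))"
    using P.integrable_fst'[OF iF] unfolding Fz .
  have iF': "integrable (lborel2 \<Otimes>\<^sub>M M) (case_prod (\<lambda>z x. F (z, x)))" using iF by simp
  have inner: "AE x in M. (\<integral>z. F (z, x) \<partial>lborel2) = (\<integral>a. f a * e a x \<partial>lborel) * (\<integral>b. f b * e' b x \<partial>lborel)"
    using P.AE_integrable_snd[OF iF']
  proof eventually_elim
    case (elim x)
    then have "(\<integral>z. F (z, x) \<partial>lborel2) = (\<integral>a. \<integral>b. F ((a, b), x) \<partial>lborel \<partial>lborel)"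
      using lborel_pair.integral_fst'[OF elim] by simp
    also have "\<dots> = (\<integral>a. \<integral>b. (f a * e a x) * (f b * e' b x) \<partial>lborel \<partial>lborel)"
      by (simp add: F_def mult_ac)
    also have "\<dots> = (\<integral>a. f a * e a x \<partial>lborel) * (\<integral>b. f b * e' b x \<partial>lborel)"
      by simp
    finally show ?case .
  qed
  have [measurable]: "(\<lambda>(x, a). e a x) \<in> borel_measurable (M \<Otimes>\<^sub>M borel)" "(\<lambda>(x, a). e' a x) \<in> borel_measurable (M \<Otimes>\<^sub>M borel)"
    using measurable_compose[OF measurable_pair_swap' me(1)] measurable_compose[OF measurable_pair_swap' me(2)] by (auto simp: case_prod_beta)
  have m2: "(\<lambda>x. (\<integral>a. f a * e a x \<partial>lborel) * (\<integral>b. f b * e' b x \<partial>lborel)) \<in> borel_measurable M"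
    by measurable
  show "(\<integral>x. (\<integral>a. f a * e a x \<partial>lborel) * (\<integral>b. f b * e' b x \<partial>lborel) \<partial>M)
      = (\<integral>z. f (fst z) * f (snd z) * (\<integral>x. e (fst z) x * e' (snd z) x \<partial>M) \<partial>lborel2)"
  proof -
    have "(\<integral>x. (\<integral>a. f a * e a x \<partial>lborel) * (\<integral>b. f b * e' b x \<partial>lborel) \<partial>M) = (\<integral>x. \<integral>z. F (z, x) \<partial>lborel2 \<partial>M)"
      by (rule integral_cong_AE[OF m2 borel_measurable_integrable[OF P.integrable_snd[OF iF']] AE_symmetric[OF inner]])
    also have "\<dots> = (\<integral>z. \<integral>x. F (z, x) \<partial>M \<partial>lborel2)" by (rule P.Fubini_integral[OF iF'])
    finally show ?thesis unfolding Fz .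
  qed
  show "integrable M (\<lambda>x. (\<integral>a. f a * e a x \<partial>lborel) * (\<integral>b. f b * e' b x \<partial>lborel))"
    by (rule Bochner_Integration.integrable_cong_AE_imp[OF P.integrable_snd[OF iF'] m2]) (use inner in auto)
qed

section \<open>Gram matrices and difference quotients of fractional integrals\<close>

context fractional_order
begin

text \<open>The inner product of the increments from \<open>q\<close> to \<open>p\<close> and from
  \<open>s\<close> to \<open>r\<close>, recovered from squared distances by polarisation.\<close>

definition gram :: "real \<Rightarrow> real \<Rightarrow> real \<Rightarrow> real \<Rightarrow> real" where
  "gram p q r s = (dist_pow p s + dist_pow q r - dist_pow p r - dist_pow q s) / 2"

lemma gram_translate: "gram (a - h) a (a - l) a = gram (- h) 0 (- l) 0"
  by (simp add: gram_def dist_pow_def algebra_simps)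

text \<open>Single members \<open>E p\<close> need not be square integrable, so the polarisation
  identity is arranged to contain differences of two members only.\<close>

lemma increment_inner:
  assumes F: "increment_family M E k"
  shows "integrable M (\<lambda>x. (E p x - E q x) * (E r x - E s x))"
    "(\<integral>x. (E p x - E q x) * (E r x - E s x) \<partial>M) = k * gram p q r s"
proof -
  have S: "sq_int M (\<lambda>x. E p x - E q x)" and I: "(\<integral>x. (E p x - E q x)\<^sup>2 \<partial>M) = k * dist_pow p q" for p q
    using F by (auto simp: increment_family_def)
  show "integrable M (\<lambda>x. (E p x - E q x) * (E r x - E s x))" by (rule integrable_mult_sq_int[OF S S])
  have S2: "integrable M (\<lambda>x. (E p x - E q x)\<^sup>2)" for p q using S by (simp add: sq_int_real_iff)
  have "(\<integral>x. (E p x - E q x) * (E r x - E s x) \<partial>M)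
     = (\<integral>x. ((E p x - E s x)\<^sup>2 + (E q x - E r x)\<^sup>2 - (E p x - E r x)\<^sup>2 - (E q x - E s x)\<^sup>2) / 2 \<partial>M)"
    by (intro Bochner_Integration.integral_cong refl) (simp add: power2_eq_square algebra_simps)
  also have "\<dots> = k * gram p q r s"
    using S2 by (simp add: I gram_def algebra_simps)
  finally show "(\<integral>x. (E p x - E q x) * (E r x - E s x) \<partial>M) = k * gram p q r s" .
qed

text \<open>Two step sizes at once, so that one norm formula covers both a difference quotient
  (second coefficient 0) and the difference of two quotients, as needed for the Cauchy
  property.\<close>

definition incr :: "(real \<Rightarrow> 'a \<Rightarrow> real) \<Rightarrow> real \<Rightarrow> real \<Rightarrow> real \<Rightarrow> real \<Rightarrow> real \<Rightarrow> 'a \<Rightarrow> real" where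
  "incr E c h d l a x = c * (E (a - h) x - E a x) + d * (E (a - l) x - E a x)"

definition gram2 :: "real \<Rightarrow> real \<Rightarrow> real \<Rightarrow> real \<Rightarrow> real \<Rightarrow> real \<Rightarrow> real" where
  "gram2 c h d l a b = c\<^sup>2 * gram (a - h) a (b - h) b + c * d * gram (a - h) a (b - l) b
     + c * d * gram (a - l) a (b - h) b + d\<^sup>2 * gram (a - l) a (b - l) b"

lemma incr_inner:
  assumes F: "increment_family M E k"
  shows "(\<integral>x. incr E c h d l a x * incr E c h d l b x \<partial>M) = k * gram2 c h d l a b"
proof -
  note i = increment_inner[OF F]
  have "(\<integral>x. incr E c h d l a x * incr E c h d l b x \<partial>M)
    = (\<integral>x. c\<^sup>2 * ((E (a - h) x - E a x) * (E (b - h) x - E b x)) + c * d * ((E (a - h) x - E a x) * (E (b - l) x - E b x))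
      + c * d * ((E (a - l) x - E a x) * (E (b - h) x - E b x)) + d\<^sup>2 * ((E (a - l) x - E a x) * (E (b - l) x - E b x)) \<partial>M)"
    by (intro Bochner_Integration.integral_cong refl) (simp add: incr_def power2_eq_square algebra_simps)
  also have "\<dots> = c\<^sup>2 * (k * gram (a - h) a (b - h) b) + c * d * (k * gram (a - h) a (b - l) b)
      + c * d * (k * gram (a - l) a (b - h) b) + d\<^sup>2 * (k * gram (a - l) a (b - l) b)"
    by (simp add: i)
  also have "\<dots> = k * gram2 c h d l a b"
    by (simp add: gram2_def algebra_simps)
  finally show ?thesis .
qed

lemma sq_int_incr: "increment_family M E k \<Longrightarrow> sq_int M (incr E c h d l a)"
  unfolding incr_def increment_family_def by (intro sq_int_add sq_int_cmult) auto

lemma measurable_incr: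
  assumes F: "increment_family M E k"
  shows "(\<lambda>(a, x). incr E c h d l a x) \<in> borel_measurable (borel \<Otimes>\<^sub>M M)"
proof -
  have m: "(\<lambda>(p, x). E p x) \<in> borel_measurable (borel \<Otimes>\<^sub>M M)" using F by (simp add: increment_family_def)
  have [measurable]: "(\<lambda>w. E (fst w - r) (snd w)) \<in> borel_measurable (borel \<Otimes>\<^sub>M M)" for r
    using measurable_compose[OF _ m, of "\<lambda>w. (fst w - r, snd w)" "borel \<Otimes>\<^sub>M M"] by auto
  have [measurable]: "(\<lambda>w. E (fst w) (snd w)) \<in> borel_measurable (borel \<Otimes>\<^sub>M M)"
    using m by (simp add: case_prod_beta)
  show ?thesis unfolding incr_def case_prod_beta by measurable
qed

text \<open>No family occurs here: the squared norms of the superpositions for any two increment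
  families are \<open>energy\<close> times their constants \<open>k\<close>.\<close>

definition energy :: "(real \<Rightarrow> real) \<Rightarrow> real \<Rightarrow> real \<Rightarrow> real \<Rightarrow> real \<Rightarrow> real" where
  "energy f c h d l = (\<integral>z. f (fst z) * f (snd z) * gram2 c h d l (fst z) (snd z) \<partial>lborel2)"

lemma incr_conv:
  assumes F: "increment_family M E k" and f: "integrable lborel f"
  shows "sq_int M (\<lambda>x. \<integral>a. f a * incr E c h d l a x \<partial>lborel)"
    "(\<integral>x. (\<integral>a. f a * incr E c h d l a x \<partial>lborel)\<^sup>2 \<partial>M) = k * energy f c h d l"
proof -
  have M: "sigma_finite_measure M" using F by (simp add: increment_family_def)
  \<comment> \<open>The Gram matrix is translation invariant, so the norm does not depend on
    \<open>a\<close> and can be taken at 0.\<close>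
  have bd: "(\<integral>x. (incr E c h d l a x)\<^sup>2 \<partial>M) \<le> k * gram2 c h d l 0 0" for a
    using incr_inner[OF F, of c h d l a a] by (simp add: power2_eq_square gram2_def gram_translate)
  note G = Fubini_gram[OF M measurable_incr[OF F] measurable_incr[OF F] sq_int_incr[OF F] bd sq_int_incr[OF F] bd f]
  have "(\<integral>x. (\<integral>a. f a * incr E c h d l a x \<partial>lborel)\<^sup>2 \<partial>M) = (\<integral>z. f (fst z) * f (snd z) * (k * gram2 c h d l (fst z) (snd z)) \<partial>lborel2)"
    using G(2) by (simp add: power2_eq_square incr_inner[OF F])
  also have "\<dots> = (\<integral>z. k * (f (fst z) * f (snd z) * gram2 c h d l (fst z) (snd z)) \<partial>lborel2)"
    by (simp add: mult_ac)
  also have "\<dots> = k * energy f c h d l"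
    unfolding energy_def by (rule integral_mult_right_zero)
  finally show "(\<integral>x. (\<integral>a. f a * incr E c h d l a x \<partial>lborel)\<^sup>2 \<partial>M) = k * energy f c h d l" .
  interpret M: sigma_finite_measure M by (fact M)
  have [measurable]: "f \<in> borel_measurable borel" using f by auto
  have [measurable]: "(\<lambda>(x, a). incr E c h d l a x) \<in> borel_measurable (M \<Otimes>\<^sub>M borel)"
    using measurable_compose[OF measurable_pair_swap' measurable_incr[OF F]] by (auto simp: case_prod_beta)
  have "(\<lambda>x. \<integral>a. f a * incr E c h d l a x \<partial>lborel) \<in> borel_measurable M" by measurable
  then show "sq_int M (\<lambda>x. \<integral>a. f a * incr E c h d l a x \<partial>lborel)"
    using G(3) by (simp add: sq_int_real_iff power2_eq_square)
qed

text \<open>For \<open>E p t = K (t - p)\<close> the increment is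
  \<open>K (t + h - a) - K (t - a)\<close>, so this is the forward difference quotient of the
  fractional integral of \<open>f\<close>.\<close>

definition diffquot :: "(real \<Rightarrow> 'a \<Rightarrow> real) \<Rightarrow> (real \<Rightarrow> real) \<Rightarrow> real \<Rightarrow> 'a \<Rightarrow> real" where
  "diffquot E f h x = (\<integral>a. f a * (E (a - h) x - E a x) \<partial>lborel) / h"

lemma diffquot_eq: "diffquot E f h x = (\<integral>a. f a * incr E (1/h) h 0 0 a x \<partial>lborel)"
  unfolding diffquot_def integral_divide_zero[symmetric] by (simp add: incr_def)

lemma diffquot_norm:
  assumes F: "increment_family M E k" and f: "integrable lborel f"
  shows "sq_int M (diffquot E f h)" "(\<integral>x. (diffquot E f h x)\<^sup>2 \<partial>M) = k * energy f (1/h) h 0 0"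
  using incr_conv[OF F f, of "1/h" h 0 0] by (simp_all add: diffquot_eq[abs_def])

lemma diffquot_diff_norm:
  assumes F: "increment_family M E k" and f: "integrable lborel f"
    and i: "\<And>h x. integrable lborel (\<lambda>a. f a * (E (a - h) x - E a x))"
  shows "(\<integral>x. (diffquot E f h x - diffquot E f l x)\<^sup>2 \<partial>M) = k * energy f (1/h) h (-1/l) l"
proof -
  have "diffquot E f h x - diffquot E f l x = (\<integral>a. f a * incr E (1/h) h (-1/l) l a x \<partial>lborel)" for x
  proof -
    have "diffquot E f h x - diffquot E f l x = (\<integral>a. (f a * (E (a - h) x - E a x)) / h - (f a * (E (a - l) x - E a x)) / l \<partial>lborel)"
      unfolding diffquot_def integral_divide_zero[symmetric] by (rule Bochner_Integration.integral_diff[symmetric]) (use i in auto)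
    also have "\<dots> = (\<integral>a. f a * incr E (1/h) h (-1/l) l a x \<partial>lborel)"
      by (simp add: incr_def diff_divide_distrib algebra_simps)
    finally show ?thesis .
  qed
  then show ?thesis using incr_conv(2)[OF F f, of "1/h" h "-1/l" l] by simp
qed

text \<open>The inner product of a left and a right increment is a second difference of
  \<open>pos_pow\<close>. It is not symmetric in the two parameters, but the density
  \<open>f a * f b\<close> is, so only its symmetrisation counts, and that is a multiple of the Gram
  matrix of \<open>dist_pow\<close> with a negative sign.\<close>

lemma diffquot_mixed:
  assumes f: "integrable lborel f"
  shows "(\<integral>t. diffquot (\<lambda>p t. K (t - p)) f h t * diffquot (\<lambda>p t. K (p - t)) f h t \<partial>lborel) = - k3 * energy f (1/h) h 0 0"
proof -
  let ?E = "\<lambda>p t. K (t - p)" and ?E' = "\<lambda>p t. K (p - t)"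
  note F = increment_family_K and F' = increment_family_K_reflected
  have bd: "(\<integral>x. (incr ?E c h d l a x)\<^sup>2 \<partial>lborel) \<le> k1 * gram2 c h d l 0 0" for a c d l
    using incr_inner[OF F, of c h d l a a] by (simp add: power2_eq_square gram2_def gram_translate)
  have bd': "(\<integral>x. (incr ?E' c h d l a x)\<^sup>2 \<partial>lborel) \<le> k1 * gram2 c h d l 0 0" for a c d l
    using incr_inner[OF F', of c h d l a a] by (simp add: power2_eq_square gram2_def gram_translate)
  note G = Fubini_gram[OF lborel.sigma_finite_measure_axioms measurable_incr[OF F] measurable_incr[OF F'] sq_int_incr[OF F] bd sq_int_incr[OF F'] bd' f,
      of "1/h" 0 0 "1/h" 0 0]
  define s where "s a b = k3 * (pos_pow (a - h) (b - h) - pos_pow (a - h) b - pos_pow a (b - h) + pos_pow a b) * (1/h)\<^sup>2" for a b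
  have inn: "(\<integral>x. incr ?E (1/h) h 0 0 a x * incr ?E' (1/h) h 0 0 b x \<partial>lborel) = s a b" for a b
  proof -
    have "(\<integral>x. incr ?E (1/h) h 0 0 a x * incr ?E' (1/h) h 0 0 b x \<partial>lborel)
      = (\<integral>x. (K (x - (a - h)) * K (b - h - x) - K (x - (a - h)) * K (b - x) - K (x - a) * K (b - h - x) + K (x - a) * K (b - x)) * (1/h)\<^sup>2 \<partial>lborel)"
    proof (intro Bochner_Integration.integral_cong refl)
      fix x
      have *: "(1/h * (A - B)) * (1/h * (C - D)) = (A * C - A * D - B * C + B * D) * (1/h)\<^sup>2" for A B C D :: real
        by (simp only: power2_eq_square ring_distribs mult_ac)
      show "incr ?E (1/h) h 0 0 a x * incr ?E' (1/h) h 0 0 b x = (K (x - (a - h)) * K (b - h - x) - K (x - (a - h)) * K (b - x) - K (x - a) * K (b - h - x) + K (x - a) * K (b - x)) * (1/h)\<^sup>2"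
        unfolding incr_def mult_zero_left add_0_right by (rule *)
    qed
    also have "\<dots> = (k3 * pos_pow (a - h) (b - h) - k3 * pos_pow (a - h) b - k3 * pos_pow a (b - h) + k3 * pos_pow a b) * (1/h)\<^sup>2"
      unfolding integral_mult_left_zero using integral_K_K(1) integral_K_K(2) by simp
    also have "\<dots> = s a b" by (simp add: s_def algebra_simps)
    finally show ?thesis .
  qed
  \<comment> \<open>Adding the swapped term turns each \<open>pos_pow\<close> into
    \<open>dist_pow\<close>; the four signs are opposite to those in \<open>gram\<close>.\<close>
  have sym: "s a b + s b a = - 2 * k3 * gram2 (1/h) h 0 0 a b" for a b
  proof -
    have "s a b + s b a = k3 * (1/h)\<^sup>2 * ((pos_pow (a - h) (b - h) + pos_pow (b - h) (a - h)) - (pos_pow (a - h) b + pos_pow b (a - h))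
       - (pos_pow a (b - h) + pos_pow (b - h) a) + (pos_pow a b + pos_pow b a))"
      by (simp only: s_def ring_distribs mult_ac)
    also have "\<dots> = - 2 * k3 * ((1/h)\<^sup>2 * gram (a - h) a (b - h) b)"
    proof -
      have *: "k * c * (A - B - C + D) = - 2 * k * (c * ((B + C - A - D) / 2))" for A B C D k c :: real
        by (simp add: algebra_simps)
      show ?thesis unfolding pos_pow_add gram_def by (rule *)
    qed
    finally show ?thesis by (simp add: gram2_def)
  qed
  have si: "integrable lborel2 (\<lambda>z. f (fst z) * f (snd z) * s (fst z) (snd z))" using G(1) unfolding inn .
  have si': "integrable lborel2 (\<lambda>z. f (fst z) * f (snd z) * s (snd z) (fst z))"
    using lborel_pair.integrable_product_swap[OF si] by (simp add: case_prod_unfold mult_ac)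
  have sw: "(\<integral>z. f (fst z) * f (snd z) * s (snd z) (fst z) \<partial>lborel2) = (\<integral>z. f (fst z) * f (snd z) * s (fst z) (snd z) \<partial>lborel2)"
    using lborel_pair.integral_product_swap[OF borel_measurable_integrable[OF si]] by (simp add: case_prod_unfold mult_ac)
  have "2 * (\<integral>z. f (fst z) * f (snd z) * s (fst z) (snd z) \<partial>lborel2)
    = (\<integral>z. f (fst z) * f (snd z) * s (fst z) (snd z) + f (fst z) * f (snd z) * s (snd z) (fst z) \<partial>lborel2)"
    using si si' sw by simp
  also have "\<dots> = (\<integral>z. (- 2 * k3) * (f (fst z) * f (snd z) * gram2 (1/h) h 0 0 (fst z) (snd z)) \<partial>lborel2)"
    by (intro Bochner_Integration.integral_cong refl) (simp add: distrib_left[symmetric] sym)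
  also have "\<dots> = - 2 * k3 * energy f (1/h) h 0 0"
    unfolding energy_def by (rule integral_mult_right_zero)
  finally have "(\<integral>z. f (fst z) * f (snd z) * s (fst z) (snd z) \<partial>lborel2) = - k3 * energy f (1/h) h 0 0" by simp
  then show ?thesis using G(2) unfolding inn diffquot_eq by simp
qed


section \<open>Approximation of the Slobodeckij quotient by running averages\<close>

definition slob :: "(real \<Rightarrow> real) \<Rightarrow> real \<times> real \<Rightarrow> real" where
  "slob f = (\<lambda>(t, s). m (t - s) * (f t - f s))"

definition avg :: "(real \<Rightarrow> real) \<Rightarrow> real \<Rightarrow> real \<Rightarrow> real" where
  "avg f h t = (\<integral>a. f a * indicator {t..<t+h} a \<partial>lborel) / h"

lemma measurable_slob [measurable (raw)]:
  assumes [measurable]: "f \<in> borel_measurable borel" shows "slob f \<in> borel_measurable lborel2"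
  unfolding slob_def by measurable

lemma integrable_mult_indicator_real:
  "integrable lborel f \<Longrightarrow> integrable lborel (\<lambda>a. f a * indicator {c..<d} a)" for f :: "real \<Rightarrow> real"
  by (rule integrable_real_mult_indicator) auto

text \<open>The condition \<open>a - h < t \<le> a\<close> on the jump is the condition
  \<open>t \<le> a < t + h\<close> on the density, so superposing step functions averages
  \<open>f\<close> over a forward interval.\<close>

lemma diffquot_stepY:
  assumes f: "integrable lborel f" and h: "0 < h"
  shows "diffquot stepY f h (t, s) = m (t - s) * (avg f h t - avg f h s)"
proof -
  have e: "f a * (stepY (a - h) (t, s) - stepY a (t, s)) = m (t - s) * (f a * indicator {t..<t+h} a - f a * indicator {s..<s+h} a)" for a
    using h by (auto simp: stepY_diff indicator_def algebra_simps)
  show ?thesis unfolding diffquot_def e avg_def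
    using integrable_mult_indicator_real[OF f] by (simp add: diff_divide_distrib[symmetric])
qed

lemma integrable_stepY:
  assumes f: "integrable lborel f"
  shows "integrable lborel (\<lambda>a. f a * (stepY (a - h) x - stepY a x))"
proof (rule Bochner_Integration.integrable_bound)
  have [measurable]: "f \<in> borel_measurable borel" using f by auto
  define t s where "t = fst x" and "s = snd x"
  then have x: "x = (t, s)" by simp
  show "integrable lborel (\<lambda>a. f a * (4 * m (t - s)))" using f by (rule integrable_mult_left)
  have [measurable]: "(\<lambda>a. indicator {a + c<..} r :: real) \<in> borel_measurable borel" for c r :: real
  proof -
    have "(\<lambda>a. indicator {a + c<..} r :: real) = indicator {..<r - c}" by (auto simp: indicator_def)
    then show ?thesis by simp
  qed
  note this[of 0, simplified, measurable] this[of "-h", simplified, measurable]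
  show "(\<lambda>a. f a * (stepY (a - h) x - stepY a x)) \<in> borel_measurable lborel"
    unfolding x stepY_def by simp
  have "\<bar>stepY p x\<bar> \<le> 2 * m (t - s)" for p
    by (auto simp: x stepY_def indicator_def)
  from this[of "_ - h"] this have "\<bar>stepY (a - h) x - stepY a x\<bar> \<le> 4 * m (t - s)" for a
    using abs_triangle_ineq4[of "stepY (a - h) x" "stepY a x"] by (smt (verit))
  then show "AE a in lborel. norm (f a * (stepY (a - h) x - stepY a x)) \<le> norm (f a * (4 * m (t - s)))"
    by (auto simp: abs_mult intro!: mult_left_mono)
qed

lemma sq_int_shift:
  fixes f :: "real \<Rightarrow> real"
  assumes "sq_int lborel f" shows "sq_int lborel (\<lambda>r. f (t + r))"
  using assms lborel_integrable_real_affine[of "\<lambda>x. (f x)\<^sup>2" 1 t]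
    measurable_compose[of "\<lambda>r. t + r" borel borel f borel] by (simp add: sq_int_real_iff)

text \<open>Averaging over translations along the diagonal does not increase the Slobodeckij seminorm.\<close>

lemma diffquot_stepY_norm_le:
  assumes f: "integrable lborel f" "sq_int lborel f" and s: "sq_int lborel2 (slob f)" and h: "0 < h"
  shows "(\<integral>z. (diffquot stepY f h z)\<^sup>2 \<partial>lborel2) \<le> (\<integral>z. (slob f z)\<^sup>2 \<partial>lborel2)"
proof -
  have [measurable]: "f \<in> borel_measurable borel" using f by auto
  define S where "S = (\<integral>\<^sup>+z. ennreal ((slob f z)\<^sup>2) \<partial>lborel2)"
  have S: "S = ennreal (\<integral>z. (slob f z)\<^sup>2 \<partial>lborel2)" using sq_int_nn_integral_eq[OF s] by (simp add: S_def)
  define G where "G w r = ennreal (1/h * indicator {0..<h} r) * ennreal ((slob f (fst w + r, snd w + r))\<^sup>2)" for w :: "real \<times> real" and r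
  have sf: "slob f \<in> borel_measurable lborel2" by (rule measurable_slob) fact
  have "(\<lambda>w. (fst (fst w) + snd w, snd (fst w) + snd w)) \<in> lborel2 \<Otimes>\<^sub>M lborel \<rightarrow>\<^sub>M (lborel2 :: (real \<times> real) measure)" by measurable
  from measurable_compose[OF this sf]
  have [measurable]: "(\<lambda>w. slob f (fst (fst w) + snd w, snd (fst w) + snd w)) \<in> borel_measurable (lborel2 \<Otimes>\<^sub>M lborel)" .
  note sf [measurable]
  have [measurable]: "(\<lambda>(w, r). G w r) \<in> borel_measurable (lborel2 \<Otimes>\<^sub>M lborel)"
    unfolding G_def by measurable
  have av: "avg f h t = (\<integral>r. f (t + r) * indicator {0..<h} r \<partial>lborel) / h" for t
  proof -
    have "(\<integral>a. f a * indicator {t..<t+h} a \<partial>lborel) = (\<integral>r. f (t + r) * indicator {t..<t+h} (t + r) \<partial>lborel)"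
      using lborel_integral_real_affine[of 1 "\<lambda>a. f a * indicator {t..<t+h} a" t] by simp
    also have "(\<lambda>r. indicator {t..<t+h} (t + r)) = (indicator {0..<h} :: real \<Rightarrow> real)" by (auto simp: indicator_def)
    finally show ?thesis by (simp add: avg_def)
  qed
  have pw: "ennreal ((diffquot stepY f h w)\<^sup>2) \<le> (\<integral>\<^sup>+r. G w r \<partial>lborel)" for w
  proof -
    obtain t u where w: "w = (t, u)" by (cases w)
    let ?i = "indicator {0..<h} :: real \<Rightarrow> real"
    have i2: "(?i r)\<^sup>2 = ?i r" for r by (simp add: indicator_def)
    have sqi: "sq_int lborel ?i" using integrable_real_indicator[of "{0..<h}" lborel] h by (simp add: sq_int_real_iff i2)
    define g where "g r = (f (t + r) - f (u + r)) * ?i r" for r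
    have [measurable]: "g \<in> borel_measurable borel" unfolding g_def by measurable
    have sg: "sq_int lborel g"
      by (rule sq_int_bound[OF sq_int_diff[OF sq_int_shift[OF f(2), of t] sq_int_shift[OF f(2), of u]]])
         (auto simp: g_def indicator_def)
    have ii: "integrable lborel (\<lambda>r. f (c + r) * ?i r)" for c
      using integrable_mult_sq_int[OF sq_int_shift[OF f(2)] sqi] .
    have eq: "avg f h t - avg f h u = (\<integral>r. g r * ?i r \<partial>lborel) / h"
    proof -
      have "g r * ?i r = f (t + r) * ?i r - f (u + r) * ?i r" for r by (simp add: g_def indicator_def)
      then show ?thesis using ii by (simp add: av diff_divide_distrib)
    qed
    \<comment> \<open>The cut-off is already contained in \<open>g\<close>; the repeated indicator
      is the second factor of Cauchy-Schwarz and contributes the length \<open>h\<close>.\<close>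
    have cs: "(\<integral>r. g r * ?i r \<partial>lborel)\<^sup>2 \<le> (\<integral>r. (g r)\<^sup>2 \<partial>lborel) * h"
      using integral_Cauchy_Schwarz_sq[OF sg sqi] h by (simp add: i2)
    have "(avg f h t - avg f h u)\<^sup>2 \<le> (\<integral>r. (g r)\<^sup>2 \<partial>lborel) * h / h\<^sup>2"
      unfolding eq power_divide by (intro divide_right_mono cs) simp
    then have le: "(avg f h t - avg f h u)\<^sup>2 \<le> (1/h) * (\<integral>r. (g r)\<^sup>2 \<partial>lborel)"
      using h by (simp add: power2_eq_square)
    have "(diffquot stepY f h w)\<^sup>2 = (m (t - u))\<^sup>2 * (avg f h t - avg f h u)\<^sup>2"
      unfolding w diffquot_stepY[OF f(1) h] by (simp add: power_mult_distrib)
    also have "\<dots> \<le> (m (t - u))\<^sup>2 * ((1/h) * (\<integral>r. (g r)\<^sup>2 \<partial>lborel))" by (intro mult_left_mono le) simp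
    also have "\<dots> = (\<integral>r. (m (t - u))\<^sup>2 * ((1/h) * (g r)\<^sup>2) \<partial>lborel)" by simp
    finally have "ennreal ((diffquot stepY f h w)\<^sup>2) \<le> ennreal (\<integral>r. (m (t - u))\<^sup>2 * ((1/h) * (g r)\<^sup>2) \<partial>lborel)" by (rule ennreal_leI)
    also have "\<dots> = (\<integral>\<^sup>+r. ennreal ((m (t - u))\<^sup>2 * ((1/h) * (g r)\<^sup>2)) \<partial>lborel)"
      using sg h by (intro nn_integral_eq_integral[symmetric]) (auto simp: sq_int_real_iff)
    also have "\<dots> = (\<integral>\<^sup>+r. G w r \<partial>lborel)"
      using h by (intro nn_integral_cong) (auto simp: G_def w slob_def g_def indicator_def power_mult_distrib ennreal_mult[symmetric] mult_ac)
    finally show ?thesis .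
  qed
  interpret P: pair_sigma_finite lborel2 "lborel :: real measure" ..
  have "(\<integral>\<^sup>+z. ennreal ((diffquot stepY f h z)\<^sup>2) \<partial>lborel2) \<le> (\<integral>\<^sup>+z. \<integral>\<^sup>+r. G z r \<partial>lborel \<partial>lborel2)"
    by (intro nn_integral_mono pw)
  also have "\<dots> = (\<integral>\<^sup>+r. \<integral>\<^sup>+z. G z r \<partial>lborel2 \<partial>lborel)"
    using P.Fubini[of "\<lambda>(z, r). G z r"] by simp
  also have "\<dots> = (\<integral>\<^sup>+r. ennreal (1/h * indicator {0..<h} r) * S \<partial>lborel)"
  proof (rule nn_integral_cong)
    fix r
    have "(\<integral>\<^sup>+z. G z r \<partial>lborel2) = ennreal (1/h * indicator {0..<h} r) * (\<integral>\<^sup>+w. ennreal ((slob f (fst w + r, snd w + r))\<^sup>2) \<partial>lborel2)"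
      unfolding G_def by (rule nn_integral_cmult) measurable
    also have "(\<integral>\<^sup>+w. ennreal ((slob f (fst w + r, snd w + r))\<^sup>2) \<partial>lborel2) = (\<integral>\<^sup>+t. \<integral>\<^sup>+u. ennreal ((slob f (t + r, u + r))\<^sup>2) \<partial>lborel \<partial>lborel)"
      by (subst nn_integral_lborel2) auto
    also have "\<dots> = (\<integral>\<^sup>+t. \<integral>\<^sup>+u. ennreal ((slob f (t + r, u))\<^sup>2) \<partial>lborel \<partial>lborel)"
      by (intro nn_integral_cong nn_integral_lborel_shift) measurable
    also have "\<dots> = (\<integral>\<^sup>+t. \<integral>\<^sup>+u. ennreal ((slob f (t, u))\<^sup>2) \<partial>lborel \<partial>lborel)"
      by (rule nn_integral_lborel_shift) measurable
    also have "\<dots> = S" unfolding S_def by (rule nn_integral_lborel2[symmetric]) measurable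
    finally show "(\<integral>\<^sup>+z. G z r \<partial>lborel2) = ennreal (1/h * indicator {0..<h} r) * S" .
  qed
  also have "\<dots> = (\<integral>\<^sup>+r. ennreal (1/h * indicator {0..<h} r) \<partial>lborel) * S"
    by (rule nn_integral_multc) measurable
  also have "(\<integral>\<^sup>+r. ennreal (1/h * indicator {0..<h} r) \<partial>lborel) = (\<integral>\<^sup>+r. ennreal (1/h) * indicator {0..<h} r \<partial>lborel)"
    by (intro nn_integral_cong) (auto simp: indicator_def)
  also have "\<dots> = 1" using h by (subst nn_integral_cmult_indicator) (auto simp: ennreal_mult[symmetric])
  finally have "(\<integral>\<^sup>+z. ennreal ((diffquot stepY f h z)\<^sup>2) \<partial>lborel2) \<le> ennreal (\<integral>z. (slob f z)\<^sup>2 \<partial>lborel2)" by (simp add: S)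
  then show ?thesis
    using sq_int_nn_integral_eq[OF diffquot_norm(1)[OF increment_family_stepY f(1)], of h] by simp
qed

lemma DERIV_imp_sequence:
  assumes "(J has_real_derivative D) (at t)"
  shows "(\<lambda>n. (J (t + 1 / real (Suc n)) - J t) / (1 / real (Suc n))) \<longlonglongrightarrow> D"
proof -
  have "(\<lambda>h. (J (t + h) - J t) / h) \<midarrow>0\<rightarrow> D" using assms by (simp add: DERIV_def)
  moreover have "(\<lambda>n. 1 / real (Suc n)) \<longlonglongrightarrow> 0" using LIMSEQ_inverse_real_of_nat by (simp add: inverse_eq_divide)
  ultimately show ?thesis
    unfolding LIMSEQ_SEQ_conv[symmetric] by (elim allE[of _ "\<lambda>n. 1 / real (Suc n)"]) (simp del: of_nat_Suc)
qed

text \<open>The averages are difference quotients of an indefinite integral, so this is Lebesgue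
  differentiation along the steps \<open>1 / real (Suc n)\<close>.\<close>

lemma AE_avg_tendsto:
  assumes f: "integrable lborel f"
  shows "AE t in lborel. (\<lambda>n. avg f (1 / real (Suc n)) t) \<longlonglongrightarrow> f t"
proof -
  have [measurable]: "f \<in> borel_measurable borel" using f by auto
  define J where "J t = (\<integral>a. f a * indicator {..<t} a \<partial>lborel)" for t
  have i: "integrable lborel (\<lambda>a. f a * indicator {..<t} a)" for t by (rule integrable_real_mult_indicator) (use f in auto)
  have J1: "J b - J a = (\<integral>x. f x * indicator {a..<b} x \<partial>lborel)" if "a \<le> b" for a b
  proof -
    have "J b - J a = (\<integral>x. f x * indicator {..<b} x - f x * indicator {..<a} x \<partial>lborel)" using i by (simp add: J_def)
    also have "\<dots> = (\<integral>x. f x * indicator {a..<b} x \<partial>lborel)"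
      using that by (intro Bochner_Integration.integral_cong refl) (auto simp: indicator_def)
    finally show ?thesis .
  qed
  have "AE t in lborel. (J has_real_derivative f t) (at t)"
  proof (rule AE_DERIV_indefinite_integral)
    show "set_integrable lborel {a..b} f" for a b
      unfolding set_integrable_def using integrable_real_mult_indicator[OF _ f, of "{a..b}"] by (simp add: mult.commute)
    show "J b - J a = (LINT x:{a..b}|lborel. f x)" if "a \<le> b" for a b
      unfolding J1[OF that] set_lebesgue_integral_def
    proof (rule integral_cong_AE)
      show "AE x in lborel. f x * indicator {a..<b} x = indicator {a..b} x *\<^sub>R f x"
        using AE_lborel_singleton[of b] by eventually_elim (auto simp: indicator_def)
    qed measurable
  qed
  then show ?thesis
  proof eventually_elim
    case (elim t)
    have "avg f (1 / real (Suc n)) t = (J (t + 1 / real (Suc n)) - J t) / (1 / real (Suc n))" for n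
      by (simp add: avg_def J1)
    then show ?case using DERIV_imp_sequence[OF elim] by simp
  qed
qed

text \<open>Averaging converges at almost every pair of times and does not increase the norm;
  together this gives convergence in L2 without a dominating function.\<close>

lemma diffquot_stepY_tendsto:
  assumes f: "integrable lborel f" "sq_int lborel f" and s: "sq_int lborel2 (slob f)"
  shows "(\<lambda>n. \<integral>z. (norm (diffquot stepY f (1 / real (Suc n)) z - slob f z))\<^sup>2 \<partial>lborel2) \<longlonglongrightarrow> 0"
proof (rule L2_tendsto_if_AE_tendsto_norm_le)
  have [measurable]: "f \<in> borel_measurable borel" using f by auto
  show "sq_int lborel2 (diffquot stepY f (1 / real (Suc n)))" for n by (rule diffquot_norm(1)[OF increment_family_stepY f(1)])
  show "sq_int lborel2 (slob f)" by fact
  show "(\<integral>z. (norm (diffquot stepY f (1 / real (Suc n)) z))\<^sup>2 \<partial>lborel2) \<le> (\<integral>z. (norm (slob f z))\<^sup>2 \<partial>lborel2)" for n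
    using diffquot_stepY_norm_le[OF f s] by simp
  let ?P = "\<lambda>t. (\<lambda>n. avg f (1 / real (Suc n)) t) \<longlonglongrightarrow> f t"
  obtain N where N: "N \<in> null_sets lborel" "{t \<in> space lborel. \<not> ?P t} \<subseteq> N"
    using AE_avg_tendsto[OF f(1)] by (auto elim!: AE_E simp: null_sets_def)
  have P: "?P t" if "t \<notin> N" for t using N that by auto
  have [measurable]: "N \<in> sets borel" using N by auto
  have "AE z in lborel2. fst z \<notin> N \<and> snd z \<notin> N"
  proof (rule lborel_pair.AE_pair_measure)
    show "{x \<in> space lborel2. fst x \<notin> N \<and> snd x \<notin> N} \<in> sets lborel2" by measurable
    show "AE x in lborel. AE y in lborel. fst (x, y) \<notin> N \<and> snd (x, y) \<notin> N"
      using AE_not_in[OF N(1)]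
    proof (rule eventually_mono)
      fix x assume "x \<notin> N"
      then show "AE y in lborel. fst (x, y) \<notin> N \<and> snd (x, y) \<notin> N" using AE_not_in[OF N(1)] by simp
    qed
  qed
  then show "AE z in lborel2. (\<lambda>n. diffquot stepY f (1 / real (Suc n)) z) \<longlonglongrightarrow> slob f z"
  proof (rule eventually_mono)
    fix z assume z: "fst z \<notin> N \<and> snd z \<notin> N"
    obtain t u where ts: "z = (t, u)" by (cases z)
    have "(\<lambda>n. m (t - u) * (avg f (1 / real (Suc n)) t - avg f (1 / real (Suc n)) u)) \<longlonglongrightarrow> m (t - u) * (f t - f u)"
      using z ts by (intro tendsto_intros P) auto
    then show "(\<lambda>n. diffquot stepY f (1 / real (Suc n)) z) \<longlonglongrightarrow> slob f z"
      unfolding ts using diffquot_stepY[OF f(1)] by (simp add: slob_def)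
  qed
qed

text \<open>Up to a reflection, \<open>L (t - a) - L (s - a)\<close> as a function of
  \<open>a\<close> is an increment of the family, so Cauchy-Schwarz gives Hoelder continuity of
  exponent \<open>1/2 - \<sigma>\<close>.\<close>

lemma Holder_kernel_integral:
  assumes F: "increment_family lborel (\<lambda>p t. L (t - p)) k"
    and f: "sq_int lborel f" and i: "\<And>t. integrable lborel (\<lambda>a. f a * L (t - a))"
  shows "\<bar>(\<integral>a. f a * L (t - a) \<partial>lborel) - (\<integral>a. f a * L (s - a) \<partial>lborel)\<bar>
     \<le> sqrt (\<integral>a. (f a)\<^sup>2 \<partial>lborel) * sqrt (k * dist_pow t s)"
proof -
  let ?g = "\<lambda>u. L (u - (-t)) - L (u - (-s))"
  have g: "sq_int lborel ?g" "(\<integral>u. (?g u)\<^sup>2 \<partial>lborel) = k * dist_pow (-t) (-s)"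
    using F unfolding increment_family_def by blast+
  have g': "sq_int lborel (\<lambda>a. L (t - a) - L (s - a))" "(\<integral>a. (L (t - a) - L (s - a))\<^sup>2 \<partial>lborel) = k * dist_pow t s"
    using g lborel_integrable_real_affine[of "\<lambda>u. (?g u)\<^sup>2" "-1" 0] lborel_integral_real_affine[of "-1" "\<lambda>u. (?g u)\<^sup>2" 0]
      measurable_compose[of "\<lambda>u. -u" borel borel ?g borel]
    by (simp_all add: sq_int_real_iff add.commute dist_pow_def abs_minus_commute)
  have "(\<integral>a. f a * L (t - a) \<partial>lborel) - (\<integral>a. f a * L (s - a) \<partial>lborel) = (\<integral>a. f a * (L (t - a) - L (s - a)) \<partial>lborel)"
    using i by (simp add: right_diff_distrib)
  then show ?thesis using integral_Cauchy_Schwarz[OF f g'(1)] g'(2) by simp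
qed

text \<open>The quotients for \<open>stepY\<close> converge, hence are Cauchy; proportional norms
  make the quotients for \<open>L\<close> Cauchy, and their L2 limit is shown to be the derivative.
  The kernel is left general so that both \<open>K\<close> and its reflection can be
  inserted.\<close>

lemma kernel_derivative:
  assumes F: "increment_family lborel (\<lambda>p t. L (t - p)) k"
    and f: "integrable lborel f" "sq_int lborel f" and s: "sq_int lborel2 (slob f)"
    and i: "\<And>t. integrable lborel (\<lambda>a. f a * L (t - a))"
  obtains \<phi> where "sq_int lborel \<phi>"
    "(\<lambda>n. \<integral>t. (norm (diffquot (\<lambda>p t. L (t - p)) f (1 / real (Suc n)) t - \<phi> t))\<^sup>2 \<partial>lborel) \<longlonglongrightarrow> 0"
    "k2 * (\<integral>t. (\<phi> t)\<^sup>2 \<partial>lborel) = k * (\<integral>z. (slob f z)\<^sup>2 \<partial>lborel2)"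
    "AE t in lborel. ((\<lambda>t. \<integral>a. f a * L (t - a) \<partial>lborel) has_real_derivative \<phi> t) (at t)"
    "continuous_on UNIV (\<lambda>t. \<integral>a. f a * L (t - a) \<partial>lborel)"
proof -
  let ?E = "\<lambda>p t. L (t - p)"
  define J where "J t = (\<integral>a. f a * L (t - a) \<partial>lborel)" for t
  define h where "h n = 1 / real (Suc n)" for n
  have h: "0 < h n" "h n \<le> 1" for n by (auto simp: h_def)
  define P where "P n = diffquot ?E f (h n)" for n
  define Y where "Y n = diffquot stepY f (h n)" for n
  have iE: "integrable lborel (\<lambda>a. f a * (?E (a - h) x - ?E a x))" for h x
    using i[of "x + h"] i[of x] by (simp add: right_diff_distrib algebra_simps)
  have P: "P n t = (J (t + h n) - J t) / h n" for n t
    using i[of "t + h n"] i[of t] by (simp add: P_def diffquot_def J_def right_diff_distrib algebra_simps)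
  have sP: "sq_int lborel (P n)" for n unfolding P_def by (rule diffquot_norm(1)[OF F f(1)])
  have sY: "sq_int lborel2 (Y n)" for n unfolding Y_def by (rule diffquot_norm(1)[OF increment_family_stepY f(1)])
  have cmp1: "k2 * (\<integral>t. (P n t)\<^sup>2 \<partial>lborel) = k * (\<integral>z. (Y n z)\<^sup>2 \<partial>lborel2)" for n
    unfolding P_def Y_def diffquot_norm(2)[OF F f(1)] diffquot_norm(2)[OF increment_family_stepY f(1)] by simp
  have cmp2: "k2 * (\<integral>t. (P n t - P l t)\<^sup>2 \<partial>lborel) = k * (\<integral>z. (Y n z - Y l z)\<^sup>2 \<partial>lborel2)" for n l
    unfolding P_def Y_def diffquot_diff_norm[OF F f(1) iE] diffquot_diff_norm[OF increment_family_stepY f(1) integrable_stepY[OF f(1)]] by simp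
  have Yl: "(\<lambda>n. \<integral>z. (norm (Y n z - slob f z))\<^sup>2 \<partial>lborel2) \<longlonglongrightarrow> 0"
    unfolding Y_def h_def by (rule diffquot_stepY_tendsto[OF f s])
  have Cau: "\<exists>N. \<forall>m\<ge>N. \<forall>n\<ge>N. (\<integral>t. (norm (P m t - P n t))\<^sup>2 \<partial>lborel) < e" if e: "0 < e" for e
  proof -
    \<comment> \<open>Nothing is assumed on the sign of \<open>k\<close>, and it may vanish;
      \<open>\<bar>k\<bar> + 1\<close> is a safe substitute.\<close>
    have "0 < e * k2 / (\<bar>k\<bar> + 1)" using e k2_pos by simp
    from L2_tendsto_Cauchy[OF sY s Yl this] obtain N where
      N: "\<And>m n. N \<le> m \<Longrightarrow> N \<le> n \<Longrightarrow> (\<integral>z. (Y m z - Y n z)\<^sup>2 \<partial>lborel2) < e * k2 / (\<bar>k\<bar> + 1)" by auto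
    have "(\<integral>t. (P m t - P n t)\<^sup>2 \<partial>lborel) < e" if "N \<le> m" "N \<le> n" for m n
    proof -
      let ?y = "\<integral>z. (Y m z - Y n z)\<^sup>2 \<partial>lborel2"
      have y: "0 \<le> ?y" by simp
      have "k2 * (\<integral>t. (P m t - P n t)\<^sup>2 \<partial>lborel) = k * ?y" by (rule cmp2)
      also have "\<dots> \<le> (\<bar>k\<bar> + 1) * ?y" by (intro mult_right_mono y) simp
      also have "\<dots> < (\<bar>k\<bar> + 1) * (e * k2 / (\<bar>k\<bar> + 1))" using N[OF that] by (intro mult_strict_left_mono) auto
      also have "\<dots> = k2 * e" by simp
      finally show ?thesis using k2_pos by simp
    qed
    then show ?thesis by auto
  qed
  obtain \<phi> r where phi: "sq_int lborel \<phi>" "(\<lambda>n. \<integral>t. (norm (P n t - \<phi> t))\<^sup>2 \<partial>lborel) \<longlonglongrightarrow> 0"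
    "strict_mono (r :: nat \<Rightarrow> nat)" "AE t in lborel. (\<lambda>k. P (r k) t) \<longlonglongrightarrow> \<phi> t"
    by (rule Riesz_Fischer[OF sP Cau])
  have norm: "k2 * (\<integral>t. (\<phi> t)\<^sup>2 \<partial>lborel) = k * (\<integral>z. (slob f z)\<^sup>2 \<partial>lborel2)"
  proof (rule LIMSEQ_unique)
    show "(\<lambda>n. k2 * (\<integral>t. (P n t)\<^sup>2 \<partial>lborel)) \<longlonglongrightarrow> k2 * (\<integral>t. (\<phi> t)\<^sup>2 \<partial>lborel)"
      using tendsto_integral_inner[OF sP phi(1) sP phi(1) phi(2) phi(2)] by (intro tendsto_mult_left) (simp add: power2_eq_square)
    show "(\<lambda>n. k2 * (\<integral>t. (P n t)\<^sup>2 \<partial>lborel)) \<longlonglongrightarrow> k * (\<integral>z. (slob f z)\<^sup>2 \<partial>lborel2)"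
      unfolding cmp1 using tendsto_integral_inner[OF sY s sY s Yl Yl] by (intro tendsto_mult_left) (simp add: power2_eq_square)
  qed
  have contJ: "continuous_on UNIV J"
  proof (rule continuous_at_imp_continuous_on, rule ballI)
    fix x
    have "((\<lambda>t. J t - J x) \<longlongrightarrow> 0) (at x)"
    proof (rule Lim_null_comparison[OF always_eventually])
      show "\<forall>t. norm (J t - J x) \<le> sqrt (\<integral>a. (f a)\<^sup>2 \<partial>lborel) * sqrt (k * dist_pow t x)"
        using Holder_kernel_integral[OF F f(2) i] by (simp add: J_def)
      have "((\<lambda>t. dist_pow t x) \<longlongrightarrow> \<bar>x - x\<bar> powr (1 - 2 * \<sigma>)) (at x)"
        unfolding dist_pow_def using \<sigma>_half by (intro tendsto_powr' tendsto_intros) auto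
      then have "((\<lambda>t. sqrt (\<integral>a. (f a)\<^sup>2 \<partial>lborel) * sqrt (k * dist_pow t x)) \<longlongrightarrow> sqrt (\<integral>a. (f a)\<^sup>2 \<partial>lborel) * sqrt (k * 0)) (at x)"
        by (intro tendsto_intros) simp
      then show "((\<lambda>t. sqrt (\<integral>a. (f a)\<^sup>2 \<partial>lborel) * sqrt (k * dist_pow t x)) \<longlongrightarrow> 0) (at x)" by simp
    qed
    then show "isCont J x" by (simp add: isCont_def LIM_zero_iff)
  qed
  have "AE t in lborel. (J has_real_derivative \<phi> t) (at t)"
  proof (rule AE_DERIV_indefinite_integral)
    show "set_integrable lborel {a..b} \<phi>" for a b by (rule sq_int_imp_set_integrable[OF phi(1)])
    \<comment> \<open>The integral of the quotients over \<open>{a..b}\<close> has two limits: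
      averages of the continuous \<open>J\<close> near the end points, and the integral of the L2
      limit tested against an indicator.\<close>
    show "J b - J a = (LINT x:{a..b}|lborel. \<phi> x)" if ab: "a \<le> b" for a b
    proof (rule LIMSEQ_unique)
      \<comment> \<open>The enlarged interval makes \<open>Q\<close> differentiable from both sides
        at all points up to \<open>b + 1\<close>, which includes the shifted point
        \<open>b + h n\<close>.\<close>
      obtain Q where Q: "\<And>x. x \<in> {a-1..b+2} \<Longrightarrow> (Q has_vector_derivative J x) (at x within {a-1..b+2})"
        using antiderivative_continuous[OF continuous_on_subset[OF contJ, of "{a-1..b+2}"]] by auto
      have DQ: "(Q has_real_derivative J x) (at x)" if "x \<in> {a..b+1}" for x
        using Q[of x] that at_within_interior[of x "{a-1..b+2}"]
        by (simp add: has_real_derivative_iff_has_vector_derivative)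
      have "(P n has_integral (Q (b + h n) - Q b) / h n - (Q (a + h n) - Q a) / h n) {a..b}" for n
        unfolding P
      proof (rule fundamental_theorem_of_calculus[OF ab])
        fix x assume x: "x \<in> {a..b}"
        have "((\<lambda>x. Q (x + h n)) has_real_derivative J (x + h n)) (at x)"
          using DQ[of "x + h n"] x h[of n] by (subst DERIV_shift[symmetric]) auto
        then have "((\<lambda>x. (Q (x + h n) - Q x) / h n) has_real_derivative (J (x + h n) - J x) / h n) (at x)"
          using DQ[of x] x by (intro DERIV_cdivide DERIV_diff) auto
        then show "((\<lambda>x. (Q (x + h n) - Q x) / h n) has_vector_derivative (J (x + h n) - J x) / h n) (at x within {a..b})"
          by (simp add: has_real_derivative_iff_has_vector_derivative[symmetric] has_field_derivative_at_within)
      qed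
      then have PQ: "(LINT x:{a..b}|lborel. P n x) = (Q (b + h n) - Q b) / h n - (Q (a + h n) - Q a) / h n" for n
        unfolding set_borel_integral_eq_integral(2)[OF sq_int_imp_set_integrable[OF sP]] by (rule integral_unique)
      show "(\<lambda>n. LINT x:{a..b}|lborel. P n x) \<longlonglongrightarrow> J b - J a"
        unfolding PQ h_def using ab by (intro tendsto_diff DERIV_imp_sequence DQ) auto
      have si: "sq_int lborel (indicator {a..b} :: real \<Rightarrow> real)"
      proof -
        have "(\<lambda>x. (indicator {a..b} x :: real)\<^sup>2) = indicator {a..b}" by (auto simp: indicator_def)
        then show ?thesis using integrable_real_indicator[of "{a..b}" lborel] ab by (auto simp: sq_int_real_iff)
      qed
      show "(\<lambda>n. LINT x:{a..b}|lborel. P n x) \<longlonglongrightarrow> (LINT x:{a..b}|lborel. \<phi> x)"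
        using tendsto_integral_inner[OF si si sP phi(1) _ phi(2)] by (simp add: set_lebesgue_integral_def)
    qed
  qed
  then show thesis
    using phi(1,2) norm contJ unfolding J_def[abs_def] P_def h_def by (rule_tac that[of \<phi>]) auto
qed


subsection \<open>Fractional derivatives of functions supported in an interval\<close>

text \<open>On bounded pieces \<open>K\<close> is square integrable because
  \<open>2 * \<sigma> < 1\<close>; hence the fractional integrals of square-integrable functions
  supported in \<open>(0, T)\<close> converge at every time.\<close>

lemma sq_int_K_cutoff:
  "sq_int lborel (\<lambda>a. indicator {0..T} a * K (t - a))"
  "sq_int lborel (\<lambda>a. indicator {0..T} a * K (a - t))"
proof -
  let ?g = "\<lambda>c x. ennreal (indicator {0..c} x * x powr (-2 * \<sigma>))"
  have fin: "(\<integral>\<^sup>+x. ?g \<bar>c\<bar> x \<partial>lborel) < \<infinity>" for c using nn_integral_K_sq[of "\<bar>c\<bar>"] by simp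
  have "(\<integral>\<^sup>+a. ennreal ((norm (indicator {0..T} a * K (t - a)))\<^sup>2) \<partial>lborel) \<le> (\<integral>\<^sup>+a. ?g \<bar>t\<bar> (t - a) \<partial>lborel)"
    by (intro nn_integral_mono ennreal_leI) (auto simp: power_mult_distrib K_sq indicator_def)
  also have "\<dots> = (\<integral>\<^sup>+x. ?g \<bar>t\<bar> x \<partial>lborel)" by (rule nn_integral_lborel_reflect) measurable
  finally show "sq_int lborel (\<lambda>a. indicator {0..T} a * K (t - a))" using fin[of t] by (simp add: sq_int_iff_nn_integral)
  have "(\<integral>\<^sup>+a. ennreal ((norm (indicator {0..T} a * K (a - t)))\<^sup>2) \<partial>lborel) \<le> (\<integral>\<^sup>+a. ?g \<bar>T - t\<bar> (a + (- t)) \<partial>lborel)"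
    by (intro nn_integral_mono ennreal_leI) (auto simp: power_mult_distrib K_sq indicator_def)
  also have "\<dots> = (\<integral>\<^sup>+x. ?g \<bar>T - t\<bar> x \<partial>lborel)" by (rule nn_integral_lborel_shift) measurable
  finally show "sq_int lborel (\<lambda>a. indicator {0..T} a * K (a - t))" using fin[of "T - t"] by (simp add: sq_int_iff_nn_integral)
qed

lemma
  assumes f: "sq_int lborel f" and supp: "\<And>t. t \<notin> {0<..<T} \<Longrightarrow> f t = 0"
  shows integrable_supported: "integrable lborel f"
    and integrable_K_left: "integrable lborel (\<lambda>a. f a * K (t - a))"
    and integrable_K_right: "integrable lborel (\<lambda>a. f a * K (a - t))"
proof -
  have fi: "f a * indicator {0..T} a = f a" for a
  proof (cases "a \<in> {0<..<T}")
    case False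
    then show ?thesis using supp[of a] by simp
  qed (simp add: indicator_def)
  have "set_integrable lborel {0..T} f" by (rule sq_int_imp_set_integrable[OF f])
  then show "integrable lborel f" by (simp add: set_integrable_def mult.commute fi)
  have c: "f a * (indicator {0..T} a * x) = f a * x" for a x by (metis fi mult.assoc)
  then show "integrable lborel (\<lambda>a. f a * K (t - a))" "integrable lborel (\<lambda>a. f a * K (a - t))"
    using integrable_mult_sq_int[OF f sq_int_K_cutoff(1)[of T t]] integrable_mult_sq_int[OF f sq_int_K_cutoff(2)[of T t]] by (simp_all only: c)
qed

text \<open>For a function supported in \<open>(0, T)\<close>, \<open>Jl\<close> and the companion
  \<open>Jr\<close> are the Abel integrals inside the Riemann-Liouville derivatives, without the
  Gamma factor.\<close>

definition Jl :: "(real \<Rightarrow> real) \<Rightarrow> real \<Rightarrow> real" where "Jl f t = (\<integral>a. f a * K (t - a) \<partial>lborel)"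
definition Jr :: "(real \<Rightarrow> real) \<Rightarrow> real \<Rightarrow> real" where "Jr f t = (\<integral>a. f a * K (a - t) \<partial>lborel)"

theorem fractional_derivatives:
  assumes f: "sq_int lborel f" and supp: "\<And>t. t \<notin> {0<..<T} \<Longrightarrow> f t = 0" and s: "sq_int lborel2 (slob f)"
  obtains \<phi> \<psi> where "sq_int lborel \<phi>" "sq_int lborel \<psi>"
    "AE t in lborel. (Jl f has_real_derivative \<phi> t) (at t)" "AE t in lborel. (Jr f has_real_derivative \<psi> t) (at t)"
    "k2 * (\<integral>t. (\<phi> t)\<^sup>2 \<partial>lborel) = k1 * (\<integral>z. (slob f z)\<^sup>2 \<partial>lborel2)"
    "k2 * (\<integral>t. (\<psi> t)\<^sup>2 \<partial>lborel) = k1 * (\<integral>z. (slob f z)\<^sup>2 \<partial>lborel2)"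
    "k2 * (\<integral>t. \<phi> t * \<psi> t \<partial>lborel) = - k3 * (\<integral>z. (slob f z)\<^sup>2 \<partial>lborel2)"
    "continuous_on UNIV (Jl f)" "continuous_on UNIV (Jr f)"
proof -
  have fi: "integrable lborel f" by (rule integrable_supported[OF f supp])
  obtain \<phi> where phi: "sq_int lborel \<phi>"
    "(\<lambda>n. \<integral>t. (norm (diffquot (\<lambda>p t. K (t - p)) f (1 / real (Suc n)) t - \<phi> t))\<^sup>2 \<partial>lborel) \<longlonglongrightarrow> 0"
    "k2 * (\<integral>t. (\<phi> t)\<^sup>2 \<partial>lborel) = k1 * (\<integral>z. (slob f z)\<^sup>2 \<partial>lborel2)"
    "AE t in lborel. ((\<lambda>t. \<integral>a. f a * K (t - a) \<partial>lborel) has_real_derivative \<phi> t) (at t)"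
    "continuous_on UNIV (\<lambda>t. \<integral>a. f a * K (t - a) \<partial>lborel)"
    by (rule kernel_derivative[OF increment_family_K fi f s integrable_K_left[OF f supp]])
  \<comment> \<open>The right derivative is the case where the kernel is \<open>K\<close> composed
    with negation.\<close>
  have F': "increment_family lborel (\<lambda>p t. K (- (t - p))) k1" using increment_family_K_reflected by simp
  have i': "integrable lborel (\<lambda>a. f a * K (- (t - a)))" for t using integrable_K_right[OF f supp] by simp
  obtain \<psi> where psi': "sq_int lborel \<psi>"
    "(\<lambda>n. \<integral>t. (norm (diffquot (\<lambda>p t. K (- (t - p))) f (1 / real (Suc n)) t - \<psi> t))\<^sup>2 \<partial>lborel) \<longlonglongrightarrow> 0"
    "k2 * (\<integral>t. (\<psi> t)\<^sup>2 \<partial>lborel) = k1 * (\<integral>z. (slob f z)\<^sup>2 \<partial>lborel2)"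
    "AE t in lborel. ((\<lambda>t. \<integral>a. f a * K (- (t - a)) \<partial>lborel) has_real_derivative \<psi> t) (at t)"
    "continuous_on UNIV (\<lambda>t. \<integral>a. f a * K (- (t - a)) \<partial>lborel)"
    by (rule kernel_derivative[OF F' fi f s i'])
  note psi = psi'[unfolded minus_diff_eq]
  let ?P = "\<lambda>n. diffquot (\<lambda>p t. K (t - p)) f (1 / real (Suc n))" and ?M = "\<lambda>n. diffquot (\<lambda>p t. K (p - t)) f (1 / real (Suc n))"
    and ?Y = "\<lambda>n. diffquot stepY f (1 / real (Suc n))"
  have sP: "sq_int lborel (?P n)" "sq_int lborel (?M n)" "sq_int lborel2 (?Y n)" for n
    using diffquot_norm(1)[OF increment_family_K fi] diffquot_norm(1)[OF increment_family_K_reflected fi]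
      diffquot_norm(1)[OF increment_family_stepY fi] by blast+
  have mixed: "k2 * (\<integral>t. \<phi> t * \<psi> t \<partial>lborel) = - k3 * (\<integral>z. (slob f z)\<^sup>2 \<partial>lborel2)"
  proof (rule LIMSEQ_unique)
    show "(\<lambda>n. k2 * (\<integral>t. ?P n t * ?M n t \<partial>lborel)) \<longlonglongrightarrow> k2 * (\<integral>t. \<phi> t * \<psi> t \<partial>lborel)"
      using tendsto_integral_inner[OF sP(1) phi(1) sP(2) psi(1) phi(2) psi(2)] by (intro tendsto_mult_left) simp
    have eq: "k2 * (\<integral>t. ?P n t * ?M n t \<partial>lborel) = - k3 * (\<integral>z. (?Y n z)\<^sup>2 \<partial>lborel2)" for n
      using diffquot_mixed[OF fi, of "1 / real (Suc n)"] diffquot_norm(2)[OF increment_family_stepY fi, of "1 / real (Suc n)"]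
      by (simp del: of_nat_Suc)
    have Yl: "(\<lambda>n. \<integral>z. (norm (?Y n z - slob f z))\<^sup>2 \<partial>lborel2) \<longlonglongrightarrow> 0"
      by (rule diffquot_stepY_tendsto[OF fi f s])
    show "(\<lambda>n. k2 * (\<integral>t. ?P n t * ?M n t \<partial>lborel)) \<longlonglongrightarrow> - k3 * (\<integral>z. (slob f z)\<^sup>2 \<partial>lborel2)"
      unfolding eq using tendsto_integral_inner[OF sP(3) s sP(3) s Yl Yl] by (intro tendsto_mult_left) (simp add: power2_eq_square)
  qed
  have J: "(\<lambda>t. \<integral>a. f a * K (t - a) \<partial>lborel) = Jl f" "(\<lambda>t. \<integral>a. f a * K (a - t) \<partial>lborel) = Jr f"
    by (auto simp: Jl_def Jr_def)
  note p = phi(1,3,4,5)[unfolded J] and q = psi(1,3,4,5)[unfolded J]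
  show thesis by (rule that[OF p(1) q(1) p(3) q(3) p(2) q(2) mixed p(4) q(4)])
qed

lemma Jl_nonpos: "(\<And>t. t \<notin> {0<..<T} \<Longrightarrow> f t = 0) \<Longrightarrow> t \<le> 0 \<Longrightarrow> Jl f t = 0"
  unfolding Jl_def by (rule integral_eq_zero_AE, rule AE_I2) (auto simp: K_def)

lemma Jr_ge: "(\<And>t. t \<notin> {0<..<T} \<Longrightarrow> f t = 0) \<Longrightarrow> T \<le> t \<Longrightarrow> Jr f t = 0"
  unfolding Jr_def by (rule integral_eq_zero_AE, rule AE_I2) (auto simp: K_def)

subsection \<open>A fractional Hardy inequality\<close>

text \<open>Together with \<open>slobI\<close> this is the squared norm of one time slice in the
  fractional Sobolev space on \<open>(0, T)\<close>. Extended values let the inequalities below hold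
  without finiteness hypotheses.\<close>

definition L2I :: "real \<Rightarrow> (real \<Rightarrow> real) \<Rightarrow> ennreal" where
  "L2I T f = (\<integral>\<^sup>+t. ennreal (indicator {0<..<T} t * (f t)\<^sup>2) \<partial>lborel)"

definition slobI :: "real \<Rightarrow> (real \<Rightarrow> real) \<Rightarrow> ennreal" where
  "slobI T f = (\<integral>\<^sup>+z. ennreal (indicator ({0<..<T} \<times> {0<..<T}) z * (slob f z)\<^sup>2) \<partial>lborel2)"

text \<open>Young's inequality for \<open>(x - y) + y\<close>. A coefficient of the second square
  close to 1 is what makes absorption possible in the Hardy argument.\<close>

lemma sq_le_weighted: "0 < \<eta> \<Longrightarrow> x\<^sup>2 \<le> (1 + 1 / \<eta>) * (x - y)\<^sup>2 + (1 + \<eta>) * y\<^sup>2" for x y \<eta> :: real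
proof -
  assume e: "0 < \<eta>"
  have "0 \<le> ((x - y) - \<eta> * y)\<^sup>2 / \<eta>" using e by simp
  also have "\<dots> = (1 / \<eta>) * (x - y)\<^sup>2 - 2 * ((x - y) * y) + \<eta> * y\<^sup>2"
    using e by (simp add: power2_eq_square field_simps)
  finally show ?thesis by (simp add: power2_eq_square algebra_simps)
qed

text \<open>Compare \<open>f t\<close> with \<open>f (t * l)\<close> and average over
  \<open>l\<close> between 2 and 3. The difference is controlled by the seminorm; the shifted term
  is, after rescaling, a multiple of the left-hand side with factor
  \<open>2 powr (2 * \<sigma> - 1)\<close>, which is below 1 as
  \<open>\<sigma> < 1/2\<close>.\<close>

lemma Hardy_truncated:
  assumes [measurable]: "f \<in> borel_measurable borel" and \<delta>: "0 < \<delta>" "\<delta> < T" and \<eta>: "0 < \<eta>"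
  defines "I \<equiv> \<integral>\<^sup>+t. ennreal (indicator {\<delta><..<T} t * (t powr (-2 * \<sigma>) * (f t)\<^sup>2)) \<partial>lborel"
  shows "I \<le> ennreal ((1 + 1 / \<eta>) * 2 powr (1 + 2 * \<sigma>)) * slobI T f + ennreal ((1 + \<eta>) * 2 powr (2 * \<sigma> - 1)) * I
    + ennreal ((T / 3) powr (-2 * \<sigma>)) * L2I T f"
proof -
  let ?i = "indicator {\<delta><..<T/3} :: real \<Rightarrow> real" and ?j = "indicator {2<..<3} :: real \<Rightarrow> real"
  define G0 where "G0 t l = ennreal (?i t * ?j l * (t powr (-2 * \<sigma>) * (f t)\<^sup>2))" for t l
  define G1 where "G1 t l = ennreal (?i t * ?j l * (t powr (-2 * \<sigma>) * (f t - f (t * l))\<^sup>2))" for t l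
  define G2 where "G2 t l = ennreal (?i t * ?j l * (t powr (-2 * \<sigma>) * (f (t * l))\<^sup>2))" for t l
  have [measurable]: "(\<lambda>(t, l). G0 t l) \<in> borel_measurable lborel2" "(\<lambda>(t, l). G1 t l) \<in> borel_measurable lborel2" "(\<lambda>(t, l). G2 t l) \<in> borel_measurable lborel2"
    unfolding G0_def G1_def G2_def by measurable
  define W where "W = (\<integral>\<^sup>+t. ennreal (?i t * (t powr (-2 * \<sigma>) * (f t)\<^sup>2)) \<partial>lborel)"
  have T: "0 < T" using \<delta> by simp
  have "I \<le> (\<integral>\<^sup>+t. ennreal (?i t * (t powr (-2 * \<sigma>) * (f t)\<^sup>2)) + ennreal ((T / 3) powr (-2 * \<sigma>)) * ennreal (indicator {0<..<T} t * (f t)\<^sup>2) \<partial>lborel)"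
    unfolding I_def
  proof (rule nn_integral_mono)
    fix t :: real
    \<comment> \<open>Only \<open>t < T/3\<close> can be scaled by up to 3 inside the interval; on
      the rest the weight is bounded and the L2 norm suffices.\<close>
    consider "t \<in> {\<delta><..<T/3}" | "t \<in> {\<delta><..<T}" "T/3 \<le> t" | "t \<notin> {\<delta><..<T}" using \<delta> by fastforce
    then show "ennreal (indicator {\<delta><..<T} t * (t powr (-2 * \<sigma>) * (f t)\<^sup>2)) \<le> ennreal (?i t * (t powr (-2 * \<sigma>) * (f t)\<^sup>2)) + ennreal ((T / 3) powr (-2 * \<sigma>)) * ennreal (indicator {0<..<T} t * (f t)\<^sup>2)"
    proof cases
      case 1
      then have "indicator {\<delta><..<T} t = ?i t" using T by (auto simp: indicator_def)
      then show ?thesis by simp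
    next
      case 2
      have "t powr (-2 * \<sigma>) \<le> (T/3) powr (-2 * \<sigma>)" using 2 T \<sigma>_pos by (intro powr_mono2') auto
      then have "t powr (-2 * \<sigma>) * (f t)\<^sup>2 \<le> (T/3) powr (-2 * \<sigma>) * (f t)\<^sup>2" by (rule mult_right_mono) simp
      then have "ennreal (indicator {\<delta><..<T} t * (t powr (-2 * \<sigma>) * (f t)\<^sup>2)) \<le> ennreal ((T / 3) powr (-2 * \<sigma>)) * ennreal (indicator {0<..<T} t * (f t)\<^sup>2)"
        using 2 \<delta> by (simp add: ennreal_mult[symmetric] ennreal_leI)
      then show ?thesis by (simp add: add_increasing)
    qed simp
  qed
  also have "\<dots> = W + ennreal ((T / 3) powr (-2 * \<sigma>)) * L2I T f"
    unfolding W_def L2I_def by (simp add: nn_integral_add nn_integral_cmult)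
  finally have step1: "I \<le> W + ennreal ((T / 3) powr (-2 * \<sigma>)) * L2I T f" .
  \<comment> \<open>The range of \<open>l\<close> has length 1, so averaging over it introduces no
    factor.\<close>
  have j: "(\<integral>\<^sup>+l. ennreal (?j l) \<partial>lborel) = 1"
    by (subst ennreal_indicator) simp
  have "W = (\<integral>\<^sup>+t. \<integral>\<^sup>+l. G0 t l \<partial>lborel \<partial>lborel)"
    unfolding W_def
  proof (rule nn_integral_cong)
    fix t
    have "(\<integral>\<^sup>+l. G0 t l \<partial>lborel) = (\<integral>\<^sup>+l. ennreal (?i t * (t powr (-2 * \<sigma>) * (f t)\<^sup>2)) * ennreal (?j l) \<partial>lborel)"
      by (intro nn_integral_cong) (simp add: G0_def ennreal_mult[symmetric] mult_ac)
    then show "ennreal (?i t * (t powr (-2 * \<sigma>) * (f t)\<^sup>2)) = (\<integral>\<^sup>+l. G0 t l \<partial>lborel)"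
      by (simp add: nn_integral_cmult j)
  qed
  also have "\<dots> \<le> (\<integral>\<^sup>+t. \<integral>\<^sup>+l. ennreal (1 + 1 / \<eta>) * G1 t l + ennreal (1 + \<eta>) * G2 t l \<partial>lborel \<partial>lborel)"
  proof (intro nn_integral_mono)
    fix t l :: real
    have "?i t * ?j l * (t powr (-2 * \<sigma>) * (f t)\<^sup>2) \<le> ?i t * ?j l * (t powr (-2 * \<sigma>) * ((1 + 1 / \<eta>) * (f t - f (t * l))\<^sup>2 + (1 + \<eta>) * (f (t * l))\<^sup>2))"
      by (intro mult_left_mono sq_le_weighted \<eta>) auto
    also have "\<dots> = (1 + 1 / \<eta>) * (?i t * ?j l * (t powr (-2 * \<sigma>) * (f t - f (t * l))\<^sup>2)) + (1 + \<eta>) * (?i t * ?j l * (t powr (-2 * \<sigma>) * (f (t * l))\<^sup>2))"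
      by (simp add: algebra_simps)
    finally show "G0 t l \<le> ennreal (1 + 1 / \<eta>) * G1 t l + ennreal (1 + \<eta>) * G2 t l"
      unfolding G0_def G1_def G2_def using \<eta> by (simp add: ennreal_mult[symmetric] ennreal_plus[symmetric] ennreal_leI del: ennreal_plus)
  qed
  also have "\<dots> = ennreal (1 + 1 / \<eta>) * (\<integral>\<^sup>+t. \<integral>\<^sup>+l. G1 t l \<partial>lborel \<partial>lborel) + ennreal (1 + \<eta>) * (\<integral>\<^sup>+t. \<integral>\<^sup>+l. G2 t l \<partial>lborel \<partial>lborel)"
    by (simp add: nn_integral_add nn_integral_cmult)
  also have "(\<integral>\<^sup>+t. \<integral>\<^sup>+l. G1 t l \<partial>lborel \<partial>lborel) \<le> ennreal (2 powr (1 + 2 * \<sigma>)) * slobI T f"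
  proof -
    have "(\<integral>\<^sup>+t. \<integral>\<^sup>+l. G1 t l \<partial>lborel \<partial>lborel) \<le> (\<integral>\<^sup>+t. \<integral>\<^sup>+s. ennreal (2 powr (1 + 2 * \<sigma>)) * ennreal (indicator ({0<..<T} \<times> {0<..<T}) (t, s) * (slob f (t, s))\<^sup>2) \<partial>lborel \<partial>lborel)"
    proof (rule nn_integral_mono)
      fix t
      show "(\<integral>\<^sup>+l. G1 t l \<partial>lborel) \<le> (\<integral>\<^sup>+s. ennreal (2 powr (1 + 2 * \<sigma>)) * ennreal (indicator ({0<..<T} \<times> {0<..<T}) (t, s) * (slob f (t, s))\<^sup>2) \<partial>lborel)"
      proof (cases "t \<in> {\<delta><..<T/3}")
        case True
        then have t: "0 < t" "t < T/3" using \<delta> by auto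
        let ?F = "\<lambda>s. ennreal (indicator {2*t<..<3*t} s * (t powr (-2 * \<sigma> - 1) * (f t - f s)\<^sup>2))"
        have "(\<integral>\<^sup>+l. G1 t l \<partial>lborel) = (\<integral>\<^sup>+l. ennreal t * ?F (0 + t * l) \<partial>lborel)"
        proof (rule nn_integral_cong)
          fix l
          have "t powr (-2 * \<sigma>) = t * t powr (-2 * \<sigma> - 1)" using t by (simp add: powr_mult_base)
          moreover have "indicator {2*t<..<3*t} (t * l) = ?j l" using t by (auto simp: indicator_def)
          ultimately show "G1 t l = ennreal t * ?F (0 + t * l)"
            using True t unfolding G1_def by (simp add: ennreal_mult[symmetric] mult_ac)
        qed
        also have "\<dots> = ennreal t * (\<integral>\<^sup>+l. ?F (0 + t * l) \<partial>lborel)" by (rule nn_integral_cmult) measurable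
        also have "\<dots> = (\<integral>\<^sup>+s. ?F s \<partial>lborel)" using t by (subst nn_integral_real_affine[of ?F t 0]) auto
        also have "\<dots> \<le> (\<integral>\<^sup>+s. ennreal (2 powr (1 + 2 * \<sigma>)) * ennreal (indicator ({0<..<T} \<times> {0<..<T}) (t, s) * (slob f (t, s))\<^sup>2) \<partial>lborel)"
        proof (rule nn_integral_mono)
          fix s
          show "?F s \<le> ennreal (2 powr (1 + 2 * \<sigma>)) * ennreal (indicator ({0<..<T} \<times> {0<..<T}) (t, s) * (slob f (t, s))\<^sup>2)"
          proof (cases "s \<in> {2*t<..<3*t}")
            case True
            \<comment> \<open>Here \<open>t < \<bar>t - s\<bar> < 2 * t\<close>, so the powers of
              \<open>t\<close> and of \<open>\<bar>t - s\<bar>\<close> are comparable; this produces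
              the factor \<open>2 powr (1 + 2 * \<sigma>)\<close>.\<close>
            then have st: "0 < s" "s < T" "0 < \<bar>t - s\<bar>" "\<bar>t - s\<bar> / 2 \<le> t" using t by auto
            have "t powr (-(1 + 2 * \<sigma>)) \<le> (\<bar>t - s\<bar> / 2) powr (-(1 + 2 * \<sigma>))"
              using st \<sigma>_pos by (intro powr_mono2') auto
            also have "\<dots> = 2 powr (1 + 2 * \<sigma>) * (m (t - s))\<^sup>2"
              unfolding m_sq powr_divide powr_minus by (simp add: divide_inverse)
            finally have le: "t powr (-(1 + 2 * \<sigma>)) \<le> 2 powr (1 + 2 * \<sigma>) * (m (t - s))\<^sup>2" .
            have e: "-2 * \<sigma> - 1 = -(1 + 2 * \<sigma>)" by simp
            have "t powr (-2 * \<sigma> - 1) * (f t - f s)\<^sup>2 \<le> 2 powr (1 + 2 * \<sigma>) * (m (t - s))\<^sup>2 * (f t - f s)\<^sup>2"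
              unfolding e by (intro mult_right_mono le) simp
            then show ?thesis using True st t
              by (simp add: slob_def power_mult_distrib ennreal_mult[symmetric] mult.assoc ennreal_leI)
          qed simp
        qed
        finally show ?thesis .
      qed (simp add: G1_def)
    qed
    also have "\<dots> = (\<integral>\<^sup>+z. ennreal (2 powr (1 + 2 * \<sigma>)) * ennreal (indicator ({0<..<T} \<times> {0<..<T}) z * (slob f z)\<^sup>2) \<partial>lborel2)"
      by (rule nn_integral_lborel2[symmetric]) measurable
    also have "\<dots> = ennreal (2 powr (1 + 2 * \<sigma>)) * slobI T f"
      unfolding slobI_def by (rule nn_integral_cmult) measurable
    finally show ?thesis .
  qed
  also have "(\<integral>\<^sup>+t. \<integral>\<^sup>+l. G2 t l \<partial>lborel \<partial>lborel) \<le> ennreal (2 powr (2 * \<sigma> - 1)) * I"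
  proof -
    have "(\<integral>\<^sup>+t. \<integral>\<^sup>+l. G2 t l \<partial>lborel \<partial>lborel) = (\<integral>\<^sup>+l. \<integral>\<^sup>+t. G2 t l \<partial>lborel \<partial>lborel)"
      by (rule lborel_pair.Fubini'[symmetric]) measurable
    also have "\<dots> \<le> (\<integral>\<^sup>+l. ennreal (?j l) * (ennreal (2 powr (2 * \<sigma> - 1)) * I) \<partial>lborel)"
    proof (rule nn_integral_mono)
      fix l
      show "(\<integral>\<^sup>+t. G2 t l \<partial>lborel) \<le> ennreal (?j l) * (ennreal (2 powr (2 * \<sigma> - 1)) * I)"
      proof (cases "l \<in> {2<..<3}")
        case True
        \<comment> \<open>In the substitution \<open>s = l * t\<close> the weight gives
          \<open>l powr (2 * \<sigma>)\<close> and the measure \<open>1 / l\<close>; the total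
          exponent is negative, so \<open>l > 2\<close> can be replaced by 2.\<close>
        then have l: "2 < l" "l < 3" by auto
        let ?F = "\<lambda>s. ennreal (indicator {\<delta><..<T} s * (s powr (-2 * \<sigma>) * (f s)\<^sup>2))"
        have "(\<integral>\<^sup>+t. G2 t l \<partial>lborel) \<le> (\<integral>\<^sup>+t. ennreal (l powr (2 * \<sigma>)) * ?F (0 + l * t) \<partial>lborel)"
        proof (rule nn_integral_mono)
          fix t
          show "G2 t l \<le> ennreal (l powr (2 * \<sigma>)) * ?F (0 + l * t)"
          proof (cases "t \<in> {\<delta><..<T/3}")
            case True
            then have t: "\<delta> < t" "t < T/3" "0 < t" using \<delta> by auto
            \<comment> \<open>The scaled point stays above \<open>\<delta>\<close> and below
              \<open>T\<close>, so it lies in the domain of the same truncated integral.\<close>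
            have a: "t * 2 < l * t" "l * t < t * 3" using t l by (simp_all add: mult.commute[of l t])
            have "\<delta> < l * t" "l * t < T" using a t by linarith+
            then have tl: "l * t \<in> {\<delta><..<T}" by simp
            have "(l * t) powr (-2 * \<sigma>) = l powr (-2 * \<sigma>) * t powr (-2 * \<sigma>)" using l t by (simp add: powr_mult)
            then have "l powr (2 * \<sigma>) * (l * t) powr (-2 * \<sigma>) = t powr (-2 * \<sigma>)" using l by (simp add: powr_minus)
            then have e: "l powr (2 * \<sigma>) * ((l * t) powr (-2 * \<sigma>) * (f (l * t))\<^sup>2) = t powr (-2 * \<sigma>) * (f (l * t))\<^sup>2"
              by (simp add: mult.assoc[symmetric])
            have 1: "G2 t l = ennreal (t powr (-2 * \<sigma>) * (f (l * t))\<^sup>2)"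
              using True l by (simp add: G2_def mult.commute[of t l])
            have 2: "?F (0 + l * t) = ennreal ((l * t) powr (-2 * \<sigma>) * (f (l * t))\<^sup>2)" using tl by simp
            show ?thesis unfolding 1 2 e[symmetric] by (simp add: ennreal_mult)
          qed (simp add: G2_def)
        qed
        also have "\<dots> = ennreal (l powr (2 * \<sigma>)) * (\<integral>\<^sup>+t. ?F (0 + l * t) \<partial>lborel)" by (rule nn_integral_cmult) measurable
        also have "\<dots> = ennreal (l powr (2 * \<sigma>)) * (ennreal (1 / l) * (ennreal l * (\<integral>\<^sup>+t. ?F (0 + l * t) \<partial>lborel)))"
          using l by (simp add: mult.assoc[symmetric] ennreal_mult[symmetric])
        also have "ennreal l * (\<integral>\<^sup>+t. ?F (0 + l * t) \<partial>lborel) = I"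
        proof -
          have "?F \<in> borel_measurable borel" by measurable
          from nn_integral_real_affine[OF this, of l 0] l show ?thesis by (simp add: I_def)
        qed
        also have "ennreal (l powr (2 * \<sigma>)) * (ennreal (1 / l) * I) = ennreal (l powr (2 * \<sigma> - 1)) * I"
          using l by (simp add: mult.assoc[symmetric] ennreal_mult[symmetric] powr_diff)
        also have "\<dots> \<le> ennreal (2 powr (2 * \<sigma> - 1)) * I"
          using l \<sigma>_half by (intro mult_right_mono ennreal_leI powr_mono2') auto
        finally show ?thesis using True by simp
      qed (simp add: G2_def)
    qed
    also have "\<dots> = ennreal (2 powr (2 * \<sigma> - 1)) * I" by (simp add: nn_integral_multc j)
    finally show ?thesis .
  qed
  finally have "W \<le> ennreal (1 + 1 / \<eta>) * (ennreal (2 powr (1 + 2 * \<sigma>)) * slobI T f) + ennreal (1 + \<eta>) * (ennreal (2 powr (2 * \<sigma> - 1)) * I)"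
    by (simp add: add_mono mult_left_mono)
  then have "W \<le> ennreal ((1 + 1 / \<eta>) * 2 powr (1 + 2 * \<sigma>)) * slobI T f + ennreal ((1 + \<eta>) * 2 powr (2 * \<sigma> - 1)) * I"
    using \<eta> by (simp add: ennreal_mult mult.assoc)
  with step1 show ?thesis by (meson add_right_mono order_trans)
qed

text \<open>An infinite \<open>I\<close> would satisfy the first inequality for free. To guarantee
  finiteness the Hardy integral is truncated away from 0 before this is applied.\<close>

lemma ennreal_absorb:
  assumes "I \<le> X + ennreal \<theta> * I" "I < \<infinity>" "0 \<le> \<theta>" "\<theta> < 1"
  shows "I \<le> ennreal (1 / (1 - \<theta>)) * X"
proof (cases X)
  case (real x)
  obtain i where i: "I = ennreal i" "0 \<le> i" using assms(2) by (cases I) auto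
  have "i \<le> x + \<theta> * i" using assms(1,3) i real by (simp add: ennreal_mult[symmetric] ennreal_plus[symmetric] del: ennreal_plus)
  then have "i \<le> 1 / (1 - \<theta>) * x" using assms(4) by (simp add: field_simps)
  then show ?thesis using i real assms(4) by (simp add: ennreal_mult[symmetric] ennreal_leI)
next
  case top
  then show ?thesis using assms(4) by (simp add: ennreal_mult_top)
qed

lemma Hardy:
  assumes T: "0 < T"
  obtains C where "0 < C" "\<And>f. f \<in> borel_measurable borel \<Longrightarrow>
    (\<integral>\<^sup>+t. ennreal (indicator {0<..<T} t * (t powr (-2 * \<sigma>) * (f t)\<^sup>2)) \<partial>lborel) \<le> ennreal C * (L2I T f + slobI T f)"
proof -
  define q where "q = 2 powr (1 - 2 * \<sigma>)"
  have q: "1 < q" unfolding q_def using \<sigma>_half by (intro gr_one_powr) auto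
  \<comment> \<open>With this choice \<open>\<theta> = (q + 1) / (2 * q)\<close>, which is below 1
    because \<open>q > 1\<close>.\<close>
  define \<eta> where "\<eta> = (q - 1) / 2"
  have \<eta>: "0 < \<eta>" using q by (simp add: \<eta>_def)
  define \<theta> where "\<theta> = (1 + \<eta>) * 2 powr (2 * \<sigma> - 1)"
  have qi: "2 powr (2 * \<sigma> - 1) = 1 / q" unfolding q_def using powr_minus[of 2 "1 - 2 * \<sigma>"] by (simp add: inverse_eq_divide)
  have \<theta>: "0 \<le> \<theta>" "\<theta> < 1" using q \<eta> unfolding \<theta>_def qi by (auto simp: \<eta>_def field_simps)
  define c where "c = max ((1 + 1 / \<eta>) * 2 powr (1 + 2 * \<sigma>)) ((T / 3) powr (-2 * \<sigma>))"
  have c: "0 < c" using T by (simp add: c_def less_max_iff_disj)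
  define C where "C = 1 / (1 - \<theta>) * c"
  have C: "0 < C" using c \<theta> by (simp add: C_def)
  show thesis
  proof (rule that[OF C])
    fix f :: "real \<Rightarrow> real" assume [measurable]: "f \<in> borel_measurable borel"
    let ?R = "ennreal C * (L2I T f + slobI T f)"
    show "(\<integral>\<^sup>+t. ennreal (indicator {0<..<T} t * (t powr (-2 * \<sigma>) * (f t)\<^sup>2)) \<partial>lborel) \<le> ?R"
    proof (cases "L2I T f = \<infinity>")
      case True then show ?thesis using C by (simp add: ennreal_mult_top)
    next
      case False
      \<comment> \<open>The offset 2 keeps every truncation strictly below \<open>T\<close>; the
        truncations tend to 0 and Fatou's lemma removes them.\<close>
      define \<delta> where "\<delta> n = T / real (n + 2)" for n :: nat
      have \<delta>: "0 < \<delta> n" "\<delta> n < T" for n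
        using T mult_strict_left_mono[of 1 "real (n + 2)" T] by (simp_all add: \<delta>_def divide_less_eq)
      let ?g = "\<lambda>\<delta> t. ennreal (indicator {\<delta><..<T} t * (t powr (-2 * \<sigma>) * (f t)\<^sup>2))"
      have bnd: "(\<integral>\<^sup>+t. ?g (\<delta> n) t \<partial>lborel) \<le> ?R" for n
      proof -
        let ?I = "\<integral>\<^sup>+t. ?g (\<delta> n) t \<partial>lborel"
        have "?I \<le> (\<integral>\<^sup>+t. ennreal (\<delta> n powr (-2 * \<sigma>)) * ennreal (indicator {0<..<T} t * (f t)\<^sup>2) \<partial>lborel)"
        proof (rule nn_integral_mono)
          fix t
          show "?g (\<delta> n) t \<le> ennreal (\<delta> n powr (-2 * \<sigma>)) * ennreal (indicator {0<..<T} t * (f t)\<^sup>2)"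
          proof (cases "t \<in> {\<delta> n<..<T}")
            case True
            have "t powr (-2 * \<sigma>) \<le> \<delta> n powr (-2 * \<sigma>)" using True \<delta>[of n] \<sigma>_pos by (intro powr_mono2') auto
            then have "t powr (-2 * \<sigma>) * (f t)\<^sup>2 \<le> \<delta> n powr (-2 * \<sigma>) * (f t)\<^sup>2" by (rule mult_right_mono) simp
            then show ?thesis using True \<delta>[of n] by (simp add: ennreal_mult[symmetric] ennreal_leI)
          qed simp
        qed
        also have "\<dots> = ennreal (\<delta> n powr (-2 * \<sigma>)) * L2I T f" unfolding L2I_def by (rule nn_integral_cmult) measurable
        also have "\<dots> < \<infinity>" using False by (simp add: ennreal_mult_less_top less_top)
        finally have fin: "?I < \<infinity>" .
        have "?I \<le> ennreal ((1 + 1 / \<eta>) * 2 powr (1 + 2 * \<sigma>)) * slobI T f + ennreal ((1 + \<eta>) * 2 powr (2 * \<sigma> - 1)) * ?I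
             + ennreal ((T / 3) powr (-2 * \<sigma>)) * L2I T f"
          by (rule Hardy_truncated[OF _ \<delta> \<eta>]) measurable
        also have "\<dots> \<le> ennreal c * slobI T f + ennreal \<theta> * ?I + ennreal c * L2I T f"
          unfolding \<theta>_def by (intro add_mono mult_right_mono ennreal_leI order_refl) (auto simp: c_def)
        also have "\<dots> = ennreal c * (L2I T f + slobI T f) + ennreal \<theta> * ?I" by (simp add: distrib_left add_ac)
        finally have "?I \<le> ennreal (1 / (1 - \<theta>)) * (ennreal c * (L2I T f + slobI T f))" by (rule ennreal_absorb[OF _ fin \<theta>])
        also have "\<dots> = ?R" using c \<theta> by (simp add: C_def ennreal_mult[symmetric] mult.assoc[symmetric])
        finally show ?thesis .
      qed
      have lim: "\<delta> \<longlonglongrightarrow> 0" unfolding \<delta>_def using LIMSEQ_ignore_initial_segment[OF lim_const_over_n[of T], of 2] by simp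
      have "(\<integral>\<^sup>+t. ?g 0 t \<partial>lborel) = (\<integral>\<^sup>+t. liminf (\<lambda>n. ?g (\<delta> n) t) \<partial>lborel)"
      proof (rule nn_integral_cong)
        fix t :: real
        have "eventually (\<lambda>n. ?g (\<delta> n) t = ?g 0 t) sequentially"
        proof (cases "0 < t")
          case True
          then have "eventually (\<lambda>n. \<delta> n < t) sequentially" using order_tendstoD(2)[OF lim] by blast
          then show ?thesis by eventually_elim (use True in \<open>auto simp: indicator_def\<close>)
        next
          case f: False
          then have "?g (\<delta> n) t = ?g 0 t" for n using \<delta>(1)[of n] by (auto simp: indicator_def)
          then show ?thesis by simp
        qed
        then have "(\<lambda>n. ?g (\<delta> n) t) \<longlonglongrightarrow> ?g 0 t" by (rule tendsto_eventually)
        from lim_imp_Liminf[OF trivial_limit_sequentially this] show "?g 0 t = liminf (\<lambda>n. ?g (\<delta> n) t)" by simp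
      qed
      also have "\<dots> \<le> liminf (\<lambda>n. \<integral>\<^sup>+t. ?g (\<delta> n) t \<partial>lborel)" by (rule nn_integral_liminf) measurable
      also have "\<dots> \<le> liminf (\<lambda>n::nat. ?R)" by (intro Liminf_mono always_eventually allI bnd)
      also have "\<dots> = ?R" by (simp add: Liminf_const)
      finally show ?thesis .
    qed
  qed
qed

lemma
  assumes [measurable]: "f \<in> borel_measurable borel"
  shows L2I_reflect: "L2I T (\<lambda>t. f (T - t)) = L2I T f"
    and slobI_reflect: "slobI T (\<lambda>t. f (T - t)) = slobI T f"
proof -
  have "L2I T (\<lambda>t. f (T - t)) = (\<integral>\<^sup>+t. ennreal (indicator {0<..<T} (T - t) * (f (T - t))\<^sup>2) \<partial>lborel)"
    unfolding L2I_def by (intro nn_integral_cong) (auto simp: indicator_def)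
  also have "\<dots> = L2I T f" unfolding L2I_def by (rule nn_integral_lborel_reflect) measurable
  finally show "L2I T (\<lambda>t. f (T - t)) = L2I T f" .
  let ?h = "\<lambda>z. ennreal (indicator ({0<..<T} \<times> {0<..<T}) z * (slob f z)\<^sup>2)"
  have [measurable]: "slob f \<in> borel_measurable lborel2" "slob (\<lambda>t. f (T - t)) \<in> borel_measurable lborel2"
    by (rule measurable_slob; measurable)+
  have [measurable]: "?h \<in> borel_measurable lborel2" by measurable
  have e: "slob (\<lambda>t. f (T - t)) (t, s) = slob f (T - t, T - s)" for t s
    by (simp add: slob_def) (metis m_minus minus_diff_eq)
  have "slobI T (\<lambda>t. f (T - t)) = (\<integral>\<^sup>+t. \<integral>\<^sup>+s. ennreal (indicator ({0<..<T} \<times> {0<..<T}) (t, s) * (slob (\<lambda>t. f (T - t)) (t, s))\<^sup>2) \<partial>lborel \<partial>lborel)"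
    unfolding slobI_def by (rule nn_integral_lborel2) measurable
  also have "\<dots> = (\<integral>\<^sup>+t. \<integral>\<^sup>+s. ?h (T - t, T - s) \<partial>lborel \<partial>lborel)"
    unfolding e by (intro nn_integral_cong) (auto simp: indicator_def)
  also have "\<dots> = (\<integral>\<^sup>+t. \<integral>\<^sup>+s. ?h (T - t, s) \<partial>lborel \<partial>lborel)"
    by (intro nn_integral_cong nn_integral_lborel_reflect) measurable
  also have "\<dots> = (\<integral>\<^sup>+t. \<integral>\<^sup>+s. ?h (t, s) \<partial>lborel \<partial>lborel)"
    by (rule nn_integral_lborel_reflect) measurable
  also have "\<dots> = slobI T f" unfolding slobI_def by (rule nn_integral_lborel2[symmetric]) measurable
  finally show "slobI T (\<lambda>t. f (T - t)) = slobI T f" .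
qed

text \<open>For the zero extension, pairs with both times outside contribute nothing, and pairs with
  one time outside contribute \<open>(f t)^2\<close> times the weight of the complement. Both
  singular weights are handled by Hardy, the one at \<open>T\<close> after reflection; each of the
  two mixed regions costs \<open>C0 / \<sigma>\<close>.\<close>

lemma slob_upper:
  assumes T: "0 < T"
  obtains C where "0 < C" "\<And>f. f \<in> borel_measurable borel \<Longrightarrow> (\<And>t. t \<notin> {0<..<T} \<Longrightarrow> f t = 0) \<Longrightarrow>
    (\<integral>\<^sup>+z. ennreal ((slob f z)\<^sup>2) \<partial>lborel2) \<le> ennreal C * (L2I T f + slobI T f)"
proof -
  obtain C0 where C0: "0 < C0" and H: "\<And>f. f \<in> borel_measurable borel \<Longrightarrow>
    (\<integral>\<^sup>+t. ennreal (indicator {0<..<T} t * (t powr (-2 * \<sigma>) * (f t)\<^sup>2)) \<partial>lborel) \<le> ennreal C0 * (L2I T f + slobI T f)"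
    by (rule Hardy[OF T]) blast
  show thesis
  proof (rule that)
    show "0 < 1 + 2 * C0 / \<sigma>" using C0 \<sigma>_pos by (simp add: add_pos_pos)
    fix f :: "real \<Rightarrow> real" assume f [measurable]: "f \<in> borel_measurable borel" and supp: "\<And>t. t \<notin> {0<..<T} \<Longrightarrow> f t = 0"
    let ?X = "L2I T f + slobI T f"
    have [measurable]: "slob f \<in> borel_measurable lborel2" by (rule measurable_slob) measurable
    let ?D = "{0<..<T}"
    define A where "A t s = ennreal (indicator ?D t * (f t)\<^sup>2) * ennreal (indicator (-?D) s * (m (t - s))\<^sup>2)" for t s
    have mA: "(\<lambda>z. A (fst z) (snd z)) \<in> borel_measurable lborel2" "(\<lambda>z. A (snd z) (fst z)) \<in> borel_measurable lborel2"
      unfolding A_def by measurable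
    have IA: "(\<integral>\<^sup>+t. \<integral>\<^sup>+s. A t s \<partial>lborel \<partial>lborel) \<le> ennreal (C0 / \<sigma>) * ?X"
    proof -
      let ?a = "\<lambda>t. ennreal (indicator ?D t * (t powr (-2 * \<sigma>) * (f t)\<^sup>2))"
      let ?b = "\<lambda>t. ennreal (indicator ?D t * (t powr (-2 * \<sigma>) * (f (T - t))\<^sup>2))"
      have "(\<integral>\<^sup>+t. \<integral>\<^sup>+s. A t s \<partial>lborel \<partial>lborel) = (\<integral>\<^sup>+t. ennreal (1 / (2 * \<sigma>)) * (?a t + ?b (T - t)) \<partial>lborel)"
      proof (rule nn_integral_cong)
        fix t :: real
        have "(\<integral>\<^sup>+s. A t s \<partial>lborel) = ennreal (indicator ?D t * (f t)\<^sup>2) * (\<integral>\<^sup>+s. ennreal (indicator (-?D) s * (m (t - s))\<^sup>2) \<partial>lborel)"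
          unfolding A_def by (rule nn_integral_cmult) measurable
        also have "\<dots> = ennreal (1 / (2 * \<sigma>)) * (?a t + ?b (T - t))"
        proof (cases "t \<in> ?D")
          case True
          then have "(\<integral>\<^sup>+s. ennreal (indicator (-?D) s * (m (t - s))\<^sup>2) \<partial>lborel) = ennreal ((t powr (-2 * \<sigma>) + (T - t) powr (-2 * \<sigma>)) / (2 * \<sigma>))"
            by (intro nn_integral_m_outside) auto
          then show ?thesis using True \<sigma>_pos
            by (simp add: ennreal_mult[symmetric] ennreal_plus[symmetric] del: ennreal_plus)
               (simp add: algebra_simps add_divide_distrib)
        qed (auto simp: indicator_def)
        finally show "(\<integral>\<^sup>+s. A t s \<partial>lborel) = ennreal (1 / (2 * \<sigma>)) * (?a t + ?b (T - t))" .
      qed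
      also have "\<dots> = ennreal (1 / (2 * \<sigma>)) * ((\<integral>\<^sup>+t. ?a t \<partial>lborel) + (\<integral>\<^sup>+t. ?b (T - t) \<partial>lborel))"
        by (simp add: nn_integral_cmult nn_integral_add)
      also have "(\<integral>\<^sup>+t. ?b (T - t) \<partial>lborel) = (\<integral>\<^sup>+t. ?b t \<partial>lborel)" by (rule nn_integral_lborel_reflect) measurable
      also have "(\<integral>\<^sup>+t. ?b t \<partial>lborel) \<le> ennreal C0 * ?X"
        using H[of "\<lambda>t. f (T - t)"] unfolding L2I_reflect[OF f] slobI_reflect[OF f] by simp
      also have "(\<integral>\<^sup>+t. ?a t \<partial>lborel) \<le> ennreal C0 * ?X" by (rule H[OF f])
      also have "ennreal (1 / (2 * \<sigma>)) * (ennreal C0 * ?X + ennreal C0 * ?X) = ennreal (C0 / \<sigma>) * ?X"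
      proof -
        have "ennreal C0 * ?X + ennreal C0 * ?X = ennreal (2 * C0) * ?X"
          using C0 by (simp add: distrib_right[symmetric] ennreal_plus[symmetric] del: ennreal_plus)
        then show ?thesis using C0 \<sigma>_pos by (simp add: mult.assoc[symmetric] ennreal_mult[symmetric])
      qed
      finally show ?thesis by (simp add: add_mono mult_left_mono)
    qed
    have "(\<integral>\<^sup>+z. ennreal ((slob f z)\<^sup>2) \<partial>lborel2) \<le> (\<integral>\<^sup>+z. ennreal (indicator (?D \<times> ?D) z * (slob f z)\<^sup>2) + (A (fst z) (snd z) + A (snd z) (fst z)) \<partial>lborel2)"
    proof (rule nn_integral_mono)
      fix z :: "real \<times> real"
      obtain t s where z: "z = (t, s)" by (cases z)
      have "m (s - t) = m (t - s)" by (metis m_minus minus_diff_eq)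
      then show "ennreal ((slob f z)\<^sup>2) \<le> ennreal (indicator (?D \<times> ?D) z * (slob f z)\<^sup>2) + (A (fst z) (snd z) + A (snd z) (fst z))"
        using supp[of t] supp[of s] unfolding z
        by (cases "t \<in> ?D"; cases "s \<in> ?D") (auto simp: A_def slob_def power_mult_distrib ennreal_mult[symmetric] mult.commute)
    qed
    also have "\<dots> = slobI T f + ((\<integral>\<^sup>+z. A (fst z) (snd z) \<partial>lborel2) + (\<integral>\<^sup>+z. A (snd z) (fst z) \<partial>lborel2))"
      unfolding slobI_def using mA by (simp add: nn_integral_add)
    also have "(\<integral>\<^sup>+z. A (snd z) (fst z) \<partial>lborel2) = (\<integral>\<^sup>+t. \<integral>\<^sup>+s. A t s \<partial>lborel \<partial>lborel)"
      using lborel_pair.nn_integral_snd[OF mA(2)] by simp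
    also have "(\<integral>\<^sup>+z. A (fst z) (snd z) \<partial>lborel2) = (\<integral>\<^sup>+t. \<integral>\<^sup>+s. A t s \<partial>lborel \<partial>lborel)"
      using nn_integral_lborel2[OF mA(1)] by simp
    also have "slobI T f + ((\<integral>\<^sup>+t. \<integral>\<^sup>+s. A t s \<partial>lborel \<partial>lborel) + (\<integral>\<^sup>+t. \<integral>\<^sup>+s. A t s \<partial>lborel \<partial>lborel))
       \<le> ?X + (ennreal (C0 / \<sigma>) * ?X + ennreal (C0 / \<sigma>) * ?X)"
      by (intro add_mono IA) (simp add: add_increasing)
    also have "\<dots> = ennreal (1 + 2 * C0 / \<sigma>) * ?X"
    proof -
      have "ennreal (1 + 2 * C0 / \<sigma>) = 1 + (ennreal (C0 / \<sigma>) + ennreal (C0 / \<sigma>))"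
        using C0 \<sigma>_pos by (simp add: ennreal_plus[symmetric] ennreal_1[symmetric] del: ennreal_plus ennreal_1)
      then show ?thesis by (simp add: distrib_right)
    qed
    finally show "(\<integral>\<^sup>+z. ennreal ((slob f z)\<^sup>2) \<partial>lborel2) \<le> ennreal (1 + 2 * C0 / \<sigma>) * ?X" .
  qed
qed

text \<open>For the second bound it suffices to look at times \<open>s\<close> between
  \<open>T\<close> and \<open>2 * T\<close>, where the extension vanishes: there the quotient is
  \<open>m (t - s) * f t\<close>, and the two times are less than \<open>2 * T\<close>
  apart.\<close>

lemma slob_lower:
  assumes T: "0 < T" and [measurable]: "f \<in> borel_measurable borel" and supp: "\<And>t. t \<notin> {0<..<T} \<Longrightarrow> f t = 0"
  shows "slobI T f \<le> (\<integral>\<^sup>+z. ennreal ((slob f z)\<^sup>2) \<partial>lborel2)"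
    and "ennreal (T * (2 * T) powr (-(1 + 2 * \<sigma>))) * L2I T f \<le> (\<integral>\<^sup>+z. ennreal ((slob f z)\<^sup>2) \<partial>lborel2)"
proof -
  have [measurable]: "slob f \<in> borel_measurable lborel2" by (rule measurable_slob) measurable
  show "slobI T f \<le> (\<integral>\<^sup>+z. ennreal ((slob f z)\<^sup>2) \<partial>lborel2)"
    unfolding slobI_def by (intro nn_integral_mono) (auto simp: indicator_def)
  let ?c = "(2 * T) powr (-(1 + 2 * \<sigma>))"
  have "ennreal (T * ?c) * L2I T f = (\<integral>\<^sup>+t. ennreal (indicator {0<..<T} t * (f t)\<^sup>2) * ennreal (T * ?c) \<partial>lborel)"
    unfolding L2I_def by (subst nn_integral_multc) (auto simp: mult.commute)
  also have "\<dots> \<le> (\<integral>\<^sup>+t. \<integral>\<^sup>+s. ennreal ((slob f (t, s))\<^sup>2) \<partial>lborel \<partial>lborel)"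
  proof (rule nn_integral_mono)
    fix t :: real
    show "ennreal (indicator {0<..<T} t * (f t)\<^sup>2) * ennreal (T * ?c) \<le> (\<integral>\<^sup>+s. ennreal ((slob f (t, s))\<^sup>2) \<partial>lborel)"
    proof (cases "t \<in> {0<..<T}")
      case True
      have "ennreal (indicator {0<..<T} t * (f t)\<^sup>2) * ennreal (T * ?c) = (\<integral>\<^sup>+s. ennreal ((f t)\<^sup>2 * ?c) * indicator {T<..<2*T} s \<partial>lborel)"
        using True T by (subst nn_integral_cmult_indicator) (auto simp: ennreal_mult[symmetric] mult_ac)
      also have "\<dots> \<le> (\<integral>\<^sup>+s. ennreal ((slob f (t, s))\<^sup>2) \<partial>lborel)"
      proof (rule nn_integral_mono)
        fix s
        show "ennreal ((f t)\<^sup>2 * ?c) * indicator {T<..<2*T} s \<le> ennreal ((slob f (t, s))\<^sup>2)"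
        proof (cases "s \<in> {T<..<2*T}")
          case s: True
          then have "?c \<le> (m (t - s))\<^sup>2" unfolding m_sq using True \<sigma>_pos by (intro powr_mono2') auto
          then have "(f t)\<^sup>2 * ?c \<le> (f t)\<^sup>2 * (m (t - s))\<^sup>2" by (rule mult_left_mono) simp
          then show ?thesis using s supp[of s] by (simp add: slob_def power_mult_distrib mult.commute ennreal_leI)
        qed simp
      qed
      finally show ?thesis .
    qed simp
  qed
  also have "\<dots> = (\<integral>\<^sup>+z. ennreal ((slob f z)\<^sup>2) \<partial>lborel2)" by (rule nn_integral_lborel2[symmetric]) measurable
  finally show "ennreal (T * ?c) * L2I T f \<le> (\<integral>\<^sup>+z. ennreal ((slob f z)\<^sup>2) \<partial>lborel2)" .
qed

end

subsection \<open>The Lax-Milgram theorem\<close>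

text \<open>
  The operations need not satisfy any vector space law: all statements are modulo null vectors
  of the form \<open>ip\<close>, which need not be definite.
\<close>

locale semi_hilbert =
  fixes V :: "'v set" and add :: "'v \<Rightarrow> 'v \<Rightarrow> 'v" and scl :: "real \<Rightarrow> 'v \<Rightarrow> 'v" and ip :: "'v \<Rightarrow> 'v \<Rightarrow> real"
  assumes nonempty: "V \<noteq> {}"
    and add_mem [simp]: "x \<in> V \<Longrightarrow> y \<in> V \<Longrightarrow> add x y \<in> V"
    and scl_mem [simp]: "x \<in> V \<Longrightarrow> scl c x \<in> V"
    and ip_add_left [simp]: "x \<in> V \<Longrightarrow> y \<in> V \<Longrightarrow> z \<in> V \<Longrightarrow> ip (add x y) z = ip x z + ip y z"
    and ip_scl_left [simp]: "x \<in> V \<Longrightarrow> z \<in> V \<Longrightarrow> ip (scl c x) z = c * ip x z"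
    and ip_commute: "x \<in> V \<Longrightarrow> y \<in> V \<Longrightarrow> ip x y = ip y x"
    and ip_nonneg [simp]: "x \<in> V \<Longrightarrow> 0 \<le> ip x x"
    and complete: "(\<And>n. s n \<in> V) \<Longrightarrow>
      (\<And>e. 0 < e \<Longrightarrow> \<exists>N. \<forall>m\<ge>N. \<forall>n\<ge>N. ip (add (s m) (scl (-1) (s n))) (add (s m) (scl (-1) (s n))) < e) \<Longrightarrow>
      \<exists>x\<in>V. (\<lambda>n::nat. ip (add (s n) (scl (-1) x)) (add (s n) (scl (-1) x))) \<longlonglongrightarrow> 0"
begin

lemma ip_add_right [simp]: "x \<in> V \<Longrightarrow> y \<in> V \<Longrightarrow> z \<in> V \<Longrightarrow> ip z (add x y) = ip z x + ip z y"
  using ip_add_left ip_commute add_mem by metis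

lemma ip_scl_right [simp]: "x \<in> V \<Longrightarrow> z \<in> V \<Longrightarrow> ip z (scl c x) = c * ip z x"
  using ip_scl_left ip_commute scl_mem by metis

definition sub :: "'v \<Rightarrow> 'v \<Rightarrow> 'v" where "sub x y = add x (scl (-1) y)"

lemma sub_mem [simp]: "x \<in> V \<Longrightarrow> y \<in> V \<Longrightarrow> sub x y \<in> V"
  by (simp add: sub_def)

lemma ip_sub_left [simp]: "x \<in> V \<Longrightarrow> y \<in> V \<Longrightarrow> z \<in> V \<Longrightarrow> ip (sub x y) z = ip x z - ip y z"
  by (simp add: sub_def)

lemma ip_sub_right [simp]: "x \<in> V \<Longrightarrow> y \<in> V \<Longrightarrow> z \<in> V \<Longrightarrow> ip z (sub x y) = ip z x - ip z y"
  by (simp add: sub_def)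

lemma ip_Cauchy_Schwarz:
  assumes [simp]: "x \<in> V" "y \<in> V"
  shows "(ip x y)\<^sup>2 \<le> ip x x * ip y y"
proof (rule quadratic_nonneg_imp_square_le)
  fix t
  have "0 \<le> ip (sub x (scl t y)) (sub x (scl t y))" by (rule ip_nonneg) simp
  then show "0 \<le> ip x x - 2 * t * ip x y + t\<^sup>2 * ip y y"
    by (simp add: ip_commute[of y x] power2_eq_square algebra_simps)
qed simp

definition dst :: "'v \<Rightarrow> 'v \<Rightarrow> real" where "dst x y = sqrt (ip (sub x y) (sub x y))"

lemma dst_nonneg [simp]: "x \<in> V \<Longrightarrow> y \<in> V \<Longrightarrow> 0 \<le> dst x y"
  unfolding dst_def by (intro real_sqrt_ge_zero ip_nonneg sub_mem)

lemma dst_sq: "x \<in> V \<Longrightarrow> y \<in> V \<Longrightarrow> (dst x y)\<^sup>2 = ip (sub x y) (sub x y)"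
  unfolding dst_def by (intro real_sqrt_pow2 ip_nonneg sub_mem)

lemma dst_commute: "x \<in> V \<Longrightarrow> y \<in> V \<Longrightarrow> dst x y = dst y x"
  by (simp add: dst_def ip_commute[of x y])

lemma dst_triangle:
  assumes [simp]: "x \<in> V" "y \<in> V" "z \<in> V"
  shows "dst x z \<le> dst x y + dst y z"
proof -
  have "\<bar>ip (sub x y) (sub y z)\<bar> \<le> dst x y * dst y z"
    using real_sqrt_le_mono[OF ip_Cauchy_Schwarz[of "sub x y" "sub y z"]]
    unfolding dst_def real_sqrt_mult by (simp del: ip_sub_left ip_sub_right)
  then have "(dst x z)\<^sup>2 \<le> (dst x y)\<^sup>2 + 2 * (dst x y * dst y z) + (dst y z)\<^sup>2"
    unfolding dst_sq[OF assms(1,2)] dst_sq[OF assms(2,3)] dst_sq[OF assms(1,3)]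
    by (simp add: ip_commute[of y x] ip_commute[of z x] ip_commute[of z y] algebra_simps)
  also have "\<dots> = (dst x y + dst y z)\<^sup>2" by (simp add: power2_sum)
  finally show ?thesis by (rule power2_le_imp_le) simp
qed

lemma dst_complete:
  assumes s: "\<And>n. s n \<in> V" and C: "\<And>e. 0 < e \<Longrightarrow> \<exists>N. \<forall>m\<ge>N. \<forall>n\<ge>N. dst (s m) (s n) < e"
  obtains x where "x \<in> V" "(\<lambda>n::nat. dst (s n) x) \<longlonglongrightarrow> 0"
proof -
  have "\<exists>N. \<forall>m\<ge>N. \<forall>n\<ge>N. ip (add (s m) (scl (-1) (s n))) (add (s m) (scl (-1) (s n))) < e" if "0 < e" for e
  proof -
    from C[of "sqrt e"] that obtain N where "\<forall>m\<ge>N. \<forall>n\<ge>N. dst (s m) (s n) < sqrt e" by auto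
    then show ?thesis unfolding dst_def sub_def real_sqrt_less_iff by blast
  qed
  from complete[OF s this] obtain x where x: "x \<in> V" "(\<lambda>n. ip (add (s n) (scl (-1) x)) (add (s n) (scl (-1) x))) \<longlonglongrightarrow> 0"
    by blast
  from tendsto_real_sqrt[OF x(2)] have "(\<lambda>n. dst (s n) x) \<longlonglongrightarrow> 0" by (simp only: dst_def sub_def real_sqrt_zero)
  with x(1) show thesis by (rule that)
qed

definition bounded_functional :: "('v \<Rightarrow> real) \<Rightarrow> bool" where
  "bounded_functional l \<longleftrightarrow> (\<forall>x\<in>V. \<forall>y\<in>V. l (add x y) = l x + l y) \<and> (\<forall>c. \<forall>x\<in>V. l (scl c x) = c * l x) \<and>
     (\<exists>C\<ge>0. \<forall>x\<in>V. (l x)\<^sup>2 \<le> C * ip x x)"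

text \<open>The representative minimises \<open>ip x x - 2 * l x\<close>. A minimising sequence is
  Cauchy by the parallelogram law, and vanishing of the first variation at its limit is the
  representation.\<close>

lemma Riesz_representation:
  assumes l: "bounded_functional l"
  obtains r where "r \<in> V" "\<And>w. w \<in> V \<Longrightarrow> ip r w = l w"
proof -
  from l obtain C where C: "0 \<le> C" "\<And>x. x \<in> V \<Longrightarrow> (l x)\<^sup>2 \<le> C * ip x x" unfolding bounded_functional_def by blast
  have ladd [simp]: "l (add x y) = l x + l y" if "x \<in> V" "y \<in> V" for x y using l that unfolding bounded_functional_def by blast
  have lscl [simp]: "l (scl c x) = c * l x" if "x \<in> V" for x c using l that unfolding bounded_functional_def by blast
  define I where "I x = ip x x - 2 * l x" for x
  have lower: "- C \<le> I x" if x: "x \<in> V" for x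
  proof -
    have "\<bar>l x\<bar> \<le> sqrt C * sqrt (ip x x)"
      using real_sqrt_le_mono[OF C(2)[OF x]] by (simp add: real_sqrt_mult)
    moreover have "0 \<le> (sqrt C - sqrt (ip x x))\<^sup>2" by simp
    then have "2 * (sqrt C * sqrt (ip x x)) \<le> C + ip x x" using C(1) x by (simp add: power2_diff mult.assoc)
    ultimately show ?thesis unfolding I_def by linarith
  qed
  define m where "m = Inf (I ` V)"
  have bdd: "bdd_below (I ` V)" using lower by (auto intro!: bdd_belowI[of _ "-C"])
  have m_le: "m \<le> I x" if "x \<in> V" for x unfolding m_def using bdd that by (rule cINF_lower)
  have "\<exists>x\<in>V. I x < m + 1 / (real n + 1)" for n
  proof -
    have "Inf (I ` V) < m + 1 / (real n + 1)" by (simp add: m_def)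
    then show ?thesis using nonempty bdd by (subst (asm) cInf_less_iff) auto
  qed
  then obtain s where s: "\<And>n. s n \<in> V" and sI: "\<And>n. I (s n) < m + 1 / (real n + 1)" by metis
  \<comment> \<open>The parallelogram law; the linear parts of \<open>I\<close> cancel at the
    midpoint.\<close>
  have sq: "ip (sub x y) (sub x y) = 2 * (I x + I y - 2 * I (scl (1/2) (add x y)))" if "x \<in> V" "y \<in> V" for x y
    using that by (simp add: I_def ip_commute[of y x] algebra_simps)
  have Cau: "\<exists>N. \<forall>m\<ge>N. \<forall>n\<ge>N. dst (s m) (s n) < e" if e: "0 < e" for e
  proof -
    obtain N :: nat where N: "1 / (real N + 1) < e\<^sup>2 / 4"
      using reals_Archimedean[of "e\<^sup>2/4"] e by (auto simp: inverse_eq_divide add.commute)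
    have "dst (s i) (s j) < e" if "i \<ge> N" "j \<ge> N" for i j
    proof -
      have "(dst (s i) (s j))\<^sup>2 = 2 * (I (s i) + I (s j) - 2 * I (scl (1/2) (add (s i) (s j))))" unfolding dst_sq[OF s s] by (rule sq) (rule s)+
      also have "\<dots> < 2 * (1 / (real i + 1) + 1 / (real j + 1))"
        using sI[of i] sI[of j] m_le[of "scl (1/2) (add (s i) (s j))"] s by simp
      also have "\<dots> \<le> 2 * (1 / (real N + 1) + 1 / (real N + 1))" using that by (intro mult_left_mono add_mono divide_left_mono) auto
      also have "\<dots> < e\<^sup>2" using N by simp
      finally show ?thesis by (rule power2_less_imp_less) (use e in simp)
    qed
    then show ?thesis by blast
  qed
  obtain r where r: "r \<in> V" "(\<lambda>n. dst (s n) r) \<longlonglongrightarrow> 0" by (rule dst_complete[OF s Cau])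
  have "ip r w = l w" if w: "w \<in> V" for w
  proof -
    have lim: "(\<lambda>n. ip (s n) w) \<longlonglongrightarrow> ip r w"
    proof (rule LIM_zero_cancel, rule Lim_null_comparison[OF always_eventually])
      show "\<forall>n. norm (ip (s n) w - ip r w) \<le> dst (s n) r * sqrt (ip w w)"
      proof
        fix n
        show "norm (ip (s n) w - ip r w) \<le> dst (s n) r * sqrt (ip w w)"
          using real_sqrt_le_mono[OF ip_Cauchy_Schwarz[of "sub (s n) r" w]] s r w
          by (simp add: real_sqrt_mult dst_def)
      qed
      show "(\<lambda>n. dst (s n) r * sqrt (ip w w)) \<longlonglongrightarrow> 0" using tendsto_mult_right[OF r(2), of "sqrt (ip w w)"] by simp
    qed
    \<comment> \<open>Perturbing \<open>s n\<close> in direction \<open>w\<close> cannot go below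
      the infimum. Passing to the limit only requires convergence of \<open>ip (s n) w\<close>, and
      a quadratic without constant term that is nonnegative has no linear term.\<close>
    have "0 \<le> 0 - 2 * t * (l w - ip r w) + t\<^sup>2 * ip w w" for t
    proof (rule LIMSEQ_le)
      show "(\<lambda>n. - (1 / (real n + 1))) \<longlonglongrightarrow> 0"
        using tendsto_minus[OF LIMSEQ_inverse_real_of_nat] by (simp add: inverse_eq_divide add.commute)
      show "(\<lambda>n. 0 - 2 * t * (l w - ip (s n) w) + t\<^sup>2 * ip w w) \<longlonglongrightarrow> 0 - 2 * t * (l w - ip r w) + t\<^sup>2 * ip w w"
        by (intro tendsto_intros lim)
      have "- (1 / (real n + 1)) \<le> 0 - 2 * t * (l w - ip (s n) w) + t\<^sup>2 * ip w w" for n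
        using sI[of n] m_le[of "add (s n) (scl t w)"] s[of n] w
        by (simp add: I_def ip_commute[of w "s n"] power2_eq_square algebra_simps)
      then show "\<exists>N. \<forall>n\<ge>N. - (1 / (real n + 1)) \<le> 0 - 2 * t * (l w - ip (s n) w) + t\<^sup>2 * ip w w" by blast
    qed
    then have "(l w - ip r w)\<^sup>2 \<le> 0 * ip w w" by (rule quadratic_nonneg_imp_square_le) (use w in simp)
    then show ?thesis by simp
  qed
  with r(1) show thesis by (rule that)
qed

text \<open>With \<open>R u\<close> representing the residual \<open>b u w - l w\<close>, the map
  \<open>u - \<rho> * R u\<close> is a strict contraction; its fixed point has vanishing
  residual.\<close>

theorem Lax_Milgram:
  assumes b1: "\<And>x y z. x \<in> V \<Longrightarrow> y \<in> V \<Longrightarrow> z \<in> V \<Longrightarrow> b (add x y) z = b x z + b y z"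
    and b2: "\<And>x z c. x \<in> V \<Longrightarrow> z \<in> V \<Longrightarrow> b (scl c x) z = c * b x z"
    and b3: "\<And>x y z. x \<in> V \<Longrightarrow> y \<in> V \<Longrightarrow> z \<in> V \<Longrightarrow> b z (add x y) = b z x + b z y"
    and b4: "\<And>x z c. x \<in> V \<Longrightarrow> z \<in> V \<Longrightarrow> b z (scl c x) = c * b z x"
    and bM: "\<And>x y. x \<in> V \<Longrightarrow> y \<in> V \<Longrightarrow> (b x y)\<^sup>2 \<le> M * ip x x * ip y y"
    and \<beta>: "0 < \<beta>" "\<And>x. x \<in> V \<Longrightarrow> \<beta> * ip x x \<le> b x x"
    and l: "bounded_functional l"
  obtains u where "u \<in> V" "\<And>w. w \<in> V \<Longrightarrow> b u w = l w"
proof -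
  \<comment> \<open>The bound is enlarged to be positive and above \<open>\<beta>\<close> squared,
    so that the contraction factor below is the root of a number strictly between 0 and 1.\<close>
  define M' where "M' = \<bar>M\<bar> + \<beta>\<^sup>2 + 1"
  have M': "0 < M'" "\<beta>\<^sup>2 < M'" by (auto simp: M'_def intro: add_nonneg_pos)
  have bM': "(b x y)\<^sup>2 \<le> M' * ip x x * ip y y" if "x \<in> V" "y \<in> V" for x y
  proof -
    have "M * (ip x x * ip y y) \<le> M' * (ip x x * ip y y)"
    proof (rule mult_right_mono)
      show "M \<le> M'" unfolding M'_def using abs_ge_self[of M] zero_le_power2[of \<beta>] by linarith
    qed (use that in simp)
    then show ?thesis using bM[OF that] by (simp add: mult.assoc)
  qed
  have bl: "bounded_functional (\<lambda>w. b u w - l w)" if u: "u \<in> V" for u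
  proof -
    from l obtain C where C: "0 \<le> C" "\<And>x. x \<in> V \<Longrightarrow> (l x)\<^sup>2 \<le> C * ip x x" unfolding bounded_functional_def by blast
    have "(b u w - l w)\<^sup>2 \<le> (2 * M' * ip u u + 2 * C) * ip w w" if "w \<in> V" for w
    proof -
      have "(b u w - l w)\<^sup>2 \<le> 2 * (b u w)\<^sup>2 + 2 * (l w)\<^sup>2" using sq_norm_diff_le[of "b u w" "l w"] by simp
      then show ?thesis using bM'[OF u that] C(2)[OF that] by (simp add: algebra_simps)
    qed
    moreover have "0 \<le> 2 * M' * ip u u + 2 * C" using M' C u by simp
    ultimately show ?thesis using l u unfolding bounded_functional_def
      by (auto simp: b3 b4 algebra_simps intro!: exI[of _ "2 * M' * ip u u + 2 * C"])
  qed
  have "\<exists>r. \<forall>u\<in>V. r u \<in> V \<and> (\<forall>w\<in>V. ip (r u) w = b u w - l w)"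
  proof (rule bchoice, rule ballI)
    fix u assume "u \<in> V"
    obtain r where "r \<in> V" "\<And>w. w \<in> V \<Longrightarrow> ip r w = b u w - l w"
      using Riesz_representation[OF bl[OF \<open>u \<in> V\<close>]] by metis
    then show "\<exists>r. r \<in> V \<and> (\<forall>w\<in>V. ip r w = b u w - l w)" by blast
  qed
  then obtain R where R [simp]: "\<And>u. u \<in> V \<Longrightarrow> R u \<in> V" and ipR: "\<And>u w. u \<in> V \<Longrightarrow> w \<in> V \<Longrightarrow> ip (R u) w = b u w - l w"
    by blast
  \<comment> \<open>The minimiser of \<open>1 - 2 * \<rho> * \<beta> + \<rho>^2 * M'\<close>, the
    bound for the squared contraction factor.\<close>
  define \<rho> where "\<rho> = \<beta> / M'"
  define f where "f u = sub u (scl \<rho> (R u))" for u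
  define k where "k = sqrt (1 - \<beta>\<^sup>2 / M')"
  have k: "0 \<le> k" "k < 1" using M' \<beta>(1) by (auto simp: k_def)
  have fV [simp]: "f u \<in> V" if "u \<in> V" for u using that by (simp add: f_def)
  have contr: "dst (f x) (f y) \<le> k * dst x y" if [simp]: "x \<in> V" "y \<in> V" for x y
  proof -
    define d where "d = sub x y"
    define e where "e = sub (R x) (R y)"
    have [simp]: "d \<in> V" "e \<in> V" by (auto simp: d_def e_def)
    \<comment> \<open>The functional \<open>l\<close> cancels in the difference of two
      residuals.\<close>
    have ie: "ip e w = b d w" if "w \<in> V" for w
      using that b1[of x "scl (-1) y" w] b2[of y w "-1"] by (simp add: e_def d_def sub_def ipR)
    have "(ip e e)\<^sup>2 \<le> M' * ip d d * ip e e" using bM'[of d e] by (simp add: ie)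
    then have ee: "ip e e \<le> M' * ip d d"
      by (cases "ip e e = 0") (use M' ip_nonneg[of e] ip_nonneg[of d] in \<open>auto simp: power2_eq_square simp del: ip_nonneg\<close>)
    have "(dst (f x) (f y))\<^sup>2 = ip d d - 2 * \<rho> * ip e d + \<rho>\<^sup>2 * ip e e"
      unfolding dst_sq[OF fV[OF that(1)] fV[OF that(2)]] d_def e_def
      by (simp add: f_def ip_commute[of y x] ip_commute[of x "R x"] ip_commute[of x "R y"] ip_commute[of y "R x"] ip_commute[of y "R y"]
           ip_commute[of "R y" "R x"] power2_eq_square algebra_simps)
    also have "\<dots> \<le> ip d d - 2 * \<rho> * (\<beta> * ip d d) + \<rho>\<^sup>2 * (M' * ip d d)"
      using ee \<beta>(2)[of d] ie[of d] M' \<beta>(1) by (intro add_mono diff_mono mult_left_mono) (auto simp: \<rho>_def)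
    also have "\<dots> = (1 - \<beta>\<^sup>2 / M') * ip d d"
      using M' by (simp add: \<rho>_def power2_eq_square field_simps)
    also have "\<dots> = (k * dst x y)\<^sup>2" using M' by (simp add: k_def power_mult_distrib dst_sq d_def less_imp_le)
    finally show ?thesis by (rule power2_le_imp_le) (use k in simp)
  qed
  obtain u0 where [simp]: "u0 \<in> V" using nonempty by blast
  define s where "s n = (f ^^ n) u0" for n
  have s [simp]: "s n \<in> V" for n by (induction n) (auto simp: s_def)
  have sS: "s (Suc n) = f (s n)" for n by (simp add: s_def)
  \<comment> \<open>The sum of the geometric series of step lengths; it is the solution of
    \<open>k * B + dst (s 1) (s 0) = B\<close>.\<close>
  define B where "B = dst (s 1) (s 0) / (1 - k)"
  have B: "dst (s j) (s 0) \<le> B" for j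
  proof (induction j)
    case 0
    have "dst (s 0) (s 0) = 0" by (simp add: dst_def)
    moreover have "0 \<le> B" unfolding B_def using k dst_nonneg[OF s s] by (intro divide_nonneg_nonneg) auto
    ultimately show ?case by simp
  next
    case (Suc j)
    have "dst (s (Suc j)) (s 0) \<le> dst (s (Suc j)) (s 1) + dst (s 1) (s 0)" by (rule dst_triangle) simp_all
    also have "dst (s (Suc j)) (s 1) \<le> k * dst (s j) (s 0)" using contr[of "s j" "s 0"] by (simp add: sS)
    also have "\<dots> \<le> k * B" using Suc k by (intro mult_left_mono)
    also have "k * B + dst (s 1) (s 0) = B" using k by (simp add: B_def field_simps)
    finally show ?case by simp
  qed
  have step: "dst (s (n + j)) (s n) \<le> k ^ n * B" for n j
  proof (induction n)
    case 0 show ?case using B by simp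
  next
    case (Suc n)
    have "dst (s (Suc n + j)) (s (Suc n)) \<le> k * dst (s (n + j)) (s n)" using contr[of "s (n+j)" "s n"] by (simp add: sS)
    also have "\<dots> \<le> k * (k ^ n * B)" using Suc k by (intro mult_left_mono)
    finally show ?case by simp
  qed
  have Cau: "\<exists>N. \<forall>m\<ge>N. \<forall>n\<ge>N. dst (s m) (s n) < e" if e: "0 < e" for e
  proof -
    have "(\<lambda>n. k ^ n * B) \<longlonglongrightarrow> 0 * B" using k by (intro tendsto_intros LIMSEQ_power_zero) auto
    from LIMSEQ_D[OF this, of "e/2"] e obtain N where N: "\<bar>k ^ N * B\<bar> < e/2" by auto
    have "dst (s m) (s n) < e" if "m \<ge> N" "n \<ge> N" for m n
    proof -
      have 1: "dst (s i) (s N) < e/2" if "i \<ge> N" for i using step[of N "i - N"] N that by auto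
      have "dst (s m) (s n) \<le> dst (s m) (s N) + dst (s N) (s n)" by (rule dst_triangle) simp_all
      also have "dst (s N) (s n) = dst (s n) (s N)" by (rule dst_commute) simp_all
      finally show ?thesis using 1[OF that(1)] 1[OF that(2)] by simp
    qed
    then show ?thesis by blast
  qed
  obtain u where u: "u \<in> V" "(\<lambda>n. dst (s n) u) \<longlonglongrightarrow> 0" by (rule dst_complete[OF s Cau])
  have "dst (f u) u \<le> 0"
  proof (rule LIMSEQ_le_const)
    show "(\<lambda>n. k * dst (s n) u + dst (s (Suc n)) u) \<longlonglongrightarrow> 0"
      using tendsto_add[OF tendsto_mult_left[OF u(2), of k] LIMSEQ_Suc[OF u(2)]] by simp
    have "dst (f u) u \<le> k * dst (s n) u + dst (s (Suc n)) u" for n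
      using dst_triangle[of "f u" "f (s n)" u] contr[of "s n" u] u dst_commute[of "f u" "f (s n)"] by (simp add: sS)
    then show "\<exists>N. \<forall>n\<ge>N. dst (f u) u \<le> k * dst (s n) u + dst (s (Suc n)) u" by blast
  qed
  \<comment> \<open>The fixed point equation holds only up to a null vector. This is enough: it
    makes \<open>R u\<close> a null vector, and Cauchy-Schwarz then annihilates the
    residual.\<close>
  then have "dst (f u) u = 0" using u by (simp add: order_antisym)
  then have "ip (sub (f u) u) (sub (f u) u) = 0" using dst_sq[of "f u" u] u by simp
  then have "\<rho>\<^sup>2 * ip (R u) (R u) = 0" using u by (simp add: f_def ip_commute[of u "R u"] power2_eq_square algebra_simps)
  then have Ru: "ip (R u) (R u) = 0" using \<beta>(1) M' by (simp add: \<rho>_def)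
  have "b u w = l w" if "w \<in> V" for w
    using ip_Cauchy_Schwarz[of "R u" w] Ru u that by (simp add: ipR)
  with u(1) show thesis by (rule that)
qed

end

subsection \<open>Smooth bump functions\<close>

text \<open>The classical flat function \<open>exp (-1/x)\<close> together with all polynomial
  multiples in \<open>1 / x\<close>: a family closed under differentiation.\<close>

definition flat :: "real poly \<Rightarrow> real \<Rightarrow> real" where
  "flat p x = (if 0 < x then poly p (1 / x) * exp (- (1 / x)) else 0)"

text \<open>The factor \<open>[:0, 0, 1:]\<close> is the inner derivative \<open>1 / x^2\<close>,
  its sign being absorbed in \<open>p - pderiv p\<close>.\<close>

definition flat_deriv :: "real poly \<Rightarrow> real poly" where
  "flat_deriv p = [:0, 0, 1:] * (p - pderiv p)"

lemma tendsto_poly_exp_0: "((\<lambda>y. poly p y * exp (- y)) \<longlongrightarrow> (0::real)) at_top"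
proof -
  have "((\<lambda>y. \<Sum>i\<le>degree p. coeff p i * (y ^ i / exp y)) \<longlongrightarrow> (\<Sum>i\<le>degree p. coeff p i * 0)) at_top"
    by (intro tendsto_sum tendsto_mult_left tendsto_power_div_exp_0)
  then show ?thesis by (simp add: poly_altdef exp_minus divide_inverse sum_distrib_right mult.assoc)
qed

lemma flat_tendsto_0: "(flat p \<longlongrightarrow> 0) (at_right 0)"
proof -
  have "((\<lambda>h. poly p (inverse h) * exp (- inverse h)) \<longlongrightarrow> 0) (at_right 0)"
    by (rule filterlim_compose[OF tendsto_poly_exp_0 filterlim_inverse_at_top_right])
  then show ?thesis
    by (rule Lim_transform_eventually) (auto simp: flat_def inverse_eq_divide eventually_at_filter)
qed

lemma DERIV_flat: "(flat p has_real_derivative flat (flat_deriv p) x) (at x)"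
proof (cases x "0::real" rule: linorder_cases)
  case less
  have "((\<lambda>x. 0) has_real_derivative 0) (at x)" by simp
  then have "(flat p has_real_derivative 0) (at x)"
    by (rule has_field_derivative_transform_within_open[where S="{..<0}"]) (use less in \<open>auto simp: flat_def\<close>)
  then show ?thesis using less by (simp add: flat_def)
next
  case equal
  have "((\<lambda>h. (flat p (0 + h) - flat p 0) / h) \<longlongrightarrow> 0) (at 0)"
  proof (rule filterlim_split_at)
    show "((\<lambda>h. (flat p (0 + h) - flat p 0) / h) \<longlongrightarrow> 0) (at_left 0)"
      by (rule tendsto_eventually) (auto simp: flat_def eventually_at_filter)
    \<comment> \<open>To the right of 0, dividing by \<open>h\<close> only multiplies the polynomial
      by its variable, so the quotient is again flat.\<close>
    show "((\<lambda>h. (flat p (0 + h) - flat p 0) / h) \<longlongrightarrow> 0) (at_right 0)"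
      by (rule Lim_transform_eventually[OF flat_tendsto_0[of "[:0, 1:] * p"]])
         (auto simp: flat_def eventually_at_filter)
  qed
  then show ?thesis unfolding DERIV_def equal by (simp add: flat_def)
next
  case greater
  have "((\<lambda>x. poly p (1 / x) * exp (- (1 / x))) has_real_derivative flat (flat_deriv p) x) (at x)"
    using greater
    by (auto intro!: derivative_eq_intros poly_DERIV[THEN DERIV_chain2] simp: flat_def flat_deriv_def field_simps power2_eq_square)
  then show ?thesis
    by (rule has_field_derivative_transform_within_open[where S="{0<..}"]) (use greater in \<open>auto simp: flat_def\<close>)
qed

lemma Ck_on_const: "Ck_on k (\<lambda>x. c) UNIV"
proof (induction k arbitrary: c)
  case (Suc k)
  have "frechet_derivative (\<lambda>x::'a. c) (at x) = (\<lambda>h. 0)" for x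
    using frechet_derivative_at[OF has_derivative_const, of x c] by simp
  then show ?case using Suc by simp
qed simp

text \<open>The induction must range over all polynomials, since a partial derivative is the same
  kind of function with the polynomial \<open>flat_deriv p\<close> scaled by a direction
  component.\<close>

lemma Ck_on_flat_affine: "Ck_on k (\<lambda>x. flat p (x \<bullet> e + c)) UNIV"
proof (induction k arbitrary: p)
  case 0
  have "continuous_on UNIV (flat p)"
    using DERIV_flat[of p] by (intro continuous_at_imp_continuous_on ballI DERIV_isCont) blast
  then show ?case by (auto intro!: continuous_intros continuous_on_compose2[of UNIV "flat p"])
next
  case (Suc k)
  have d: "((\<lambda>x. flat p (x \<bullet> e + c)) has_derivative (\<lambda>h. flat (flat_deriv p) (x \<bullet> e + c) * (h \<bullet> e))) (at x)" for x
    by (rule has_derivative_eq_rhs[OF has_derivative_compose[OF _ DERIV_flat[of p, unfolded has_field_derivative_def], where f="\<lambda>x. x \<bullet> e + c"]])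
       (auto intro!: derivative_eq_intros)
  have "frechet_derivative (\<lambda>x. flat p (x \<bullet> e + c)) (at x) b = flat (smult (b \<bullet> e) (flat_deriv p)) (x \<bullet> e + c)" for x b
    unfolding frechet_derivative_at[OF d, symmetric] by (simp add: flat_def)
  moreover have "(\<lambda>x. flat p (x \<bullet> e + c)) differentiable (at x)" for x
    using d unfolding differentiable_def by blast
  ultimately show ?case using Suc by simp
qed

lemma Ck_on_SucD: "Ck_on (Suc k) f UNIV \<Longrightarrow> Ck_on k f UNIV"
proof (induction k arbitrary: f)
  case 0
  then show ?case by (auto intro!: continuous_at_imp_continuous_on differentiable_imp_continuous_within)
qed auto

lemma Ck_on_add:
  "Ck_on k f UNIV \<Longrightarrow> Ck_on k g UNIV \<Longrightarrow> Ck_on k (\<lambda>x. f x + g x) UNIV"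
proof (induction k arbitrary: f g)
  case 0 then show ?case by (auto intro: continuous_intros)
next
  case (Suc k)
  have "frechet_derivative (\<lambda>x. f x + g x) (at x) b = frechet_derivative f (at x) b + frechet_derivative g (at x) b" for x b
    using Suc.prems by (intro fun_cong[OF frechet_derivative_at[symmetric], THEN trans] has_derivative_add)
      (auto simp: frechet_derivative_works[symmetric])
  then show ?case using Suc by auto
qed

lemma Ck_on_mult:
  "Ck_on k f UNIV \<Longrightarrow> Ck_on k g UNIV \<Longrightarrow> Ck_on k (\<lambda>x. f x * g x) UNIV"
proof (induction k arbitrary: f g)
  case 0 then show ?case by (auto intro: continuous_intros)
next
  case (Suc k)
  have "frechet_derivative (\<lambda>x. f x * g x) (at x) b = f x * frechet_derivative g (at x) b + frechet_derivative f (at x) b * g x" for x b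
    using Suc.prems by (intro fun_cong[OF frechet_derivative_at[symmetric], THEN trans] has_derivative_mult)
      (auto simp: frechet_derivative_works[symmetric])
  moreover have "Ck_on k f UNIV" "Ck_on k g UNIV" using Suc.prems by (auto intro: Ck_on_SucD)
  ultimately show ?case using Suc by (auto intro!: Ck_on_add Suc.IH)
qed

lemma Ck_on_prod:
  assumes "finite I" "\<And>i. i \<in> I \<Longrightarrow> Ck_on k (f i) UNIV"
  shows "Ck_on k (\<lambda>x. \<Prod>i\<in>I. f i x) UNIV"
  using assms by (induction I rule: finite_induct) (auto intro: Ck_on_const Ck_on_mult)

text \<open>As \<open>n\<close> grows, these functions increase to the indicator function of \<open>box a b\<close>.\<close>

definition box_bump :: "'a::euclidean_space \<Rightarrow> 'a \<Rightarrow> nat \<Rightarrow> 'a \<Rightarrow> real" where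
  "box_bump a b n x = (\<Prod>i\<in>Basis. flat 1 (real (Suc n) * (x \<bullet> i - a \<bullet> i)) * flat 1 (real (Suc n) * (b \<bullet> i - x \<bullet> i)))"

lemma flat_1_bounds: "0 \<le> flat 1 x" "flat 1 x \<le> 1"
  by (auto simp: flat_def)

lemma box_bump_bounds: "0 \<le> box_bump a b n x" "box_bump a b n x \<le> 1"
  unfolding box_bump_def by (auto intro!: prod_nonneg prod_le_1 mult_le_one flat_1_bounds mult_nonneg_nonneg)

lemma flat_nonpos: "x \<le> 0 \<Longrightarrow> flat p x = 0"
  by (simp add: flat_def)

lemma box_bump_outside: assumes "x \<notin> box a b" shows "box_bump a b n x = 0"
proof -
  obtain i where i: "i \<in> Basis" "x \<bullet> i \<le> a \<bullet> i \<or> b \<bullet> i \<le> x \<bullet> i"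
    using assms by (auto simp: mem_box not_less)
  then have "real (Suc n) * (x \<bullet> i - a \<bullet> i) \<le> 0 \<or> real (Suc n) * (b \<bullet> i - x \<bullet> i) \<le> 0"
    by (auto intro!: mult_nonneg_nonpos simp del: of_nat_Suc)
  then have "flat 1 (real (Suc n) * (x \<bullet> i - a \<bullet> i)) * flat 1 (real (Suc n) * (b \<bullet> i - x \<bullet> i)) = 0"
    using flat_nonpos by auto
  with i(1) show ?thesis unfolding box_bump_def by (intro prod_zero) auto
qed

lemma box_bump_tendsto: "(\<lambda>n. box_bump a b n x) \<longlonglongrightarrow> indicator (box a b) x"
proof (cases "x \<in> box a b")
  case True
  have *: "(\<lambda>n. flat 1 (real (Suc n) * c)) \<longlonglongrightarrow> 1" if c: "0 < c" for c
  proof -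
    have "(\<lambda>n. exp (- (1 / c * inverse (real (Suc n))))) \<longlonglongrightarrow> exp (- (1 / c * 0))"
      by (intro tendsto_intros LIMSEQ_inverse_real_of_nat)
    moreover have "flat 1 (real (Suc n) * c) = exp (- (1 / c * inverse (real (Suc n))))" for n
      using c by (simp add: flat_def divide_simps del: of_nat_Suc)
    ultimately show ?thesis by simp
  qed
  have "(\<lambda>n. box_bump a b n x) \<longlonglongrightarrow> (\<Prod>i\<in>(Basis::'a set). 1 * 1)"
    unfolding box_bump_def by (intro tendsto_prod tendsto_mult *) (use True in \<open>auto simp: mem_box\<close>)
  then show ?thesis using True by simp
qed (simp add: box_bump_outside)

lemma test_fun_box_bump:
  assumes "cbox a b \<subseteq> \<Omega>" shows "test_fun \<Omega> (box_bump a b n)"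
  unfolding test_fun_def
proof (intro conjI exI[of _ "cbox a b"] allI impI)
  have "Ck_on k (\<lambda>x. flat 1 (real (Suc n) * (x \<bullet> i - a \<bullet> i))) UNIV" for k i
    using Ck_on_flat_affine[of k 1 "real (Suc n) *\<^sub>R i" "- (real (Suc n) * (a \<bullet> i))"]
    by (simp add: right_diff_distrib del: of_nat_Suc)
  moreover have "Ck_on k (\<lambda>x. flat 1 (real (Suc n) * (b \<bullet> i - x \<bullet> i))) UNIV" for k i
    using Ck_on_flat_affine[of k 1 "- real (Suc n) *\<^sub>R i" "real (Suc n) * (b \<bullet> i)"]
    by (simp add: right_diff_distrib del: of_nat_Suc)
  ultimately show "smooth_on (box_bump a b n) UNIV"
    unfolding smooth_on_def box_bump_def[abs_def] by (intro allI Ck_on_prod Ck_on_mult) auto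
  show "box_bump a b n x = 0" if "x \<notin> cbox a b" for x
    using that box_subset_cbox by (intro box_bump_outside) blast
qed (use assms in auto)

subsection \<open>The fundamental lemma of the calculus of variations\<close>

text \<open>The positive and negative parts of \<open>g\<close> are densities of finite measures
  that agree on boxes, an intersection-stable generator of the Borel sets; so the measures, and then
  the densities, coincide.\<close>

lemma AE_zero_if_box_integrals_zero:
  fixes g :: "'a::euclidean_space \<Rightarrow> real"
  assumes g: "integrable lborel g" and z: "\<And>a b. (\<integral>x. indicator (box a b) x * g x \<partial>lborel) = 0"
  shows "AE x in lborel. g x = 0"
proof -
  have [measurable]: "g \<in> borel_measurable borel" using g by auto
  have fin: "(\<integral>\<^sup>+x. ennreal (g x) \<partial>lborel) < \<infinity>" "(\<integral>\<^sup>+x. ennreal (- g x) \<partial>lborel) < \<infinity>"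
    using g by (auto simp: real_integrable_def less_top)
  have eq: "emeasure (density lborel (\<lambda>x. ennreal (g x))) X = emeasure (density lborel (\<lambda>x. ennreal (- g x))) X"
    if Xr: "X \<in> range (\<lambda>(a, b). box a b)" for X
  proof -
    obtain a b where X: "X = box a b" using Xr by auto
    let ?i = "indicator (box a b) :: 'a \<Rightarrow> real"
    have i: "integrable lborel (\<lambda>x. ?i x * g x)" using integrable_mult_indicator[OF _ g, of "box a b"] by simp
    have e: "enn2real (\<integral>\<^sup>+x. ennreal (?i x * g x) \<partial>lborel) = enn2real (\<integral>\<^sup>+x. ennreal (- (?i x * g x)) \<partial>lborel)"
      using real_lebesgue_integral_def[OF i] z[of a b] by simp
    have ne: "(\<integral>\<^sup>+x. ennreal (?i x * g x) \<partial>lborel) \<noteq> \<infinity>" "(\<integral>\<^sup>+x. ennreal (- (?i x * g x)) \<partial>lborel) \<noteq> \<infinity>"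
      using i by (auto simp: real_integrable_def)
    have "(\<integral>\<^sup>+x. ennreal (?i x * g x) \<partial>lborel) = (\<integral>\<^sup>+x. ennreal (- (?i x * g x)) \<partial>lborel)"
    proof -
      have *: "A = B" if "enn2real A = enn2real B" "A \<noteq> \<infinity>" "B \<noteq> \<infinity>" for A B :: ennreal
        using that by (cases A; cases B) auto
      show ?thesis by (rule *[OF e ne])
    qed
    moreover have "(\<integral>\<^sup>+x. ennreal (?i x * g x) \<partial>lborel) = (\<integral>\<^sup>+x. ennreal (g x) * indicator X x \<partial>lborel)"
      "(\<integral>\<^sup>+x. ennreal (- (?i x * g x)) \<partial>lborel) = (\<integral>\<^sup>+x. ennreal (- g x) * indicator X x \<partial>lborel)"
      unfolding X by (intro nn_integral_cong; auto simp: indicator_def)+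
    ultimately show ?thesis unfolding X by (subst (1 2) emeasure_density) auto
  qed
  have "density lborel (\<lambda>x. ennreal (g x)) = density lborel (\<lambda>x. ennreal (- g x))"
  proof (rule measure_eqI_generator_eq)
    let ?E = "range (\<lambda>(a, b). box a b::'a set)"
    show "Int_stable ?E" by (auto simp: Int_stable_def box_Int_box)
    show "?E \<subseteq> Pow UNIV" "sets (density lborel (\<lambda>x. ennreal (g x))) = sigma_sets UNIV ?E" "sets (density lborel (\<lambda>x. ennreal (- g x))) = sigma_sets UNIV ?E"
      by (simp_all add: borel_eq_box)
    let ?A = "\<lambda>n::nat. box (- (real n *\<^sub>R One)) (real n *\<^sub>R One) :: 'a set"
    show "range ?A \<subseteq> ?E" "(\<Union>i. ?A i) = UNIV" unfolding UN_box_eq_UNIV by auto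
    fix i
    have "emeasure (density lborel (\<lambda>x. ennreal (g x))) (?A i) \<le> (\<integral>\<^sup>+x. ennreal (g x) \<partial>lborel)"
      by (subst emeasure_density) (auto intro!: nn_integral_mono simp: indicator_def)
    then show "emeasure (density lborel (\<lambda>x. ennreal (g x))) (?A i) \<noteq> \<infinity>" using fin(1) by auto
  qed (fact eq)
  \<comment> \<open>Positive and negative part agree, and at most one of them is nonzero.\<close>
  then have "AE x in lborel. ennreal (g x) = ennreal (- g x)"
    using fin by (subst (asm) finite_density_unique) auto
  then show ?thesis
  proof eventually_elim
    case (elim x)
    have *: "y = 0" if y: "ennreal y = ennreal (- y)" for y :: real
    proof (cases "0 \<le> y")
      case True
      then have "ennreal y = 0" using y by (simp add: ennreal_neg)
      then show ?thesis using True by (simp add: ennreal_eq_0_iff)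
    next
      case False
      then have "ennreal (- y) = 0" using y by (simp add: ennreal_neg)
      then show ?thesis using False by (simp add: ennreal_eq_0_iff)
    qed
    from *[OF elim] show ?case .
  qed
qed

lemma L2_iff_sq_int: "S \<in> sets lebesgue \<Longrightarrow> L2 S f \<longleftrightarrow> sq_int (lebesgue_on S) f"
  by (auto simp: L2_def L2_sq_def sq_int_iff_nn_integral nn_integral_restrict_space)

lemma L2_sq_eq_nn_integral: "S \<in> sets lebesgue \<Longrightarrow> L2_sq S f = (\<integral>\<^sup>+x. ennreal ((norm (f x))\<^sup>2) \<partial>lebesgue_on S)"
  by (simp add: L2_sq_def nn_integral_restrict_space)

lemma L2_sq_eq_integral: "S \<in> sets lebesgue \<Longrightarrow> L2 S f \<Longrightarrow> L2_sq S f = ennreal (\<integral>x. (norm (f x))\<^sup>2 \<partial>lebesgue_on S)"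
  by (simp add: L2_sq_eq_nn_integral L2_iff_sq_int sq_int_nn_integral_eq)

lemma set_lebesgue_integral_eq_integral_on:
  "S \<in> sets lebesgue \<Longrightarrow> (LINT x:S|lebesgue. f x) = (\<integral>x. f x \<partial>lebesgue_on S)" for f :: "'a::euclidean_space \<Rightarrow> real"
  by (simp add: set_lebesgue_integral_def integral_restrict_space)

text \<open>Bumps inside a box with closure in the domain converge to the indicator of the box and
  are dominated by it, so all box integrals vanish; countably many closed boxes cover the
  domain.\<close>

lemma fundamental_lemma:
  fixes G :: "'a::euclidean_space \<Rightarrow> real"
  assumes \<Omega>: "open \<Omega>" and G: "sq_int (lebesgue_on \<Omega>) G"
    and z: "\<And>\<psi>. test_fun \<Omega> \<psi> \<Longrightarrow> (\<integral>x. G x * \<psi> x \<partial>lebesgue_on \<Omega>) = 0"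
  shows "AE x in lebesgue_on \<Omega>. G x = 0"
proof -
  have [simp, measurable]: "\<Omega> \<in> sets lebesgue" using \<Omega> by (simp add: lmeasurable_open borel_open)
  define H where "H x = indicator \<Omega> x * G x" for x
  have [measurable]: "H \<in> borel_measurable lebesgue"
    using G borel_measurable_restrict_space_iff[of \<Omega> lebesgue G] by (simp add: H_def[abs_def] sq_int_def)
  have H2: "(\<lambda>x. (H x)\<^sup>2) = (\<lambda>x. indicator \<Omega> x *\<^sub>R (G x)\<^sup>2)" by (auto simp: H_def indicator_def)
  have sH: "sq_int lebesgue H"
    using sq_int_integrable[OF G] integrable_restrict_space[of \<Omega> lebesgue "\<lambda>x. (G x)\<^sup>2"]
    by (simp add: sq_int_real_iff H2)
  have si: "sq_int lebesgue (indicator (box a b) :: 'a \<Rightarrow> real)" for a b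
  proof -
    have "(\<lambda>x. (indicator (box a b) x :: real)\<^sup>2) = indicator (box a b)" by (auto simp: indicator_def)
    moreover have "box a b \<in> sets lebesgue" by (rule fmeasurableD) simp
    ultimately show ?thesis using integrable_real_indicator[of "box a b" lebesgue] emeasure_lborel_box_finite[of a b]
      by (auto simp: sq_int_real_iff less_top intro: borel_measurable_indicator)
  qed
  have iH: "integrable lebesgue (\<lambda>x. indicator (box a b) x * H x)" for a b
    by (rule integrable_mult_sq_int[OF si sH])
  have box0: "(\<integral>x. indicator (box a b) x * H x \<partial>lebesgue) = 0" if ab: "cbox a b \<subseteq> \<Omega>" for a b
  proof (rule LIMSEQ_unique)
    have "(\<integral>x. box_bump a b n x * H x \<partial>lebesgue) = 0" for n
      using z[OF test_fun_box_bump[OF ab, of n]] by (simp add: integral_restrict_space H_def mult_ac)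
    then show "(\<lambda>n. \<integral>x. box_bump a b n x * H x \<partial>lebesgue) \<longlonglongrightarrow> 0" by simp
    show "(\<lambda>n. \<integral>x. box_bump a b n x * H x \<partial>lebesgue) \<longlonglongrightarrow> (\<integral>x. indicator (box a b) x * H x \<partial>lebesgue)"
    proof (rule integral_dominated_convergence)
      show "integrable lebesgue (\<lambda>x. norm (indicator (box a b) x * H x))" using iH by (rule integrable_norm)
      show "AE x in lebesgue. (\<lambda>n. box_bump a b n x * H x) \<longlonglongrightarrow> indicator (box a b) x * H x"
        by (intro AE_I2 tendsto_mult_right box_bump_tendsto)
      show "AE x in lebesgue. norm (box_bump a b n x * H x) \<le> norm (indicator (box a b) x * H x)" for n
      proof (rule AE_I2)
        fix x show "norm (box_bump a b n x * H x) \<le> norm (indicator (box a b) x * H x)"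
          using box_bump_bounds[of a b n x] box_bump_outside[of x a b n]
          by (cases "x \<in> box a b") (auto simp: abs_mult mult_left_le_one_le)
      qed
      have "continuous_on UNIV (box_bump a b n)" for n
        using test_fun_box_bump[of a b UNIV n] unfolding test_fun_def smooth_on_def by (auto dest: spec[of _ 0])
      then have "box_bump a b n \<in> borel_measurable lebesgue" for n
        by (intro measurable_completion) (simp add: borel_measurable_continuous_onI)
      then show "(\<lambda>x. box_bump a b n x * H x) \<in> borel_measurable lebesgue" for n by measurable
    qed (use iH in auto)
  qed
  have AEbox: "AE x in lebesgue. x \<in> cbox a b \<longrightarrow> H x = 0" if ab: "cbox a b \<subseteq> \<Omega>" for a b
  proof -
    \<comment> \<open>The uniqueness result for box integrals concerns Borel measure, hence a Borel
      version of the function cut off to one box.\<close>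
    obtain g where g [measurable]: "g \<in> borel_measurable lborel" and ae: "AE x in lborel. indicator (box a b) x * H x = g x"
      using completion_ex_borel_measurable_real[OF borel_measurable_integrable[OF iH[of a b]]] by auto
    have aeL: "AE x in lebesgue. indicator (box a b) x * H x = g x" using ae by (rule AE_completion)
    have gL: "integrable lebesgue g"
      using iH[of a b] by (rule Bochner_Integration.integrable_cong_AE_imp) (use aeL in \<open>auto intro: measurable_completion\<close>)
    have "AE x in lborel. g x = 0"
    proof (rule AE_zero_if_box_integrals_zero)
      show "integrable lborel g" using gL by (simp add: integrable_completion)
      fix l u
      obtain c d where cd: "box l u \<inter> box a b = box c d" by (rule that[OF box_Int_box])
      have "(\<integral>x. indicator (box l u) x * g x \<partial>lborel) = (\<integral>x. indicator (box l u) x * g x \<partial>lebesgue)"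
        by (rule integral_completion[symmetric]) measurable
      also have "\<dots> = (\<integral>x. indicator (box c d) x * H x \<partial>lebesgue)"
      proof (rule integral_cong_AE)
        show "AE x in lebesgue. indicator (box l u) x * g x = indicator (box c d) x * H x"
          using aeL
        proof eventually_elim
          case (elim x)
          have "indicator (box c d) x = (indicator (box l u) x * indicator (box a b) x :: real)"
            unfolding cd[symmetric] by (simp add: indicator_inter_arith)
          then show ?case using elim by simp
        qed
      next
        have [measurable]: "g \<in> borel_measurable lebesgue" by (rule measurable_completion) measurable
        have [measurable]: "box r s \<in> sets lebesgue" for r s :: 'a by (rule fmeasurableD) simp
        show "(\<lambda>x. indicator (box l u) x * g x) \<in> borel_measurable lebesgue" by measurable
        show "(\<lambda>x. indicator (box c d) x * H x) \<in> borel_measurable lebesgue" by measurable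
      qed
      also have "\<dots> = 0"
      proof (cases "box c d = {}")
        case False
        have "box c d \<subseteq> box a b" using cd by blast
        then have "closure (box c d) \<subseteq> cbox a b" using box_subset_cbox by (intro closure_minimal closed_cbox) blast
        then have "cbox c d \<subseteq> \<Omega>" using closure_box[OF False] ab by simp
        then show ?thesis by (rule box0)
      qed simp
      finally show "(\<integral>x. indicator (box l u) x * g x \<partial>lborel) = 0" .
    qed
    then have "AE x in lebesgue. g x = 0" by (rule AE_completion)
    \<comment> \<open>Cut-offs are taken on open boxes but the covering uses closed ones; box
      boundaries are null sets.\<close>
    moreover have "AE x in lebesgue. x \<notin> cbox a b - box a b"
      using negligible_frontier_interval[of a b] by (intro AE_not_in) (simp add: negligible_iff_null_sets)
    ultimately show ?thesis using aeL by eventually_elim (auto simp: indicator_def)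
  qed
  obtain \<D> where D: "countable \<D>" "\<D> \<subseteq> Pow \<Omega>" "\<And>X. X \<in> \<D> \<Longrightarrow> \<exists>a b. X = cbox a b" "\<Union>\<D> = \<Omega>"
    using open_countable_Union_open_cbox[OF \<Omega>] by metis
  have "AE x in lebesgue. \<forall>X\<in>\<D>. x \<in> X \<longrightarrow> H x = 0"
  proof (subst AE_ball_countable[OF D(1)], rule ballI)
    fix X assume X: "X \<in> \<D>"
    then obtain a b where "X = cbox a b" "cbox a b \<subseteq> \<Omega>" using D by blast
    then show "AE x in lebesgue. x \<in> X \<longrightarrow> H x = 0" using AEbox by simp
  qed
  then have "AE x in lebesgue. x \<in> \<Omega> \<longrightarrow> G x = 0"
  proof eventually_elim
    case (elim x)
    show ?case
    proof
      assume x: "x \<in> \<Omega>"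
      then obtain X where "X \<in> \<D>" "x \<in> X" using D(4) by blast
      then have "H x = 0" using elim by blast
      then show "G x = 0" using x by (simp add: H_def)
    qed
  qed
  then show ?thesis by (subst AE_restrict_space_iff) auto
qed

subsection \<open>Weak gradients and the space H10\<close>

lemma sq_int_lborel_imp_lebesgue_on:
  fixes h :: "'a::euclidean_space \<Rightarrow> 'b::euclidean_space"
  assumes h: "sq_int lborel h" and [measurable]: "S \<in> sets lebesgue"
  shows "sq_int (lebesgue_on S) h"
proof -
  have "integrable lebesgue (\<lambda>x. (norm (h x))\<^sup>2)"
    using sq_int_integrable[OF h] by (subst integrable_completion) auto
  then have "integrable lebesgue (\<lambda>x. indicator S x *\<^sub>R (norm (h x))\<^sup>2)"
    by (rule integrable_mult_indicator[OF assms(2)])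
  then have "integrable (lebesgue_on S) (\<lambda>x. (norm (h x))\<^sup>2)"
    by (subst integrable_restrict_space) auto
  moreover have "h \<in> borel_measurable (lebesgue_on S)"
    using h by (intro measurable_restrict_space1 measurable_completion) (simp add: sq_int_def)
  ultimately show ?thesis by (simp add: sq_int_def)
qed

lemma sq_int_continuous_compact_support:
  fixes h :: "'a::euclidean_space \<Rightarrow> 'b::euclidean_space"
  assumes c: "continuous_on UNIV h" and K: "compact K" "\<And>x. x \<notin> K \<Longrightarrow> h x = 0"
  shows "sq_int lborel h"
proof -
  have "integrable lborel (\<lambda>x. indicator K x *\<^sub>R (norm (h x))\<^sup>2)"
    by (intro borel_integrable_compact K continuous_intros continuous_on_subset[OF c]) auto
  also have "(\<lambda>x. indicator K x *\<^sub>R (norm (h x))\<^sup>2) = (\<lambda>x. (norm (h x))\<^sup>2)"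
  proof (rule ext)
    fix x show "indicator K x *\<^sub>R (norm (h x))\<^sup>2 = (norm (h x))\<^sup>2" by (cases "x \<in> K") (simp_all add: K(2))
  qed
  finally show ?thesis using borel_measurable_continuous_onI[OF c] by (simp add: sq_int_def)
qed

lemma test_fun_continuous: "test_fun \<Omega> \<psi> \<Longrightarrow> continuous_on UNIV \<psi>"
  unfolding test_fun_def smooth_on_def by (auto dest: spec[of _ 0])

lemma test_fun_differentiable: "test_fun \<Omega> \<psi> \<Longrightarrow> \<psi> differentiable (at x)"
  unfolding test_fun_def smooth_on_def by (auto dest: spec[of _ "Suc 0"])

lemma test_fun_sq_int:
  assumes \<psi>: "test_fun \<Omega> \<psi>" and S: "S \<in> sets lebesgue"
  shows "sq_int (lebesgue_on S) \<psi>"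
proof -
  obtain K where "compact K" "\<And>x. x \<notin> K \<Longrightarrow> \<psi> x = 0" using \<psi> unfolding test_fun_def by blast
  from sq_int_continuous_compact_support[OF test_fun_continuous[OF \<psi>] this] show ?thesis
    by (rule sq_int_lborel_imp_lebesgue_on[OF _ S])
qed

lemma grad_sq_int:
  assumes \<psi>: "test_fun \<Omega> \<psi>" and S: "S \<in> sets lebesgue"
  shows "sq_int (lebesgue_on S) (grad \<psi>)"
proof -
  obtain K where K: "compact K" "\<And>x. x \<notin> K \<Longrightarrow> \<psi> x = 0" using \<psi> unfolding test_fun_def by blast
  have "Ck_on (Suc 0) \<psi> UNIV" using \<psi> unfolding test_fun_def smooth_on_def by blast
  then have "continuous_on UNIV (\<lambda>x. frechet_derivative \<psi> (at x) (axis k 1))" for k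
    by (auto simp: Basis_vec_def)
  then have "continuous_on UNIV (grad \<psi>)" unfolding grad_def[abs_def] by (intro continuous_on_vec_lambda)
  moreover have "grad \<psi> x = 0" if "x \<notin> K" for x
  proof -
    have "open (- K)" "x \<in> - K" using compact_imp_closed[OF K(1)] that by (auto simp: open_Compl)
    moreover have "((\<lambda>x. 0) has_derivative (\<lambda>h. 0)) (at x)" by simp
    ultimately have "(\<psi> has_derivative (\<lambda>h. 0)) (at x)"
      using K(2) by (intro has_derivative_transform_within_open[of "\<lambda>x. 0" _ x UNIV "- K" \<psi>]) auto
    from frechet_derivative_at[OF this, symmetric] show ?thesis by (simp add: grad_def vec_eq_iff)
  qed
  ultimately have "sq_int lborel (grad \<psi>)" using K(1) by (intro sq_int_continuous_compact_support)
  then show ?thesis by (rule sq_int_lborel_imp_lebesgue_on[OF _ S])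
qed

lemma test_fun_lincomb:
  assumes f: "test_fun \<Omega> f" and g: "test_fun \<Omega> g"
  shows "test_fun \<Omega> (\<lambda>x. a * f x + b * g x)"
proof -
  obtain K L where K: "compact K" "K \<subseteq> \<Omega>" "\<And>x. x \<notin> K \<Longrightarrow> f x = 0" and L: "compact L" "L \<subseteq> \<Omega>" "\<And>x. x \<notin> L \<Longrightarrow> g x = 0"
    using f g unfolding test_fun_def by metis
  show ?thesis unfolding test_fun_def
  proof (intro conjI exI[of _ "K \<union> L"])
    show "smooth_on (\<lambda>x. a * f x + b * g x) UNIV"
      using f g unfolding test_fun_def smooth_on_def by (auto intro!: Ck_on_add Ck_on_mult Ck_on_const)
  qed (use K L in auto)
qed

lemma grad_lincomb:
  assumes f: "test_fun \<Omega> f" and g: "test_fun \<Omega> g"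
  shows "grad (\<lambda>x. a * f x + b * g x) x = a *\<^sub>R grad f x + b *\<^sub>R grad g x"
proof -
  have "((\<lambda>x. a * f x + b * g x) has_derivative (\<lambda>h. a * frechet_derivative f (at x) h + b * frechet_derivative g (at x) h)) (at x)"
    using test_fun_differentiable[OF f, of x] test_fun_differentiable[OF g, of x]
    by (intro has_derivative_add has_derivative_mult_right) (simp_all add: frechet_derivative_works[symmetric])
  from frechet_derivative_at[OF this, symmetric] show ?thesis by (simp add: grad_def vec_eq_iff)
qed

lemma L2_sq_lincomb_le:
  fixes f g :: "'a::euclidean_space \<Rightarrow> 'b::euclidean_space"
  assumes S: "S \<in> sets lebesgue" and [measurable]: "f \<in> borel_measurable (lebesgue_on S)" "g \<in> borel_measurable (lebesgue_on S)"
  shows "L2_sq S (\<lambda>x. a *\<^sub>R f x + b *\<^sub>R g x) \<le> ennreal (2 * a\<^sup>2) * L2_sq S f + ennreal (2 * b\<^sup>2) * L2_sq S g"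
proof -
  have "L2_sq S (\<lambda>x. a *\<^sub>R f x + b *\<^sub>R g x)
     \<le> (\<integral>\<^sup>+x. ennreal (2 * a\<^sup>2) * ennreal ((norm (f x))\<^sup>2) + ennreal (2 * b\<^sup>2) * ennreal ((norm (g x))\<^sup>2) \<partial>lebesgue_on S)"
    unfolding L2_sq_eq_nn_integral[OF S]
  proof (rule nn_integral_mono)
    fix x
    have "(norm (a *\<^sub>R f x + b *\<^sub>R g x))\<^sup>2 \<le> 2 * a\<^sup>2 * (norm (f x))\<^sup>2 + 2 * b\<^sup>2 * (norm (g x))\<^sup>2"
      using sq_norm_add_le[of "a *\<^sub>R f x" "b *\<^sub>R g x"] by (simp add: power_mult_distrib)
    then show "ennreal ((norm (a *\<^sub>R f x + b *\<^sub>R g x))\<^sup>2) \<le> ennreal (2 * a\<^sup>2) * ennreal ((norm (f x))\<^sup>2) + ennreal (2 * b\<^sup>2) * ennreal ((norm (g x))\<^sup>2)"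
      by (simp add: ennreal_mult[symmetric] ennreal_plus[symmetric] ennreal_leI del: ennreal_plus)
  qed
  also have "\<dots> = ennreal (2 * a\<^sup>2) * L2_sq S f + ennreal (2 * b\<^sup>2) * L2_sq S g"
    unfolding L2_sq_eq_nn_integral[OF S] by (simp add: nn_integral_add nn_integral_cmult)
  finally show ?thesis .
qed

lemma weak_gradient_iff:
  assumes \<Omega>: "\<Omega> \<in> sets lebesgue"
  shows "weak_gradient \<Omega> f G \<longleftrightarrow> sq_int (lebesgue_on \<Omega>) f \<and> sq_int (lebesgue_on \<Omega>) G \<and>
    (\<forall>\<psi> k. test_fun \<Omega> \<psi> \<longrightarrow> (\<integral>x. f x * grad \<psi> x $ k \<partial>lebesgue_on \<Omega>) = - (\<integral>x. G x $ k * \<psi> x \<partial>lebesgue_on \<Omega>))"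
  unfolding weak_gradient_def L2_iff_sq_int[OF \<Omega>] set_lebesgue_integral_eq_integral_on[OF \<Omega>] ..

lemma sq_int_component:
  "sq_int M G \<Longrightarrow> sq_int M (\<lambda>x. G x $ k)" for G :: "'a \<Rightarrow> real ^ 'd"
proof (rule sq_int_bound)
  assume G: "sq_int M G"
  then have [measurable]: "G \<in> borel_measurable M" by (simp add: sq_int_def)
  have "(\<lambda>x. G x \<bullet> axis k 1) \<in> borel_measurable M" by measurable
  then show "(\<lambda>x. G x $ k) \<in> borel_measurable M" by (simp add: inner_axis)
qed (auto simp: component_le_norm_cart)

text \<open>Two weak gradients have the same integral against every test function, in each
  component. This is what identifies the gradient picked by \<open>x_grad\<close> up to null
  sets.\<close>

lemma weak_gradient_unique:
  assumes o: "open \<Omega>" and G: "weak_gradient \<Omega> f G" and G': "weak_gradient \<Omega> f G'"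
  shows "AE x in lebesgue_on \<Omega>. G x = G' x"
proof -
  have \<Omega>: "\<Omega> \<in> sets lebesgue" using o by (simp add: lmeasurable_open borel_open)
  note G = G[unfolded weak_gradient_iff[OF \<Omega>]] and G' = G'[unfolded weak_gradient_iff[OF \<Omega>]]
  have "AE x in lebesgue_on \<Omega>. G x $ k - G' x $ k = 0" for k
  proof (rule fundamental_lemma[OF o])
    show "sq_int (lebesgue_on \<Omega>) (\<lambda>x. G x $ k - G' x $ k)"
      using G G' by (intro sq_int_diff sq_int_component) auto
    fix \<psi> assume \<psi>: "test_fun \<Omega> \<psi>"
    have i: "integrable (lebesgue_on \<Omega>) (\<lambda>x. G x $ k * \<psi> x)" "integrable (lebesgue_on \<Omega>) (\<lambda>x. G' x $ k * \<psi> x)"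
      using G G' by (intro integrable_mult_sq_int sq_int_component test_fun_sq_int[OF \<psi> \<Omega>]; simp)+
    have "(\<integral>x. (G x $ k - G' x $ k) * \<psi> x \<partial>lebesgue_on \<Omega>) = (\<integral>x. G x $ k * \<psi> x \<partial>lebesgue_on \<Omega>) - (\<integral>x. G' x $ k * \<psi> x \<partial>lebesgue_on \<Omega>)"
      using i by (simp add: left_diff_distrib)
    also have "\<dots> = 0"
    proof -
      have "(\<integral>x. f x * grad \<psi> x $ k \<partial>lebesgue_on \<Omega>) = - (\<integral>x. G x $ k * \<psi> x \<partial>lebesgue_on \<Omega>)"
        "(\<integral>x. f x * grad \<psi> x $ k \<partial>lebesgue_on \<Omega>) = - (\<integral>x. G' x $ k * \<psi> x \<partial>lebesgue_on \<Omega>)"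
        using G G' \<psi> by blast+
      then show ?thesis by linarith
    qed
    finally show "(\<integral>x. (G x $ k - G' x $ k) * \<psi> x \<partial>lebesgue_on \<Omega>) = 0" .
  qed
  then have "AE x in lebesgue_on \<Omega>. \<forall>k\<in>UNIV. G x $ k - G' x $ k = 0"
    by (intro AE_finite_allI) auto
  then show ?thesis by eventually_elim (simp add: vec_eq_iff)
qed

text \<open>\<open>H10\<close> hides its gradient behind an existential quantifier; linear
  combinations and limits need it explicitly.\<close>

definition H10_pair :: "(real ^ 'd) set \<Rightarrow> (real ^ 'd \<Rightarrow> real) \<Rightarrow> (real ^ 'd \<Rightarrow> real ^ 'd) \<Rightarrow> bool" where
  "H10_pair \<Omega> f G \<longleftrightarrow> weak_gradient \<Omega> f G \<and>
     (\<forall>\<epsilon>>0. \<exists>\<psi>. test_fun \<Omega> \<psi> \<and> L2_sq \<Omega> (\<lambda>x. f x - \<psi> x) + L2_sq \<Omega> (\<lambda>x. G x - grad \<psi> x) < \<epsilon>)"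

lemma H10_iff: "H10 \<Omega> f \<longleftrightarrow> (\<exists>G. H10_pair \<Omega> f G)"
  by (simp add: H10_def H10_pair_def)

lemma L2_sq_cong_AE:
  assumes S: "S \<in> sets lebesgue" and "AE x in lebesgue_on S. f x = g x"
  shows "L2_sq S f = L2_sq S g"
  unfolding L2_sq_eq_nn_integral[OF S] using assms(2) by (intro nn_integral_cong_AE) auto

lemma sq_int_cong_AE:
  assumes f: "sq_int M f" and g: "g \<in> borel_measurable M" and ae: "AE x in M. f x = g x"
  shows "sq_int M g"
  by (rule sq_int_bound[OF f g]) (use ae in auto)

lemma H10_pair_cong_AE:
  assumes \<Omega>: "\<Omega> \<in> sets lebesgue" and P: "H10_pair \<Omega> f G"
    and m: "f' \<in> borel_measurable (lebesgue_on \<Omega>)" "G' \<in> borel_measurable (lebesgue_on \<Omega>)"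
    and ae: "AE x in lebesgue_on \<Omega>. f x = f' x" "AE x in lebesgue_on \<Omega>. G x = G' x"
  shows "H10_pair \<Omega> f' G'"
proof -
  have W: "sq_int (lebesgue_on \<Omega>) f" "sq_int (lebesgue_on \<Omega>) G"
    "\<And>\<psi> k. test_fun \<Omega> \<psi> \<Longrightarrow> (\<integral>x. f x * grad \<psi> x $ k \<partial>lebesgue_on \<Omega>) = - (\<integral>x. G x $ k * \<psi> x \<partial>lebesgue_on \<Omega>)"
    using P unfolding H10_pair_def weak_gradient_iff[OF \<Omega>] by blast+
  have "weak_gradient \<Omega> f' G'" unfolding weak_gradient_iff[OF \<Omega>]
  proof (intro conjI allI impI)
    show f': "sq_int (lebesgue_on \<Omega>) f'" by (rule sq_int_cong_AE[OF W(1) m(1) ae(1)])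
    show G': "sq_int (lebesgue_on \<Omega>) G'" by (rule sq_int_cong_AE[OF W(2) m(2) ae(2)])
    fix \<psi> k assume \<psi>: "test_fun \<Omega> \<psi>"
    have [measurable]: "\<psi> \<in> borel_measurable (lebesgue_on \<Omega>)" "(\<lambda>x. grad \<psi> x $ k) \<in> borel_measurable (lebesgue_on \<Omega>)"
      using test_fun_sq_int[OF \<psi> \<Omega>] sq_int_component[OF grad_sq_int[OF \<psi> \<Omega>]] by (auto simp: sq_int_def)
    have [measurable]: "(\<lambda>x. G x $ k) \<in> borel_measurable (lebesgue_on \<Omega>)" "(\<lambda>x. G' x $ k) \<in> borel_measurable (lebesgue_on \<Omega>)"
      "f \<in> borel_measurable (lebesgue_on \<Omega>)" "f' \<in> borel_measurable (lebesgue_on \<Omega>)"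
      using sq_int_component[OF W(2)] sq_int_component[OF G'] W(1) m by (auto simp: sq_int_def)
    have "(\<integral>x. f' x * grad \<psi> x $ k \<partial>lebesgue_on \<Omega>) = (\<integral>x. f x * grad \<psi> x $ k \<partial>lebesgue_on \<Omega>)"
      by (rule integral_cong_AE) (measurable, use ae(1) in auto)
    moreover have "(\<integral>x. G' x $ k * \<psi> x \<partial>lebesgue_on \<Omega>) = (\<integral>x. G x $ k * \<psi> x \<partial>lebesgue_on \<Omega>)"
      by (rule integral_cong_AE) (measurable, use ae(2) in auto)
    ultimately show "(\<integral>x. f' x * grad \<psi> x $ k \<partial>lebesgue_on \<Omega>) = - (\<integral>x. G' x $ k * \<psi> x \<partial>lebesgue_on \<Omega>)"
      using W(3)[OF \<psi>] by simp
  qed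
  moreover have "L2_sq \<Omega> (\<lambda>x. f' x - \<psi> x) = L2_sq \<Omega> (\<lambda>x. f x - \<psi> x)" "L2_sq \<Omega> (\<lambda>x. G' x - grad \<psi> x) = L2_sq \<Omega> (\<lambda>x. G x - grad \<psi> x)" for \<psi>
    by (rule L2_sq_cong_AE[OF \<Omega>]; use ae in auto)+
  ultimately show ?thesis using P unfolding H10_pair_def by simp
qed

text \<open>The gradient hidden in \<open>H10\<close> agrees almost everywhere with any given one,
  and approximation by test functions does not see null sets.\<close>

lemma H10_pair_if_weak_gradient:
  assumes o: "open \<Omega>" and f: "H10 \<Omega> f" and G: "weak_gradient \<Omega> f G"
  shows "H10_pair \<Omega> f G"
proof -
  have \<Omega>: "\<Omega> \<in> sets lebesgue" using o by (simp add: lmeasurable_open borel_open)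
  obtain G0 where G0: "H10_pair \<Omega> f G0" using f by (auto simp: H10_iff)
  then have "AE x in lebesgue_on \<Omega>. G0 x = G x" using G o by (intro weak_gradient_unique) (auto simp: H10_pair_def)
  then show ?thesis using G by (intro H10_pair_cong_AE[OF \<Omega> G0]) (auto simp: weak_gradient_iff[OF \<Omega>] sq_int_def)
qed

lemma weak_gradient_lincomb:
  assumes \<Omega>: "\<Omega> \<in> sets lebesgue" and 1: "weak_gradient \<Omega> f G" and 2: "weak_gradient \<Omega> f' G'"
  shows "weak_gradient \<Omega> (\<lambda>x. a * f x + b * f' x) (\<lambda>x. a *\<^sub>R G x + b *\<^sub>R G' x)"
  unfolding weak_gradient_iff[OF \<Omega>]
proof (intro conjI allI impI)
  note 1 = 1[unfolded weak_gradient_iff[OF \<Omega>]] and 2 = 2[unfolded weak_gradient_iff[OF \<Omega>]]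
  show "sq_int (lebesgue_on \<Omega>) (\<lambda>x. a * f x + b * f' x)" "sq_int (lebesgue_on \<Omega>) (\<lambda>x. a *\<^sub>R G x + b *\<^sub>R G' x)"
    using 1 2 by (auto intro!: sq_int_add sq_int_cmult sq_int_scaleR)
  fix \<psi> k assume \<psi>: "test_fun \<Omega> \<psi>"
  note s = test_fun_sq_int[OF \<psi> \<Omega>] sq_int_component[OF grad_sq_int[OF \<psi> \<Omega>], of k]
  have i: "integrable (lebesgue_on \<Omega>) (\<lambda>x. f x * grad \<psi> x $ k)" "integrable (lebesgue_on \<Omega>) (\<lambda>x. f' x * grad \<psi> x $ k)"
    "integrable (lebesgue_on \<Omega>) (\<lambda>x. G x $ k * \<psi> x)" "integrable (lebesgue_on \<Omega>) (\<lambda>x. G' x $ k * \<psi> x)"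
    using 1 2 s by (auto intro!: integrable_mult_sq_int sq_int_component)
  have e: "(\<integral>x. f x * grad \<psi> x $ k \<partial>lebesgue_on \<Omega>) = - (\<integral>x. G x $ k * \<psi> x \<partial>lebesgue_on \<Omega>)"
    "(\<integral>x. f' x * grad \<psi> x $ k \<partial>lebesgue_on \<Omega>) = - (\<integral>x. G' x $ k * \<psi> x \<partial>lebesgue_on \<Omega>)" using 1 2 \<psi> by blast+
  have "(\<integral>x. (a * f x + b * f' x) * grad \<psi> x $ k \<partial>lebesgue_on \<Omega>)
     = (\<integral>x. a * (f x * grad \<psi> x $ k) + b * (f' x * grad \<psi> x $ k) \<partial>lebesgue_on \<Omega>)"
    by (simp add: algebra_simps)
  also have "\<dots> = a * (\<integral>x. f x * grad \<psi> x $ k \<partial>lebesgue_on \<Omega>) + b * (\<integral>x. f' x * grad \<psi> x $ k \<partial>lebesgue_on \<Omega>)"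
    using i by simp
  also have "\<dots> = - (\<integral>x. a * (G x $ k * \<psi> x) + b * (G' x $ k * \<psi> x) \<partial>lebesgue_on \<Omega>)"
    unfolding e using i by simp
  finally show "(\<integral>x. (a * f x + b * f' x) * grad \<psi> x $ k \<partial>lebesgue_on \<Omega>) = - (\<integral>x. (a *\<^sub>R G x + b *\<^sub>R G' x) $ k * \<psi> x \<partial>lebesgue_on \<Omega>)"
    by (simp add: algebra_simps)
qed

text \<open>Tolerances in the definitions are extended reals and may be infinite; estimates are
  carried out below a real tolerance.\<close>

lemma ennreal_approx_real:
  fixes \<epsilon> :: ennreal
  assumes "0 < \<epsilon>" obtains e where "0 < e" "ennreal e \<le> \<epsilon>"
proof (cases \<epsilon>)
  case (real r) then show thesis using assms that[of r] by simp
next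
  case top then show thesis using that[of 1] by simp
qed

lemma ennreal_sum_less:
  assumes "a < ennreal r" "0 \<le> c" "0 \<le> d" "b < ennreal s" "c * r + d * s < e"
  shows "ennreal c * a + ennreal d * b < ennreal e"
proof -
  obtain x y where a: "a = ennreal x" "0 \<le> x" and b: "b = ennreal y" "0 \<le> y"
    using assms(1,4) by (cases a; cases b) auto
  have "x < r" "y < s" using assms(1,4) a b by (auto simp: ennreal_less_iff)
  then have "c * x + d * y \<le> c * r + d * s" using assms(2,3) by (intro add_mono mult_left_mono) auto
  then have "c * x + d * y < e" using assms(5) by simp
  then show ?thesis using a b assms(2,3) by (simp add: ennreal_mult[symmetric] ennreal_plus[symmetric] ennreal_less_iff del: ennreal_plus)
qed

lemma H10_pair_lincomb:
  assumes \<Omega>: "\<Omega> \<in> sets lebesgue" and 1: "H10_pair \<Omega> f G" and 2: "H10_pair \<Omega> f' G'"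
  shows "H10_pair \<Omega> (\<lambda>x. a * f x + b * f' x) (\<lambda>x. a *\<^sub>R G x + b *\<^sub>R G' x)"
  unfolding H10_pair_def
proof (intro conjI allI impI)
  show "weak_gradient \<Omega> (\<lambda>x. a * f x + b * f' x) (\<lambda>x. a *\<^sub>R G x + b *\<^sub>R G' x)"
    using 1 2 by (intro weak_gradient_lincomb[OF \<Omega>]) (auto simp: H10_pair_def)
  note w = 1[unfolded H10_pair_def weak_gradient_iff[OF \<Omega>]] 2[unfolded H10_pair_def weak_gradient_iff[OF \<Omega>]]
  fix \<epsilon> :: ennreal assume "0 < \<epsilon>"
  then obtain e where e: "0 < e" "ennreal e \<le> \<epsilon>" by (rule ennreal_approx_real)
  \<comment> \<open>The summand 1 allows both coefficients to vanish and makes the final inequality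
    strict.\<close>
  define r where "r = e / (2 * a\<^sup>2 + 2 * b\<^sup>2 + 1)"
  have den: "0 < 2 * a\<^sup>2 + 2 * b\<^sup>2 + 1" by (simp add: add_nonneg_pos)
  then have r: "0 < r" using e by (simp add: r_def)
  have rs: "2 * a\<^sup>2 * r + 2 * b\<^sup>2 * r < e"
  proof -
    have "2 * a\<^sup>2 * r + 2 * b\<^sup>2 * r < (2 * a\<^sup>2 + 2 * b\<^sup>2 + 1) * r" using r by (simp add: algebra_simps)
    also have "\<dots> = e" using den by (simp add: r_def)
    finally show ?thesis .
  qed
  obtain \<psi> where \<psi>: "test_fun \<Omega> \<psi>" "L2_sq \<Omega> (\<lambda>x. f x - \<psi> x) + L2_sq \<Omega> (\<lambda>x. G x - grad \<psi> x) < ennreal r"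
    using 1 r unfolding H10_pair_def by (meson ennreal_less_zero_iff)
  obtain \<eta> where \<eta>: "test_fun \<Omega> \<eta>" "L2_sq \<Omega> (\<lambda>x. f' x - \<eta> x) + L2_sq \<Omega> (\<lambda>x. G' x - grad \<eta> x) < ennreal r"
    using 2 r unfolding H10_pair_def by (meson ennreal_less_zero_iff)
  have m: "(\<lambda>x. f x - \<psi> x) \<in> borel_measurable (lebesgue_on \<Omega>)" "(\<lambda>x. f' x - \<eta> x) \<in> borel_measurable (lebesgue_on \<Omega>)"
    "(\<lambda>x. G x - grad \<psi> x) \<in> borel_measurable (lebesgue_on \<Omega>)" "(\<lambda>x. G' x - grad \<eta> x) \<in> borel_measurable (lebesgue_on \<Omega>)"
    using w test_fun_sq_int[OF \<psi>(1) \<Omega>] test_fun_sq_int[OF \<eta>(1) \<Omega>] grad_sq_int[OF \<psi>(1) \<Omega>] grad_sq_int[OF \<eta>(1) \<Omega>]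
    by (auto simp: sq_int_def)
  show "\<exists>\<zeta>. test_fun \<Omega> \<zeta> \<and> L2_sq \<Omega> (\<lambda>x. (a * f x + b * f' x) - \<zeta> x) + L2_sq \<Omega> (\<lambda>x. (a *\<^sub>R G x + b *\<^sub>R G' x) - grad \<zeta> x) < \<epsilon>"
  proof (intro exI conjI)
    show "test_fun \<Omega> (\<lambda>x. a * \<psi> x + b * \<eta> x)" by (rule test_fun_lincomb[OF \<psi>(1) \<eta>(1)])
    have "L2_sq \<Omega> (\<lambda>x. (a * f x + b * f' x) - (a * \<psi> x + b * \<eta> x)) = L2_sq \<Omega> (\<lambda>x. a *\<^sub>R (f x - \<psi> x) + b *\<^sub>R (f' x - \<eta> x))"
      by (simp add: algebra_simps)
    moreover have "L2_sq \<Omega> (\<lambda>x. (a *\<^sub>R G x + b *\<^sub>R G' x) - grad (\<lambda>x. a * \<psi> x + b * \<eta> x) x) = L2_sq \<Omega> (\<lambda>x. a *\<^sub>R (G x - grad \<psi> x) + b *\<^sub>R (G' x - grad \<eta> x))"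
      unfolding grad_lincomb[OF \<psi>(1) \<eta>(1)] by (simp add: algebra_simps)
    ultimately have "L2_sq \<Omega> (\<lambda>x. (a * f x + b * f' x) - (a * \<psi> x + b * \<eta> x)) + L2_sq \<Omega> (\<lambda>x. (a *\<^sub>R G x + b *\<^sub>R G' x) - grad (\<lambda>x. a * \<psi> x + b * \<eta> x) x)
      \<le> (ennreal (2 * a\<^sup>2) * L2_sq \<Omega> (\<lambda>x. f x - \<psi> x) + ennreal (2 * b\<^sup>2) * L2_sq \<Omega> (\<lambda>x. f' x - \<eta> x))
       + (ennreal (2 * a\<^sup>2) * L2_sq \<Omega> (\<lambda>x. G x - grad \<psi> x) + ennreal (2 * b\<^sup>2) * L2_sq \<Omega> (\<lambda>x. G' x - grad \<eta> x))"
      using L2_sq_lincomb_le[OF \<Omega> m(1,2), of a b] L2_sq_lincomb_le[OF \<Omega> m(3,4), of a b] by (simp add: add_mono)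
    also have "\<dots> = ennreal (2 * a\<^sup>2) * (L2_sq \<Omega> (\<lambda>x. f x - \<psi> x) + L2_sq \<Omega> (\<lambda>x. G x - grad \<psi> x))
       + ennreal (2 * b\<^sup>2) * (L2_sq \<Omega> (\<lambda>x. f' x - \<eta> x) + L2_sq \<Omega> (\<lambda>x. G' x - grad \<eta> x))"
      by (simp add: distrib_left add_ac)
    also have "\<dots> < ennreal e" by (rule ennreal_sum_less[OF \<psi>(2) _ _ \<eta>(2) rs]) auto
    also have "\<dots> \<le> \<epsilon>" by (rule e(2))
    finally show "L2_sq \<Omega> (\<lambda>x. (a * f x + b * f' x) - (a * \<psi> x + b * \<eta> x)) + L2_sq \<Omega> (\<lambda>x. (a *\<^sub>R G x + b *\<^sub>R G' x) - grad (\<lambda>x. a * \<psi> x + b * \<eta> x) x) < \<epsilon>" .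
  qed
qed

text \<open>The integration by parts formula is continuous in L2, and a test function close to a
  late member of the sequence is close to the limit. The squared triangle inequality doubles both
  errors, so each may be a fifth of the tolerance.\<close>

lemma H10_pair_limit:
  assumes \<Omega>: "\<Omega> \<in> sets lebesgue" and P: "\<And>n::nat. H10_pair \<Omega> (f n) (G n)"
    and f': "sq_int (lebesgue_on \<Omega>) f'" and G': "sq_int (lebesgue_on \<Omega>) G'"
    and lf: "(\<lambda>n. \<integral>x. (norm (f n x - f' x))\<^sup>2 \<partial>lebesgue_on \<Omega>) \<longlonglongrightarrow> 0"
    and lG: "(\<lambda>n. \<integral>x. (norm (G n x - G' x))\<^sup>2 \<partial>lebesgue_on \<Omega>) \<longlonglongrightarrow> 0"
  shows "H10_pair \<Omega> f' G'"
  unfolding H10_pair_def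
proof (intro conjI allI impI)
  have W: "sq_int (lebesgue_on \<Omega>) (f n)" "sq_int (lebesgue_on \<Omega>) (G n)"
    "\<And>\<psi> k. test_fun \<Omega> \<psi> \<Longrightarrow> (\<integral>x. f n x * grad \<psi> x $ k \<partial>lebesgue_on \<Omega>) = - (\<integral>x. G n x $ k * \<psi> x \<partial>lebesgue_on \<Omega>)" for n
    using P[of n] unfolding H10_pair_def weak_gradient_iff[OF \<Omega>] by blast+
  show "weak_gradient \<Omega> f' G'" unfolding weak_gradient_iff[OF \<Omega>]
  proof (intro conjI allI impI f' G')
    fix \<psi> k assume \<psi>: "test_fun \<Omega> \<psi>"
    note s = test_fun_sq_int[OF \<psi> \<Omega>] sq_int_component[OF grad_sq_int[OF \<psi> \<Omega>], of k]
    have s': "sq_int (lebesgue_on \<Omega>) (\<lambda>x. \<psi> x *\<^sub>R (axis k 1 :: real^'a))"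
      using s(1) by (auto simp: sq_int_def power_mult_distrib)
    have e: "G x $ k * \<psi> x = G x \<bullet> (\<psi> x *\<^sub>R axis k 1)" for G :: "real^'a \<Rightarrow> real^'a" and x
      by (simp add: inner_axis)
    show "(\<integral>x. f' x * grad \<psi> x $ k \<partial>lebesgue_on \<Omega>) = - (\<integral>x. G' x $ k * \<psi> x \<partial>lebesgue_on \<Omega>)"
    proof (rule LIMSEQ_unique)
      show "(\<lambda>n. \<integral>x. f n x * grad \<psi> x $ k \<partial>lebesgue_on \<Omega>) \<longlonglongrightarrow> (\<integral>x. f' x * grad \<psi> x $ k \<partial>lebesgue_on \<Omega>)"
        using tendsto_integral_inner[OF W(1) f' s(2) s(2) lf] by simp
      show "(\<lambda>n. \<integral>x. f n x * grad \<psi> x $ k \<partial>lebesgue_on \<Omega>) \<longlonglongrightarrow> - (\<integral>x. G' x $ k * \<psi> x \<partial>lebesgue_on \<Omega>)"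
        unfolding W(3)[OF \<psi>] e by (intro tendsto_minus tendsto_integral_inner[OF W(2) G' s' s' lG]) simp
    qed
  qed
  fix \<epsilon> :: ennreal assume "0 < \<epsilon>"
  then obtain e where e: "0 < e" "ennreal e \<le> \<epsilon>" by (rule ennreal_approx_real)
  have "eventually (\<lambda>n. (\<integral>x. (norm (f n x - f' x))\<^sup>2 \<partial>lebesgue_on \<Omega>) < e/10) sequentially"
    "eventually (\<lambda>n. (\<integral>x. (norm (G n x - G' x))\<^sup>2 \<partial>lebesgue_on \<Omega>) < e/10) sequentially"
    using order_tendstoD(2)[OF lf, of "e/10"] order_tendstoD(2)[OF lG, of "e/10"] e by auto
  then have "eventually (\<lambda>n. (\<integral>x. (norm (f n x - f' x))\<^sup>2 \<partial>lebesgue_on \<Omega>) + (\<integral>x. (norm (G n x - G' x))\<^sup>2 \<partial>lebesgue_on \<Omega>) < e/5) sequentially"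
    by eventually_elim simp
  then obtain n where n: "(\<integral>x. (norm (f n x - f' x))\<^sup>2 \<partial>lebesgue_on \<Omega>) + (\<integral>x. (norm (G n x - G' x))\<^sup>2 \<partial>lebesgue_on \<Omega>) < e/5"
    by (auto simp: eventually_sequentially)
  obtain \<psi> where \<psi>: "test_fun \<Omega> \<psi>" "L2_sq \<Omega> (\<lambda>x. f n x - \<psi> x) + L2_sq \<Omega> (\<lambda>x. G n x - grad \<psi> x) < ennreal (e/5)"
    using P[of n] e unfolding H10_pair_def by (meson ennreal_less_zero_iff zero_less_divide_iff zero_less_numeral)
  have L: "L2_sq \<Omega> (\<lambda>x. f' x - f n x) + L2_sq \<Omega> (\<lambda>x. G' x - G n x) < ennreal (e/5)"
    using n L2_sq_eq_integral[OF \<Omega>, unfolded L2_iff_sq_int[OF \<Omega>], OF sq_int_diff[OF f' W(1)[of n]]]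
      L2_sq_eq_integral[OF \<Omega>, unfolded L2_iff_sq_int[OF \<Omega>], OF sq_int_diff[OF G' W(2)[of n]]]
    by (simp add: norm_minus_commute ennreal_plus[symmetric] ennreal_less_iff abs_minus_commute power2_commute del: ennreal_plus)
  have m: "(\<lambda>x. f' x - f n x) \<in> borel_measurable (lebesgue_on \<Omega>)" "(\<lambda>x. f n x - \<psi> x) \<in> borel_measurable (lebesgue_on \<Omega>)"
    "(\<lambda>x. G' x - G n x) \<in> borel_measurable (lebesgue_on \<Omega>)" "(\<lambda>x. G n x - grad \<psi> x) \<in> borel_measurable (lebesgue_on \<Omega>)"
    using W(1,2)[of n] f' G' test_fun_sq_int[OF \<psi>(1) \<Omega>] grad_sq_int[OF \<psi>(1) \<Omega>] by (auto simp: sq_int_def)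
  show "\<exists>\<psi>. test_fun \<Omega> \<psi> \<and> L2_sq \<Omega> (\<lambda>x. f' x - \<psi> x) + L2_sq \<Omega> (\<lambda>x. G' x - grad \<psi> x) < \<epsilon>"
  proof (intro exI conjI, rule \<psi>(1))
    have "L2_sq \<Omega> (\<lambda>x. f' x - \<psi> x) + L2_sq \<Omega> (\<lambda>x. G' x - grad \<psi> x)
       \<le> (ennreal 2 * L2_sq \<Omega> (\<lambda>x. f' x - f n x) + ennreal 2 * L2_sq \<Omega> (\<lambda>x. f n x - \<psi> x))
       + (ennreal 2 * L2_sq \<Omega> (\<lambda>x. G' x - G n x) + ennreal 2 * L2_sq \<Omega> (\<lambda>x. G n x - grad \<psi> x))"
      using L2_sq_lincomb_le[OF \<Omega> m(1,2), of 1 1] L2_sq_lincomb_le[OF \<Omega> m(3,4), of 1 1] by (simp add: add_mono)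
    also have "\<dots> = ennreal 2 * (L2_sq \<Omega> (\<lambda>x. f' x - f n x) + L2_sq \<Omega> (\<lambda>x. G' x - G n x))
       + ennreal 2 * (L2_sq \<Omega> (\<lambda>x. f n x - \<psi> x) + L2_sq \<Omega> (\<lambda>x. G n x - grad \<psi> x))"
      by (simp add: distrib_left add_ac)
    also have "\<dots> < ennreal e" by (rule ennreal_sum_less[OF L _ _ \<psi>(2)]) (use e in auto)
    also have "\<dots> \<le> \<epsilon>" by (rule e(2))
    finally show "L2_sq \<Omega> (\<lambda>x. f' x - \<psi> x) + L2_sq \<Omega> (\<lambda>x. G' x - grad \<psi> x) < \<epsilon>" .
  qed
qed

lemma zero_Cinf_L2_lincomb:
  assumes \<Omega>: "\<Omega> \<in> sets lebesgue" and w: "zero_Cinf_L2 \<Omega> T w" and w': "zero_Cinf_L2 \<Omega> T w'"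
  shows "zero_Cinf_L2 \<Omega> T (\<lambda>p. a * w p + b * w' p)"
proof -
  from w obtain W \<delta> where W: "w \<in> borel_measurable (lebesgue_on (cylinder \<Omega> T))" "W 0 = w"
     "\<And>k t. t \<in> {0<..<T} \<Longrightarrow> L2 \<Omega> (\<lambda>x. W k (x, t))"
     "\<And>k t. t \<in> {0<..<T} \<Longrightarrow> ((\<lambda>h. L2_sq \<Omega> (\<lambda>x. (W k (x, t + h) - W k (x, t)) / h - W (Suc k) (x, t))) \<longlongrightarrow> 0) (at 0)"
     "0 < \<delta>" "\<And>t. t \<in> {0<..<T} \<Longrightarrow> t < \<delta> \<Longrightarrow> (AE x in lebesgue_on \<Omega>. w (x, t) = 0)"
    unfolding zero_Cinf_L2_def by blast
  from w' obtain W' \<delta>' where W': "w' \<in> borel_measurable (lebesgue_on (cylinder \<Omega> T))" "W' 0 = w'"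
     "\<And>k t. t \<in> {0<..<T} \<Longrightarrow> L2 \<Omega> (\<lambda>x. W' k (x, t))"
     "\<And>k t. t \<in> {0<..<T} \<Longrightarrow> ((\<lambda>h. L2_sq \<Omega> (\<lambda>x. (W' k (x, t + h) - W' k (x, t)) / h - W' (Suc k) (x, t))) \<longlongrightarrow> 0) (at 0)"
     "0 < \<delta>'" "\<And>t. t \<in> {0<..<T} \<Longrightarrow> t < \<delta>' \<Longrightarrow> (AE x in lebesgue_on \<Omega>. w' (x, t) = 0)"
    unfolding zero_Cinf_L2_def by blast
  have mW: "(\<lambda>x. W k (x, t)) \<in> borel_measurable (lebesgue_on \<Omega>)" "(\<lambda>x. W' k (x, t)) \<in> borel_measurable (lebesgue_on \<Omega>)" if "t \<in> {0<..<T}" for k t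
    using W(3)[OF that] W'(3)[OF that] by (auto simp: L2_def)
  define V where "V k p = a * W k p + b * W' k p" for k p
  have "L2 \<Omega> (\<lambda>x. V k (x, t))" if "t \<in> {0<..<T}" for k t
    using W(3)[OF that] W'(3)[OF that] unfolding L2_iff_sq_int[OF \<Omega>] V_def by (intro sq_int_add sq_int_cmult)
  moreover have "((\<lambda>h. L2_sq \<Omega> (\<lambda>x. (V k (x, t + h) - V k (x, t)) / h - V (Suc k) (x, t))) \<longlongrightarrow> 0) (at 0)" if t: "t \<in> {0<..<T}" for k t
  proof (rule tendsto_sandwich[OF always_eventually])
    let ?d = "\<lambda>h x. (W k (x, t + h) - W k (x, t)) / h - W (Suc k) (x, t)" and ?d' = "\<lambda>h x. (W' k (x, t + h) - W' k (x, t)) / h - W' (Suc k) (x, t)"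
    show "((\<lambda>h. 0) \<longlongrightarrow> (0::ennreal)) (at (0::real))" by simp
    have "((\<lambda>h. ennreal (2 * a\<^sup>2) * L2_sq \<Omega> (?d h) + ennreal (2 * b\<^sup>2) * L2_sq \<Omega> (?d' h)) \<longlongrightarrow> ennreal (2 * a\<^sup>2) * 0 + ennreal (2 * b\<^sup>2) * 0) (at 0)"
      by (intro tendsto_add ennreal_tendsto_cmult W(4)[OF t] W'(4)[OF t]) auto
    then show "((\<lambda>h. ennreal (2 * a\<^sup>2) * L2_sq \<Omega> (?d h) + ennreal (2 * b\<^sup>2) * L2_sq \<Omega> (?d' h)) \<longlongrightarrow> 0) (at 0)" by simp
    have "((\<lambda>h. t + h) \<longlongrightarrow> t + 0) (at 0)" by (intro tendsto_intros)
    \<comment> \<open>Slices are known to be measurable only at times inside the interval, so the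
      estimate is restricted to small \<open>h\<close>.\<close>
    then have "eventually (\<lambda>h. t + h \<in> {0<..<T}) (at 0)"
      using t by (intro topological_tendstoD) auto
    then show "eventually (\<lambda>h. L2_sq \<Omega> (\<lambda>x. (V k (x, t + h) - V k (x, t)) / h - V (Suc k) (x, t)) \<le> ennreal (2 * a\<^sup>2) * L2_sq \<Omega> (?d h) + ennreal (2 * b\<^sup>2) * L2_sq \<Omega> (?d' h)) (at 0)"
    proof eventually_elim
      case (elim h)
      note [measurable] = mW[OF t] mW[OF elim]
      have "(\<lambda>x. (V k (x, t + h) - V k (x, t)) / h - V (Suc k) (x, t)) = (\<lambda>x. a *\<^sub>R ?d h x + b *\<^sub>R ?d' h x)"
        by (auto simp: V_def diff_divide_distrib add_divide_distrib algebra_simps)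
      then show ?case using L2_sq_lincomb_le[OF \<Omega>, of "?d h" "?d' h" a b] by simp
    qed
  qed simp
  moreover have "AE x in lebesgue_on \<Omega>. a * w (x, t) + b * w' (x, t) = 0" if "t \<in> {0<..<T}" "t < min \<delta> \<delta>'" for t
  proof -
    have "AE x in lebesgue_on \<Omega>. w (x, t) = 0" "AE x in lebesgue_on \<Omega>. w' (x, t) = 0" using W(6) W'(6) that by auto
    then show ?thesis by eventually_elim simp
  qed
  moreover have "V 0 = (\<lambda>p. a * w p + b * w' p)" using W(2) W'(2) by (auto simp: V_def)
  moreover have "(\<lambda>p. a * w p + b * w' p) \<in> borel_measurable (lebesgue_on (cylinder \<Omega> T))" using W(1) W'(1) by measurable
  ultimately show ?thesis unfolding zero_Cinf_L2_def
    using W(5) W'(5) by (intro conjI exI[of _ V] exI[of _ "min \<delta> \<delta>'"]) auto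
qed

subsection \<open>Null sets in products\<close>

text \<open>\<open>P\<close> need not be measurable; the sections are taken of a measurable null set
  containing the exceptional points.\<close>

lemma (in pair_sigma_finite) AE_slices:
  assumes "AE p in M1 \<Otimes>\<^sub>M M2. P p"
  shows "AE x in M1. AE y in M2. P (x, y)" and "AE y in M2. AE x in M1. P (x, y)"
proof -
  obtain N where N: "N \<in> null_sets (M1 \<Otimes>\<^sub>M M2)" "{p \<in> space (M1 \<Otimes>\<^sub>M M2). \<not> P p} \<subseteq> N"
    using assms by (auto elim!: AE_E simp: null_sets_def)
  have [measurable]: "N \<in> sets (M1 \<Otimes>\<^sub>M M2)" using N by auto
  have 1: "AE x in M1. AE y in M2. (x, y) \<notin> N" using AE_pair[OF AE_not_in[OF N(1)]] .
  have "{x \<in> space (M1 \<Otimes>\<^sub>M M2). (\<lambda>x y. (x, y) \<notin> N) (fst x) (snd x)} \<in> sets (M1 \<Otimes>\<^sub>M M2)" by simp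
  then have 2: "AE y in M2. AE x in M1. (x, y) \<notin> N" using AE_commute[of "\<lambda>x y. (x, y) \<notin> N"] 1 by blast
  show "AE x in M1. AE y in M2. P (x, y)"
    using 1 AE_space
  proof eventually_elim
    case (elim x)
    show ?case using elim(1) AE_space by eventually_elim (use elim(2) N(2) in \<open>auto simp: space_pair_measure\<close>)
  qed
  show "AE y in M2. AE x in M1. P (x, y)"
    using 2 AE_space
  proof eventually_elim
    case (elim x)
    show ?case using elim(1) AE_space by eventually_elim (use elim(2) N(2) in \<open>auto simp: space_pair_measure\<close>)
  qed
qed

lemma AE_lebesgue_on_iff:
  "S \<in> sets lebesgue \<Longrightarrow> (AE x in lebesgue_on S. P x) \<longleftrightarrow> (AE x in lborel. x \<in> S \<longrightarrow> P x)"
  by (simp add: AE_restrict_space_iff AE_completion_iff)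

lemma measurable_completion_AE_eq:
  assumes g: "g \<in> borel_measurable M" and ae: "AE x in M. f x = g x"
  shows "f \<in> borel_measurable (completion M)"
proof (rule measurableI)
  fix A :: "'b set" assume A: "A \<in> sets borel"
  obtain N where N: "N \<in> null_sets M" "{x \<in> space M. f x \<noteq> g x} \<subseteq> N"
    using ae by (auto elim!: AE_E simp: null_sets_def)
  have "g -` A \<inter> space M - N \<in> sets (completion M)"
    using measurable_sets[OF g A] N by auto
  moreover have "f -` A \<inter> space M \<inter> N \<in> sets (completion M)"
    using N(1) by (intro null_setsD2 null_sets_completion_subset[OF _ null_sets_completionI[OF N(1)]]) auto
  ultimately have "(g -` A \<inter> space M - N) \<union> (f -` A \<inter> space M \<inter> N) \<in> sets (completion M)" by (rule sets.Un)
  also have "(g -` A \<inter> space M - N) \<union> (f -` A \<inter> space M \<inter> N) = f -` A \<inter> space (completion M)"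
    using N(2) by auto
  finally show "f -` A \<inter> space (completion M) \<in> sets (completion M)" .
qed simp

text \<open>\<open>f\<close> becomes measurable for the completed measure because it agrees almost
  everywhere with \<open>g\<close>. This admits integrands built from \<open>deriv\<close> and from
  Hilbert choice, whose measurability is not known beforehand.\<close>

lemma integral_lebesgue_AE_eq:
  fixes f g :: "'a::euclidean_space \<Rightarrow> real"
  assumes g: "g \<in> borel_measurable lborel" and ae: "AE x in lborel. f x = g x"
  shows "(\<integral>x. f x \<partial>lebesgue) = (\<integral>x. g x \<partial>lborel)"
proof -
  have "(\<integral>x. f x \<partial>lebesgue) = (\<integral>x. g x \<partial>lebesgue)"
    using AE_completion[OF ae] by (intro integral_cong_AE measurable_completion_AE_eq[OF g ae] measurable_completion g)
  then show ?thesis using integral_completion[OF g] by simp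
qed

lemma completion_ex_borel_measurable_euclidean:
  fixes g :: "'a \<Rightarrow> 'b::euclidean_space"
  assumes g: "g \<in> borel_measurable (completion M)"
  shows "\<exists>g'\<in>borel_measurable M. AE x in M. g x = g' x"
proof -
  have "\<exists>h. h \<in> borel_measurable M \<and> (AE x in M. g x \<bullet> b = h x)" for b
    using completion_ex_borel_measurable_real[of "\<lambda>x. g x \<bullet> b" M] g by auto
  then have "\<exists>h. \<forall>b. h b \<in> borel_measurable M \<and> (AE x in M. g x \<bullet> b = h b x)"
    by (intro choice allI)
  then obtain h where h: "\<And>b. h b \<in> borel_measurable M" "\<And>b. AE x in M. g x \<bullet> b = h b x"
    by blast
  have "AE x in M. \<forall>b\<in>(Basis::'b set). g x \<bullet> b = h b x"
    by (intro AE_finite_allI h finite_Basis)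
  then have "AE x in M. g x = (\<Sum>b\<in>Basis. h b x *\<^sub>R b)"
  proof eventually_elim
    case (elim x)
    have "(\<Sum>b\<in>Basis. h b x *\<^sub>R b) = (\<Sum>b\<in>Basis. (g x \<bullet> b) *\<^sub>R b)" using elim by (intro sum.cong) auto
    then show ?case by (simp only: euclidean_representation)
  qed
  moreover have "(\<lambda>x. \<Sum>b\<in>Basis. h b x *\<^sub>R b) \<in> borel_measurable M"
    using h(1) by (intro borel_measurable_sum borel_measurable_scaleR) auto
  ultimately show ?thesis by (intro bexI[of _ "\<lambda>x. \<Sum>b\<in>Basis. h b x *\<^sub>R b"])
qed

text \<open>A pointwise limit along one subsequence already determines the L2 limit. Applied to
  functions and to their Slobodeckij quotients, it keeps the two limits consistent.\<close>

lemma L2_Cauchy_AE_limit: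
  fixes f :: "nat \<Rightarrow> 'a \<Rightarrow> 'b::euclidean_space"
  assumes f: "\<And>n. sq_int M (f n)"
    and C: "\<And>e. 0 < e \<Longrightarrow> \<exists>N. \<forall>m\<ge>N. \<forall>n\<ge>N. (\<integral>x. (norm (f m x - f n x))\<^sup>2 \<partial>M) < e"
    and r: "strict_mono (r :: nat \<Rightarrow> nat)" and g: "g \<in> borel_measurable M" and ae: "AE x in M. (\<lambda>k. f (r k) x) \<longlonglongrightarrow> g x"
  shows "sq_int M g" "(\<lambda>n. \<integral>x. (norm (f n x - g x))\<^sup>2 \<partial>M) \<longlonglongrightarrow> 0"
proof -
  obtain g' r' where g': "sq_int M g'" "(\<lambda>n. \<integral>x. (norm (f n x - g' x))\<^sup>2 \<partial>M) \<longlonglongrightarrow> 0"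
    by (rule Riesz_Fischer[OF f C])
  have "(\<lambda>n. \<integral>x. (norm (f (r n) x - g' x))\<^sup>2 \<partial>M) \<longlonglongrightarrow> 0"
    using LIMSEQ_subseq_LIMSEQ[OF g'(2) r] by (simp add: o_def)
  then obtain s where s: "strict_mono (s :: nat \<Rightarrow> nat)" "AE x in M. (\<lambda>k. f (r (s k)) x) \<longlonglongrightarrow> g' x"
    by (rule L2_tendsto_AE_subseq[OF f g'(1)])
  have eq: "AE x in M. g' x = g x" using ae s(2)
  proof eventually_elim
    case (elim x)
    from LIMSEQ_subseq_LIMSEQ[OF elim(1) s(1)] have "(\<lambda>k. f (r (s k)) x) \<longlonglongrightarrow> g x" by (simp add: o_def)
    with elim(2) show ?case by (rule LIMSEQ_unique)
  qed
  show "sq_int M g" by (rule sq_int_cong_AE[OF g'(1) g eq])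
  have "(\<integral>x. (norm (f n x - g x))\<^sup>2 \<partial>M) = (\<integral>x. (norm (f n x - g' x))\<^sup>2 \<partial>M)" for n
    using eq f[of n] g g'(1) by (intro integral_cong_AE) (auto simp: sq_int_def)
  with g'(2) show "(\<lambda>n. \<integral>x. (norm (f n x - g x))\<^sup>2 \<partial>M) \<longlonglongrightarrow> 0" by simp
qed

subsection \<open>The solution space\<close>

locale parabolic = fractional_order \<sigma> for \<sigma> :: real +
  fixes \<Omega> :: "(real ^ 'd) set" and T :: real
  assumes open_\<Omega>: "open \<Omega>" and bounded_\<Omega>: "bounded \<Omega>" and T_pos: "0 < T"
begin

abbreviation XT :: "((real ^ 'd) \<times> real) measure" where "XT \<equiv> lborel \<Otimes>\<^sub>M lborel"
abbreviation XTT :: "((real ^ 'd) \<times> real \<times> real) measure" where "XTT \<equiv> lborel \<Otimes>\<^sub>M lborel2"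
abbreviation D :: "((real ^ 'd) \<times> real) set" where "D \<equiv> cylinder \<Omega> T"

sublocale XTT: pair_sigma_finite "lborel :: (real ^ 'd) measure" lborel2 ..

lemma \<Omega>_borel [measurable]: "\<Omega> \<in> sets borel" using open_\<Omega> by (rule borel_open)

lemma \<Omega>_lebesgue [simp]: "\<Omega> \<in> sets lebesgue" by simp

lemma D_borel [measurable]: "D \<in> sets borel"
  unfolding cylinder_def by (intro borel_open open_Times open_\<Omega>) simp

lemma D_lebesgue [simp]: "D \<in> sets lebesgue" by simp

lemma sets_XT: "sets XT = sets borel"
  unfolding lborel_prod by (rule sets_lborel)

lemma D_XT [measurable]: "D \<in> sets XT" unfolding sets_XT by (rule D_borel)

lemma mem_D: "(x, t) \<in> D \<longleftrightarrow> x \<in> \<Omega> \<and> t \<in> {0<..<T}" by (simp add: cylinder_def)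

lemma AE_D_iff: "(AE p in lebesgue_on D. P p) \<longleftrightarrow> (AE p in XT. p \<in> D \<longrightarrow> P p)"
  using AE_lebesgue_on_iff[OF D_lebesgue, of P] by (simp only: lborel_prod)

lemma AE_D_slices:
  assumes "AE p in lebesgue_on D. P p"
  shows "AE t in lborel. t \<in> {0<..<T} \<longrightarrow> (AE x in lebesgue_on \<Omega>. P (x, t))"
    and "AE x in lborel. x \<in> \<Omega> \<longrightarrow> (AE t in lborel. t \<in> {0<..<T} \<longrightarrow> P (x, t))"
proof -
  note * = lborel_pair.AE_slices[OF assms[unfolded AE_D_iff]]
  show "AE t in lborel. t \<in> {0<..<T} \<longrightarrow> (AE x in lebesgue_on \<Omega>. P (x, t))"
    using *(2) unfolding AE_lebesgue_on_iff[OF \<Omega>_lebesgue]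
    by eventually_elim (auto simp: mem_D elim: eventually_mono)
  show "AE x in lborel. x \<in> \<Omega> \<longrightarrow> (AE t in lborel. t \<in> {0<..<T} \<longrightarrow> P (x, t))"
    using *(1) by eventually_elim (auto simp: mem_D elim: eventually_mono)
qed

text \<open>The converse of slicing relies on Fubini, hence on measurability of the set where
  \<open>P\<close> holds.\<close>

lemma AE_D_if_slices:
  assumes "AE t in lborel. t \<in> {0<..<T} \<longrightarrow> (AE x in lebesgue_on \<Omega>. P (x, t))"
    and [measurable]: "{p. P p} \<in> sets borel"
  shows "AE p in lebesgue_on D. P p"
proof -
  have [measurable]: "{p. P p} \<in> sets XT" using assms(2) unfolding sets_XT .
  have P1: "{p \<in> space XT. (\<lambda>x t. (x, t) \<in> D \<longrightarrow> P (x, t)) (fst p) (snd p)} \<in> sets XT"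
  proof -
    have "{p \<in> space XT. (\<lambda>x t. (x, t) \<in> D \<longrightarrow> P (x, t)) (fst p) (snd p)} = (- D) \<union> {p. P p}"
      by (auto simp: space_pair_measure)
    also have "\<dots> \<in> sets XT" using assms(2) D_borel unfolding sets_XT by (intro sets.Un sets.compl_sets borel_comp)
    finally show ?thesis .
  qed
  have "AE t in lborel. AE x in lborel. (x, t) \<in> D \<longrightarrow> P (x, t)"
    using assms(1) unfolding AE_lebesgue_on_iff[OF \<Omega>_lebesgue]
    by eventually_elim (auto simp: mem_D elim: eventually_mono)
  then have "AE x in lborel. AE t in lborel. (x, t) \<in> D \<longrightarrow> P (x, t)"
    using lborel_pair.AE_commute[OF P1] by simp
  then have "AE p in XT. p \<in> D \<longrightarrow> P p"
    using P1 by (intro lborel_pair.AE_pair_measure) auto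
  then show ?thesis unfolding AE_D_iff .
qed

text \<open>A Slobodeckij quotient evaluates a function at two times, so an exceptional set of
  \<open>(x, t)\<close> must be excluded at both.\<close>

lemma AE_XTT_if_XT:
  assumes "AE p in XT. P p"
  shows "AE w in XTT. P (fst w, fst (snd w)) \<and> P (fst w, snd (snd w))"
proof -
  obtain N where N: "N \<in> null_sets XT" "{p \<in> space XT. \<not> P p} \<subseteq> N"
    using assms by (auto elim!: AE_E simp: null_sets_def)
  have [measurable]: "N \<in> sets XT" using N by auto
  have "AE w in XTT. (fst w, fst (snd w)) \<notin> N \<and> (fst w, snd (snd w)) \<notin> N"
  proof (rule XTT.AE_pair_measure)
    show "{w \<in> space XTT. (fst w, fst (snd w)) \<notin> N \<and> (fst w, snd (snd w)) \<notin> N} \<in> sets XTT" by measurable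
    have *: "AE x in lborel. AE t in lborel. (x, t) \<notin> N" by (rule lborel_pair.AE_slices(1)[OF AE_not_in[OF N(1)]])
    show "AE x in lborel. AE w in lborel2. (fst (x, w), fst (snd (x, w))) \<notin> N \<and> (fst (x, w), snd (snd (x, w))) \<notin> N"
      using *
    proof eventually_elim
      case (elim x)
      show ?case unfolding fst_conv snd_conv
      proof (rule lborel_pair.AE_pair_measure)
        show "{w \<in> space lborel2. (x, fst w) \<notin> N \<and> (x, snd w) \<notin> N} \<in> sets lborel2" by measurable
        show "AE t in lborel. AE s in lborel. (x, fst (t, s)) \<notin> N \<and> (x, snd (t, s)) \<notin> N"
          using elim
        proof (rule eventually_mono)
          fix t assume "(x, t) \<notin> N"
          then show "AE s in lborel. (x, fst (t, s)) \<notin> N \<and> (x, snd (t, s)) \<notin> N" using elim by simp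
        qed
      qed
    qed
  qed
  then show ?thesis by eventually_elim (use N(2) in \<open>auto simp: space_pair_measure\<close>)
qed

lemma Hs_L2_sq_cong_AE:
  assumes "AE p in lebesgue_on D. u p = v p"
  shows "Hs_L2_sq \<Omega> T s u = Hs_L2_sq \<Omega> T s v"
proof -
  have *: "AE t in lebesgue. t \<in> {0<..<T} \<longrightarrow> (AE x in lebesgue_on \<Omega>. u (x, t) = v (x, t))"
    by (rule AE_completion[OF AE_D_slices(1)[OF assms]])
  have 1: "L2_sq \<Omega> (\<lambda>x. u (x, t)) = L2_sq \<Omega> (\<lambda>x. v (x, t))" if "AE x in lebesgue_on \<Omega>. u (x, t) = v (x, t)" for t
    using that by (intro L2_sq_cong_AE) auto
  have 2: "L2_sq \<Omega> (\<lambda>x. u (x, t) - u (x, r)) = L2_sq \<Omega> (\<lambda>x. v (x, t) - v (x, r))"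
    if "AE x in lebesgue_on \<Omega>. u (x, t) = v (x, t)" "AE x in lebesgue_on \<Omega>. u (x, r) = v (x, r)" for t r
  proof (rule L2_sq_cong_AE)
    show "AE x in lebesgue_on \<Omega>. u (x, t) - u (x, r) = v (x, t) - v (x, r)"
      using that by eventually_elim simp
  qed simp
  show ?thesis unfolding Hs_L2_sq_def
  proof (intro arg_cong2[where f="(+)"] nn_integral_cong_AE)
    show "AE t in lebesgue. L2_sq \<Omega> (\<lambda>x. u (x, t)) * indicator {0<..<T} t = L2_sq \<Omega> (\<lambda>x. v (x, t)) * indicator {0<..<T} t"
      using * by eventually_elim (auto simp: 1 indicator_def)
    show "AE t in lebesgue. (\<integral>\<^sup>+r\<in>{0<..<T}. L2_sq \<Omega> (\<lambda>x. u (x, t) - u (x, r)) * ennreal (\<bar>t - r\<bar> powr - (1 + 2 * s)) \<partial>lebesgue) * indicator {0<..<T} t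
       = (\<integral>\<^sup>+r\<in>{0<..<T}. L2_sq \<Omega> (\<lambda>x. v (x, t) - v (x, r)) * ennreal (\<bar>t - r\<bar> powr - (1 + 2 * s)) \<partial>lebesgue) * indicator {0<..<T} t"
      using *
    proof eventually_elim
      case t: (elim t)
      show ?case
      proof (cases "t \<in> {0<..<T}")
        case True
        have "(\<integral>\<^sup>+r\<in>{0<..<T}. L2_sq \<Omega> (\<lambda>x. u (x, t) - u (x, r)) * ennreal (\<bar>t - r\<bar> powr - (1 + 2 * s)) \<partial>lebesgue)
           = (\<integral>\<^sup>+r\<in>{0<..<T}. L2_sq \<Omega> (\<lambda>x. v (x, t) - v (x, r)) * ennreal (\<bar>t - r\<bar> powr - (1 + 2 * s)) \<partial>lebesgue)"
        proof (rule nn_integral_cong_AE, use * in eventually_elim)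
          case (elim r)
          show ?case
          proof (cases "r \<in> {0<..<T}")
            case r: True
            then show ?thesis using 2[of t r] elim t True by simp
          qed simp
        qed
        then show ?thesis by simp
      qed simp
    qed
  qed
qed

lemma nn_integral_XT_swap:
  assumes [measurable]: "(\<lambda>(x, t). f x t) \<in> borel_measurable XT"
  shows "(\<integral>\<^sup>+t. \<integral>\<^sup>+x. f x t \<partial>lborel \<partial>lborel) = (\<integral>\<^sup>+x. \<integral>\<^sup>+t. f x t \<partial>lborel \<partial>lborel)"
  by (rule lborel_pair.Fubini') fact

text \<open>The norm of L2-valued functions of time is rewritten as an integral over
  \<open>x\<close> of one-dimensional norms, so that the results on the line apply slice by
  slice.\<close>

lemma Hs_L2_sq_Fubini:
  assumes u: "u \<in> borel_measurable XT"
  shows "Hs_L2_sq \<Omega> T \<sigma> u = (\<integral>\<^sup>+x. indicator \<Omega> x * (L2I T (\<lambda>t. u (x, t)) + slobI T (\<lambda>t. u (x, t))) \<partial>lborel)"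
proof -
  note [measurable] = u
  let ?i = "indicator \<Omega> :: _ \<Rightarrow> ennreal" and ?j = "indicator {0<..<T} :: _ \<Rightarrow> ennreal"
  have A: "(\<integral>\<^sup>+t\<in>{0<..<T}. L2_sq \<Omega> (\<lambda>x. u (x, t)) \<partial>lebesgue) = (\<integral>\<^sup>+x. ?i x * L2I T (\<lambda>t. u (x, t)) \<partial>lborel)"
  proof -
    have "(\<integral>\<^sup>+t\<in>{0<..<T}. L2_sq \<Omega> (\<lambda>x. u (x, t)) \<partial>lebesgue) = (\<integral>\<^sup>+t. \<integral>\<^sup>+x. ?i x * (?j t * ennreal ((u (x, t))\<^sup>2)) \<partial>lborel \<partial>lborel)"
      unfolding nn_integral_completion L2_sq_def
    proof (rule nn_integral_cong)
      fix t :: real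
      have "(\<integral>\<^sup>+x. ennreal ((norm (u (x, t)))\<^sup>2) * ?i x \<partial>lborel) * ?j t = (\<integral>\<^sup>+x. ennreal ((norm (u (x, t)))\<^sup>2) * ?i x * ?j t \<partial>lborel)"
        by (rule nn_integral_multc[symmetric]) measurable
      then show "(\<integral>\<^sup>+x. ennreal ((norm (u (x, t)))\<^sup>2) * ?i x \<partial>lborel) * ?j t = (\<integral>\<^sup>+x. ?i x * (?j t * ennreal ((u (x, t))\<^sup>2)) \<partial>lborel)"
        by (simp add: mult_ac)
    qed
    also have "\<dots> = (\<integral>\<^sup>+x. \<integral>\<^sup>+t. ?i x * (?j t * ennreal ((u (x, t))\<^sup>2)) \<partial>lborel \<partial>lborel)"
      by (rule nn_integral_XT_swap) measurable
    also have "\<dots> = (\<integral>\<^sup>+x. ?i x * L2I T (\<lambda>t. u (x, t)) \<partial>lborel)"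
    proof (rule nn_integral_cong)
      fix x
      have "(\<integral>\<^sup>+t. ?i x * (?j t * ennreal ((u (x, t))\<^sup>2)) \<partial>lborel) = ?i x * (\<integral>\<^sup>+t. ?j t * ennreal ((u (x, t))\<^sup>2) \<partial>lborel)"
        by (rule nn_integral_cmult) measurable
      also have "(\<integral>\<^sup>+t. ?j t * ennreal ((u (x, t))\<^sup>2) \<partial>lborel) = L2I T (\<lambda>t. u (x, t))"
        unfolding L2I_def by (intro nn_integral_cong) (auto simp: indicator_def)
      finally show "(\<integral>\<^sup>+t. ?i x * (?j t * ennreal ((u (x, t))\<^sup>2)) \<partial>lborel) = ?i x * L2I T (\<lambda>t. u (x, t))" .
    qed
    finally show ?thesis .
  qed
  define F where "F x w = ?i x * ennreal (indicator ({0<..<T} \<times> {0<..<T}) w * (slob (\<lambda>t. u (x, t)) w)\<^sup>2)" for x w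
  have mF: "(\<lambda>(x, w). F x w) \<in> borel_measurable XTT"
    unfolding F_def slob_def by (simp add: case_prod_beta) measurable
  have F': "F x (t, r) = ?i x * (ennreal ((u (x, t) - u (x, r))\<^sup>2) * (ennreal (\<bar>t - r\<bar> powr - (1 + 2 * \<sigma>)) * (?j r * ?j t)))" for x t r
    by (auto simp: F_def slob_def indicator_def power_mult_distrib m_sq ennreal_mult[symmetric] mult_ac)
  have B: "(\<integral>\<^sup>+t\<in>{0<..<T}. (\<integral>\<^sup>+r\<in>{0<..<T}. L2_sq \<Omega> (\<lambda>x. u (x, t) - u (x, r)) * ennreal (\<bar>t - r\<bar> powr - (1 + 2 * \<sigma>)) \<partial>lebesgue) \<partial>lebesgue)
     = (\<integral>\<^sup>+x. ?i x * slobI T (\<lambda>t. u (x, t)) \<partial>lborel)"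
  proof -
    have "(\<integral>\<^sup>+t\<in>{0<..<T}. (\<integral>\<^sup>+r\<in>{0<..<T}. L2_sq \<Omega> (\<lambda>x. u (x, t) - u (x, r)) * ennreal (\<bar>t - r\<bar> powr - (1 + 2 * \<sigma>)) \<partial>lebesgue) \<partial>lebesgue)
       = (\<integral>\<^sup>+t. \<integral>\<^sup>+r. \<integral>\<^sup>+x. F x (t, r) \<partial>lborel \<partial>lborel \<partial>lborel)"
      unfolding nn_integral_completion L2_sq_def
    proof (rule nn_integral_cong)
      fix t :: real
      let ?g = "\<lambda>r x. ennreal ((norm (u (x, t) - u (x, r)))\<^sup>2) * ?i x"
      have [measurable]: "(\<lambda>(r, x). ?g r x) \<in> borel_measurable (lborel \<Otimes>\<^sub>M lborel)" by measurable
      have "(\<integral>\<^sup>+r. (\<integral>\<^sup>+x. ?g r x \<partial>lborel) * ennreal (\<bar>t - r\<bar> powr - (1 + 2 * \<sigma>)) * ?j r \<partial>lborel) * ?j t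
         = (\<integral>\<^sup>+r. (\<integral>\<^sup>+x. ?g r x \<partial>lborel) * ennreal (\<bar>t - r\<bar> powr - (1 + 2 * \<sigma>)) * ?j r * ?j t \<partial>lborel)"
        by (rule nn_integral_multc[symmetric]) measurable
      also have "\<dots> = (\<integral>\<^sup>+r. \<integral>\<^sup>+x. F x (t, r) \<partial>lborel \<partial>lborel)"
      proof (rule nn_integral_cong)
        fix r
        have "(\<integral>\<^sup>+x. ?g r x \<partial>lborel) * (ennreal (\<bar>t - r\<bar> powr - (1 + 2 * \<sigma>)) * ?j r * ?j t)
           = (\<integral>\<^sup>+x. ?g r x * (ennreal (\<bar>t - r\<bar> powr - (1 + 2 * \<sigma>)) * ?j r * ?j t) \<partial>lborel)"
          by (rule nn_integral_multc[symmetric]) measurable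
        also have "\<dots> = (\<integral>\<^sup>+x. F x (t, r) \<partial>lborel)" unfolding F' by (simp add: mult_ac)
        finally show "(\<integral>\<^sup>+x. ?g r x \<partial>lborel) * ennreal (\<bar>t - r\<bar> powr - (1 + 2 * \<sigma>)) * ?j r * ?j t = (\<integral>\<^sup>+x. F x (t, r) \<partial>lborel)"
          by (simp add: mult_ac)
      qed
      finally show "(\<integral>\<^sup>+r. (\<integral>\<^sup>+x. ?g r x \<partial>lborel) * ennreal (\<bar>t - r\<bar> powr - (1 + 2 * \<sigma>)) * ?j r \<partial>lborel) * ?j t = (\<integral>\<^sup>+r. \<integral>\<^sup>+x. F x (t, r) \<partial>lborel \<partial>lborel)" .
    qed
    also have "\<dots> = (\<integral>\<^sup>+w. \<integral>\<^sup>+x. F x w \<partial>lborel \<partial>lborel2)"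
    proof -
      have "(\<lambda>w. \<integral>\<^sup>+x. F x w \<partial>lborel) \<in> borel_measurable lborel2"
        using measurable_compose[OF measurable_pair_swap' mF] by (intro lborel.borel_measurable_nn_integral) (simp add: case_prod_beta)
      from nn_integral_lborel2[OF this] show ?thesis by simp
    qed
    also have "\<dots> = (\<integral>\<^sup>+x. \<integral>\<^sup>+w. F x w \<partial>lborel2 \<partial>lborel)" by (rule XTT.Fubini'[OF mF])
    also have "\<dots> = (\<integral>\<^sup>+x. ?i x * slobI T (\<lambda>t. u (x, t)) \<partial>lborel)"
    proof (rule nn_integral_cong)
      fix x
      have [measurable]: "slob (\<lambda>t. u (x, t)) \<in> borel_measurable lborel2" by (rule measurable_slob) measurable
      show "(\<integral>\<^sup>+w. F x w \<partial>lborel2) = ?i x * slobI T (\<lambda>t. u (x, t))"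
        unfolding F_def slobI_def by (rule nn_integral_cmult) measurable
    qed
    finally show ?thesis .
  qed
  have ms: "(\<lambda>x. ?i x * slobI T (\<lambda>t. u (x, t))) \<in> borel_measurable lborel"
  proof -
    have "(\<lambda>x. \<integral>\<^sup>+w. F x w \<partial>lborel2) \<in> borel_measurable lborel"
      using mF by (rule sigma_finite_measure.borel_measurable_nn_integral[OF sigma_finite_lborel2])
    moreover have "(\<integral>\<^sup>+w. F x w \<partial>lborel2) = ?i x * slobI T (\<lambda>t. u (x, t))" for x
    proof -
      have [measurable]: "slob (\<lambda>t. u (x, t)) \<in> borel_measurable lborel2" by (rule measurable_slob) measurable
      show ?thesis unfolding F_def slobI_def by (rule nn_integral_cmult) measurable
    qed
    ultimately show ?thesis by simp
  qed
  have ml: "(\<lambda>x. ?i x * L2I T (\<lambda>t. u (x, t))) \<in> borel_measurable lborel" unfolding L2I_def by measurable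
  show ?thesis
    unfolding Hs_L2_sq_def A B distrib_left by (rule nn_integral_add[OF ml ms, symmetric])
qed

end

lemma test_fun_zero: "test_fun \<Omega> (\<lambda>x. 0)"
  unfolding test_fun_def smooth_on_def using Ck_on_const by (intro conjI exI[of _ "{}"]) auto

lemma grad_zero: "grad (\<lambda>x. 0) x = 0"
  using frechet_derivative_at[OF has_derivative_const, of x 0] by (simp add: grad_def vec_eq_iff)

lemma H10_pair_zero:
  assumes \<Omega>: "\<Omega> \<in> sets lebesgue" shows "H10_pair \<Omega> (\<lambda>x. 0) (\<lambda>x. 0)"
  unfolding H10_pair_def weak_gradient_iff[OF \<Omega>]
  by (auto intro!: exI[of _ "\<lambda>x. 0"] simp: test_fun_zero grad_zero L2_sq_def)

lemma zero_Cinf_L2_zero: "0 < T \<Longrightarrow> zero_Cinf_L2 \<Omega> T (\<lambda>p. 0)"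
  unfolding zero_Cinf_L2_def by (auto intro!: exI[of _ "\<lambda>k p. 0"] exI[of _ T] simp: L2_def L2_sq_def)

lemma integral_lebesgue_on_le:
  fixes h :: "'a::euclidean_space \<Rightarrow> real"
  assumes h: "integrable lborel h" "\<And>x. 0 \<le> h x" and S [measurable]: "S \<in> sets borel"
  shows "(\<integral>x. h x \<partial>lebesgue_on S) \<le> (\<integral>x. h x \<partial>lborel)"
proof -
  have [measurable]: "h \<in> borel_measurable borel" using h(1) by auto
  have "(\<integral>x. h x \<partial>lebesgue_on S) = (\<integral>x. indicator S x *\<^sub>R h x \<partial>lebesgue)" by (simp add: integral_restrict_space)
  also have "\<dots> = (\<integral>x. indicator S x *\<^sub>R h x \<partial>lborel)" by (rule integral_completion) measurable
  also have "\<dots> \<le> (\<integral>x. h x \<partial>lborel)"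
    using h integrable_mult_indicator[OF _ h(1), of S] by (intro integral_mono) (auto simp: indicator_def)
  finally show ?thesis .
qed

lemma norm_fst_le_self: "norm (fst p) \<le> norm p" and norm_snd_le_self: "norm (snd p) \<le> norm p"
  for p :: "'a::real_normed_vector \<times> 'b::real_normed_vector"
  using norm_fst_le[of "fst p" "snd p"] norm_snd_le[of "snd p" "fst p"] by simp_all

lemma borel_measurable_fst_comp: "z \<in> borel_measurable M \<Longrightarrow> (\<lambda>p. fst (z p)) \<in> borel_measurable M"
  for z :: "'a \<Rightarrow> 'b::euclidean_space \<times> 'c::euclidean_space"
  by (erule measurable_compose) (intro borel_measurable_continuous_onI continuous_intros)

lemma borel_measurable_snd_comp: "z \<in> borel_measurable M \<Longrightarrow> (\<lambda>p. snd (z p)) \<in> borel_measurable M"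
  for z :: "'a \<Rightarrow> 'b::euclidean_space \<times> 'c::euclidean_space"
  by (erule measurable_compose) (intro borel_measurable_continuous_onI continuous_intros)

section \<open>Linear structure and completeness of the solution space\<close>

context parabolic
begin

text \<open>Elements of the spaces are measurable only for completed Lebesgue measure, while slicing
  and Fubini take place on products of Borel measures; zero outside the cylinder encodes the zero
  extension in time.\<close>

lemma Borel_representative:
  fixes u :: "(real ^ 'd) \<times> real \<Rightarrow> 'b::euclidean_space"
  assumes "u \<in> borel_measurable (lebesgue_on D)"
  obtains v where "v \<in> borel_measurable XT" "\<And>p. p \<notin> D \<Longrightarrow> v p = 0" "AE p in lebesgue_on D. u p = v p"
proof -
  have "(\<lambda>p. indicator D p *\<^sub>R u p) \<in> borel_measurable lebesgue"
    using assms by (simp add: borel_measurable_restrict_space_iff)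
  from completion_ex_borel_measurable_euclidean[OF this] obtain w where
    w: "w \<in> borel_measurable lborel" "AE p in lborel. indicator D p *\<^sub>R u p = w p" by blast
  have wX: "w \<in> borel_measurable XT" using w(1) by (simp add: lborel_prod)
  show thesis
  proof (rule that[of "\<lambda>p. indicator D p *\<^sub>R w p"])
    show "(\<lambda>p. indicator D p *\<^sub>R w p) \<in> borel_measurable XT" using wX by measurable
    show "AE p in lebesgue_on D. u p = indicator D p *\<^sub>R w p"
      unfolding AE_lebesgue_on_iff[OF D_lebesgue] using w(2) by eventually_elim (auto simp: indicator_def)
  qed simp
qed

lemma XT_measurable_imp_lebesgue_on_D:
  "v \<in> borel_measurable XT \<Longrightarrow> v \<in> borel_measurable (lebesgue_on D)"
  by (intro measurable_restrict_space1 measurable_completion) (simp add: lborel_prod)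

lemma ennreal_lincomb_sq_le:
  fixes x y :: real
  assumes "0 \<le> i"
  shows "ennreal (i * (a * x + b * y)\<^sup>2) \<le> ennreal (2 * a\<^sup>2) * ennreal (i * x\<^sup>2) + ennreal (2 * b\<^sup>2) * ennreal (i * y\<^sup>2)"
proof -
  have "i * (a * x + b * y)\<^sup>2 \<le> i * (2 * (a * x)\<^sup>2 + 2 * (b * y)\<^sup>2)"
    using sq_norm_add_le[of "a * x" "b * y"] assms by (intro mult_left_mono) auto
  also have "\<dots> = 2 * a\<^sup>2 * (i * x\<^sup>2) + 2 * b\<^sup>2 * (i * y\<^sup>2)" by (simp add: power_mult_distrib algebra_simps)
  finally show ?thesis using assms by (simp add: ennreal_mult[symmetric] ennreal_plus[symmetric] ennreal_leI del: ennreal_plus)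
qed

lemma L2I_lincomb_le:
  assumes [measurable]: "f \<in> borel_measurable borel" "g \<in> borel_measurable borel"
  shows "L2I T (\<lambda>t. a * f t + b * g t) \<le> ennreal (2 * a\<^sup>2) * L2I T f + ennreal (2 * b\<^sup>2) * L2I T g"
proof -
  have "L2I T (\<lambda>t. a * f t + b * g t) \<le> (\<integral>\<^sup>+t. ennreal (2 * a\<^sup>2) * ennreal (indicator {0<..<T} t * (f t)\<^sup>2) + ennreal (2 * b\<^sup>2) * ennreal (indicator {0<..<T} t * (g t)\<^sup>2) \<partial>lborel)"
    unfolding L2I_def by (intro nn_integral_mono ennreal_lincomb_sq_le) simp
  also have "\<dots> = ennreal (2 * a\<^sup>2) * L2I T f + ennreal (2 * b\<^sup>2) * L2I T g"
    unfolding L2I_def by (simp add: nn_integral_add nn_integral_cmult)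
  finally show ?thesis .
qed

lemma slob_lincomb: "slob (\<lambda>t. a * f t + b * g t) w = a * slob f w + b * slob g w"
  by (cases w) (simp add: slob_def algebra_simps)

lemma slobI_lincomb_le:
  assumes f: "f \<in> borel_measurable borel" and g: "g \<in> borel_measurable borel"
  shows "slobI T (\<lambda>t. a * f t + b * g t) \<le> ennreal (2 * a\<^sup>2) * slobI T f + ennreal (2 * b\<^sup>2) * slobI T g"
proof -
  note [measurable] = measurable_slob[OF f] measurable_slob[OF g]
  have "slobI T (\<lambda>t. a * f t + b * g t) \<le> (\<integral>\<^sup>+z. ennreal (2 * a\<^sup>2) * ennreal (indicator ({0<..<T} \<times> {0<..<T}) z * (slob f z)\<^sup>2)
      + ennreal (2 * b\<^sup>2) * ennreal (indicator ({0<..<T} \<times> {0<..<T}) z * (slob g z)\<^sup>2) \<partial>lborel2)"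
    unfolding slobI_def slob_lincomb by (intro nn_integral_mono ennreal_lincomb_sq_le) simp
  also have "\<dots> = ennreal (2 * a\<^sup>2) * slobI T f + ennreal (2 * b\<^sup>2) * slobI T g"
    unfolding slobI_def by (simp add: nn_integral_add nn_integral_cmult)
  finally show ?thesis .
qed

lemma measurable_L2I_slobI:
  assumes u: "u \<in> borel_measurable XT"
  shows "(\<lambda>x. L2I T (\<lambda>t. u (x, t)) + slobI T (\<lambda>t. u (x, t))) \<in> borel_measurable lborel"
proof -
  note [measurable] = u
  have "(\<lambda>(x, w). ennreal (indicator ({0<..<T} \<times> {0<..<T}) w * (slob (\<lambda>t. u (x, t)) w)\<^sup>2)) \<in> borel_measurable XTT"
    unfolding slob_def by (simp add: case_prod_beta) measurable
  then have "(\<lambda>x. slobI T (\<lambda>t. u (x, t))) \<in> borel_measurable lborel"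
    unfolding slobI_def by (rule sigma_finite_measure.borel_measurable_nn_integral[OF sigma_finite_lborel2])
  moreover have "(\<lambda>x. L2I T (\<lambda>t. u (x, t))) \<in> borel_measurable lborel" unfolding L2I_def by measurable
  ultimately show ?thesis by (rule borel_measurable_add[rotated])
qed

lemma Hs_L2_sq_lincomb_le:
  assumes "u \<in> borel_measurable (lebesgue_on D)" "v \<in> borel_measurable (lebesgue_on D)"
  shows "Hs_L2_sq \<Omega> T \<sigma> (\<lambda>p. a * u p + b * v p) \<le> ennreal (2 * a\<^sup>2) * Hs_L2_sq \<Omega> T \<sigma> u + ennreal (2 * b\<^sup>2) * Hs_L2_sq \<Omega> T \<sigma> v"
proof -
  obtain u' where u': "u' \<in> borel_measurable XT" "AE p in lebesgue_on D. u p = u' p" by (rule Borel_representative[OF assms(1)])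
  obtain v' where v': "v' \<in> borel_measurable XT" "AE p in lebesgue_on D. v p = v' p" by (rule Borel_representative[OF assms(2)])
  note [measurable] = u'(1) v'(1)
  have "AE p in lebesgue_on D. a * u p + b * v p = a * u' p + b * v' p" using u'(2) v'(2) by eventually_elim simp
  then have "Hs_L2_sq \<Omega> T \<sigma> (\<lambda>p. a * u p + b * v p) = Hs_L2_sq \<Omega> T \<sigma> (\<lambda>p. a * u' p + b * v' p)" by (rule Hs_L2_sq_cong_AE)
  also have "\<dots> = (\<integral>\<^sup>+x. indicator \<Omega> x * (L2I T (\<lambda>t. a * u' (x, t) + b * v' (x, t)) + slobI T (\<lambda>t. a * u' (x, t) + b * v' (x, t))) \<partial>lborel)"
    by (rule Hs_L2_sq_Fubini) measurable
  also have "\<dots> \<le> (\<integral>\<^sup>+x. ennreal (2 * a\<^sup>2) * (indicator \<Omega> x * (L2I T (\<lambda>t. u' (x, t)) + slobI T (\<lambda>t. u' (x, t))))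
      + ennreal (2 * b\<^sup>2) * (indicator \<Omega> x * (L2I T (\<lambda>t. v' (x, t)) + slobI T (\<lambda>t. v' (x, t)))) \<partial>lborel)"
  proof (rule nn_integral_mono)
    fix x
    have m: "(\<lambda>t. u' (x, t)) \<in> borel_measurable borel" "(\<lambda>t. v' (x, t)) \<in> borel_measurable borel" by measurable
    have "L2I T (\<lambda>t. a * u' (x, t) + b * v' (x, t)) + slobI T (\<lambda>t. a * u' (x, t) + b * v' (x, t))
      \<le> ennreal (2 * a\<^sup>2) * (L2I T (\<lambda>t. u' (x, t)) + slobI T (\<lambda>t. u' (x, t))) + ennreal (2 * b\<^sup>2) * (L2I T (\<lambda>t. v' (x, t)) + slobI T (\<lambda>t. v' (x, t)))"
      using add_mono[OF L2I_lincomb_le[OF m, of a b] slobI_lincomb_le[OF m, of a b]] by (simp add: distrib_left add_ac)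
    then show "indicator \<Omega> x * (L2I T (\<lambda>t. a * u' (x, t) + b * v' (x, t)) + slobI T (\<lambda>t. a * u' (x, t) + b * v' (x, t)))
       \<le> ennreal (2 * a\<^sup>2) * (indicator \<Omega> x * (L2I T (\<lambda>t. u' (x, t)) + slobI T (\<lambda>t. u' (x, t))))
      + ennreal (2 * b\<^sup>2) * (indicator \<Omega> x * (L2I T (\<lambda>t. v' (x, t)) + slobI T (\<lambda>t. v' (x, t))))"
      by (cases "x \<in> \<Omega>") simp_all
  qed
  also have "\<dots> = ennreal (2 * a\<^sup>2) * (\<integral>\<^sup>+x. indicator \<Omega> x * (L2I T (\<lambda>t. u' (x, t)) + slobI T (\<lambda>t. u' (x, t))) \<partial>lborel)
      + ennreal (2 * b\<^sup>2) * (\<integral>\<^sup>+x. indicator \<Omega> x * (L2I T (\<lambda>t. v' (x, t)) + slobI T (\<lambda>t. v' (x, t))) \<partial>lborel)"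
    using measurable_L2I_slobI[OF u'(1)] measurable_L2I_slobI[OF v'(1)] by (subst nn_integral_add) (auto simp: nn_integral_cmult)
  also have "\<dots> = ennreal (2 * a\<^sup>2) * Hs_L2_sq \<Omega> T \<sigma> u' + ennreal (2 * b\<^sup>2) * Hs_L2_sq \<Omega> T \<sigma> v'"
    unfolding Hs_L2_sq_Fubini[OF u'(1)] Hs_L2_sq_Fubini[OF v'(1)] ..
  also have "\<dots> = ennreal (2 * a\<^sup>2) * Hs_L2_sq \<Omega> T \<sigma> u + ennreal (2 * b\<^sup>2) * Hs_L2_sq \<Omega> T \<sigma> v"
    unfolding Hs_L2_sq_cong_AE[OF u'(2)] Hs_L2_sq_cong_AE[OF v'(2)] ..
  finally show ?thesis .
qed

lemma zero_Hs_L2_limit: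
  assumes u: "u \<in> borel_measurable (lebesgue_on D)" "Hs_L2_sq \<Omega> T \<sigma> u < \<infinity>"
    and a: "\<And>e. 0 < e \<Longrightarrow> \<exists>v. zero_Hs_L2 \<Omega> T \<sigma> v \<and> Hs_L2_sq \<Omega> T \<sigma> (\<lambda>p. u p - v p) < ennreal e"
  shows "zero_Hs_L2 \<Omega> T \<sigma> u"
  unfolding zero_Hs_L2_def
proof (intro conjI allI impI u)
  fix \<epsilon> :: ennreal assume "0 < \<epsilon>"
  then obtain e where e: "0 < e" "ennreal e \<le> \<epsilon>" by (rule ennreal_approx_real)
  then obtain v where v: "zero_Hs_L2 \<Omega> T \<sigma> v" "Hs_L2_sq \<Omega> T \<sigma> (\<lambda>p. u p - v p) < ennreal (e/5)" using a[of "e/5"] by auto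
  have "(0::ennreal) < ennreal (e/5)" using e by simp
  then obtain w where w: "zero_Cinf_L2 \<Omega> T w" "Hs_L2_sq \<Omega> T \<sigma> (\<lambda>p. v p - w p) < ennreal (e/5)"
    using v(1) unfolding zero_Hs_L2_def by blast
  have mv: "v \<in> borel_measurable (lebesgue_on D)" using v(1) by (simp add: zero_Hs_L2_def)
  have mw: "w \<in> borel_measurable (lebesgue_on D)" using w(1) by (simp add: zero_Cinf_L2_def)
  have "Hs_L2_sq \<Omega> T \<sigma> (\<lambda>p. u p - w p) = Hs_L2_sq \<Omega> T \<sigma> (\<lambda>p. 1 * (u p - v p) + 1 * (v p - w p))" by simp
  also have "\<dots> \<le> ennreal (2 * 1\<^sup>2) * Hs_L2_sq \<Omega> T \<sigma> (\<lambda>p. u p - v p) + ennreal (2 * 1\<^sup>2) * Hs_L2_sq \<Omega> T \<sigma> (\<lambda>p. v p - w p)"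
    using u mv mw by (intro Hs_L2_sq_lincomb_le borel_measurable_diff)
  also have "\<dots> < ennreal e" by (rule ennreal_sum_less[OF v(2) _ _ w(2)]) (use e in auto)
  also have "\<dots> \<le> \<epsilon>" by (rule e(2))
  finally show "\<exists>w. zero_Cinf_L2 \<Omega> T w \<and> Hs_L2_sq \<Omega> T \<sigma> (\<lambda>p. u p - w p) < \<epsilon>" using w(1) by blast
qed

lemma zero_Hs_L2_lincomb:
  assumes u: "zero_Hs_L2 \<Omega> T \<sigma> u" and v: "zero_Hs_L2 \<Omega> T \<sigma> v"
  shows "zero_Hs_L2 \<Omega> T \<sigma> (\<lambda>p. a * u p + b * v p)"
proof -
  have m: "u \<in> borel_measurable (lebesgue_on D)" "v \<in> borel_measurable (lebesgue_on D)"
    and fin: "Hs_L2_sq \<Omega> T \<sigma> u < \<infinity>" "Hs_L2_sq \<Omega> T \<sigma> v < \<infinity>"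
    using u v by (auto simp: zero_Hs_L2_def)
  show ?thesis unfolding zero_Hs_L2_def
  proof (intro conjI allI impI)
    show "(\<lambda>p. a * u p + b * v p) \<in> borel_measurable (lebesgue_on D)" using m by measurable
    show "Hs_L2_sq \<Omega> T \<sigma> (\<lambda>p. a * u p + b * v p) < \<infinity>"
      using le_less_trans[OF Hs_L2_sq_lincomb_le[OF m, of a b]] fin by (simp add: ennreal_mult_less_top)
    fix \<epsilon> :: ennreal assume "0 < \<epsilon>"
    then obtain e where e: "0 < e" "ennreal e \<le> \<epsilon>" by (rule ennreal_approx_real)
    define r where "r = e / (2 * a\<^sup>2 + 2 * b\<^sup>2 + 1)"
    have den: "0 < 2 * a\<^sup>2 + 2 * b\<^sup>2 + 1" by (simp add: add_nonneg_pos)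
    then have r: "(0::ennreal) < ennreal r" using e by (simp add: r_def)
    have rs: "2 * a\<^sup>2 * r + 2 * b\<^sup>2 * r < e"
    proof -
      have "2 * a\<^sup>2 * r + 2 * b\<^sup>2 * r < (2 * a\<^sup>2 + 2 * b\<^sup>2 + 1) * r" using r by (simp add: algebra_simps)
      also have "\<dots> = e" using den by (simp add: r_def)
      finally show ?thesis .
    qed
    obtain w where w: "zero_Cinf_L2 \<Omega> T w" "Hs_L2_sq \<Omega> T \<sigma> (\<lambda>p. u p - w p) < ennreal r"
      using u r unfolding zero_Hs_L2_def by blast
    obtain w' where w': "zero_Cinf_L2 \<Omega> T w'" "Hs_L2_sq \<Omega> T \<sigma> (\<lambda>p. v p - w' p) < ennreal r"
      using v r unfolding zero_Hs_L2_def by blast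
    have mw: "(\<lambda>p. u p - w p) \<in> borel_measurable (lebesgue_on D)" "(\<lambda>p. v p - w' p) \<in> borel_measurable (lebesgue_on D)"
      using m w(1) w'(1) by (auto simp: zero_Cinf_L2_def)
    have "Hs_L2_sq \<Omega> T \<sigma> (\<lambda>p. (a * u p + b * v p) - (a * w p + b * w' p)) = Hs_L2_sq \<Omega> T \<sigma> (\<lambda>p. a * (u p - w p) + b * (v p - w' p))"
      by (simp add: algebra_simps)
    also have "\<dots> \<le> ennreal (2 * a\<^sup>2) * Hs_L2_sq \<Omega> T \<sigma> (\<lambda>p. u p - w p) + ennreal (2 * b\<^sup>2) * Hs_L2_sq \<Omega> T \<sigma> (\<lambda>p. v p - w' p)"
      by (rule Hs_L2_sq_lincomb_le[OF mw])
    also have "\<dots> < ennreal e" by (rule ennreal_sum_less[OF w(2) _ _ w'(2) rs]) auto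
    also have "\<dots> \<le> \<epsilon>" by (rule e(2))
    finally show "\<exists>w. zero_Cinf_L2 \<Omega> T w \<and> Hs_L2_sq \<Omega> T \<sigma> (\<lambda>p. a * u p + b * v p - w p) < \<epsilon>"
      using zero_Cinf_L2_lincomb[OF \<Omega>_lebesgue w(1) w'(1)] by blast
  qed
qed

text \<open>
  An element of the solution space is stored as a Borel function with values \<open>(u, \<nabla>u)\<close>, extended
  by zero outside the cylinder; \<open>Hz z (x, t, s)\<close> is the integrand of the Slobodeckij seminorm on
  the whole time axis.
\<close>

definition Hz :: "((real ^ 'd) \<times> real \<Rightarrow> real \<times> (real ^ 'd)) \<Rightarrow> (real ^ 'd) \<times> real \<times> real \<Rightarrow> real" where
  "Hz z w = slob (\<lambda>t. fst (z (fst w, t))) (snd w)"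

definition V :: "((real ^ 'd) \<times> real \<Rightarrow> real \<times> (real ^ 'd)) set" where
  "V = {z. z \<in> borel_measurable XT \<and> (\<forall>p. p \<notin> D \<longrightarrow> z p = 0) \<and> sq_int XT z \<and> sq_int XTT (Hz z) \<and>
     (AE t in lborel. t \<in> {0<..<T} \<longrightarrow> H10_pair \<Omega> (\<lambda>x. fst (z (x, t))) (\<lambda>x. snd (z (x, t)))) \<and>
     zero_Hs_L2 \<Omega> T \<sigma> (\<lambda>p. fst (z p))}"

lemma V_D:
  assumes "z \<in> V"
  shows "z \<in> borel_measurable XT" "\<And>p. p \<notin> D \<Longrightarrow> z p = 0" "sq_int XT z" "sq_int XTT (Hz z)"
    "AE t in lborel. t \<in> {0<..<T} \<longrightarrow> H10_pair \<Omega> (\<lambda>x. fst (z (x, t))) (\<lambda>x. snd (z (x, t)))"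
    "zero_Hs_L2 \<Omega> T \<sigma> (\<lambda>p. fst (z p))"
  using assms by (auto simp: V_def)

lemma Hz_measurable: "z \<in> borel_measurable XT \<Longrightarrow> Hz z \<in> borel_measurable XTT"
proof -
  assume "z \<in> borel_measurable XT"
  define u where "u p = fst (z p)" for p
  have [measurable]: "u \<in> borel_measurable XT"
    unfolding u_def[abs_def] using \<open>z \<in> borel_measurable XT\<close> by (rule borel_measurable_fst_comp)
  show "Hz z \<in> borel_measurable XTT"
    unfolding Hz_def[abs_def] slob_def u_def[symmetric] by (simp add: case_prod_beta) measurable
qed

lemma Hz_lincomb: "Hz (\<lambda>p. a *\<^sub>R z p + b *\<^sub>R z' p) w = a * Hz z w + b * Hz z' w"
  by (simp add: Hz_def slob_lincomb)

lemma V_lincomb: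
  assumes z: "z \<in> V" and z': "z' \<in> V"
  shows "(\<lambda>p. a *\<^sub>R z p + b *\<^sub>R z' p) \<in> V"
  unfolding V_def mem_Collect_eq
proof (intro conjI allI impI)
  note z = V_D[OF z] and z' = V_D[OF z']
  note [measurable] = z(1) z'(1)
  show "(\<lambda>p. a *\<^sub>R z p + b *\<^sub>R z' p) \<in> borel_measurable XT" by measurable
  show "a *\<^sub>R z p + b *\<^sub>R z' p = 0" if "p \<notin> D" for p using z(2)[OF that] z'(2)[OF that] by simp
  show "sq_int XT (\<lambda>p. a *\<^sub>R z p + b *\<^sub>R z' p)" using z(3) z'(3) by (intro sq_int_add sq_int_scaleR)
  have "sq_int XTT (\<lambda>w. a * Hz z w + b * Hz z' w)" using z(4) z'(4) by (intro sq_int_add sq_int_cmult)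
  then show "sq_int XTT (Hz (\<lambda>p. a *\<^sub>R z p + b *\<^sub>R z' p))" by (simp add: Hz_lincomb[abs_def])
  show "AE t in lborel. t \<in> {0<..<T} \<longrightarrow> H10_pair \<Omega> (\<lambda>x. fst (a *\<^sub>R z (x, t) + b *\<^sub>R z' (x, t))) (\<lambda>x. snd (a *\<^sub>R z (x, t) + b *\<^sub>R z' (x, t)))"
    using z(5) z'(5)
  proof eventually_elim
    case (elim t)
    then show ?case using H10_pair_lincomb[OF \<Omega>_lebesgue, of "\<lambda>x. fst (z (x, t))" "\<lambda>x. snd (z (x, t))" "\<lambda>x. fst (z' (x, t))" "\<lambda>x. snd (z' (x, t))" a b] by simp
  qed
  show "zero_Hs_L2 \<Omega> T \<sigma> (\<lambda>p. fst (a *\<^sub>R z p + b *\<^sub>R z' p))"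
    using zero_Hs_L2_lincomb[OF z(6) z'(6), of a b] by simp
qed

lemma V_zero: "(\<lambda>p. 0) \<in> V"
proof -
  have "Hz (\<lambda>p. 0) = (\<lambda>w. 0)" by (auto simp: Hz_def slob_def)
  moreover have "Hs_L2_sq \<Omega> T \<sigma> (\<lambda>p. 0) = 0" by (simp add: Hs_L2_sq_def L2_sq_def)
  ultimately show ?thesis
    using zero_Cinf_L2_zero[OF T_pos, of \<Omega>] H10_pair_zero[OF \<Omega>_lebesgue]
    by (auto simp: V_def zero_Hs_L2_def intro!: exI[of _ "\<lambda>p. 0"])
qed

lemma XTT_nn_integral:
  assumes "z \<in> borel_measurable XT"
  shows "(\<integral>\<^sup>+w. ennreal ((Hz z w)\<^sup>2) \<partial>XTT) = (\<integral>\<^sup>+x. \<integral>\<^sup>+w. ennreal ((slob (\<lambda>t. fst (z (x, t))) w)\<^sup>2) \<partial>lborel2 \<partial>lborel)"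
proof -
  note [measurable] = Hz_measurable[OF assms]
  have "(\<integral>\<^sup>+x. \<integral>\<^sup>+w. ennreal ((Hz z (x, w))\<^sup>2) \<partial>lborel2 \<partial>lborel) = (\<integral>\<^sup>+w. ennreal ((Hz z w)\<^sup>2) \<partial>XTT)"
    by (rule sigma_finite_measure.nn_integral_fst[OF sigma_finite_lborel2]) measurable
  then show ?thesis by (simp add: Hz_def)
qed

lemma Hs_L2_sq_le:
  assumes [measurable]: "z \<in> borel_measurable XT" and z: "\<And>p. p \<notin> D \<Longrightarrow> z p = 0"
  shows "Hs_L2_sq \<Omega> T \<sigma> (\<lambda>p. fst (z p)) \<le> (\<integral>\<^sup>+p. ennreal ((norm (z p))\<^sup>2) \<partial>XT) + (\<integral>\<^sup>+w. ennreal ((Hz z w)\<^sup>2) \<partial>XTT)"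
proof -
  let ?u = "\<lambda>x t. fst (z (x, t))"
  have mH: "(\<lambda>x. \<integral>\<^sup>+w. ennreal ((slob (?u x) w)\<^sup>2) \<partial>lborel2) \<in> borel_measurable lborel"
  proof -
    note [measurable] = Hz_measurable[OF assms(1)]
    have "(\<lambda>(x, w). ennreal ((Hz z (x, w))\<^sup>2)) \<in> borel_measurable XTT" by measurable
    from sigma_finite_measure.borel_measurable_nn_integral[OF sigma_finite_lborel2 this] show ?thesis by (simp add: Hz_def)
  qed
  have "Hs_L2_sq \<Omega> T \<sigma> (\<lambda>p. fst (z p)) = (\<integral>\<^sup>+x. indicator \<Omega> x * (L2I T (?u x) + slobI T (?u x)) \<partial>lborel)"
    by (rule Hs_L2_sq_Fubini[OF borel_measurable_fst_comp[OF assms(1)]])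
  also have "\<dots> \<le> (\<integral>\<^sup>+x. (\<integral>\<^sup>+t. ennreal ((norm (z (x, t)))\<^sup>2) \<partial>lborel) + (\<integral>\<^sup>+w. ennreal ((slob (?u x) w)\<^sup>2) \<partial>lborel2) \<partial>lborel)"
  proof (rule nn_integral_mono)
    fix x
    have "(\<lambda>t. z (x, t)) \<in> borel_measurable borel" by measurable
    then have m: "?u x \<in> borel_measurable borel" by (rule borel_measurable_fst_comp)
    have s: "?u x t = 0" if "t \<notin> {0<..<T}" for t using z[of "(x, t)"] that by (simp add: mem_D)
    have "L2I T (?u x) \<le> (\<integral>\<^sup>+t. ennreal ((norm (z (x, t)))\<^sup>2) \<partial>lborel)"
      unfolding L2I_def
    proof (intro nn_integral_mono ennreal_leI)
      fix t
      have "\<bar>?u x t\<bar> \<le> norm (z (x, t))" using norm_fst_le_self[of "z (x, t)"] by simp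
      from power_mono[OF this, of 2] show "indicator {0<..<T} t * (?u x t)\<^sup>2 \<le> (norm (z (x, t)))\<^sup>2" by (auto simp: indicator_def)
    qed
    moreover have "slobI T (?u x) \<le> (\<integral>\<^sup>+w. ennreal ((slob (?u x) w)\<^sup>2) \<partial>lborel2)" by (rule slob_lower(1)[OF T_pos m s])
    ultimately have "L2I T (?u x) + slobI T (?u x) \<le> (\<integral>\<^sup>+t. ennreal ((norm (z (x, t)))\<^sup>2) \<partial>lborel) + (\<integral>\<^sup>+w. ennreal ((slob (?u x) w)\<^sup>2) \<partial>lborel2)" by (rule add_mono)
    then show "indicator \<Omega> x * (L2I T (?u x) + slobI T (?u x)) \<le> (\<integral>\<^sup>+t. ennreal ((norm (z (x, t)))\<^sup>2) \<partial>lborel) + (\<integral>\<^sup>+w. ennreal ((slob (?u x) w)\<^sup>2) \<partial>lborel2)"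
      by (auto simp: indicator_def)
  qed
  also have "\<dots> = (\<integral>\<^sup>+x. \<integral>\<^sup>+t. ennreal ((norm (z (x, t)))\<^sup>2) \<partial>lborel \<partial>lborel) + (\<integral>\<^sup>+x. \<integral>\<^sup>+w. ennreal ((slob (?u x) w)\<^sup>2) \<partial>lborel2 \<partial>lborel)"
    by (rule nn_integral_add[OF _ mH]) measurable
  also have "\<dots> = (\<integral>\<^sup>+p. ennreal ((norm (z p))\<^sup>2) \<partial>XT) + (\<integral>\<^sup>+w. ennreal ((Hz z w)\<^sup>2) \<partial>XTT)"
    unfolding XTT_nn_integral[OF assms(1)] by (subst lborel.nn_integral_fst) auto
  finally show ?thesis .
qed

text \<open>The Slobodeckij part runs over the whole time axis instead of \<open>(0, T)\<close>. By
  Hardy the norm is equivalent to that of \<open>B_space\<close>, and in this form the fractional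
  part of the equation is an exact multiple of it.\<close>

definition ip :: "((real ^ 'd) \<times> real \<Rightarrow> real \<times> (real ^ 'd)) \<Rightarrow> ((real ^ 'd) \<times> real \<Rightarrow> real \<times> (real ^ 'd)) \<Rightarrow> real" where
  "ip z z' = (\<integral>p. z p \<bullet> z' p \<partial>XT) + (\<integral>w. Hz z w * Hz z' w \<partial>XTT)"

lemma ip_self: "ip z z = (\<integral>p. (norm (z p))\<^sup>2 \<partial>XT) + (\<integral>w. (Hz z w)\<^sup>2 \<partial>XTT)"
  by (simp add: ip_def power2_norm_eq_inner power2_eq_square[of "Hz z _"])

lemma Hs_L2_sq_le_ip:
  assumes "z \<in> V" shows "Hs_L2_sq \<Omega> T \<sigma> (\<lambda>p. fst (z p)) \<le> ennreal (ip z z)"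
proof -
  note z = V_D[OF assms]
  from Hs_L2_sq_le[OF z(1,2)] show ?thesis
    using sq_int_nn_integral_eq[OF z(3)] sq_int_nn_integral_eq[OF z(4)]
    by (simp add: ip_self ennreal_plus[symmetric] del: ennreal_plus)
qed

text \<open>Convergence in L2 of the cylinder gives, along a subsequence, convergence in L2 of
  almost every time slice, where closedness of the pairs applies.\<close>

lemma H10_slices_limit:
  assumes s: "\<And>n. s n \<in> V" and z: "z \<in> borel_measurable XT" "sq_int XT z"
    and l: "(\<lambda>n. \<integral>p. (norm (s n p - z p))\<^sup>2 \<partial>XT) \<longlonglongrightarrow> 0"
  shows "AE t in lborel. t \<in> {0<..<T} \<longrightarrow> H10_pair \<Omega> (\<lambda>x. fst (z (x, t))) (\<lambda>x. snd (z (x, t)))"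
proof -
  define F where "F n t = (\<integral>x. (norm (s n (x, t) - z (x, t)))\<^sup>2 \<partial>lborel)" for n t
  have sz: "sq_int XT (\<lambda>p. s n p - z p)" for n by (rule sq_int_diff[OF V_D(3)[OF s] z(2)])
  have i: "integrable XT (\<lambda>(x, t). (norm (s n (x, t) - z (x, t)))\<^sup>2)" for n
    using sq_int_integrable[OF sz[of n]] by (simp add: case_prod_unfold)
  have iF: "integrable lborel (F n)" for n unfolding F_def[abs_def] by (rule lborel_pair.integrable_snd[OF i])
  have F0: "0 \<le> F n t" for n t by (simp add: F_def)
  have IF: "(\<integral>t. F n t \<partial>lborel) = (\<integral>p. (norm (s n p - z p))\<^sup>2 \<partial>XT)" for n
    unfolding F_def using lborel_pair.integral_snd[OF i[of n]] by (simp add: case_prod_unfold)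
  \<comment> \<open>The slice errors converge in L1; taking roots turns this into the L2 convergence
    required for extracting a subsequence.\<close>
  have "sq_int lborel (\<lambda>t. sqrt (F n t))" for n
    using iF[of n] F0 by (auto simp: sq_int_real_iff)
  moreover have "(\<lambda>n. \<integral>t. (norm (sqrt (F n t) - 0))\<^sup>2 \<partial>lborel) \<longlonglongrightarrow> 0"
    using l F0 by (simp add: IF)
  ultimately obtain r where r: "strict_mono (r :: nat \<Rightarrow> nat)" "AE t in lborel. (\<lambda>k. sqrt (F (r k) t)) \<longlonglongrightarrow> 0"
    using L2_tendsto_AE_subseq[of lborel "\<lambda>n t. sqrt (F n t)" "\<lambda>t. 0"] by auto
  have "AE t in lborel. \<forall>n. t \<in> {0<..<T} \<longrightarrow> H10_pair \<Omega> (\<lambda>x. fst (s n (x, t))) (\<lambda>x. snd (s n (x, t)))"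
    unfolding AE_all_countable using V_D(5)[OF s] by blast
  moreover have "AE t in lborel. \<forall>n. integrable lborel (\<lambda>x. (norm (s n (x, t) - z (x, t)))\<^sup>2)"
    unfolding AE_all_countable using lborel_pair.AE_integrable_snd[OF i] by blast
  moreover have "AE t in lborel. integrable lborel (\<lambda>x. (norm (z (x, t)))\<^sup>2)"
    using lborel_pair.AE_integrable_snd[of "\<lambda>x t. (norm (z (x, t)))\<^sup>2"] sq_int_integrable[OF z(2)] by (simp add: case_prod_unfold)
  ultimately show ?thesis using r(2)
  proof eventually_elim
    case (elim t)
    note [measurable] = z(1) V_D(1)[OF s] borel_measurable_fst_comp[OF z(1)] borel_measurable_snd_comp[OF z(1)]
      borel_measurable_fst_comp[OF V_D(1)[OF s]] borel_measurable_snd_comp[OF V_D(1)[OF s]]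
    have lim: "(\<lambda>k. F (r k) t) \<longlonglongrightarrow> 0" using tendsto_power[OF elim(4), of 2] F0 by simp
    have szt: "sq_int lborel (\<lambda>x. z (x, t))" using elim(3) by (simp add: sq_int_def)
    have le1: "(norm (fst a - fst b))\<^sup>2 \<le> (norm (a - b))\<^sup>2" and le2: "(norm (snd a - snd b))\<^sup>2 \<le> (norm (a - b))\<^sup>2" for a b :: "real \<times> (real ^ 'd)"
      using power_mono[OF norm_fst_le_self[of "a - b"], of 2] power_mono[OF norm_snd_le_self[of "a - b"], of 2] by simp_all
    have ii: "integrable lborel (\<lambda>x. (norm (s (r n) (x, t) - z (x, t)))\<^sup>2)" for n using elim(2) by blast
    have i1: "integrable lborel (\<lambda>x. (norm (fst (s (r n) (x, t)) - fst (z (x, t))))\<^sup>2)" for n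
      by (rule Bochner_Integration.integrable_bound[OF ii[of n]], measurable) (use le1 in simp)
    have i2: "integrable lborel (\<lambda>x. (norm (snd (s (r n) (x, t)) - snd (z (x, t))))\<^sup>2)" for n
      by (rule Bochner_Integration.integrable_bound[OF ii[of n]], measurable) (use le2 in simp)
    show ?case
    proof
      assume t: "t \<in> {0<..<T}"
      show "H10_pair \<Omega> (\<lambda>x. fst (z (x, t))) (\<lambda>x. snd (z (x, t)))"
      proof (rule H10_pair_limit[OF \<Omega>_lebesgue])
        show "H10_pair \<Omega> (\<lambda>x. fst (s (r n) (x, t))) (\<lambda>x. snd (s (r n) (x, t)))" for n using elim(1) t by blast
        have "sq_int lborel (\<lambda>x. fst (z (x, t)))"
          by (rule sq_int_bound[OF szt borel_measurable_fst_comp[OF sq_int_measurable[OF szt]] AE_I2[OF norm_fst_le_self]])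
        then show "sq_int (lebesgue_on \<Omega>) (\<lambda>x. fst (z (x, t)))" by (rule sq_int_lborel_imp_lebesgue_on) simp
        have "sq_int lborel (\<lambda>x. snd (z (x, t)))"
          by (rule sq_int_bound[OF szt borel_measurable_snd_comp[OF sq_int_measurable[OF szt]] AE_I2[OF norm_snd_le_self]])
        then show "sq_int (lebesgue_on \<Omega>) (\<lambda>x. snd (z (x, t)))" by (rule sq_int_lborel_imp_lebesgue_on) simp
        show "(\<lambda>n. \<integral>x. (norm (fst (s (r n) (x, t)) - fst (z (x, t))))\<^sup>2 \<partial>lebesgue_on \<Omega>) \<longlonglongrightarrow> 0"
        proof (rule tendsto_sandwich[OF always_eventually always_eventually tendsto_const lim])
          show "\<forall>n. (\<integral>x. (norm (fst (s (r n) (x, t)) - fst (z (x, t))))\<^sup>2 \<partial>lebesgue_on \<Omega>) \<le> F (r n) t"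
            unfolding F_def using integral_lebesgue_on_le[OF i1 _ \<Omega>_borel] integral_mono[OF i1 ii le1] by (auto intro: order_trans)
        qed simp
        show "(\<lambda>n. \<integral>x. (norm (snd (s (r n) (x, t)) - snd (z (x, t))))\<^sup>2 \<partial>lebesgue_on \<Omega>) \<longlonglongrightarrow> 0"
        proof (rule tendsto_sandwich[OF always_eventually always_eventually tendsto_const lim])
          show "\<forall>n. (\<integral>x. (norm (snd (s (r n) (x, t)) - snd (z (x, t))))\<^sup>2 \<partial>lebesgue_on \<Omega>) \<le> F (r n) t"
            unfolding F_def using integral_lebesgue_on_le[OF i2 _ \<Omega>_borel] integral_mono[OF i2 ii le2] by (auto intro: order_trans)
        qed simp
      qed
    qed
  qed
qed

lemma ip_diff_self:
  "ip (\<lambda>p. z p + (-1) *\<^sub>R z' p) (\<lambda>p. z p + (-1) *\<^sub>R z' p)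
    = (\<integral>p. (norm (z p - z' p))\<^sup>2 \<partial>XT) + (\<integral>w. (norm (Hz z w - Hz z' w))\<^sup>2 \<partial>XTT)"
  unfolding ip_self using Hz_lincomb[of 1 z "-1" z'] by simp

lemma V_complete:
  assumes s: "\<And>n. s n \<in> V"
    and C: "\<And>e. 0 < e \<Longrightarrow> \<exists>N. \<forall>m\<ge>N. \<forall>n\<ge>N. ip (\<lambda>p. s m p + (-1) *\<^sub>R s n p) (\<lambda>p. s m p + (-1) *\<^sub>R s n p) < e"
  shows "\<exists>z\<in>V. (\<lambda>n::nat. ip (\<lambda>p. s n p + (-1) *\<^sub>R z p) (\<lambda>p. s n p + (-1) *\<^sub>R z p)) \<longlonglongrightarrow> 0"
proof -
  note sV = V_D[OF s]
  have C1: "\<exists>N. \<forall>m\<ge>N. \<forall>n\<ge>N. (\<integral>p. (norm (s m p - s n p))\<^sup>2 \<partial>XT) < e" if e: "0 < e" for e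
  proof -
    obtain N where N: "\<forall>m\<ge>N. \<forall>n\<ge>N. ip (\<lambda>p. s m p + (-1) *\<^sub>R s n p) (\<lambda>p. s m p + (-1) *\<^sub>R s n p) < e" using C[OF e] by blast
    have "(\<integral>p. (norm (s m p - s n p))\<^sup>2 \<partial>XT) \<le> ip (\<lambda>p. s m p + (-1) *\<^sub>R s n p) (\<lambda>p. s m p + (-1) *\<^sub>R s n p)" for m n
      unfolding ip_diff_self by simp
    then show ?thesis using N by (meson le_less_trans)
  qed
  have C2: "\<exists>N. \<forall>m\<ge>N. \<forall>n\<ge>N. (\<integral>w. (norm (Hz (s m) w - Hz (s n) w))\<^sup>2 \<partial>XTT) < e" if e: "0 < e" for e
  proof -
    obtain N where N: "\<forall>m\<ge>N. \<forall>n\<ge>N. ip (\<lambda>p. s m p + (-1) *\<^sub>R s n p) (\<lambda>p. s m p + (-1) *\<^sub>R s n p) < e" using C[OF e] by blast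
    have "(\<integral>w. (norm (Hz (s m) w - Hz (s n) w))\<^sup>2 \<partial>XTT) \<le> ip (\<lambda>p. s m p + (-1) *\<^sub>R s n p) (\<lambda>p. s m p + (-1) *\<^sub>R s n p)" for m n
      unfolding ip_diff_self by simp
    then show ?thesis using N by (meson le_less_trans)
  qed
  obtain g r where g': "sq_int XT g" "(\<lambda>n. \<integral>p. (norm (s n p - g p))\<^sup>2 \<partial>XT) \<longlonglongrightarrow> 0"
    "strict_mono (r :: nat \<Rightarrow> nat)" "AE p in XT. (\<lambda>k. s (r k) p) \<longlonglongrightarrow> g p"
    by (rule Riesz_Fischer[OF sV(3) C1])
  note g = g'(1,3,4)
  define z where "z p = indicator D p *\<^sub>R g p" for p
  have [measurable]: "g \<in> borel_measurable XT" using g(1) by (simp add: sq_int_def)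
  have mz: "z \<in> borel_measurable XT" unfolding z_def[abs_def] by measurable
  have z0: "z p = 0" if "p \<notin> D" for p using that by (simp add: z_def)
  have ae: "AE p in XT. (\<lambda>k. s (r k) p) \<longlonglongrightarrow> z p" using g(3)
  proof eventually_elim
    case (elim p)
    show ?case
    proof (cases "p \<in> D")
      case True then show ?thesis using elim by (simp add: z_def)
    next
      case False then show ?thesis using sV(2)[OF False] by (simp add: z_def)
    qed
  qed
  note z = L2_Cauchy_AE_limit[OF sV(3) C1 g(2) mz ae]
  \<comment> \<open>The quotients \<open>Hz (s n)\<close> are also Cauchy; their limit is recognised
    as \<open>Hz z\<close> by pointwise convergence.\<close>
  have aeH: "AE w in XTT. (\<lambda>k. Hz (s (r k)) w) \<longlonglongrightarrow> Hz z w"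
    using AE_XTT_if_XT[OF ae]
  proof eventually_elim
    case (elim w)
    obtain x t u where w: "w = (x, t, u)" by (cases w) auto
    have "(\<lambda>k. m (t - u) * (fst (s (r k) (x, t)) - fst (s (r k) (x, u)))) \<longlonglongrightarrow> m (t - u) * (fst (z (x, t)) - fst (z (x, u)))"
      using elim unfolding w by (intro tendsto_intros) auto
    then show ?case by (simp add: w Hz_def slob_def)
  qed
  note H = L2_Cauchy_AE_limit[OF sV(4) C2 g(2) Hz_measurable[OF mz] aeH]
  have lim: "(\<lambda>n. ip (\<lambda>p. s n p + (-1) *\<^sub>R z p) (\<lambda>p. s n p + (-1) *\<^sub>R z p)) \<longlonglongrightarrow> 0"
    unfolding ip_diff_self using tendsto_add[OF z(2) H(2)] by simp
  have Hs: "Hs_L2_sq \<Omega> T \<sigma> (\<lambda>p. fst (z p)) < \<infinity>"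
    using le_less_trans[OF Hs_L2_sq_le[OF mz z0]] sq_int_nn_integral_eq[OF z(1)] sq_int_nn_integral_eq[OF H(1)] by simp
  have "z \<in> V" unfolding V_def mem_Collect_eq
  proof (intro conjI allI impI mz z0 z(1) H(1) H10_slices_limit[OF s mz z(1) z(2)])
  next
    have mf: "(\<lambda>p. fst (z p)) \<in> borel_measurable XT" by (rule borel_measurable_fst_comp[OF mz])
    show "zero_Hs_L2 \<Omega> T \<sigma> (\<lambda>p. fst (z p))"
    proof (rule zero_Hs_L2_limit[OF XT_measurable_imp_lebesgue_on_D[OF mf] Hs])
      fix e :: real assume e: "0 < e"
      obtain n where n: "ip (\<lambda>p. s n p + (-1) *\<^sub>R z p) (\<lambda>p. s n p + (-1) *\<^sub>R z p) < e"
        using order_tendstoD(2)[OF lim e] by (auto simp: eventually_sequentially)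
      let ?d = "\<lambda>p. z p + (-1) *\<^sub>R s n p"
      have md: "?d \<in> borel_measurable XT" using mz sV(1)[of n] by measurable
      have "Hs_L2_sq \<Omega> T \<sigma> (\<lambda>p. fst (?d p)) \<le> (\<integral>\<^sup>+p. ennreal ((norm (?d p))\<^sup>2) \<partial>XT) + (\<integral>\<^sup>+w. ennreal ((Hz ?d w)\<^sup>2) \<partial>XTT)"
        by (rule Hs_L2_sq_le[OF md]) (simp add: z0 sV(2))
      also have "\<dots> = ennreal (ip ?d ?d)"
      proof -
        have "sq_int XT ?d" using sq_int_add[OF z(1) sq_int_scaleR[OF sV(3)[of n], of "-1"]] .
        moreover have "Hz ?d = (\<lambda>w. Hz z w - Hz (s n) w)"
          using Hz_lincomb[of 1 z "-1" "s n"] by (intro ext) simp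
        then have "sq_int XTT (Hz ?d)"
          using sq_int_diff[OF H(1) sV(4)[of n]] by (simp only:)
        ultimately show ?thesis using sq_int_nn_integral_eq[of XT ?d] sq_int_nn_integral_eq[of XTT "Hz ?d"]
          by (simp add: ip_self ennreal_plus[symmetric] del: ennreal_plus)
      qed
      also have "ip ?d ?d = ip (\<lambda>p. s n p + (-1) *\<^sub>R z p) (\<lambda>p. s n p + (-1) *\<^sub>R z p)"
        unfolding ip_diff_self by (simp add: norm_minus_commute power2_commute)
      also have "ennreal \<dots> < ennreal e"
      proof -
        have "0 \<le> ip (\<lambda>p. s n p + (-1) *\<^sub>R z p) (\<lambda>p. s n p + (-1) *\<^sub>R z p)" unfolding ip_self by simp
        then show ?thesis using n by (simp add: ennreal_less_iff)
      qed
      finally show "\<exists>v. zero_Hs_L2 \<Omega> T \<sigma> v \<and> Hs_L2_sq \<Omega> T \<sigma> (\<lambda>p. fst (z p) - v p) < ennreal e"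
        using sV(6)[of n] by (intro exI[of _ "\<lambda>p. fst (s n p)"]) simp
    qed
  qed
  with lim show ?thesis by blast
qed

sublocale V: semi_hilbert V "\<lambda>z z' p. z p + z' p" "\<lambda>c z p. c *\<^sub>R z p" ip
proof
  show "V \<noteq> {}" using V_zero by blast
  show "(\<lambda>p. x p + y p) \<in> V" if "x \<in> V" "y \<in> V" for x y using V_lincomb[OF that, of 1 1] by simp
  show "(\<lambda>p. c *\<^sub>R x p) \<in> V" if "x \<in> V" for x c using V_lincomb[OF that that, of c 0] by simp
  show "ip (\<lambda>p. x p + y p) z = ip x z + ip y z" if "x \<in> V" "y \<in> V" "z \<in> V" for x y z
    using integrable_inner_sq_int[OF V_D(3)[OF that(1)] V_D(3)[OF that(3)]] integrable_inner_sq_int[OF V_D(3)[OF that(2)] V_D(3)[OF that(3)]]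
      integrable_mult_sq_int[OF V_D(4)[OF that(1)] V_D(4)[OF that(3)]] integrable_mult_sq_int[OF V_D(4)[OF that(2)] V_D(4)[OF that(3)]]
      Hz_lincomb[of 1 x 1 y]
    by (simp add: ip_def inner_add_left distrib_right)
  show "ip (\<lambda>p. c *\<^sub>R x p) z = c * ip x z" if "x \<in> V" "z \<in> V" for x z c
    using Hz_lincomb[of c x 0 x] by (simp add: ip_def distrib_left mult.assoc)
  show "ip x y = ip y x" for x y by (simp add: ip_def inner_commute mult.commute)
  show "0 \<le> ip x x" for x unfolding ip_self by simp
qed (rule V_complete)

end

section \<open>Almost everywhere differentiability in one of two variables\<close>

lemma rat_sequence:
  fixes h :: real
  obtains q :: "nat \<Rightarrow> rat" where "(\<lambda>n. real_of_rat (q n)) \<longlonglongrightarrow> h"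
proof -
  have "\<exists>q. \<forall>n. h < real_of_rat (q n) \<and> real_of_rat (q n) < h + 1 / real (Suc n)"
    by (intro choice allI of_rat_dense) simp
  then obtain q where q: "\<And>n::nat. h < real_of_rat (q n)" "\<And>n. real_of_rat (q n) < h + 1 / real (Suc n)" by blast
  have l: "(\<lambda>n. h + 1 / real (Suc n)) \<longlonglongrightarrow> h + 0"
    using LIMSEQ_inverse_real_of_nat by (intro tendsto_intros) (simp add: inverse_eq_divide)
  have "(\<lambda>n. real_of_rat (q n)) \<longlonglongrightarrow> h"
    by (rule tendsto_sandwich[OF always_eventually always_eventually tendsto_const, of _ _ "\<lambda>n. h + 1 / real (Suc n)"])
       (use q l in \<open>auto intro: less_imp_le\<close>)
  then show thesis by (rule that)
qed

lemma AE_pair_fst: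
  fixes P :: "'a::euclidean_space \<Rightarrow> bool"
  assumes "AE x in lborel. P x"
  shows "AE p in lborel \<Otimes>\<^sub>M (lborel :: 'b::euclidean_space measure). P (fst p)"
proof -
  obtain N where N: "N \<in> null_sets lborel" "{x \<in> space lborel. \<not> P x} \<subseteq> N"
    using assms by (auto elim!: AE_E simp: null_sets_def)
  have [measurable]: "N \<in> sets borel" using N by auto
  have "AE p in lborel \<Otimes>\<^sub>M (lborel :: 'b measure). fst p \<notin> N"
  proof (rule lborel_pair.AE_pair_measure)
    show "{p \<in> space (lborel \<Otimes>\<^sub>M (lborel :: 'b measure)). fst p \<notin> N} \<in> sets (lborel \<Otimes>\<^sub>M lborel)" by measurable
    show "AE x in lborel. AE y in (lborel :: 'b measure). fst (x, y) \<notin> N"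
      using AE_not_in[OF N(1)] by eventually_elim simp
  qed
  then show ?thesis by eventually_elim (use N(2) in auto)
qed

text \<open>
  The set of points of differentiability is not obviously measurable. For continuous functions
  it is described by rational increments, which makes it measurable.
\<close>

lemma AE_pair_DERIV:
  fixes J :: "'a::euclidean_space \<Rightarrow> real \<Rightarrow> real" and D :: "'a \<times> real \<Rightarrow> real"
  assumes mJ: "(\<lambda>p. J (fst p) (snd p)) \<in> borel_measurable (lborel \<Otimes>\<^sub>M lborel)" and mD [measurable]: "D \<in> borel_measurable (lborel \<Otimes>\<^sub>M lborel)"
    and c: "AE x in lborel. continuous_on UNIV (J x)"
    and d: "AE x in lborel. AE t in lborel. (J x has_real_derivative D (x, t)) (at t)"
  shows "AE p in lborel \<Otimes>\<^sub>M lborel. (J (fst p) has_real_derivative D p) (at (snd p))"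
proof -
  note [measurable] = mJ
  \<comment> \<open>Difference quotients with rational increments, compared by a non-strict
    inequality so that it survives the passage to real increments.\<close>
  define Q where "Q p \<longleftrightarrow> (\<forall>i::nat. \<exists>j::nat. \<forall>q::rat. q \<noteq> 0 \<and> \<bar>real_of_rat q\<bar> < 1 / real (Suc j) \<longrightarrow>
     \<bar>(J (fst p) (snd p + real_of_rat q) - J (fst p) (snd p)) / real_of_rat q - D p\<bar> \<le> 1 / real (Suc i))" for p
  have [measurable]: "(\<lambda>p. J (fst p) (snd p + r)) \<in> borel_measurable (lborel \<Otimes>\<^sub>M lborel)" for r
    using measurable_compose[OF _ mJ, of "\<lambda>p. (fst p, snd p + r)" "lborel \<Otimes>\<^sub>M lborel"] by simp
  have Q_meas: "{p \<in> space (lborel \<Otimes>\<^sub>M lborel). Q p} \<in> sets (lborel \<Otimes>\<^sub>M lborel)" unfolding Q_def by measurable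
  have 1: "Q (x, t)" if "(J x has_real_derivative D (x, t)) (at t)" for x t
    unfolding Q_def
  proof
    fix i :: nat
    from that have "(\<lambda>h. (J x (t + h) - J x t) / h) \<midarrow>0\<rightarrow> D (x, t)" by (simp add: DERIV_def)
    from LIM_D[OF this, of "1 / real (Suc i)"] obtain s where s: "s > 0"
      "\<And>h. h \<noteq> 0 \<Longrightarrow> \<bar>h\<bar> < s \<Longrightarrow> \<bar>(J x (t + h) - J x t) / h - D (x, t)\<bar> < 1 / real (Suc i)" by auto
    obtain j where j: "inverse (real (Suc j)) < s" using reals_Archimedean[OF s(1)] by blast
    show "\<exists>j::nat. \<forall>q::rat. q \<noteq> 0 \<and> \<bar>real_of_rat q\<bar> < 1 / real (Suc j) \<longrightarrow>
     \<bar>(J (fst (x, t)) (snd (x, t) + real_of_rat q) - J (fst (x, t)) (snd (x, t))) / real_of_rat q - D (x, t)\<bar> \<le> 1 / real (Suc i)"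
      unfolding fst_conv snd_conv
    proof (intro exI[of _ j] allI impI)
      fix q :: rat assume q: "q \<noteq> 0 \<and> \<bar>real_of_rat q\<bar> < 1 / real (Suc j)"
      then have "\<bar>real_of_rat q\<bar> < s" using j by (simp add: inverse_eq_divide)
      with s(2)[of "real_of_rat q"] q show "\<bar>(J x (t + real_of_rat q) - J x t) / real_of_rat q - D (x, t)\<bar> \<le> 1 / real (Suc i)" by simp
    qed
  qed
  have "AE x in lborel. AE t in lborel. Q (x, t)"
    using d by eventually_elim (auto intro: 1 elim: eventually_mono)
  then have AQ: "AE p in lborel \<Otimes>\<^sub>M lborel. Q p" by (intro lborel_pair.AE_pair_measure Q_meas)
  have 2: "(J x has_real_derivative D (x, t)) (at t)" if Q: "Q (x, t)" and cont: "continuous_on UNIV (J x)" for x t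
    unfolding DERIV_def
  proof (rule LIM_I)
    fix r :: real assume "0 < r"
    then obtain i where i: "inverse (real (Suc i)) < r" using reals_Archimedean by blast
    from Q obtain j where j: "\<And>q::rat. q \<noteq> 0 \<Longrightarrow> \<bar>real_of_rat q\<bar> < 1 / real (Suc j) \<Longrightarrow>
      \<bar>(J x (t + real_of_rat q) - J x t) / real_of_rat q - D (x, t)\<bar> \<le> 1 / real (Suc i)" unfolding Q_def fst_conv snd_conv by blast
    show "\<exists>s>0. \<forall>h. h \<noteq> 0 \<and> norm (h - 0) < s \<longrightarrow> norm ((J x (t + h) - J x t) / h - D (x, t)) < r"
    proof (intro exI[of _ "1 / real (Suc j)"] conjI allI impI)
      fix h :: real assume h: "h \<noteq> 0 \<and> norm (h - 0) < 1 / real (Suc j)"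
      obtain q where q: "(\<lambda>n. real_of_rat (q n)) \<longlonglongrightarrow> h" by (rule rat_sequence)
      have Jl: "(\<lambda>n. J x (t + real_of_rat (q n))) \<longlonglongrightarrow> J x (t + h)"
        using cont by (intro continuous_on_tendsto_compose[of UNIV "J x"] tendsto_intros q) auto
      have "\<bar>(J x (t + h) - J x t) / h - D (x, t)\<bar> \<le> 1 / real (Suc i)"
      proof (rule LIMSEQ_le_const2)
        show "(\<lambda>n. \<bar>(J x (t + real_of_rat (q n)) - J x t) / real_of_rat (q n) - D (x, t)\<bar>) \<longlonglongrightarrow> \<bar>(J x (t + h) - J x t) / h - D (x, t)\<bar>"
          by (intro tendsto_intros Jl q) (use h in auto)
        have "eventually (\<lambda>n. real_of_rat (q n) \<noteq> 0) sequentially" using tendsto_imp_eventually_ne[OF q] h by blast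
        moreover have "eventually (\<lambda>n. \<bar>real_of_rat (q n)\<bar> < 1 / real (Suc j)) sequentially"
          using order_tendstoD(2)[OF tendsto_rabs[OF q]] h by simp
        ultimately have "eventually (\<lambda>n. \<bar>(J x (t + real_of_rat (q n)) - J x t) / real_of_rat (q n) - D (x, t)\<bar> \<le> 1 / real (Suc i)) sequentially"
          by eventually_elim (rule j; simp)
        then show "\<exists>N. \<forall>n\<ge>N. \<bar>(J x (t + real_of_rat (q n)) - J x t) / real_of_rat (q n) - D (x, t)\<bar> \<le> 1 / real (Suc i)"
          by (simp add: eventually_sequentially)
      qed
      also have "\<dots> < r" using i by (simp add: inverse_eq_divide)
      finally show "norm ((J x (t + h) - J x t) / h - D (x, t)) < r" by simp
    qed simp
  qed
  have "AE p in lborel \<Otimes>\<^sub>M (lborel :: real measure). continuous_on UNIV (J (fst p))" by (rule AE_pair_fst[OF c])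
  with AQ show ?thesis by eventually_elim (use 2 in \<open>metis prod.collapse\<close>)
qed

context parabolic
begin

subsection \<open>Representatives of elements of the solution space\<close>

lemma nn_integral_XT_slices:
  fixes z :: "(real ^ 'd) \<times> real \<Rightarrow> real \<times> (real ^ 'd)"
  assumes m: "z \<in> borel_measurable XT" and z: "\<And>p. p \<notin> D \<Longrightarrow> z p = 0"
  shows "(\<integral>\<^sup>+t\<in>{0<..<T}. (L2_sq \<Omega> (\<lambda>x. fst (z (x, t))) + L2_sq \<Omega> (\<lambda>x. snd (z (x, t)))) \<partial>lebesgue)
    = (\<integral>\<^sup>+p. ennreal ((norm (z p))\<^sup>2) \<partial>XT)"
proof -
  note [measurable] = m borel_measurable_fst_comp[OF m] borel_measurable_snd_comp[OF m]
  have "(\<integral>\<^sup>+t\<in>{0<..<T}. (L2_sq \<Omega> (\<lambda>x. fst (z (x, t))) + L2_sq \<Omega> (\<lambda>x. snd (z (x, t)))) \<partial>lebesgue)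
    = (\<integral>\<^sup>+t. \<integral>\<^sup>+x. ennreal ((norm (z (x, t)))\<^sup>2) \<partial>lborel \<partial>lborel)"
    unfolding nn_integral_completion L2_sq_def
  proof (rule nn_integral_cong)
    fix t :: real
    show "((\<integral>\<^sup>+x\<in>\<Omega>. ennreal ((norm (fst (z (x, t))))\<^sup>2) \<partial>lborel) + (\<integral>\<^sup>+x\<in>\<Omega>. ennreal ((norm (snd (z (x, t))))\<^sup>2) \<partial>lborel)) * indicator {0<..<T} t
      = (\<integral>\<^sup>+x. ennreal ((norm (z (x, t)))\<^sup>2) \<partial>lborel)"
    proof (cases "t \<in> {0<..<T}")
      case True
      have "(\<integral>\<^sup>+x\<in>\<Omega>. ennreal ((norm (fst (z (x, t))))\<^sup>2) \<partial>lborel) + (\<integral>\<^sup>+x\<in>\<Omega>. ennreal ((norm (snd (z (x, t))))\<^sup>2) \<partial>lborel)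
        = (\<integral>\<^sup>+x. ennreal ((norm (fst (z (x, t))))\<^sup>2) * indicator \<Omega> x + ennreal ((norm (snd (z (x, t))))\<^sup>2) * indicator \<Omega> x \<partial>lborel)"
        by (rule nn_integral_add[symmetric]) measurable
      also have "\<dots> = (\<integral>\<^sup>+x. ennreal ((norm (z (x, t)))\<^sup>2) \<partial>lborel)"
      proof (rule nn_integral_cong)
        fix x
        show "ennreal ((norm (fst (z (x, t))))\<^sup>2) * indicator \<Omega> x + ennreal ((norm (snd (z (x, t))))\<^sup>2) * indicator \<Omega> x = ennreal ((norm (z (x, t)))\<^sup>2)"
        proof (cases "x \<in> \<Omega>")
          case True
          then show ?thesis by (simp add: norm_prod_def ennreal_plus[symmetric] del: ennreal_plus)
        next
          case False
          then have "z (x, t) = 0" by (intro z) (simp add: mem_D)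
          then show ?thesis using False by simp
        qed
      qed
      finally show ?thesis using True by simp
    next
      case False
      then have "z (x, t) = 0" for x by (intro z) (auto simp: mem_D)
      then show ?thesis using False by simp
    qed
  qed
  also have "\<dots> = (\<integral>\<^sup>+p. ennreal ((norm (z p))\<^sup>2) \<partial>XT)"
    by (rule lborel_pair.nn_integral_snd) measurable
  finally show ?thesis .
qed

lemma L2_H1_sq_representative:
  assumes m: "z \<in> borel_measurable XT" and z: "\<And>p. p \<notin> D \<Longrightarrow> z p = 0"
    and ae: "AE t in lborel. t \<in> {0<..<T} \<longrightarrow> (AE x in lebesgue_on \<Omega>. z (x, t) = (u (x, t), x_grad \<Omega> T u (x, t)))"
  shows "L2_H1_sq \<Omega> T u = (\<integral>\<^sup>+p. ennreal ((norm (z p))\<^sup>2) \<partial>XT)"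
proof -
  have "L2_H1_sq \<Omega> T u = (\<integral>\<^sup>+t\<in>{0<..<T}. (L2_sq \<Omega> (\<lambda>x. fst (z (x, t))) + L2_sq \<Omega> (\<lambda>x. snd (z (x, t)))) \<partial>lebesgue)"
    unfolding L2_H1_sq_def
proof (rule nn_integral_cong_AE, use AE_completion[OF ae] in eventually_elim)
  case (elim t)
  show ?case
  proof (cases "t \<in> {0<..<T}")
    case True
    with elim have a: "AE x in lebesgue_on \<Omega>. z (x, t) = (u (x, t), x_grad \<Omega> T u (x, t))" by blast
    have "L2_sq \<Omega> (\<lambda>x. u (x, t)) = L2_sq \<Omega> (\<lambda>x. fst (z (x, t)))"
      by (rule L2_sq_cong_AE[OF \<Omega>_lebesgue]) (use a in \<open>auto elim: eventually_mono\<close>)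
    moreover have "L2_sq \<Omega> (\<lambda>x. x_grad \<Omega> T u (x, t)) = L2_sq \<Omega> (\<lambda>x. snd (z (x, t)))"
      by (rule L2_sq_cong_AE[OF \<Omega>_lebesgue]) (use a in \<open>auto elim: eventually_mono\<close>)
    ultimately show ?thesis by simp
  qed simp
qed
  also have "\<dots> = (\<integral>\<^sup>+p. ennreal ((norm (z p))\<^sup>2) \<partial>XT)" by (rule nn_integral_XT_slices[OF m z])
  finally show ?thesis .
qed

lemma AE_lebesgue_on_interval:
  "(AE t in lebesgue_on {0<..<T}. P t) \<longleftrightarrow> (AE t in lborel. t \<in> {0<..<T} \<longrightarrow> P t)"
  by (rule AE_lebesgue_on_iff) simp

lemma slice_measurable_lebesgue_on:
  fixes v :: "(real ^ 'd) \<times> real \<Rightarrow> 'b::euclidean_space"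
  assumes "v \<in> borel_measurable XT" shows "(\<lambda>x. v (x, t)) \<in> borel_measurable (lebesgue_on \<Omega>)"
proof -
  have "(\<lambda>x. v (x, t)) \<in> borel_measurable lborel" using assms by measurable
  then show ?thesis by (intro measurable_restrict_space1 measurable_completion)
qed

text \<open>The Hardy inequality, through \<open>slob_upper\<close>, on each slice: the norm over
  \<open>(0, T)\<close> controls the seminorm of the zero extension with a constant that does not
  depend on \<open>x\<close>.\<close>

lemma slob_XTT_finite:
  assumes z: "z \<in> borel_measurable XT" "\<And>p. p \<notin> D \<Longrightarrow> z p = 0" and Hs: "Hs_L2_sq \<Omega> T \<sigma> (\<lambda>p. fst (z p)) < \<infinity>"
  shows "sq_int XTT (Hz z)"
proof -
  let ?u = "\<lambda>x t. fst (z (x, t))"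
  obtain C where C: "0 < C" "\<And>f. f \<in> borel_measurable borel \<Longrightarrow> (\<And>t. t \<notin> {0<..<T} \<Longrightarrow> f t = 0) \<Longrightarrow>
    (\<integral>\<^sup>+z. ennreal ((slob f z)\<^sup>2) \<partial>lborel2) \<le> ennreal C * (L2I T f + slobI T f)" by (rule slob_upper[OF T_pos]) blast
  have mu: "(\<lambda>p. fst (z p)) \<in> borel_measurable XT" by (rule borel_measurable_fst_comp[OF z(1)])
  have "(\<integral>\<^sup>+w. ennreal ((Hz z w)\<^sup>2) \<partial>XTT) = (\<integral>\<^sup>+x. \<integral>\<^sup>+w. ennreal ((slob (?u x) w)\<^sup>2) \<partial>lborel2 \<partial>lborel)"
    by (rule XTT_nn_integral[OF z(1)])
  also have "\<dots> \<le> (\<integral>\<^sup>+x. ennreal C * (indicator \<Omega> x * (L2I T (?u x) + slobI T (?u x))) \<partial>lborel)"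
  proof (rule nn_integral_mono)
    fix x
    show "(\<integral>\<^sup>+w. ennreal ((slob (?u x) w)\<^sup>2) \<partial>lborel2) \<le> ennreal C * (indicator \<Omega> x * (L2I T (?u x) + slobI T (?u x)))"
    proof (cases "x \<in> \<Omega>")
      case True
      have "(\<integral>\<^sup>+w. ennreal ((slob (?u x) w)\<^sup>2) \<partial>lborel2) \<le> ennreal C * (L2I T (?u x) + slobI T (?u x))"
      proof (rule C(2))
        show "?u x \<in> borel_measurable borel" using mu by measurable
        show "?u x t = 0" if "t \<notin> {0<..<T}" for t using z(2)[of "(x, t)"] that by (simp add: mem_D)
      qed
      then show ?thesis using True by simp
    next
      case False
      then have "?u x = (\<lambda>t. 0)" using z(2) by (auto simp: mem_D)
      then show ?thesis by (simp add: slob_def case_prod_beta)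
    qed
  qed
  also have "\<dots> = ennreal C * Hs_L2_sq \<Omega> T \<sigma> (\<lambda>p. fst (z p))"
    unfolding Hs_L2_sq_Fubini[OF mu] using measurable_L2I_slobI[OF mu] by (subst nn_integral_cmult) auto
  also have "\<dots> < \<infinity>" using Hs by (simp add: ennreal_mult_less_top)
  finally show ?thesis using Hz_measurable[OF z(1)] by (simp add: sq_int_iff_nn_integral)
qed

text \<open>\<open>L2_H10\<close> guarantees that a gradient exists, so the choice in
  \<open>x_grad\<close> is meaningful; function and gradient are then replaced jointly by a Borel
  function.\<close>

lemma B_space_representative:
  assumes B: "B_space \<Omega> T \<sigma> u"
  obtains z where "z \<in> V" "AE p in lebesgue_on D. z p = (u p, x_grad \<Omega> T u p)"
proof -
  let ?G = "x_grad \<Omega> T u"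
  from B have Hs: "zero_Hs_L2 \<Omega> T \<sigma> u" and L: "L2_H10 \<Omega> T u" by (auto simp: B_space_def)
  obtain G0 where "is_x_gradient \<Omega> T u G0" using L unfolding L2_H10_def by blast
  then have "is_x_gradient \<Omega> T u ?G" unfolding x_grad_def by (rule someI[where P = "is_x_gradient \<Omega> T u"])
  then have G: "?G \<in> borel_measurable (lebesgue_on D)"
    "AE t in lborel. t \<in> {0<..<T} \<longrightarrow> weak_gradient \<Omega> (\<lambda>x. u (x, t)) (\<lambda>x. ?G (x, t))"
    by (auto simp: is_x_gradient_def AE_lebesgue_on_interval)
  have mu: "u \<in> borel_measurable (lebesgue_on D)" using L by (simp add: L2_H10_def)
  have H10: "AE t in lborel. t \<in> {0<..<T} \<longrightarrow> H10 \<Omega> (\<lambda>x. u (x, t))" using L by (simp add: L2_H10_def AE_lebesgue_on_interval)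
  have "(\<lambda>p. (u p, ?G p)) \<in> borel_measurable (lebesgue_on D)"
    using mu G(1) by (intro borel_measurable_Pair)
  then obtain z where z: "z \<in> borel_measurable XT" "\<And>p. p \<notin> D \<Longrightarrow> z p = 0" "AE p in lebesgue_on D. (u p, ?G p) = z p"
    by (rule Borel_representative) blast
  have ae: "AE p in lebesgue_on D. z p = (u p, ?G p)" using z(3) by eventually_elim simp
  have aeu: "AE p in lebesgue_on D. u p = fst (z p)" using ae by eventually_elim simp
  have sl: "AE t in lborel. t \<in> {0<..<T} \<longrightarrow> (AE x in lebesgue_on \<Omega>. z (x, t) = (u (x, t), ?G (x, t)))"
    by (rule AE_D_slices(1)[OF ae])
  have mf: "(\<lambda>p. fst (z p)) \<in> borel_measurable XT" "(\<lambda>p. snd (z p)) \<in> borel_measurable XT"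
    by (rule borel_measurable_fst_comp[OF z(1)] borel_measurable_snd_comp[OF z(1)])+
  have Hseq: "Hs_L2_sq \<Omega> T \<sigma> u = Hs_L2_sq \<Omega> T \<sigma> (\<lambda>p. fst (z p))" by (rule Hs_L2_sq_cong_AE[OF aeu])
  have fin: "Hs_L2_sq \<Omega> T \<sigma> (\<lambda>p. fst (z p)) < \<infinity>" using Hs unfolding Hseq[symmetric] zero_Hs_L2_def by blast
  have "z \<in> V" unfolding V_def mem_Collect_eq
  proof (intro conjI allI impI z(1,2))
    have "(\<integral>\<^sup>+p. ennreal ((norm (z p))\<^sup>2) \<partial>XT) < \<infinity>"
      using L2_H1_sq_representative[OF z(1,2) sl] L by (simp add: L2_H10_def)
    then show "sq_int XT z" using z(1) by (simp add: sq_int_iff_nn_integral)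
    show "sq_int XTT (Hz z)" by (rule slob_XTT_finite[OF z(1,2) fin])
    show "AE t in lborel. t \<in> {0<..<T} \<longrightarrow> H10_pair \<Omega> (\<lambda>x. fst (z (x, t))) (\<lambda>x. snd (z (x, t)))"
      using H10 G(2) sl
    proof eventually_elim
      case (elim t)
      show ?case
      proof
        assume t: "t \<in> {0<..<T}"
        then have a: "AE x in lebesgue_on \<Omega>. z (x, t) = (u (x, t), ?G (x, t))" using elim by blast
        have "H10_pair \<Omega> (\<lambda>x. u (x, t)) (\<lambda>x. ?G (x, t))" using elim t by (intro H10_pair_if_weak_gradient[OF open_\<Omega>]) auto
        then show "H10_pair \<Omega> (\<lambda>x. fst (z (x, t))) (\<lambda>x. snd (z (x, t)))"
        proof (rule H10_pair_cong_AE[OF \<Omega>_lebesgue])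
          show "AE x in lebesgue_on \<Omega>. u (x, t) = fst (z (x, t))" "AE x in lebesgue_on \<Omega>. ?G (x, t) = snd (z (x, t))"
            using a by (auto elim: eventually_mono)
        qed (intro slice_measurable_lebesgue_on mf)+
      qed
    qed
    show "zero_Hs_L2 \<Omega> T \<sigma> (\<lambda>p. fst (z p))" unfolding zero_Hs_L2_def
    proof (intro conjI allI impI)
      show "(\<lambda>p. fst (z p)) \<in> borel_measurable (lebesgue_on D)" by (rule XT_measurable_imp_lebesgue_on_D[OF mf(1)])
      show "Hs_L2_sq \<Omega> T \<sigma> (\<lambda>p. fst (z p)) < \<infinity>" by (rule fin)
      fix \<epsilon> :: ennreal assume "0 < \<epsilon>"
      then obtain w where w: "zero_Cinf_L2 \<Omega> T w" "Hs_L2_sq \<Omega> T \<sigma> (\<lambda>p. u p - w p) < \<epsilon>" using Hs unfolding zero_Hs_L2_def by blast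
      have "Hs_L2_sq \<Omega> T \<sigma> (\<lambda>p. u p - w p) = Hs_L2_sq \<Omega> T \<sigma> (\<lambda>p. fst (z p) - w p)"
        by (rule Hs_L2_sq_cong_AE) (use aeu in \<open>auto elim: eventually_mono\<close>)
      with w show "\<exists>w. zero_Cinf_L2 \<Omega> T w \<and> Hs_L2_sq \<Omega> T \<sigma> (\<lambda>p. fst (z p) - w p) < \<epsilon>" by auto
    qed
  qed
  with ae show thesis by (rule that[rotated])
qed

text \<open>The stored second component witnesses a gradient, and uniqueness on slices identifies it
  with the chosen one.\<close>

lemma V_imp_B_space:
  assumes z: "z \<in> V"
  shows "B_space \<Omega> T \<sigma> (\<lambda>p. fst (z p))" (is ?B)
    and "AE p in lebesgue_on D. z p = (fst (z p), x_grad \<Omega> T (\<lambda>p. fst (z p)) p)" (is ?G)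
    and "L2_H1_sq \<Omega> T (\<lambda>p. fst (z p)) = (\<integral>\<^sup>+p. ennreal ((norm (z p))\<^sup>2) \<partial>XT)" (is ?L)
proof -
  let ?u = "\<lambda>p. fst (z p)"
  note zV = V_D[OF z]
  have mf: "?u \<in> borel_measurable XT" "(\<lambda>p. snd (z p)) \<in> borel_measurable XT"
    by (rule borel_measurable_fst_comp[OF zV(1)] borel_measurable_snd_comp[OF zV(1)])+
  have H: "AE t in lborel. t \<in> {0<..<T} \<longrightarrow> H10_pair \<Omega> (\<lambda>x. ?u (x, t)) (\<lambda>x. snd (z (x, t)))" by (rule zV(5))
  then have w: "AE t in lborel. t \<in> {0<..<T} \<longrightarrow> weak_gradient \<Omega> (\<lambda>x. ?u (x, t)) (\<lambda>x. snd (z (x, t)))"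
    by eventually_elim (simp add: H10_pair_def)
  have ex: "is_x_gradient \<Omega> T ?u (\<lambda>p. snd (z p))"
    unfolding is_x_gradient_def AE_lebesgue_on_interval using XT_measurable_imp_lebesgue_on_D[OF mf(2)] w by simp
  have xg: "is_x_gradient \<Omega> T ?u (x_grad \<Omega> T ?u)" unfolding x_grad_def by (rule someI[where P = "is_x_gradient \<Omega> T ?u", OF ex])
  then have xg': "x_grad \<Omega> T ?u \<in> borel_measurable (lebesgue_on D)"
    "AE t in lborel. t \<in> {0<..<T} \<longrightarrow> weak_gradient \<Omega> (\<lambda>x. ?u (x, t)) (\<lambda>x. x_grad \<Omega> T ?u (x, t))"
    by (auto simp: is_x_gradient_def AE_lebesgue_on_interval)
  have eq: "AE t in lborel. t \<in> {0<..<T} \<longrightarrow> (AE x in lebesgue_on \<Omega>. x_grad \<Omega> T ?u (x, t) = snd (z (x, t)))"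
    using w xg'(2) by eventually_elim (auto intro: weak_gradient_unique[OF open_\<Omega>])
  have sl: "AE t in lborel. t \<in> {0<..<T} \<longrightarrow> (AE x in lebesgue_on \<Omega>. z (x, t) = (?u (x, t), x_grad \<Omega> T ?u (x, t)))"
    using eq
  proof eventually_elim
    case (elim t)
    show ?case
    proof
      assume "t \<in> {0<..<T}"
      with elim have "AE x in lebesgue_on \<Omega>. x_grad \<Omega> T ?u (x, t) = snd (z (x, t))" by blast
      then show "AE x in lebesgue_on \<Omega>. z (x, t) = (?u (x, t), x_grad \<Omega> T ?u (x, t))" by eventually_elim simp
    qed
  qed
  show L: ?L by (rule L2_H1_sq_representative[OF zV(1,2) sl])
  show ?B unfolding B_space_def L2_H10_def
  proof (intro conjI zV(6))
    show "?u \<in> borel_measurable (lebesgue_on D)" by (rule XT_measurable_imp_lebesgue_on_D[OF mf(1)])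
    show "AE t in lebesgue_on {0<..<T}. H10 \<Omega> (\<lambda>x. ?u (x, t))"
      unfolding AE_lebesgue_on_interval using H by eventually_elim (auto simp: H10_iff)
    show "\<exists>G. is_x_gradient \<Omega> T ?u G" using ex by blast
    show "L2_H1_sq \<Omega> T ?u < \<infinity>" unfolding L using sq_int_nn_integral_eq[OF zV(3)] by simp
  qed
  \<comment> \<open>Equality on almost every slice gives equality almost everywhere only for jointly
    measurable functions, hence a Borel version of the chosen gradient.\<close>
  obtain G' where G': "G' \<in> borel_measurable XT" "AE p in lebesgue_on D. x_grad \<Omega> T ?u p = G' p" by (rule Borel_representative[OF xg'(1)])
  have "AE t in lborel. t \<in> {0<..<T} \<longrightarrow> (AE x in lebesgue_on \<Omega>. G' (x, t) = snd (z (x, t)))"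
    using eq AE_D_slices(1)[OF G'(2)]
  proof eventually_elim
    case (elim t)
    show ?case
    proof
      assume "t \<in> {0<..<T}"
      with elim have "AE x in lebesgue_on \<Omega>. x_grad \<Omega> T ?u (x, t) = snd (z (x, t))" "AE x in lebesgue_on \<Omega>. x_grad \<Omega> T ?u (x, t) = G' (x, t)" by auto
      then show "AE x in lebesgue_on \<Omega>. G' (x, t) = snd (z (x, t))" by eventually_elim simp
    qed
  qed
  moreover have "{p. G' p = snd (z p)} \<in> sets borel"
  proof -
    have "{p \<in> space XT. G' p = snd (z p)} \<in> sets XT" using G'(1) mf(2) by measurable
    then show ?thesis unfolding sets_XT by (simp add: space_pair_measure)
  qed
  ultimately have "AE p in lebesgue_on D. G' p = snd (z p)" by (rule AE_D_if_slices)
  with G'(2) show ?G by eventually_elim (simp add: prod_eq_iff)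
qed

text \<open>The fractional part and the spatial part of the norm both contain the L2 norm of the
  function; bounding each by \<open>ip z z\<close> explains the factor 2.\<close>

lemma B_norm_le:
  assumes z: "z \<in> V" shows "B_norm \<Omega> T \<sigma> (\<lambda>p. fst (z p)) \<le> sqrt (2 * ip z z)"
proof -
  have "L2_H1_sq \<Omega> T (\<lambda>p. fst (z p)) \<le> ennreal (ip z z)"
    unfolding V_imp_B_space(3)[OF z] using sq_int_nn_integral_eq[OF V_D(3)[OF z]] by (simp add: ip_self ennreal_leI)
  then have "Hs_L2_sq \<Omega> T \<sigma> (\<lambda>p. fst (z p)) + L2_H1_sq \<Omega> T (\<lambda>p. fst (z p)) \<le> ennreal (ip z z) + ennreal (ip z z)"
    using Hs_L2_sq_le_ip[OF z] by (intro add_mono)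
  also have "\<dots> = ennreal (2 * ip z z)" using V.ip_nonneg[OF z] by (simp add: ennreal_plus[symmetric] del: ennreal_plus)
  finally show ?thesis unfolding B_norm_def using V.ip_nonneg[OF z] by (intro real_sqrt_le_mono enn2real_leI) auto
qed

end

context fractional_order
begin

lemma
  assumes f: "sq_int lborel f" "\<And>t. t \<notin> {0<..<T} \<Longrightarrow> f t = 0" and g: "sq_int lborel g" "\<And>t. t \<notin> {0<..<T} \<Longrightarrow> g t = 0"
  shows Jl_lincomb: "Jl (\<lambda>t. a * f t + b * g t) t = a * Jl f t + b * Jl g t"
    and Jr_lincomb: "Jr (\<lambda>t. a * f t + b * g t) t = a * Jr f t + b * Jr g t"
proof -
  have "integrable lborel (\<lambda>s. f s * K (t - s))" by (rule integrable_K_left[OF f])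
  moreover have "integrable lborel (\<lambda>s. g s * K (t - s))" by (rule integrable_K_left[OF g])
  ultimately show "Jl (\<lambda>t. a * f t + b * g t) t = a * Jl f t + b * Jl g t"
    by (simp add: Jl_def distrib_right mult.assoc)
  have "integrable lborel (\<lambda>s. f s * K (s - t))" by (rule integrable_K_right[OF f])
  moreover have "integrable lborel (\<lambda>s. g s * K (s - t))" by (rule integrable_K_right[OF g])
  ultimately show "Jr (\<lambda>t. a * f t + b * g t) t = a * Jr f t + b * Jr g t"
    by (simp add: Jr_def distrib_right mult.assoc)
qed

lemma Jl_zero [simp]: "Jl (\<lambda>t. 0) = (\<lambda>t. 0)" and Jr_zero [simp]: "Jr (\<lambda>t. 0) = (\<lambda>t. 0)"
  by (simp_all add: Jl_def Jr_def fun_eq_iff)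

end

context parabolic
begin

subsection \<open>Fractional time derivatives on the cylinder\<close>

definition slice :: "((real ^ 'd) \<times> real \<Rightarrow> real \<times> (real ^ 'd)) \<Rightarrow> real ^ 'd \<Rightarrow> real \<Rightarrow> real" where
  "slice z x t = fst (z (x, t))"

text \<open>The limit along one sequence of steps, which is measurable in \<open>(x, t)\<close> by
  construction and equals the derivative wherever there is one. The argument \<open>J\<close>
  selects the left or right fractional integral.\<close>

definition tderiv :: "((real \<Rightarrow> real) \<Rightarrow> real \<Rightarrow> real) \<Rightarrow> ((real ^ 'd) \<times> real \<Rightarrow> real \<times> (real ^ 'd)) \<Rightarrow> (real ^ 'd) \<times> real \<Rightarrow> real" where
  "tderiv J z p = lim (\<lambda>n. (J (slice z (fst p)) (snd p + 1 / real (Suc n)) - J (slice z (fst p)) (snd p)) / (1 / real (Suc n)))"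

lemma slice_supp: "z \<in> V \<Longrightarrow> t \<notin> {0<..<T} \<Longrightarrow> slice z x t = 0"
  using V_D(2)[of z "(x, t)"] by (simp add: slice_def mem_D)

lemma slice_outside: "z \<in> V \<Longrightarrow> x \<notin> \<Omega> \<Longrightarrow> slice z x = (\<lambda>t. 0)"
  using V_D(2)[of z "(x, _)"] by (simp add: slice_def mem_D fun_eq_iff)

lemma slice_lincomb: "slice (\<lambda>p. a *\<^sub>R z p + b *\<^sub>R z' p) x = (\<lambda>t. a * slice z x t + b * slice z' x t)"
  by (simp add: slice_def fun_eq_iff)

lemma slices_regular:
  assumes z: "z \<in> V"
  shows "AE x in lborel. sq_int lborel (slice z x) \<and> sq_int lborel2 (slob (slice z x))"
proof -
  note zV = V_D[OF z]
  have mf: "(\<lambda>p. fst (z p)) \<in> borel_measurable XT" by (rule borel_measurable_fst_comp[OF zV(1)])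
  have ms: "slice z x \<in> borel_measurable borel" for x unfolding slice_def[abs_def] using mf by measurable
  have "AE x in lborel. integrable lborel (\<lambda>t. (norm (z (x, t)))\<^sup>2)"
    using lborel_pair.AE_integrable_fst'[OF sq_int_integrable[OF zV(3)]] .
  moreover have "AE x in lborel. integrable lborel2 (\<lambda>w. (norm (Hz z (x, w)))\<^sup>2)"
    using XTT.AE_integrable_fst'[OF sq_int_integrable[OF zV(4)]] .
  ultimately show ?thesis
  proof eventually_elim
    case (elim x)
    have "(\<lambda>t. z (x, t)) \<in> borel_measurable lborel" using zV(1) by measurable
    then have "sq_int lborel (\<lambda>t. z (x, t))" using elim(1) by (simp add: sq_int_def)
    moreover have "slice z x \<in> borel_measurable lborel" using ms by simp
    ultimately have 1: "sq_int lborel (slice z x)"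
      by (rule sq_int_bound) (simp add: slice_def norm_fst_le_self del: real_norm_def)
    have "slob (slice z x) = (\<lambda>w. Hz z (x, w))" by (simp add: Hz_def slice_def[abs_def])
    then have "sq_int lborel2 (slob (slice z x))"
      using elim(2) measurable_slob[OF ms[of x]] by (simp add: sq_int_def)
    with 1 show ?case by blast
  qed
qed

lemma
  assumes z: "z \<in> borel_measurable XT"
  shows J_measurable: "(\<lambda>p. Jl (slice z (fst p)) (snd p)) \<in> borel_measurable XT" "(\<lambda>p. Jr (slice z (fst p)) (snd p)) \<in> borel_measurable XT"
    and tderiv_measurable: "tderiv Jl z \<in> borel_measurable XT" "tderiv Jr z \<in> borel_measurable XT"
proof -
  have mf: "(\<lambda>p. fst (z p)) \<in> borel_measurable XT" by (rule borel_measurable_fst_comp[OF z])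
  define u where "u p = fst (z p)" for p
  have [measurable]: "u \<in> borel_measurable XT" using mf by (simp add: u_def[abs_def])
  have s: "slice z = (\<lambda>x t. u (x, t))" by (simp add: slice_def u_def fun_eq_iff)
  show 1: "(\<lambda>p. Jl (slice z (fst p)) (snd p)) \<in> borel_measurable XT" unfolding s Jl_def by measurable
  show 2: "(\<lambda>p. Jr (slice z (fst p)) (snd p)) \<in> borel_measurable XT" unfolding s Jr_def by measurable
  have td: "tderiv J z \<in> borel_measurable XT" if J: "(\<lambda>p. J (slice z (fst p)) (snd p)) \<in> borel_measurable XT" for J :: "(real \<Rightarrow> real) \<Rightarrow> real \<Rightarrow> real"
  proof -
    have sh: "(\<lambda>p. J (slice z (fst p)) (snd p + r)) \<in> borel_measurable XT" for r
      using measurable_compose[OF _ J, of "\<lambda>p. (fst p, snd p + r)" XT] by simp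
    show ?thesis unfolding tderiv_def[abs_def]
      by (rule borel_measurable_lim_metric, rule borel_measurable_divide, rule borel_measurable_diff, rule sh, rule J) simp
  qed
  show "tderiv Jl z \<in> borel_measurable XT" "tderiv Jr z \<in> borel_measurable XT" by (rule td[OF 1], rule td[OF 2])
qed

lemma tderiv_eq: "(J (slice z x) has_real_derivative d) (at t) \<Longrightarrow> tderiv J z (x, t) = d"
  unfolding tderiv_def fst_conv snd_conv by (rule limI[OF DERIV_imp_sequence])

text \<open>The derivatives found on the line are chosen separately for each \<open>x\<close>,
  without measurable dependence; here they are replaced by the jointly measurable
  \<open>tderiv\<close>.\<close>

lemma tderiv_slices:
  assumes z: "z \<in> V"
  shows "AE x in lborel. continuous_on UNIV (Jl (slice z x)) \<and> continuous_on UNIV (Jr (slice z x)) \<and>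
    (AE t in lborel. (Jl (slice z x) has_real_derivative tderiv Jl z (x, t)) (at t)) \<and>
    (AE t in lborel. (Jr (slice z x) has_real_derivative tderiv Jr z (x, t)) (at t)) \<and>
    sq_int lborel (\<lambda>t. tderiv Jl z (x, t)) \<and> sq_int lborel (\<lambda>t. tderiv Jr z (x, t)) \<and>
    k2 * (\<integral>t. (tderiv Jl z (x, t))\<^sup>2 \<partial>lborel) = k1 * (\<integral>w. (Hz z (x, w))\<^sup>2 \<partial>lborel2) \<and>
    k2 * (\<integral>t. (tderiv Jr z (x, t))\<^sup>2 \<partial>lborel) = k1 * (\<integral>w. (Hz z (x, w))\<^sup>2 \<partial>lborel2) \<and>
    k2 * (\<integral>t. tderiv Jl z (x, t) * tderiv Jr z (x, t) \<partial>lborel) = - k3 * (\<integral>w. (Hz z (x, w))\<^sup>2 \<partial>lborel2)"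
  using slices_regular[OF z]
proof eventually_elim
  case (elim x)
  have H: "slob (slice z x) = (\<lambda>w. Hz z (x, w))" by (simp add: Hz_def slice_def[abs_def])
  obtain \<phi> \<psi> where d: "sq_int lborel \<phi>" "sq_int lborel \<psi>"
    "AE t in lborel. (Jl (slice z x) has_real_derivative \<phi> t) (at t)" "AE t in lborel. (Jr (slice z x) has_real_derivative \<psi> t) (at t)"
    "k2 * (\<integral>t. (\<phi> t)\<^sup>2 \<partial>lborel) = k1 * (\<integral>w. (slob (slice z x) w)\<^sup>2 \<partial>lborel2)"
    "k2 * (\<integral>t. (\<psi> t)\<^sup>2 \<partial>lborel) = k1 * (\<integral>w. (slob (slice z x) w)\<^sup>2 \<partial>lborel2)"
    "k2 * (\<integral>t. \<phi> t * \<psi> t \<partial>lborel) = - k3 * (\<integral>w. (slob (slice z x) w)\<^sup>2 \<partial>lborel2)"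
    "continuous_on UNIV (Jl (slice z x))" "continuous_on UNIV (Jr (slice z x))"
    by (rule fractional_derivatives[OF conjunct1[OF elim] slice_supp[OF z] conjunct2[OF elim]])
  have eq1: "AE t in lborel. tderiv Jl z (x, t) = \<phi> t" using d(3) by eventually_elim (rule tderiv_eq)
  have eq2: "AE t in lborel. tderiv Jr z (x, t) = \<psi> t" using d(4) by eventually_elim (rule tderiv_eq)
  note eq = eq1 eq2
  have [measurable]: "(\<lambda>t. tderiv Jl z (x, t)) \<in> borel_measurable lborel" "(\<lambda>t. tderiv Jr z (x, t)) \<in> borel_measurable lborel"
    using tderiv_measurable[OF V_D(1)[OF z]] by measurable
  have m [measurable]: "\<phi> \<in> borel_measurable lborel" "\<psi> \<in> borel_measurable lborel" using d(1,2) by (simp_all add: sq_int_def)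
  have D1: "AE t in lborel. (Jl (slice z x) has_real_derivative tderiv Jl z (x, t)) (at t)"
    using d(3) eq1 by eventually_elim simp
  have D2: "AE t in lborel. (Jr (slice z x) has_real_derivative tderiv Jr z (x, t)) (at t)"
    using d(4) eq2 by eventually_elim simp
  note D = D1 D2
  have S1: "sq_int lborel (\<lambda>t. tderiv Jl z (x, t))"
    by (rule sq_int_cong_AE[OF d(1)]) (measurable, use eq1 in eventually_elim, simp)
  have S2: "sq_int lborel (\<lambda>t. tderiv Jr z (x, t))"
    by (rule sq_int_cong_AE[OF d(2)]) (measurable, use eq2 in eventually_elim, simp)
  note S = S1 S2
  have I1: "(\<integral>t. (tderiv Jl z (x, t))\<^sup>2 \<partial>lborel) = (\<integral>t. (\<phi> t)\<^sup>2 \<partial>lborel)"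
    by (rule integral_cong_AE) (measurable, use eq1 in eventually_elim, simp)
  have I2: "(\<integral>t. (tderiv Jr z (x, t))\<^sup>2 \<partial>lborel) = (\<integral>t. (\<psi> t)\<^sup>2 \<partial>lborel)"
    by (rule integral_cong_AE) (measurable, use eq2 in eventually_elim, simp)
  note I = I1 I2
  have P: "(\<integral>t. tderiv Jl z (x, t) * tderiv Jr z (x, t) \<partial>lborel) = (\<integral>t. \<phi> t * \<psi> t \<partial>lborel)"
  proof (rule integral_cong_AE)
    show "AE t in lborel. tderiv Jl z (x, t) * tderiv Jr z (x, t) = \<phi> t * \<psi> t" using eq by eventually_elim simp
  qed measurable
  show ?case using d(5-9) D S unfolding I P H by blast
qed

lemma tderiv_DERIV:
  assumes z: "z \<in> V"
  shows "AE p in XT. (Jl (slice z (fst p)) has_real_derivative tderiv Jl z p) (at (snd p))"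
    and "AE p in XT. (Jr (slice z (fst p)) has_real_derivative tderiv Jr z p) (at (snd p))"
proof -
  note m = J_measurable[OF V_D(1)[OF z]] tderiv_measurable[OF V_D(1)[OF z]]
  have c: "AE x in lborel. continuous_on UNIV (Jl (slice z x))" "AE x in lborel. continuous_on UNIV (Jr (slice z x))"
    using tderiv_slices[OF z] by (auto elim!: eventually_mono)
  have d: "AE x in lborel. AE t in lborel. (Jl (slice z x) has_real_derivative tderiv Jl z (x, t)) (at t)"
    "AE x in lborel. AE t in lborel. (Jr (slice z x) has_real_derivative tderiv Jr z (x, t)) (at t)"
    by (rule eventually_mono[OF tderiv_slices[OF z]], blast)+
  show "AE p in XT. (Jl (slice z (fst p)) has_real_derivative tderiv Jl z p) (at (snd p))"
    by (rule AE_pair_DERIV[OF m(1,3) c(1) d(1)])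
  show "AE p in XT. (Jr (slice z (fst p)) has_real_derivative tderiv Jr z p) (at (snd p))"
    by (rule AE_pair_DERIV[OF m(2,4) c(2) d(2)])
qed

lemma integral_Hz_slices:
  assumes z: "z \<in> V"
  shows "integrable lborel (\<lambda>x. \<integral>w. (Hz z (x, w))\<^sup>2 \<partial>lborel2)" "(\<integral>x. (\<integral>w. (Hz z (x, w))\<^sup>2 \<partial>lborel2) \<partial>lborel) = (\<integral>w. (Hz z w)\<^sup>2 \<partial>XTT)"
proof -
  have i: "integrable XTT (\<lambda>w. (Hz z w)\<^sup>2)" using V_D(4)[OF z] by (simp add: sq_int_real_iff)
  show "integrable lborel (\<lambda>x. \<integral>w. (Hz z (x, w))\<^sup>2 \<partial>lborel2)" by (rule XTT.integrable_fst'[OF i])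
  show "(\<integral>x. (\<integral>w. (Hz z (x, w))\<^sup>2 \<partial>lborel2) \<partial>lborel) = (\<integral>w. (Hz z w)\<^sup>2 \<partial>XTT)" by (rule XTT.integral_fst'[OF i])
qed

lemma sq_int_XT_if_slices:
  fixes f :: "(real ^ 'd) \<times> real \<Rightarrow> real"
  assumes [measurable]: "f \<in> borel_measurable XT" and g: "integrable lborel g"
    and ae: "AE x in lborel. sq_int lborel (\<lambda>t. f (x, t)) \<and> (\<integral>t. (f (x, t))\<^sup>2 \<partial>lborel) = g x"
  shows "sq_int XT f" "(\<integral>p. (f p)\<^sup>2 \<partial>XT) = (\<integral>x. g x \<partial>lborel)"
proof -
  have [measurable]: "g \<in> borel_measurable lborel" using g by simp
  have g0: "AE x in lborel. 0 \<le> g x" using ae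
  proof eventually_elim
    case (elim x)
    have "0 \<le> (\<integral>t. (f (x, t))\<^sup>2 \<partial>lborel)" by simp
    with elim show ?case by simp
  qed
  have "(\<integral>\<^sup>+p. ennreal ((norm (f p))\<^sup>2) \<partial>XT) = (\<integral>\<^sup>+x. \<integral>\<^sup>+t. ennreal ((norm (f (x, t)))\<^sup>2) \<partial>lborel \<partial>lborel)"
    by (rule lborel.nn_integral_fst[symmetric]) measurable
  also have "\<dots> = (\<integral>\<^sup>+x. ennreal (g x) \<partial>lborel)"
  proof (rule nn_integral_cong_AE, use ae in eventually_elim)
    case (elim x)
    then show ?case using sq_int_nn_integral_eq[of lborel "\<lambda>t. f (x, t)"] by simp
  qed
  also have "\<dots> = ennreal (\<integral>x. g x \<partial>lborel)" by (rule nn_integral_eq_integral[OF g g0])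
  finally have *: "(\<integral>\<^sup>+p. ennreal ((norm (f p))\<^sup>2) \<partial>XT) = ennreal (\<integral>x. g x \<partial>lborel)" .
  then show s: "sq_int XT f" by (simp add: sq_int_iff_nn_integral)
  have "0 \<le> (\<integral>x. g x \<partial>lborel)" using g0 by (rule integral_nonneg_AE)
  then show "(\<integral>p. (f p)\<^sup>2 \<partial>XT) = (\<integral>x. g x \<partial>lborel)"
    using sq_int_nn_integral_eq[OF s] unfolding * by simp
qed

lemma tderiv_norm:
  assumes z: "z \<in> V"
  shows "sq_int XT (tderiv Jl z)" "sq_int XT (tderiv Jr z)"
    "(\<integral>p. (tderiv Jl z p)\<^sup>2 \<partial>XT) = k1 / k2 * (\<integral>w. (Hz z w)\<^sup>2 \<partial>XTT)"
    "(\<integral>p. (tderiv Jr z p)\<^sup>2 \<partial>XT) = k1 / k2 * (\<integral>w. (Hz z w)\<^sup>2 \<partial>XTT)"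
proof -
  note m = tderiv_measurable[OF V_D(1)[OF z]]
  let ?g = "\<lambda>x. k1 / k2 * (\<integral>w. (Hz z (x, w))\<^sup>2 \<partial>lborel2)"
  have g: "integrable lborel ?g" using integral_Hz_slices(1)[OF z] by simp
  have ig: "(\<integral>x. ?g x \<partial>lborel) = k1 / k2 * (\<integral>w. (Hz z w)\<^sup>2 \<partial>XTT)" using integral_Hz_slices(2)[OF z] by simp
  have l: "AE x in lborel. sq_int lborel (\<lambda>t. tderiv Jl z (x, t)) \<and> (\<integral>t. (tderiv Jl z (x, t))\<^sup>2 \<partial>lborel) = ?g x"
    using tderiv_slices[OF z] by eventually_elim (use k2_pos in \<open>simp add: field_simps\<close>)
  have r: "AE x in lborel. sq_int lborel (\<lambda>t. tderiv Jr z (x, t)) \<and> (\<integral>t. (tderiv Jr z (x, t))\<^sup>2 \<partial>lborel) = ?g x"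
    using tderiv_slices[OF z] by eventually_elim (use k2_pos in \<open>simp add: field_simps\<close>)
  show "sq_int XT (tderiv Jl z)" "(\<integral>p. (tderiv Jl z p)\<^sup>2 \<partial>XT) = k1 / k2 * (\<integral>w. (Hz z w)\<^sup>2 \<partial>XTT)"
    using sq_int_XT_if_slices[OF m(1) g l] unfolding ig by blast+
  show "sq_int XT (tderiv Jr z)" "(\<integral>p. (tderiv Jr z p)\<^sup>2 \<partial>XT) = k1 / k2 * (\<integral>w. (Hz z w)\<^sup>2 \<partial>XTT)"
    using sq_int_XT_if_slices[OF m(2) g r] unfolding ig by blast+
qed

lemma tderiv_mixed:
  assumes z: "z \<in> V"
  shows "(\<integral>p. tderiv Jl z p * tderiv Jr z p \<partial>XT) = - (k3 / k2) * (\<integral>w. (Hz z w)\<^sup>2 \<partial>XTT)"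
proof -
  note m [measurable] = tderiv_measurable[OF V_D(1)[OF z]]
  have "(\<integral>p. tderiv Jl z p * tderiv Jr z p \<partial>XT) = (\<integral>x. (\<integral>t. tderiv Jl z (x, t) * tderiv Jr z (x, t) \<partial>lborel) \<partial>lborel)"
    using lborel_pair.integral_fst'[OF integrable_mult_sq_int[OF tderiv_norm(1,2)[OF z]]] by simp
  also have "\<dots> = (\<integral>x. - (k3 / k2) * (\<integral>w. (Hz z (x, w))\<^sup>2 \<partial>lborel2) \<partial>lborel)"
  proof (rule integral_cong_AE)
    show "AE x in lborel. (\<integral>t. tderiv Jl z (x, t) * tderiv Jr z (x, t) \<partial>lborel) = - (k3 / k2) * (\<integral>w. (Hz z (x, w))\<^sup>2 \<partial>lborel2)"
      using tderiv_slices[OF z] by eventually_elim (use k2_pos in \<open>simp add: field_simps\<close>)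
    show "(\<lambda>x. - (k3 / k2) * (\<integral>w. (Hz z (x, w))\<^sup>2 \<partial>lborel2)) \<in> borel_measurable lborel"
      using integral_Hz_slices(1)[OF z] by (intro borel_measurable_times) auto
  qed measurable
  also have "\<dots> = - (k3 / k2) * (\<integral>w. (Hz z w)\<^sup>2 \<partial>XTT)" using integral_Hz_slices(2)[OF z] by simp
  finally show ?thesis .
qed

text \<open>Linearity is only claimed almost everywhere: where the quotients diverge,
  \<open>lim\<close> has no useful value.\<close>

lemma tderiv_lincomb:
  assumes z: "z \<in> V" and z': "z' \<in> V"
  shows "AE p in XT. tderiv Jl (\<lambda>p. a *\<^sub>R z p + b *\<^sub>R z' p) p = a * tderiv Jl z p + b * tderiv Jl z' p"
    and "AE p in XT. tderiv Jr (\<lambda>p. a *\<^sub>R z p + b *\<^sub>R z' p) p = a * tderiv Jr z p + b * tderiv Jr z' p"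
proof -
  let ?y = "\<lambda>p. a *\<^sub>R z p + b *\<^sub>R z' p"
  have r: "AE p in XT. sq_int lborel (slice z (fst p)) \<and> sq_int lborel (slice z' (fst p))"
    by (rule AE_pair_fst) (use slices_regular[OF z] slices_regular[OF z'] in eventually_elim, blast)
  show "AE p in XT. tderiv Jl ?y p = a * tderiv Jl z p + b * tderiv Jl z' p"
    using r tderiv_DERIV(1)[OF z] tderiv_DERIV(1)[OF z']
  proof eventually_elim
    case (elim p)
    have "Jl (slice ?y (fst p)) = (\<lambda>t. a * Jl (slice z (fst p)) t + b * Jl (slice z' (fst p)) t)"
      unfolding slice_lincomb using Jl_lincomb[OF conjunct1[OF elim(1)] slice_supp[OF z] conjunct2[OF elim(1)] slice_supp[OF z']] by blast
    then have "(Jl (slice ?y (fst p)) has_real_derivative a * tderiv Jl z p + b * tderiv Jl z' p) (at (snd p))"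
      using elim(2,3) by (auto intro!: derivative_eq_intros)
    from tderiv_eq[where J = Jl and z = ?y and x = "fst p", OF this] show ?case by simp
  qed
  show "AE p in XT. tderiv Jr ?y p = a * tderiv Jr z p + b * tderiv Jr z' p"
    using r tderiv_DERIV(2)[OF z] tderiv_DERIV(2)[OF z']
  proof eventually_elim
    case (elim p)
    have "Jr (slice ?y (fst p)) = (\<lambda>t. a * Jr (slice z (fst p)) t + b * Jr (slice z' (fst p)) t)"
      unfolding slice_lincomb using Jr_lincomb[OF conjunct1[OF elim(1)] slice_supp[OF z] conjunct2[OF elim(1)] slice_supp[OF z']] by blast
    then have "(Jr (slice ?y (fst p)) has_real_derivative a * tderiv Jr z p + b * tderiv Jr z' p) (at (snd p))"
      using elim(2,3) by (auto intro!: derivative_eq_intros)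
    from tderiv_eq[where J = Jr and z = ?y and x = "fst p", OF this] show ?case by simp
  qed
qed

text \<open>The left derivative vanishes before time 0 and the right one after time
  \<open>T\<close>; each may persist on the other side, but their product does not. So products over
  the cylinder can be integrated over the whole line.\<close>

lemma tderiv_mult_outside:
  assumes z: "z \<in> V" and z': "z' \<in> V"
  shows "AE p in XT. p \<notin> D \<longrightarrow> tderiv Jl z p * tderiv Jr z' p = 0"
proof -
  \<comment> \<open>At time 0 the forward quotient already sees positive times, so that instant is
    discarded.\<close>
  have "AE p in XT. snd p \<noteq> 0"
    by (rule lborel_pair.AE_pair_measure) (measurable, simp add: AE_lborel_singleton)
  then show ?thesis using tderiv_DERIV(1)[OF z]
  proof eventually_elim
    case (elim p)
    obtain x t where p: "p = (x, t)" by (cases p)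
    show ?case
    proof (intro impI)
      assume "p \<notin> D"
      then consider "x \<notin> \<Omega>" | "t < 0" | "T \<le> t" using elim(1) unfolding p by (force simp: mem_D)
      then show "tderiv Jl z p * tderiv Jr z' p = 0"
      proof cases
        case 1
        then have "tderiv Jl z p = lim (\<lambda>n. 0)" by (simp add: tderiv_def p slice_outside[OF z])
        then show ?thesis by simp
      next
        case 2
        have "(Jl (slice z x) has_real_derivative 0) (at t)"
        proof (rule DERIV_cong_ev[OF refl _ refl, THEN iffD2])
          have "eventually (\<lambda>s. s < 0) (nhds t)" using eventually_nhds_in_open[of "{..<0}" t] 2 by simp
          then show "\<forall>\<^sub>F s in nhds t. Jl (slice z x) s = 0"
            by eventually_elim (intro Jl_nonpos[of T] slice_supp[OF z]; simp)
        qed simp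
        from tderiv_eq[where J = Jl and z = z and x = x, OF this] show ?thesis by (simp add: p)
      next
        case 3
        \<comment> \<open>The quotients in \<open>tderiv\<close> only look forward, so the instant
          \<open>T\<close> itself is included.\<close>
        have "Jr (slice z' x) s = 0" if "T \<le> s" for s using that by (intro Jr_ge[of T] slice_supp[OF z']; simp)
        then have "Jr (slice z' x) (t + 1 / real (Suc n)) = 0" "Jr (slice z' x) t = 0" for n
          using 3 by (simp_all add: add_increasing2)
        then have "tderiv Jr z' p = lim (\<lambda>n. 0)" by (simp add: tderiv_def p del: of_nat_Suc)
        then show ?thesis by simp
      qed
    qed
  qed
qed

end

lemma integral_weighted_Cauchy_Schwarz:
  fixes f :: "'a \<Rightarrow> 'b::euclidean_space" and g :: "'a \<Rightarrow> 'c::euclidean_space" and h :: "'a \<Rightarrow> real"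
  assumes f: "sq_int N f" and g: "sq_int N g" and h: "h \<in> borel_measurable N"
    and le: "\<And>x. \<bar>h x\<bar> \<le> M * (norm (f x) * norm (g x))" and M: "0 \<le> M"
  shows "integrable N h" "\<bar>\<integral>x. h x \<partial>N\<bar> \<le> M * (sqrt (\<integral>x. (norm (f x))\<^sup>2 \<partial>N) * sqrt (\<integral>x. (norm (g x))\<^sup>2 \<partial>N))"
proof -
  have nf: "sq_int N (\<lambda>x. norm (f x))" "sq_int N (\<lambda>x. norm (g x))"
    using f g by (auto simp: sq_int_def)
  have i: "integrable N (\<lambda>x. M * (norm (f x) * norm (g x)))"
    by (intro integrable_mult_right integrable_mult_sq_int nf)
  show ih: "integrable N h"
    by (rule Bochner_Integration.integrable_bound[OF i h AE_I2]) (use le M in \<open>simp add: abs_mult\<close>)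
  have "\<bar>\<integral>x. h x \<partial>N\<bar> \<le> (\<integral>x. \<bar>h x\<bar> \<partial>N)" by (rule integral_abs_bound)
  also have "\<dots> \<le> (\<integral>x. M * (norm (f x) * norm (g x)) \<partial>N)" using ih le by (intro integral_mono i) auto
  also have "\<dots> = M * (\<integral>x. norm (f x) * norm (g x) \<partial>N)" by simp
  also have "(\<integral>x. norm (f x) * norm (g x) \<partial>N) \<le> sqrt (\<integral>x. (norm (f x))\<^sup>2 \<partial>N) * sqrt (\<integral>x. (norm (g x))\<^sup>2 \<partial>N)"
    using integral_Cauchy_Schwarz[OF nf] by simp
  finally show "\<bar>\<integral>x. h x \<partial>N\<bar> \<le> M * (sqrt (\<integral>x. (norm (f x))\<^sup>2 \<partial>N) * sqrt (\<integral>x. (norm (g x))\<^sup>2 \<partial>N))"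
    using M by (simp add: mult_left_mono)
qed

section \<open>Riemann-Liouville derivatives of representatives\<close>

context fractional_order
begin

text \<open>Outside \<open>(0, T)\<close> the function \<open>u\<close> is arbitrary, so the two
  integrals agree only for end points below \<open>T\<close>. That is a neighbourhood of
  \<open>t\<close>, and a derivative is local.\<close>

lemma RL_left_eq:
  assumes ae: "AE \<tau> in lborel. \<tau> \<in> {0<..<T} \<longrightarrow> u \<tau> = f \<tau>" and f: "f \<in> borel_measurable borel"
    and supp: "\<And>t. t \<notin> {0<..<T} \<Longrightarrow> f t = 0" and t: "t \<in> {0<..<T}" and d: "(Jl f has_real_derivative d) (at t)"
  shows "RL_left \<sigma> u t = 1 / Gamma (1 - \<sigma>) * d"
proof -
  note [measurable] = f
  have eq: "(LINT \<tau>:{0<..<s}|lebesgue. (s - \<tau>) powr - \<sigma> * u \<tau>) = Jl f s" if "s < T" for s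
    unfolding set_lebesgue_integral_def Jl_def
  proof (rule integral_lebesgue_AE_eq)
    show "(\<lambda>a. f a * K (s - a)) \<in> borel_measurable lborel" by measurable
    show "AE \<tau> in lborel. indicator {0<..<s} \<tau> *\<^sub>R ((s - \<tau>) powr - \<sigma> * u \<tau>) = f \<tau> * K (s - \<tau>)"
      using ae
    proof eventually_elim
      case (elim \<tau>)
      show ?case
      proof (cases "\<tau> \<in> {0<..<s}")
        case True
        then show ?thesis using elim that by (simp add: K_def)
      next
        case False
        then have "f \<tau> = 0 \<or> K (s - \<tau>) = 0" using supp[of \<tau>] by (auto simp: K_def)
        then show ?thesis using False by auto
      qed
    qed
  qed
  have "\<forall>\<^sub>F s in nhds t. s \<in> {..<T}" using t by (intro eventually_nhds_in_open) auto
  then have ev: "\<forall>\<^sub>F s in nhds t. (LINT \<tau>:{0<..<s}|lebesgue. (s - \<tau>) powr - \<sigma> * u \<tau>) = Jl f s"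
    by eventually_elim (simp add: eq)
  show ?thesis unfolding RL_left_def deriv_cong_ev[OF ev refl] using DERIV_imp_deriv[OF d] by simp
qed

lemma RL_right_eq:
  assumes ae: "AE \<tau> in lborel. \<tau> \<in> {0<..<T} \<longrightarrow> u \<tau> = f \<tau>" and f: "f \<in> borel_measurable borel"
    and supp: "\<And>t. t \<notin> {0<..<T} \<Longrightarrow> f t = 0" and t: "t \<in> {0<..<T}" and d: "(Jr f has_real_derivative d) (at t)"
  shows "RL_right T \<sigma> u t = - (1 / Gamma (1 - \<sigma>)) * d"
proof -
  note [measurable] = f
  have eq: "(LINT \<tau>:{s<..<T}|lebesgue. (\<tau> - s) powr - \<sigma> * u \<tau>) = Jr f s" if "0 < s" for s
    unfolding set_lebesgue_integral_def Jr_def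
  proof (rule integral_lebesgue_AE_eq)
    show "(\<lambda>a. f a * K (a - s)) \<in> borel_measurable lborel" by measurable
    show "AE \<tau> in lborel. indicator {s<..<T} \<tau> *\<^sub>R ((\<tau> - s) powr - \<sigma> * u \<tau>) = f \<tau> * K (\<tau> - s)"
      using ae
    proof eventually_elim
      case (elim \<tau>)
      show ?case
      proof (cases "\<tau> \<in> {s<..<T}")
        case True
        then show ?thesis using elim that by (simp add: K_def)
      next
        case False
        then have "f \<tau> = 0 \<or> K (\<tau> - s) = 0" using supp[of \<tau>] by (auto simp: K_def)
        then show ?thesis using False by auto
      qed
    qed
  qed
  have "\<forall>\<^sub>F s in nhds t. s \<in> {0<..}" using t by (intro eventually_nhds_in_open) auto
  then have ev: "\<forall>\<^sub>F s in nhds t. (LINT \<tau>:{s<..<T}|lebesgue. (\<tau> - s) powr - \<sigma> * u \<tau>) = Jr f s"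
    by eventually_elim (simp add: eq)
  show ?thesis unfolding RL_right_def deriv_cong_ev[OF ev refl] using DERIV_imp_deriv[OF d] by simp
qed

end

context parabolic
begin

lemma RL_representative:
  assumes z: "z \<in> V" and u: "AE p in lebesgue_on D. u p = fst (z p)"
  shows "AE p in XT. p \<in> D \<longrightarrow> RL_left \<sigma> (\<lambda>\<tau>. u (fst p, \<tau>)) (snd p) = 1 / Gamma (1 - \<sigma>) * tderiv Jl z p"
    and "AE p in XT. p \<in> D \<longrightarrow> RL_right T \<sigma> (\<lambda>\<tau>. u (fst p, \<tau>)) (snd p) = - (1 / Gamma (1 - \<sigma>)) * tderiv Jr z p"
proof -
  have mf: "(\<lambda>p. fst (z p)) \<in> borel_measurable XT" by (rule borel_measurable_fst_comp[OF V_D(1)[OF z]])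
  have ms: "slice z x \<in> borel_measurable borel" for x unfolding slice_def[abs_def] using mf by measurable
  have ae: "AE p in XT. fst p \<in> \<Omega> \<longrightarrow> (AE \<tau> in lborel. \<tau> \<in> {0<..<T} \<longrightarrow> u (fst p, \<tau>) = slice z (fst p) \<tau>)"
    using AE_pair_fst[OF AE_D_slices(2)[OF u]] by (simp add: slice_def)
  show "AE p in XT. p \<in> D \<longrightarrow> RL_left \<sigma> (\<lambda>\<tau>. u (fst p, \<tau>)) (snd p) = 1 / Gamma (1 - \<sigma>) * tderiv Jl z p"
    using ae tderiv_DERIV(1)[OF z]
  proof eventually_elim
    case (elim p)
    show ?case
    proof
      assume "p \<in> D"
      then have p: "fst p \<in> \<Omega>" "snd p \<in> {0<..<T}" by (cases p; simp add: mem_D)+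
      show "RL_left \<sigma> (\<lambda>\<tau>. u (fst p, \<tau>)) (snd p) = 1 / Gamma (1 - \<sigma>) * tderiv Jl z p"
        by (rule RL_left_eq[OF mp[OF elim(1) p(1)] ms slice_supp[OF z] p(2) elim(2)])
    qed
  qed
  show "AE p in XT. p \<in> D \<longrightarrow> RL_right T \<sigma> (\<lambda>\<tau>. u (fst p, \<tau>)) (snd p) = - (1 / Gamma (1 - \<sigma>)) * tderiv Jr z p"
    using ae tderiv_DERIV(2)[OF z]
  proof eventually_elim
    case (elim p)
    show ?case
    proof
      assume "p \<in> D"
      then have p: "fst p \<in> \<Omega>" "snd p \<in> {0<..<T}" by (cases p; simp add: mem_D)+
      show "RL_right T \<sigma> (\<lambda>\<tau>. u (fst p, \<tau>)) (snd p) = - (1 / Gamma (1 - \<sigma>)) * tderiv Jr z p"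
        by (rule RL_right_eq[OF mp[OF elim(1) p(1)] ms slice_supp[OF z] p(2) elim(2)])
    qed
  qed
qed

lemma LINT_D_eq:
  fixes g h :: "(real ^ 'd) \<times> real \<Rightarrow> real"
  assumes g: "g \<in> borel_measurable XT" and ae: "AE p in XT. p \<in> D \<longrightarrow> h p = g p" and out: "AE p in XT. p \<notin> D \<longrightarrow> g p = 0"
  shows "(LINT p:D|lebesgue. h p) = (\<integral>p. g p \<partial>XT)"
proof -
  have "AE p in XT. indicator D p *\<^sub>R h p = g p" using ae out by eventually_elim (auto simp: indicator_def)
  then show ?thesis unfolding set_lebesgue_integral_def using g by (simp only: lborel_prod) (rule integral_lebesgue_AE_eq)
qed

lemma V_sq_int:
  assumes z: "z \<in> V"
  shows "sq_int XT (\<lambda>p. fst (z p))" "sq_int XT (\<lambda>p. snd (z p))"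
    "ip z z = (\<integral>p. (fst (z p))\<^sup>2 \<partial>XT) + (\<integral>p. (norm (snd (z p)))\<^sup>2 \<partial>XT) + (\<integral>w. (Hz z w)\<^sup>2 \<partial>XTT)"
proof -
  note zV = V_D[OF z]
  show f: "sq_int XT (\<lambda>p. fst (z p))"
    by (rule sq_int_bound[OF zV(3) borel_measurable_fst_comp[OF zV(1)] AE_I2[OF norm_fst_le_self]])
  show s: "sq_int XT (\<lambda>p. snd (z p))"
    by (rule sq_int_bound[OF zV(3) borel_measurable_snd_comp[OF zV(1)] AE_I2[OF norm_snd_le_self]])
  have "(norm (z p))\<^sup>2 = (fst (z p))\<^sup>2 + (norm (snd (z p)))\<^sup>2" for p by (simp add: norm_prod_def)
  then have "(\<integral>p. (norm (z p))\<^sup>2 \<partial>XT) = (\<integral>p. (fst (z p))\<^sup>2 \<partial>XT) + (\<integral>p. (norm (snd (z p)))\<^sup>2 \<partial>XT)"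
    using f s by (simp add: sq_int_def)
  then show "ip z z = (\<integral>p. (fst (z p))\<^sup>2 \<partial>XT) + (\<integral>p. (norm (snd (z p)))\<^sup>2 \<partial>XT) + (\<integral>w. (Hz z w)\<^sup>2 \<partial>XTT)"
    by (simp add: ip_self)
qed

lemma V_norms_le:
  assumes z: "z \<in> V"
  shows "sqrt (\<integral>p. (norm (fst (z p)))\<^sup>2 \<partial>XT) \<le> sqrt (ip z z)" "sqrt (\<integral>p. (norm (snd (z p)))\<^sup>2 \<partial>XT) \<le> sqrt (ip z z)"
    "(\<integral>w. (Hz z w)\<^sup>2 \<partial>XTT) \<le> ip z z"
proof -
  have "0 \<le> (\<integral>p. (fst (z p))\<^sup>2 \<partial>XT)" "0 \<le> (\<integral>p. (norm (snd (z p)))\<^sup>2 \<partial>XT)" "0 \<le> (\<integral>w. (Hz z w)\<^sup>2 \<partial>XTT)" by simp_all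
  then show "sqrt (\<integral>p. (norm (fst (z p)))\<^sup>2 \<partial>XT) \<le> sqrt (ip z z)" "sqrt (\<integral>p. (norm (snd (z p)))\<^sup>2 \<partial>XT) \<le> sqrt (ip z z)"
    "(\<integral>w. (Hz z w)\<^sup>2 \<partial>XTT) \<le> ip z z"
    unfolding V_sq_int(3)[OF z] by simp_all
qed

text \<open>\<open>slob_lower\<close> integrated over \<open>x\<close>. It recovers the L2 part of
  \<open>ip\<close> from the seminorm and thereby makes coercivity possible.\<close>

lemma Poincare_in_time:
  assumes z: "z \<in> V"
  shows "T * (2 * T) powr (-(1 + 2 * \<sigma>)) * (\<integral>p. (fst (z p))\<^sup>2 \<partial>XT) \<le> (\<integral>w. (Hz z w)\<^sup>2 \<partial>XTT)"
proof -
  let ?c = "T * (2 * T) powr (-(1 + 2 * \<sigma>))"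
  note zV = V_D[OF z]
  have mf [measurable]: "(\<lambda>p. fst (z p)) \<in> borel_measurable XT" by (rule borel_measurable_fst_comp[OF zV(1)])
  have ms: "slice z x \<in> borel_measurable borel" for x unfolding slice_def[abs_def] using mf by measurable
  have "ennreal ?c * (\<integral>\<^sup>+p. ennreal ((norm (fst (z p)))\<^sup>2) \<partial>XT) = ennreal ?c * (\<integral>\<^sup>+x. \<integral>\<^sup>+t. ennreal ((norm (fst (z (x, t))))\<^sup>2) \<partial>lborel \<partial>lborel)"
    by (subst lborel.nn_integral_fst) auto
  also have "\<dots> = (\<integral>\<^sup>+x. ennreal ?c * (\<integral>\<^sup>+t. ennreal ((norm (fst (z (x, t))))\<^sup>2) \<partial>lborel) \<partial>lborel)"
    by (rule nn_integral_cmult[symmetric]) measurable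
  also have "\<dots> \<le> (\<integral>\<^sup>+x. \<integral>\<^sup>+w. ennreal ((slob (\<lambda>t. fst (z (x, t))) w)\<^sup>2) \<partial>lborel2 \<partial>lborel)"
  proof (rule nn_integral_mono)
    fix x
    have "(\<integral>\<^sup>+t. ennreal ((norm (fst (z (x, t))))\<^sup>2) \<partial>lborel) = L2I T (slice z x)"
      unfolding L2I_def using slice_supp[OF z, of _ x] by (intro nn_integral_cong) (auto simp: slice_def indicator_def)
    then show "ennreal ?c * (\<integral>\<^sup>+t. ennreal ((norm (fst (z (x, t))))\<^sup>2) \<partial>lborel) \<le> (\<integral>\<^sup>+w. ennreal ((slob (\<lambda>t. fst (z (x, t))) w)\<^sup>2) \<partial>lborel2)"
      using slob_lower(2)[OF T_pos ms slice_supp[OF z], of x] by (simp add: slice_def[abs_def])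
  qed
  also have "\<dots> = (\<integral>\<^sup>+w. ennreal ((Hz z w)\<^sup>2) \<partial>XTT)" by (rule XTT_nn_integral[OF zV(1), symmetric])
  finally have "ennreal ?c * ennreal (\<integral>p. (norm (fst (z p)))\<^sup>2 \<partial>XT) \<le> ennreal (\<integral>w. (norm (Hz z w))\<^sup>2 \<partial>XTT)"
    using sq_int_nn_integral_eq[OF V_sq_int(1)[OF z]] sq_int_nn_integral_eq[OF zV(4)] by simp
  then show ?thesis using T_pos by (simp add: ennreal_mult[symmetric] ennreal_le_iff)
qed

end

subsection \<open>The bilinear form of the equation\<close>

text \<open>The coefficients \<open>a\<close> and \<open>c\<close> are Borel functions bounded
  everywhere; the actual data, given on the domain and partly almost everywhere, are adapted to this
  form at the end.\<close>

locale parabolic_problem = parabolic \<sigma> \<Omega> T for \<sigma> :: real and \<Omega> :: "(real ^ 'd) set" and T :: real +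
  fixes a :: "real ^ 'd \<Rightarrow> 'd \<Rightarrow> 'd \<Rightarrow> real" and c :: "real ^ 'd \<Rightarrow> real" and M lam0 :: real
  assumes a_measurable [measurable]: "(\<lambda>x. a x k l) \<in> borel_measurable borel" and a_bound: "\<bar>a x k l\<bar> \<le> M"
    and elliptic: "x \<in> \<Omega> \<Longrightarrow> lam0 * (norm \<xi>)\<^sup>2 \<le> (\<Sum>k\<in>UNIV. \<Sum>l\<in>UNIV. a x k l * \<xi> $ k * \<xi> $ l)"
    and c_measurable [measurable]: "c \<in> borel_measurable borel" and c_nonneg: "0 \<le> c x" and c_bound: "c x \<le> M"
    and lam0_pos: "0 < lam0"
begin

lemma M_nonneg: "0 \<le> M" using c_nonneg[of 0] c_bound[of 0] by simp

definition \<gamma> :: real where "\<gamma> = 1 / Gamma (1 - \<sigma>)"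

lemma \<gamma>_pos: "0 < \<gamma>" unfolding \<gamma>_def using \<sigma>_half by (simp add: Gamma_real_pos)

definition aform :: "real ^ 'd \<Rightarrow> real ^ 'd \<Rightarrow> real ^ 'd \<Rightarrow> real" where
  "aform x \<xi> \<eta> = (\<Sum>k\<in>UNIV. \<Sum>l\<in>UNIV. a x k l * \<xi> $ k * \<eta> $ l)"

definition M' :: real where "M' = real CARD('d) * (real CARD('d) * M)"

lemma M'_nonneg: "0 \<le> M'" unfolding M'_def using M_nonneg by simp

lemma aform_bound: "\<bar>aform x \<xi> \<eta>\<bar> \<le> M' * (norm \<xi> * norm \<eta>)"
proof -
  have "\<bar>a x k l * \<xi> $ k * \<eta> $ l\<bar> \<le> M * (norm \<xi> * norm \<eta>)" for k l
    unfolding abs_mult mult.assoc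
    using a_bound component_le_norm_cart[of \<xi> k] component_le_norm_cart[of \<eta> l] M_nonneg by (intro mult_mono) auto
  then have "\<bar>\<Sum>l\<in>UNIV. a x k l * \<xi> $ k * \<eta> $ l\<bar> \<le> (\<Sum>l\<in>(UNIV :: 'd set). M * (norm \<xi> * norm \<eta>))" for k
    by (intro order_trans[OF sum_abs] sum_mono)
  then have "\<bar>aform x \<xi> \<eta>\<bar> \<le> (\<Sum>k\<in>(UNIV :: 'd set). \<Sum>l\<in>(UNIV :: 'd set). M * (norm \<xi> * norm \<eta>))"
    unfolding aform_def by (rule order_trans[OF sum_abs sum_mono])
  then show ?thesis by (simp add: M'_def mult.assoc)
qed

lemma aform_lincomb_left: "aform x (r *\<^sub>R \<xi> + s *\<^sub>R \<zeta>) \<eta> = r * aform x \<xi> \<eta> + s * aform x \<zeta> \<eta>"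
  by (simp add: aform_def sum_distrib_left sum.distrib[symmetric] algebra_simps)

lemma aform_lincomb_right: "aform x \<eta> (r *\<^sub>R \<xi> + s *\<^sub>R \<zeta>) = r * aform x \<eta> \<xi> + s * aform x \<eta> \<zeta>"
  by (simp add: aform_def sum_distrib_left sum.distrib[symmetric] algebra_simps)

text \<open>The minus sign stems from \<open>RL_right\<close>; the square of \<open>\<gamma>\<close>
  collects the Gamma factors of both derivatives.\<close>

definition b :: "((real ^ 'd) \<times> real \<Rightarrow> real \<times> (real ^ 'd)) \<Rightarrow> ((real ^ 'd) \<times> real \<Rightarrow> real \<times> (real ^ 'd)) \<Rightarrow> real" where
  "b z z' = - \<gamma>\<^sup>2 * (\<integral>p. tderiv Jl z p * tderiv Jr z' p \<partial>XT) + (\<integral>p. aform (fst p) (snd (z p)) (snd (z' p)) \<partial>XT)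
    + (\<integral>p. c (fst p) * fst (z p) * fst (z' p) \<partial>XT)"

lemma b_measurable:
  assumes z: "z \<in> V" and z': "z' \<in> V"
  shows "(\<lambda>p. aform (fst p) (snd (z p)) (snd (z' p))) \<in> borel_measurable XT"
    "(\<lambda>p. c (fst p) * fst (z p) * fst (z' p)) \<in> borel_measurable XT"
proof -
  note m = V_D(1)[OF z] V_D(1)[OF z']
  note [measurable] = borel_measurable_fst_comp[OF m(1)] borel_measurable_fst_comp[OF m(2)]
  have [measurable]: "(\<lambda>p. snd (y p) $ k) \<in> borel_measurable XT" if "y \<in> borel_measurable XT" for y :: "(real ^ 'd) \<times> real \<Rightarrow> real \<times> (real ^ 'd)" and k
    using measurable_compose[OF borel_measurable_snd_comp[OF that], of "\<lambda>v. v $ k" borel]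
    by (simp add: borel_measurable_continuous_onI continuous_on_component)
  note k [measurable] = this[OF m(1)] this[OF m(2)]
  have ma: "(\<lambda>p. a (fst p) k l) \<in> borel_measurable XT" for k l by measurable
  show "(\<lambda>p. aform (fst p) (snd (z p)) (snd (z' p))) \<in> borel_measurable XT"
    unfolding aform_def by (intro borel_measurable_sum borel_measurable_times ma k)
  show "(\<lambda>p. c (fst p) * fst (z p) * fst (z' p)) \<in> borel_measurable XT" by measurable
qed

lemma
  assumes z: "z \<in> V" and z': "z' \<in> V"
  shows b_integrable: "integrable XT (\<lambda>p. tderiv Jl z p * tderiv Jr z' p)"
      "integrable XT (\<lambda>p. aform (fst p) (snd (z p)) (snd (z' p)))" "integrable XT (\<lambda>p. c (fst p) * fst (z p) * fst (z' p))"
    and b_bound: "\<bar>b z z'\<bar> \<le> (\<gamma>\<^sup>2 * (k1 / k2) + M' + M) * (sqrt (ip z z) * sqrt (ip z' z'))"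
proof -
  note t = tderiv_norm(1,3)[OF z] tderiv_norm(2,4)[OF z']
  have k1: "0 \<le> k1" by (simp add: k1_def)
  note m = b_measurable[OF z z'] and s = V_sq_int(1,2)[OF z] and s' = V_sq_int(1,2)[OF z']
  have n: "0 \<le> ip z z" "0 \<le> ip z' z'" using z z' by (simp_all add: V.ip_nonneg)
  have mt: "(\<lambda>p. tderiv Jl z p * tderiv Jr z' p) \<in> borel_measurable XT"
    using t(1,3) by (auto simp: sq_int_def)
  have le1: "\<bar>tderiv Jl z p * tderiv Jr z' p\<bar> \<le> 1 * (norm (tderiv Jl z p) * norm (tderiv Jr z' p))" for p
    by (simp add: abs_mult)
  have 1: "integrable XT (\<lambda>p. tderiv Jl z p * tderiv Jr z' p)"
    "\<bar>\<integral>p. tderiv Jl z p * tderiv Jr z' p \<partial>XT\<bar> \<le> 1 * (sqrt (\<integral>p. (norm (tderiv Jl z p))\<^sup>2 \<partial>XT) * sqrt (\<integral>p. (norm (tderiv Jr z' p))\<^sup>2 \<partial>XT))"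
    by (rule integral_weighted_Cauchy_Schwarz[OF t(1,3) mt le1 zero_le_one])+
  have 2: "integrable XT (\<lambda>p. aform (fst p) (snd (z p)) (snd (z' p)))"
    "\<bar>\<integral>p. aform (fst p) (snd (z p)) (snd (z' p)) \<partial>XT\<bar> \<le> M' * (sqrt (\<integral>p. (norm (snd (z p)))\<^sup>2 \<partial>XT) * sqrt (\<integral>p. (norm (snd (z' p)))\<^sup>2 \<partial>XT))"
    by (rule integral_weighted_Cauchy_Schwarz[OF s(2) s'(2) m(1) aform_bound M'_nonneg])+
  have le: "\<bar>c (fst p) * fst (z p) * fst (z' p)\<bar> \<le> M * (norm (fst (z p)) * norm (fst (z' p)))" for p
    using c_nonneg[of "fst p"] c_bound[of "fst p"] by (simp add: abs_mult mult.assoc mult_right_mono)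
  have 3: "integrable XT (\<lambda>p. c (fst p) * fst (z p) * fst (z' p))"
    "\<bar>\<integral>p. c (fst p) * fst (z p) * fst (z' p) \<partial>XT\<bar> \<le> M * (sqrt (\<integral>p. (norm (fst (z p)))\<^sup>2 \<partial>XT) * sqrt (\<integral>p. (norm (fst (z' p)))\<^sup>2 \<partial>XT))"
    by (rule integral_weighted_Cauchy_Schwarz[OF s(1) s'(1) m(2) le M_nonneg])+
  show "integrable XT (\<lambda>p. tderiv Jl z p * tderiv Jr z' p)"
    "integrable XT (\<lambda>p. aform (fst p) (snd (z p)) (snd (z' p)))" "integrable XT (\<lambda>p. c (fst p) * fst (z p) * fst (z' p))"
    by (fact 1 2 3)+
  let ?X = "sqrt (ip z z) * sqrt (ip z' z')"
  \<comment> \<open>Each of the two derivative norms contributes this factor.\<close>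
  define s where "s = sqrt (k1 / k2)"
  have ss: "k1 / k2 = s * s" using k1 k2_pos by (simp add: s_def real_sqrt_mult_self)
  have "sqrt (\<integral>p. (norm (tderiv Jl z p))\<^sup>2 \<partial>XT) * sqrt (\<integral>p. (norm (tderiv Jr z' p))\<^sup>2 \<partial>XT)
    = (k1 / k2) * (sqrt (\<integral>w. (Hz z w)\<^sup>2 \<partial>XTT) * sqrt (\<integral>w. (Hz z' w)\<^sup>2 \<partial>XTT))"
    unfolding real_norm_def power2_abs t(2,4) real_sqrt_mult unfolding s_def[symmetric] unfolding ss by (simp only: mult_ac)
  also have "\<dots> \<le> (k1 / k2) * ?X"
    using k1 k2_pos V_norms_le(3)[OF z] V_norms_le(3)[OF z'] n by (intro mult_left_mono mult_mono real_sqrt_le_mono) auto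
  finally have J: "\<bar>\<integral>p. tderiv Jl z p * tderiv Jr z' p \<partial>XT\<bar> \<le> (k1 / k2) * ?X" using 1(2) by simp
  have B1: "\<bar>- \<gamma>\<^sup>2 * (\<integral>p. tderiv Jl z p * tderiv Jr z' p \<partial>XT)\<bar> \<le> \<gamma>\<^sup>2 * ((k1 / k2) * ?X)"
    using mult_left_mono[OF J, of "\<gamma>\<^sup>2"] by (simp add: abs_mult)
  have B2: "\<bar>\<integral>p. aform (fst p) (snd (z p)) (snd (z' p)) \<partial>XT\<bar> \<le> M' * ?X"
    by (rule order_trans[OF 2(2)]) (intro mult_left_mono mult_mono V_norms_le z z' M'_nonneg; use n in simp)
  have B3: "\<bar>\<integral>p. c (fst p) * fst (z p) * fst (z' p) \<partial>XT\<bar> \<le> M * ?X"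
    by (rule order_trans[OF 3(2)]) (intro mult_left_mono mult_mono V_norms_le z z' M_nonneg; use n in simp)
  show "\<bar>b z z'\<bar> \<le> (\<gamma>\<^sup>2 * (k1 / k2) + M' + M) * ?X"
    unfolding b_def using B1 B2 B3 by (simp add: distrib_right mult.assoc)
qed

lemma b_lincomb_left:
  assumes z: "z \<in> V" and y: "y \<in> V" and w: "w \<in> V"
  shows "b (\<lambda>p. r *\<^sub>R z p + s *\<^sub>R y p) w = r * b z w + s * b y w"
proof -
  let ?x = "\<lambda>p. r *\<^sub>R z p + s *\<^sub>R y p"
  have x: "?x \<in> V" by (rule V_lincomb[OF z y])
  have "(\<integral>p. tderiv Jl ?x p * tderiv Jr w p \<partial>XT) = (\<integral>p. r * (tderiv Jl z p * tderiv Jr w p) + s * (tderiv Jl y p * tderiv Jr w p) \<partial>XT)"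
    using b_integrable(1)[OF x w] b_integrable(1)[OF z w] b_integrable(1)[OF y w]
    by (intro integral_cong_AE) (auto intro: eventually_mono[OF tderiv_lincomb(1)[OF z y, of r s]] simp: algebra_simps)
  also have "\<dots> = r * (\<integral>p. tderiv Jl z p * tderiv Jr w p \<partial>XT) + s * (\<integral>p. tderiv Jl y p * tderiv Jr w p \<partial>XT)"
    using b_integrable(1)[OF z w] b_integrable(1)[OF y w] by simp
  finally have 1: "(\<integral>p. tderiv Jl ?x p * tderiv Jr w p \<partial>XT) = r * (\<integral>p. tderiv Jl z p * tderiv Jr w p \<partial>XT) + s * (\<integral>p. tderiv Jl y p * tderiv Jr w p \<partial>XT)" .
  have 2: "(\<integral>p. aform (fst p) (snd (?x p)) (snd (w p)) \<partial>XT)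
    = r * (\<integral>p. aform (fst p) (snd (z p)) (snd (w p)) \<partial>XT) + s * (\<integral>p. aform (fst p) (snd (y p)) (snd (w p)) \<partial>XT)"
    using b_integrable(2)[OF z w] b_integrable(2)[OF y w] by (simp add: aform_lincomb_left)
  have "(\<integral>p. c (fst p) * fst (?x p) * fst (w p) \<partial>XT) = (\<integral>p. r * (c (fst p) * fst (z p) * fst (w p)) + s * (c (fst p) * fst (y p) * fst (w p)) \<partial>XT)"
    by (simp add: algebra_simps)
  then have 3: "(\<integral>p. c (fst p) * fst (?x p) * fst (w p) \<partial>XT)
    = r * (\<integral>p. c (fst p) * fst (z p) * fst (w p) \<partial>XT) + s * (\<integral>p. c (fst p) * fst (y p) * fst (w p) \<partial>XT)"
    using b_integrable(3)[OF z w] b_integrable(3)[OF y w] by simp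
  show ?thesis unfolding b_def 1 2 3 by (simp add: algebra_simps)
qed

lemma b_lincomb_right:
  assumes z: "z \<in> V" and y: "y \<in> V" and w: "w \<in> V"
  shows "b w (\<lambda>p. r *\<^sub>R z p + s *\<^sub>R y p) = r * b w z + s * b w y"
proof -
  let ?x = "\<lambda>p. r *\<^sub>R z p + s *\<^sub>R y p"
  have x: "?x \<in> V" by (rule V_lincomb[OF z y])
  have "(\<integral>p. tderiv Jl w p * tderiv Jr ?x p \<partial>XT) = (\<integral>p. r * (tderiv Jl w p * tderiv Jr z p) + s * (tderiv Jl w p * tderiv Jr y p) \<partial>XT)"
    using b_integrable(1)[OF w x] b_integrable(1)[OF w z] b_integrable(1)[OF w y]
    by (intro integral_cong_AE) (auto intro: eventually_mono[OF tderiv_lincomb(2)[OF z y, of r s]] simp: algebra_simps)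
  also have "\<dots> = r * (\<integral>p. tderiv Jl w p * tderiv Jr z p \<partial>XT) + s * (\<integral>p. tderiv Jl w p * tderiv Jr y p \<partial>XT)"
    using b_integrable(1)[OF w z] b_integrable(1)[OF w y] by simp
  finally have 1: "(\<integral>p. tderiv Jl w p * tderiv Jr ?x p \<partial>XT) = r * (\<integral>p. tderiv Jl w p * tderiv Jr z p \<partial>XT) + s * (\<integral>p. tderiv Jl w p * tderiv Jr y p \<partial>XT)" .
  have 2: "(\<integral>p. aform (fst p) (snd (w p)) (snd (?x p)) \<partial>XT)
    = r * (\<integral>p. aform (fst p) (snd (w p)) (snd (z p)) \<partial>XT) + s * (\<integral>p. aform (fst p) (snd (w p)) (snd (y p)) \<partial>XT)"
    using b_integrable(2)[OF w z] b_integrable(2)[OF w y] by (simp add: aform_lincomb_right)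
  have "(\<integral>p. c (fst p) * fst (w p) * fst (?x p) \<partial>XT) = (\<integral>p. r * (c (fst p) * fst (w p) * fst (z p)) + s * (c (fst p) * fst (w p) * fst (y p)) \<partial>XT)"
    by (simp add: algebra_simps)
  then have 3: "(\<integral>p. c (fst p) * fst (w p) * fst (?x p) \<partial>XT)
    = r * (\<integral>p. c (fst p) * fst (w p) * fst (z p) \<partial>XT) + s * (\<integral>p. c (fst p) * fst (w p) * fst (y p) \<partial>XT)"
    using b_integrable(3)[OF w z] b_integrable(3)[OF w y] by simp
  show ?thesis unfolding b_def 1 2 3 by (simp add: algebra_simps)
qed

text \<open>
  By \<open>tderiv_mixed\<close> the fractional term of \<open>b z z\<close> is a positive multiple of the Slobodeckij
  seminorm, which in turn controls the L2 norm.
\<close>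

lemma b_coercive:
  "\<exists>\<beta>>0. \<forall>z\<in>V. \<beta> * ip z z \<le> b z z"
proof -
  define c1 where "c1 = \<gamma>\<^sup>2 * (k3 / k2)"
  define cT where "cT = T * (2 * T) powr (-(1 + 2 * \<sigma>))"
  \<comment> \<open>Half of the fractional term is kept as the seminorm, the other half pays for the
    L2 norm through \<open>Poincare_in_time\<close>; the gradient is covered by ellipticity.\<close>
  define \<beta> where "\<beta> = min (min (c1 / 2) (c1 * cT / 2)) lam0"
  have c1: "0 < c1" unfolding c1_def using \<gamma>_pos k2_pos k3_pos by simp
  have cT: "0 < cT" unfolding cT_def using T_pos by simp
  show ?thesis
  proof (intro exI[of _ \<beta>] conjI ballI)
    show "0 < \<beta>" unfolding \<beta>_def using c1 cT lam0_pos by simp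
    fix z assume z: "z \<in> V"
    define F where "F = (\<integral>p. (fst (z p))\<^sup>2 \<partial>XT)"
    define G where "G = (\<integral>p. (norm (snd (z p)))\<^sup>2 \<partial>XT)"
    define H where "H = (\<integral>w. (Hz z w)\<^sup>2 \<partial>XTT)"
    have nn: "0 \<le> F" "0 \<le> G" "0 \<le> H" by (simp_all add: F_def G_def H_def)
    have "lam0 * G = (\<integral>p. lam0 * (norm (snd (z p)))\<^sup>2 \<partial>XT)" by (simp add: G_def)
    also have "\<dots> \<le> (\<integral>p. aform (fst p) (snd (z p)) (snd (z p)) \<partial>XT)"
    proof (rule integral_mono)
      show "integrable XT (\<lambda>p. lam0 * (norm (snd (z p)))\<^sup>2)" using V_sq_int(2)[OF z] by (simp add: sq_int_def)
      show "integrable XT (\<lambda>p. aform (fst p) (snd (z p)) (snd (z p)))" by (rule b_integrable(2)[OF z z])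
      show "lam0 * (norm (snd (z p)))\<^sup>2 \<le> aform (fst p) (snd (z p)) (snd (z p))" for p
      proof (cases "p \<in> D")
        case True
        then have "fst p \<in> \<Omega>" by (cases p) (simp add: mem_D)
        then show ?thesis unfolding aform_def by (rule elliptic)
      next
        case False
        then show ?thesis using V_D(2)[OF z False] by (simp add: aform_def)
      qed
    qed
    finally have A: "lam0 * G \<le> (\<integral>p. aform (fst p) (snd (z p)) (snd (z p)) \<partial>XT)" .
    have C: "0 \<le> (\<integral>p. c (fst p) * fst (z p) * fst (z p) \<partial>XT)"
      using c_nonneg by (intro integral_nonneg_AE AE_I2) (simp add: mult.assoc)
    have P: "cT * F \<le> H" unfolding cT_def F_def H_def by (rule Poincare_in_time[OF z])
    have "\<beta> * ip z z = \<beta> * F + \<beta> * G + \<beta> * H" using V_sq_int(3)[OF z] by (simp add: F_def G_def H_def distrib_left)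
    also have "\<dots> \<le> c1 * cT / 2 * F + lam0 * G + c1 / 2 * H"
      using nn by (intro add_mono mult_right_mono) (auto simp: \<beta>_def)
    also have "\<dots> \<le> c1 * H + lam0 * G"
    proof -
      have "c1 / 2 * (cT * F) \<le> c1 / 2 * H" using c1 by (intro mult_left_mono P) simp
      moreover have "c1 * cT / 2 * F = c1 / 2 * (cT * F)" "c1 / 2 * H + c1 / 2 * H = c1 * H" by simp_all
      ultimately show ?thesis by linarith
    qed
    also have "\<dots> \<le> b z z" unfolding b_def tderiv_mixed[OF z] using A C by (simp add: c1_def H_def mult.assoc)
    finally show "\<beta> * ip z z \<le> b z z" .
  qed
qed


text \<open>Each of the three integrands agrees almost everywhere in the cylinder with a Borel
  expression in the representatives, and that expression vanishes almost everywhere outside.\<close>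

lemma weak_form_eq:
  assumes z: "z \<in> V" "AE p in lebesgue_on D. z p = (u p, x_grad \<Omega> T u p)"
    and y: "y \<in> V" "AE p in lebesgue_on D. y p = (w p, x_grad \<Omega> T w p)"
    and A: "\<And>x k l. x \<in> \<Omega> \<Longrightarrow> A x $ k $ l = a x k l" and q: "AE x in lebesgue_on \<Omega>. q x = c x"
  shows "(LINT p:D|lebesgue. RL_left \<sigma> (\<lambda>\<tau>. u (fst p, \<tau>)) (snd p) * RL_right T \<sigma> (\<lambda>\<tau>. w (fst p, \<tau>)) (snd p)) +
    (LINT p:D|lebesgue. (\<Sum>k\<in>UNIV. \<Sum>l\<in>UNIV. A (fst p) $ k $ l * x_grad \<Omega> T u p $ k * x_grad \<Omega> T w p $ l)) +
    (LINT p:D|lebesgue. q (fst p) * u p * w p) = b z y"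
proof -
  have zu: "AE p in lebesgue_on D. u p = fst (z p)" using z(2) by eventually_elim simp
  have yw: "AE p in lebesgue_on D. w p = fst (y p)" using y(2) by eventually_elim simp
  note m = b_measurable[OF z(1) y(1)] and zae = z(2)[unfolded AE_D_iff] and yae = y(2)[unfolded AE_D_iff]
  have z0: "AE p in XT. p \<notin> D \<longrightarrow> z p = 0" using V_D(2)[OF z(1)] by simp
  have inD: "fst p \<in> \<Omega>" if "p \<in> D" for p using that by (cases p) (simp add: mem_D)
  have 1: "(LINT p:D|lebesgue. RL_left \<sigma> (\<lambda>\<tau>. u (fst p, \<tau>)) (snd p) * RL_right T \<sigma> (\<lambda>\<tau>. w (fst p, \<tau>)) (snd p))
    = (\<integral>p. - \<gamma>\<^sup>2 * (tderiv Jl z p * tderiv Jr y p) \<partial>XT)"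
  proof (rule LINT_D_eq)
    show "(\<lambda>p. - \<gamma>\<^sup>2 * (tderiv Jl z p * tderiv Jr y p)) \<in> borel_measurable XT"
      using b_integrable(1)[OF z(1) y(1)] by (intro borel_measurable_times borel_measurable_const) (auto simp: tderiv_measurable V_D(1)[OF z(1)] V_D(1)[OF y(1)])
    show "AE p in XT. p \<in> D \<longrightarrow> RL_left \<sigma> (\<lambda>\<tau>. u (fst p, \<tau>)) (snd p) * RL_right T \<sigma> (\<lambda>\<tau>. w (fst p, \<tau>)) (snd p) = - \<gamma>\<^sup>2 * (tderiv Jl z p * tderiv Jr y p)"
      using RL_representative(1)[OF z(1) zu] RL_representative(2)[OF y(1) yw]
      by eventually_elim (simp add: \<gamma>_def power2_eq_square)
    show "AE p in XT. p \<notin> D \<longrightarrow> - \<gamma>\<^sup>2 * (tderiv Jl z p * tderiv Jr y p) = 0"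
      using tderiv_mult_outside[OF z(1) y(1)] by eventually_elim simp
  qed
  have 2: "(LINT p:D|lebesgue. (\<Sum>k\<in>UNIV. \<Sum>l\<in>UNIV. A (fst p) $ k $ l * x_grad \<Omega> T u p $ k * x_grad \<Omega> T w p $ l))
    = (\<integral>p. aform (fst p) (snd (z p)) (snd (y p)) \<partial>XT)"
  proof (rule LINT_D_eq[OF m(1)])
    show "AE p in XT. p \<in> D \<longrightarrow> (\<Sum>k\<in>UNIV. \<Sum>l\<in>UNIV. A (fst p) $ k $ l * x_grad \<Omega> T u p $ k * x_grad \<Omega> T w p $ l) = aform (fst p) (snd (z p)) (snd (y p))"
      using zae yae by eventually_elim (simp add: aform_def A inD)
    show "AE p in XT. p \<notin> D \<longrightarrow> aform (fst p) (snd (z p)) (snd (y p)) = 0"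
      using z0 by eventually_elim (simp add: aform_def)
  qed
  have qae: "AE p in XT. fst p \<in> \<Omega> \<longrightarrow> q (fst p) = c (fst p)"
    using AE_pair_fst[OF q[unfolded AE_lebesgue_on_iff[OF \<Omega>_lebesgue]]] .
  have 3: "(LINT p:D|lebesgue. q (fst p) * u p * w p) = (\<integral>p. c (fst p) * fst (z p) * fst (y p) \<partial>XT)"
  proof (rule LINT_D_eq[OF m(2)])
    show "AE p in XT. p \<in> D \<longrightarrow> q (fst p) * u p * w p = c (fst p) * fst (z p) * fst (y p)"
      using zae yae qae by eventually_elim (simp add: inD)
    show "AE p in XT. p \<notin> D \<longrightarrow> c (fst p) * fst (z p) * fst (y p) = 0"
      using z0 by eventually_elim simp
  qed
  show ?thesis unfolding 1 2 3 b_def by simp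
qed

text \<open>The constant is quantified before the source: the witness
  \<open>sqrt 2 / \<beta>\<close> combines coercivity with the factor from
  \<open>B_norm_le\<close>.\<close>

theorem weak_solution_well_posed:
  assumes A: "\<And>x k l. x \<in> \<Omega> \<Longrightarrow> A x $ k $ l = a x k l" and q: "AE x in lebesgue_on \<Omega>. q x = c x" and \<alpha>: "\<alpha> / 2 = \<sigma>"
  shows "\<exists>C. \<forall>F. L2 D F \<longrightarrow> (\<exists>u. weak_solution \<Omega> T \<alpha> A q F u \<and>
    (\<forall>u'. weak_solution \<Omega> T \<alpha> A q F u' \<longrightarrow> (AE p in lebesgue_on D. u' p = u p)) \<and>
    B_norm \<Omega> T \<sigma> u \<le> C * L2_norm D F)"
proof -
  obtain \<beta> where "0 < \<beta> \<and> (\<forall>z\<in>V. \<beta> * ip z z \<le> b z z)" using b_coercive ..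
  then have \<beta>: "0 < \<beta>" "\<And>z. z \<in> V \<Longrightarrow> \<beta> * ip z z \<le> b z z" by simp_all
  define N where "N = \<gamma>\<^sup>2 * (k1 / k2) + M' + M"
  have "\<exists>u. weak_solution \<Omega> T \<alpha> A q F u \<and>
    (\<forall>u'. weak_solution \<Omega> T \<alpha> A q F u' \<longrightarrow> (AE p in lebesgue_on D. u' p = u p)) \<and>
    B_norm \<Omega> T \<sigma> u \<le> sqrt 2 / \<beta> * L2_norm D F" if F: "L2 D F" for F
  proof -
    have mF: "F \<in> borel_measurable (lebesgue_on D)" using F by (simp add: L2_def)
    obtain f where f: "f \<in> borel_measurable XT" "\<And>p. p \<notin> D \<Longrightarrow> f p = 0" "AE p in lebesgue_on D. F p = f p"
      by (rule Borel_representative[OF mF]) (rule that)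
    have fae: "AE p in XT. p \<in> D \<longrightarrow> F p = f p" using f(3) unfolding AE_D_iff .
    have "L2_sq D F = (\<integral>\<^sup>+p\<in>D. ennreal ((norm (F p))\<^sup>2) \<partial>XT)"
      unfolding L2_sq_def nn_integral_completion lborel_prod ..
    also have "\<dots> = (\<integral>\<^sup>+p. ennreal ((norm (f p))\<^sup>2) \<partial>XT)"
      by (rule nn_integral_cong_AE, use fae in eventually_elim) (auto simp: f(2) indicator_def)
    finally have Ff: "L2_sq D F = (\<integral>\<^sup>+p. ennreal ((norm (f p))\<^sup>2) \<partial>XT)" .
    then have sf: "sq_int XT f" using f(1) F by (simp add: sq_int_iff_nn_integral L2_def)
    have nF: "L2_norm D F = sqrt (\<integral>p. (norm (f p))\<^sup>2 \<partial>XT)"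
      unfolding L2_norm_def Ff sq_int_nn_integral_eq[OF sf] by simp
    define l where "l w = (\<integral>p. f p * fst (w p) \<partial>XT)" for w :: "(real ^ 'd) \<times> real \<Rightarrow> real \<times> (real ^ 'd)"
    have lw: "integrable XT (\<lambda>p. f p * fst (w p))" "\<bar>l w\<bar> \<le> L2_norm D F * sqrt (ip w w)" if w: "w \<in> V" for w
    proof -
      show "integrable XT (\<lambda>p. f p * fst (w p))" by (rule integrable_mult_sq_int[OF sf V_sq_int(1)[OF w]])
      have "\<bar>l w\<bar> \<le> L2_norm D F * sqrt (\<integral>p. (norm (fst (w p)))\<^sup>2 \<partial>XT)"
        unfolding l_def nF using integral_Cauchy_Schwarz[OF sf V_sq_int(1)[OF w]] by simp
      also have "\<dots> \<le> L2_norm D F * sqrt (ip w w)" by (intro mult_left_mono V_norms_le w) (simp add: nF)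
      finally show "\<bar>l w\<bar> \<le> L2_norm D F * sqrt (ip w w)" .
    qed
    have l: "V.bounded_functional l" unfolding V.bounded_functional_def
    proof (intro conjI ballI allI exI[of _ "(L2_norm D F)\<^sup>2"])
      show "l (\<lambda>p. x p + y p) = l x + l y" if "x \<in> V" "y \<in> V" for x y
        unfolding l_def using lw(1)[OF that(1)] lw(1)[OF that(2)] by (simp add: distrib_left)
      show "l (\<lambda>p. r *\<^sub>R x p) = r * l x" for r x unfolding l_def by (simp add: mult.left_commute)
      show "(l w)\<^sup>2 \<le> (L2_norm D F)\<^sup>2 * ip w w" if w: "w \<in> V" for w
        using power_mono[OF lw(2)[OF w], of 2] V.ip_nonneg[OF w] by (simp add: power_mult_distrib)
    qed simp
    have bN: "(b x y)\<^sup>2 \<le> N\<^sup>2 * ip x x * ip y y" if "x \<in> V" "y \<in> V" for x y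
      using power_mono[OF b_bound[OF that], of 2] V.ip_nonneg[OF that(1)] V.ip_nonneg[OF that(2)]
      by (simp add: power_mult_distrib N_def mult.assoc)
    have add_l: "b (\<lambda>p. x p + y p) w = b x w + b y w" if "x \<in> V" "y \<in> V" "w \<in> V" for x y w
      using b_lincomb_left[OF that, of 1 1] by simp
    have scl_l: "b (\<lambda>p. r *\<^sub>R x p) w = r * b x w" if "x \<in> V" "w \<in> V" for x w r
      using b_lincomb_left[OF that(1) that, of r 0] by simp
    have add_r: "b w (\<lambda>p. x p + y p) = b w x + b w y" if "x \<in> V" "y \<in> V" "w \<in> V" for x y w
      using b_lincomb_right[OF that, of 1 1] by simp
    have scl_r: "b w (\<lambda>p. r *\<^sub>R x p) = r * b w x" if "x \<in> V" "w \<in> V" for x w r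
      using b_lincomb_right[OF that(1) that, of r 0] by simp
    obtain z where z: "z \<in> V" "\<And>w. w \<in> V \<Longrightarrow> b z w = l w"
      using V.Lax_Milgram[of b, OF add_l scl_l add_r scl_r bN \<beta> l] by blast
    have source: "(LINT p:D|lebesgue. F p * w p) = l y" if y: "y \<in> V" "AE p in lebesgue_on D. y p = (w p, x_grad \<Omega> T w p)" for y w
      unfolding l_def
    proof (rule LINT_D_eq)
      show "(\<lambda>p. f p * fst (y p)) \<in> borel_measurable XT" using lw(1)[OF y(1)] by simp
      show "AE p in XT. p \<in> D \<longrightarrow> F p * w p = f p * fst (y p)"
        using fae y(2)[unfolded AE_D_iff] by eventually_elim simp
      show "AE p in XT. p \<notin> D \<longrightarrow> f p * fst (y p) = 0" using f(2) by simp
    qed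
    let ?u = "\<lambda>p. fst (z p)"
    have "weak_solution \<Omega> T \<alpha> A q F ?u" unfolding weak_solution_def \<alpha>
    proof (intro conjI allI impI)
      show "B_space \<Omega> T \<sigma> ?u" by (rule V_imp_B_space(1)[OF z(1)])
      fix w assume "B_space \<Omega> T \<sigma> w"
      then obtain y where y: "y \<in> V" "AE p in lebesgue_on D. y p = (w p, x_grad \<Omega> T w p)" by (rule B_space_representative)
      show "(LINT p:D|lebesgue. RL_left \<sigma> (\<lambda>\<tau>. ?u (fst p, \<tau>)) (snd p) * RL_right T \<sigma> (\<lambda>\<tau>. w (fst p, \<tau>)) (snd p)) +
        (LINT p:D|lebesgue. (\<Sum>k\<in>UNIV. \<Sum>l\<in>UNIV. A (fst p) $ k $ l * x_grad \<Omega> T ?u p $ k * x_grad \<Omega> T w p $ l)) +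
        (LINT p:D|lebesgue. q (fst p) * ?u p * w p) = (LINT p:D|lebesgue. F p * w p)"
        unfolding source[OF y] z(2)[OF y(1), symmetric] by (rule weak_form_eq[OF z(1) V_imp_B_space(2)[OF z(1)] y A q])
    qed
    moreover have "AE p in lebesgue_on D. u' p = ?u p" if u': "weak_solution \<Omega> T \<alpha> A q F u'" for u'
    proof -
      have B: "B_space \<Omega> T \<sigma> u'" and W: "\<And>w. B_space \<Omega> T \<sigma> w \<Longrightarrow>
        (LINT p:D|lebesgue. RL_left \<sigma> (\<lambda>\<tau>. u' (fst p, \<tau>)) (snd p) * RL_right T \<sigma> (\<lambda>\<tau>. w (fst p, \<tau>)) (snd p)) +
        (LINT p:D|lebesgue. (\<Sum>k\<in>UNIV. \<Sum>l\<in>UNIV. A (fst p) $ k $ l * x_grad \<Omega> T u' p $ k * x_grad \<Omega> T w p $ l)) +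
        (LINT p:D|lebesgue. q (fst p) * u' p * w p) = (LINT p:D|lebesgue. F p * w p)"
        using u' unfolding weak_solution_def \<alpha> by blast+
      obtain z' where z': "z' \<in> V" "AE p in lebesgue_on D. z' p = (u' p, x_grad \<Omega> T u' p)" by (rule B_space_representative[OF B])
      have bz': "b z' y = l y" if y: "y \<in> V" for y
        by (rule trans[OF sym[OF weak_form_eq[OF z' y V_imp_B_space(2)[OF y] A q]]
          W[OF V_imp_B_space(1)[OF y], unfolded source[OF y V_imp_B_space(2)[OF y]]]])
      \<comment> \<open>The difference of the two representatives is tested with itself; coercivity
        leaves it no norm.\<close>
      let ?d = "\<lambda>p. z p + (-1) *\<^sub>R z' p"
      have d: "?d \<in> V" using V_lincomb[OF z(1) z'(1), of 1 "-1"] by simp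
      have "b ?d ?d = b z ?d - b z' ?d" using b_lincomb_left[OF z(1) z'(1) d, of 1 "-1"] by simp
      also have "\<dots> = 0" using z(2)[OF d] bz'[OF d] by simp
      finally have "ip ?d ?d \<le> 0" using \<beta>(2)[OF d] \<beta>(1) by (simp add: mult_le_0_iff)
      moreover have "0 \<le> (\<integral>w. (norm (Hz z w - Hz z' w))\<^sup>2 \<partial>XTT)" "0 \<le> (\<integral>p. (norm (z p - z' p))\<^sup>2 \<partial>XT)" by simp_all
      ultimately have "(\<integral>p. (norm (z p - z' p))\<^sup>2 \<partial>XT) = 0" unfolding ip_diff_self by linarith
      then have "AE p in XT. (norm (z p - z' p))\<^sup>2 = 0"
        using sq_int_integrable[OF sq_int_diff[OF V_D(3)[OF z(1)] V_D(3)[OF z'(1)]]] by (subst (asm) integral_nonneg_eq_0_iff_AE) auto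
      with z'(2)[unfolded AE_D_iff] show ?thesis unfolding AE_D_iff by eventually_elim simp
    qed
    moreover have "B_norm \<Omega> T \<sigma> ?u \<le> sqrt 2 / \<beta> * L2_norm D F"
    proof -
      have ip0: "0 \<le> ip z z" by (rule V.ip_nonneg[OF z(1)])
      \<comment> \<open>Test with the solution itself and divide by its norm, which is why the null
        case is separate.\<close>
      have "\<beta> * sqrt (ip z z) \<le> L2_norm D F"
      proof (cases "ip z z = 0")
        case False
        then have pos: "0 < sqrt (ip z z)" using ip0 by simp
        have "\<beta> * sqrt (ip z z) * sqrt (ip z z) = \<beta> * ip z z" using ip0 by simp
        also have "\<dots> \<le> l z" using \<beta>(2)[OF z(1)] z(2)[OF z(1)] by simp
        also have "\<dots> \<le> L2_norm D F * sqrt (ip z z)" using lw(2)[OF z(1)] by simp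
        finally show ?thesis using pos by (rule mult_right_le_imp_le)
      qed (simp add: nF)
      then have "sqrt (ip z z) \<le> L2_norm D F / \<beta>" using \<beta>(1) by (simp add: field_simps)
      then have "sqrt 2 * sqrt (ip z z) \<le> sqrt 2 * (L2_norm D F / \<beta>)" by (intro mult_left_mono) simp_all
      with B_norm_le[OF z(1)] show ?thesis by (simp add: real_sqrt_mult)
    qed
    ultimately show ?thesis by blast
  qed
  then show ?thesis by blast
qed

end

section \<open>The separable source and the adaptation of the data\<close>

lemma L2_separable_source:
  fixes \<Omega> :: "(real ^ 'd) set" and \<phi> :: "real ^ 'd \<Rightarrow> real" and v :: "real \<Rightarrow> real"
  assumes \<Omega>: "open \<Omega>" and \<phi>: "continuous_on \<Omega> \<phi>" "L2 \<Omega> \<phi>" and v: "continuous_on {0..T} v"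
  shows "L2 (cylinder \<Omega> T) (\<lambda>(x, t). \<phi> x * v t)"
proof -
  let ?F = "\<lambda>(x, t). \<phi> x * v t"
  have [measurable]: "\<Omega> \<in> sets borel" using \<Omega> by (rule borel_open)
  have op: "open (cylinder \<Omega> T)" unfolding cylinder_def by (intro open_Times \<Omega>) simp
  have cF: "continuous_on (cylinder \<Omega> T) ?F" unfolding cylinder_def case_prod_beta
    by (intro continuous_on_mult continuous_on_compose2[OF \<phi>(1)] continuous_on_compose2[OF v] continuous_intros) auto
  obtain B where B: "0 < B" "\<And>t. t \<in> {0..T} \<Longrightarrow> \<bar>v t\<bar> \<le> B"
    using compact_imp_bounded[OF compact_continuous_image[OF v compact_Icc]] unfolding bounded_pos by auto
  define f where "f p = indicator (cylinder \<Omega> T) p *\<^sub>R ?F p" for p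
  have f: "f \<in> borel_measurable (lborel \<Otimes>\<^sub>M lborel)"
    using borel_measurable_continuous_on_indicator[OF borel_open[OF op] cF] by (simp add: f_def[abs_def] lborel_prod)
  define g where "g x = indicator \<Omega> x *\<^sub>R \<phi> x" for x
  have g [measurable]: "g \<in> borel_measurable lborel"
    using borel_measurable_continuous_on_indicator[OF borel_open[OF \<Omega>] \<phi>(1)] by (simp add: g_def[abs_def])
  have "L2_sq (cylinder \<Omega> T) ?F = (\<integral>\<^sup>+p. ennreal ((norm (f p))\<^sup>2) \<partial>(lborel \<Otimes>\<^sub>M lborel))"
    unfolding L2_sq_def nn_integral_completion lborel_prod by (intro nn_integral_cong) (auto simp: f_def indicator_def)
  also have "\<dots> = (\<integral>\<^sup>+x. \<integral>\<^sup>+t. ennreal ((norm (f (x, t)))\<^sup>2) \<partial>lborel \<partial>lborel)"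
    using f by (intro lborel.nn_integral_fst[symmetric] measurable_compose[OF f]) simp
  also have "\<dots> \<le> (\<integral>\<^sup>+x. \<integral>\<^sup>+t. ennreal ((g x)\<^sup>2) * (ennreal (B\<^sup>2) * indicator {0..T} t) \<partial>lborel \<partial>lborel)"
  proof (intro nn_integral_mono)
    fix x t
    show "ennreal ((norm (f (x, t)))\<^sup>2) \<le> ennreal ((g x)\<^sup>2) * (ennreal (B\<^sup>2) * indicator {0..T} t)"
    proof (cases "(x, t) \<in> cylinder \<Omega> T")
      case True
      then have x: "x \<in> \<Omega>" and t: "t \<in> {0..T}" by (auto simp: cylinder_def)
      have "(v t)\<^sup>2 \<le> B\<^sup>2" using power_mono[OF B(2)[OF t], of 2] by simp
      then show ?thesis using True x t
        by (simp add: f_def g_def power_mult_distrib ennreal_mult[symmetric] ennreal_leI mult_left_mono)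
    qed (simp add: f_def)
  qed
  also have "\<dots> = (\<integral>\<^sup>+x. ennreal ((g x)\<^sup>2) * (ennreal (B\<^sup>2) * emeasure lborel {0..T}) \<partial>lborel)"
    by (simp add: nn_integral_cmult nn_integral_cmult_indicator)
  also have "\<dots> = (\<integral>\<^sup>+x. ennreal ((g x)\<^sup>2) \<partial>lborel) * (ennreal (B\<^sup>2) * emeasure lborel {0..T})"
    by (rule nn_integral_multc) measurable
  also have "(\<integral>\<^sup>+x. ennreal ((g x)\<^sup>2) \<partial>lborel) = L2_sq \<Omega> \<phi>"
    unfolding L2_sq_def nn_integral_completion by (intro nn_integral_cong) (auto simp: g_def indicator_def)
  also have "L2_sq \<Omega> \<phi> * (ennreal (B\<^sup>2) * emeasure lborel {0..T}) < \<infinity>"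
    using \<phi>(2) by (auto simp: L2_def ennreal_mult_less_top emeasure_lborel_Icc_eq)
  finally show ?thesis
    using continuous_imp_measurable_on_sets_lebesgue[OF cF] op by (simp add: L2_def)
qed

theorem theorem3p1p2:
  fixes \<Omega> :: "(real ^ 'd) set"
    and T \<alpha> lam0 :: real
    and A :: "real ^ 'd \<Rightarrow> real ^ 'd ^ 'd"
    and q :: "real ^ 'd \<Rightarrow> real"
  assumes "smooth_bounded_domain \<Omega>"
    and "0 < T" and "0 < \<alpha>" and "\<alpha> < 1"
    and "\<forall>k l. C1_closure \<Omega> (\<lambda>x. A x $ k $ l)"
    and "\<forall>x\<in>closure \<Omega>. \<forall>k l. A x $ k $ l = A x $ l $ k"
    and "0 < lam0"
    and "\<forall>x\<in>closure \<Omega>. \<forall>\<xi>. (\<Sum>k\<in>UNIV. \<Sum>l\<in>UNIV. A x $ k $ l * \<xi> $ k * \<xi> $ l) \<ge> lam0 * (norm \<xi>)\<^sup>2"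
    and "Linf \<Omega> q" and "AE x in lebesgue_on \<Omega>. 0 < q x"
  shows "\<exists>C. \<forall>\<phi> v.
    continuous_on \<Omega> \<phi> \<and> L2 \<Omega> \<phi> \<and>
    C1_interval 0 T v \<and> (\<forall>t\<in>{0..T}. 0 \<le> v t) \<and> (\<exists>t\<in>{0..T}. v t \<noteq> 0) \<and> v 0 = 0 \<longrightarrow>
    (\<exists>u. weak_solution \<Omega> T \<alpha> A q (\<lambda>(x, t). \<phi> x * v t) u \<and>
       (\<forall>u'. weak_solution \<Omega> T \<alpha> A q (\<lambda>(x, t). \<phi> x * v t) u' \<longrightarrow>
          (AE p in lebesgue_on (cylinder \<Omega> T). u' p = u p)) \<and>
       B_norm \<Omega> T (\<alpha> / 2) u \<le> C * L2_norm (cylinder \<Omega> T) (\<lambda>(x, t). \<phi> x * v t))"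
proof -
  have \<Omega>: "open \<Omega>" "bounded \<Omega>" using assms(1) by (simp_all add: smooth_bounded_domain_def)
  then have \<Omega>b [measurable]: "\<Omega> \<in> sets borel" and \<Omega>l: "\<Omega> \<in> sets lebesgue" by auto
  \<comment> \<open>The matrix is controlled only on the closure; cutting off makes its entries
    Borel and bounded everywhere.\<close>
  define a where "a x k l = indicator \<Omega> x *\<^sub>R (A x $ k $ l)" for x k l
  have cA: "continuous_on (closure \<Omega>) (\<lambda>x. A x $ k $ l)" for k l
    using assms(5) by (simp add: C1_closure_def)
  have cc: "compact (closure \<Omega>)" using \<Omega>(2) by (simp add: compact_closure)
  have "\<exists>B. \<forall>x\<in>closure \<Omega>. \<bar>A x $ k $ l\<bar> \<le> B" for k l
    using compact_imp_bounded[OF compact_continuous_image[OF cA cc]] by (simp add: bounded_iff)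
  then obtain B where B: "\<And>k l x. x \<in> closure \<Omega> \<Longrightarrow> \<bar>A x $ k $ l\<bar> \<le> B k l" by metis
  obtain Q where Q: "AE x in lebesgue_on \<Omega>. \<bar>q x\<bar> \<le> Q" and mq: "q \<in> borel_measurable (lebesgue_on \<Omega>)"
    using assms(9) by (auto simp: Linf_def)
  \<comment> \<open>A single bound for all matrix entries and for \<open>q\<close>; absolute values
    keep it nonnegative.\<close>
  define M where "M = (\<Sum>k\<in>UNIV. \<Sum>l\<in>UNIV. \<bar>B k l\<bar>) + \<bar>Q\<bar>"
  have BM: "\<bar>B k l\<bar> \<le> M" for k l
  proof -
    have "\<bar>B k l\<bar> \<le> (\<Sum>l\<in>UNIV. \<bar>B k l\<bar>)" by (rule member_le_sum) auto
    also have "\<dots> \<le> (\<Sum>k\<in>UNIV. \<Sum>l\<in>UNIV. \<bar>B k l\<bar>)"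
      by (rule member_le_sum[where f = "\<lambda>k. \<Sum>l\<in>UNIV. \<bar>B k l\<bar>"]) (auto intro: sum_nonneg)
    finally show ?thesis by (simp add: M_def)
  qed
  have QM: "\<bar>Q\<bar> \<le> M" unfolding M_def by (simp add: sum_nonneg)
  have "(\<lambda>x. indicator \<Omega> x *\<^sub>R q x) \<in> borel_measurable lebesgue"
    using mq \<Omega>l by (simp add: borel_measurable_restrict_space_iff)
  then obtain q' where q': "q' \<in> borel_measurable lborel" "AE x in lborel. indicator \<Omega> x *\<^sub>R q x = q' x"
    using completion_ex_borel_measurable_euclidean by blast
  \<comment> \<open>Clipping a Borel version of \<open>q\<close> enforces the bounds at every point
    and changes it only on a null set of the domain, since there \<open>q\<close> lies between 0 and
    \<open>M\<close> almost everywhere.\<close>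
  define c where "c x = max 0 (min (q' x) M)" for x
  have qc: "AE x in lebesgue_on \<Omega>. q x = c x"
    using q'(2) Q[unfolded AE_lebesgue_on_iff[OF \<Omega>l]] assms(10)[unfolded AE_lebesgue_on_iff[OF \<Omega>l]]
    unfolding AE_lebesgue_on_iff[OF \<Omega>l] by eventually_elim (use QM in \<open>auto simp: c_def\<close>)
  interpret parabolic_problem "\<alpha> / 2" \<Omega> T a c M lam0
  proof
    show "0 < \<alpha> / 2" "\<alpha> / 2 < 1 / 2" "open \<Omega>" "bounded \<Omega>" "0 < T" "0 < lam0" using assms \<Omega> by simp_all
    show "(\<lambda>x. a x k l) \<in> borel_measurable borel" for k l
      unfolding a_def using \<Omega>b continuous_on_subset[OF cA closure_subset] by (rule borel_measurable_continuous_on_indicator)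
    show "\<bar>a x k l\<bar> \<le> M" for x k l
      using B[of x k l] BM[of k l] closure_subset[of \<Omega>] by (auto simp: a_def indicator_def)
    show "lam0 * (norm \<xi>)\<^sup>2 \<le> (\<Sum>k\<in>UNIV. \<Sum>l\<in>UNIV. a x k l * \<xi> $ k * \<xi> $ l)" if "x \<in> \<Omega>" for x \<xi>
      using assms(8) closure_subset[of \<Omega>] that by (auto simp: a_def)
    show "c \<in> borel_measurable borel" unfolding c_def[abs_def] using q'(1) by measurable
    show "0 \<le> c x" "c x \<le> M" for x using QM by (auto simp: c_def)
  qed
  \<comment> \<open>Obtained before \<open>\<phi>\<close> and \<open>v\<close> are fixed, so one
    constant serves all sources.\<close>
  obtain C where C: "\<And>F. L2 (cylinder \<Omega> T) F \<Longrightarrow> \<exists>u. weak_solution \<Omega> T \<alpha> A q F u \<and>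
    (\<forall>u'. weak_solution \<Omega> T \<alpha> A q F u' \<longrightarrow> (AE p in lebesgue_on (cylinder \<Omega> T). u' p = u p)) \<and>
    B_norm \<Omega> T (\<alpha> / 2) u \<le> C * L2_norm (cylinder \<Omega> T) F"
    using weak_solution_well_posed[of A q \<alpha>, OF _ qc refl] by (auto simp: a_def)
  have "L2 (cylinder \<Omega> T) (\<lambda>(x, t). \<phi> x * v t)" if "continuous_on \<Omega> \<phi>" "L2 \<Omega> \<phi>" "C1_interval 0 T v" for \<phi> v
  proof (rule L2_separable_source[OF \<Omega>(1) that(1,2)])
    show "continuous_on {0..T} v"
      using that(3) unfolding C1_interval_def by (blast intro: DERIV_continuous_on)
  qed
  with C show ?thesis by (intro exI[of _ C]) blast
qed

end
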